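(* Let $\mathcal{G}(V_n,E_n)$ be the inhomogeneous random digraph with extended type sequence $\{\mathbf W_i=(W_i^-,W_i^+,Q_i,\zeta_i): i\ge 1\}$ and edge probabilities $p_{ij}^{(n)}$ described in the context, and suppose that, as $n\to\infty$: (a) for some distribution $H$ on $\mathbb{R}_+^2\times\mathbb{R}^2$, $H_n(u,v,q,t)=\frac1n\sum_{i=1}^n 1(W_i^-\le u,\,W_i^+\le v,\,Q_i\le q,\,\zeta_i\le t)\xrightarrow{P}H(u,v,q,t)$ at all continuity points of $H$; let $(W^-,W^+,Q,\zeta)$ denote a random vector with distribution $H$; (b) $\frac1n\sum_{i=1}^n W_i^-\xrightarrow{P}E[W^-]$, $\frac1n\sum_{i=1}^n W_i^+\xrightarrow{P}E[W^+]$, $\frac1n\sum_{i=1}^n|Q_i|\xrightarrow{P}E[|Q|]$, $\frac1n\sum_{i=1}^n|\zeta_i|\xrightarrow{P}E[|\zeta|]$, with $\theta=E[W^-+W^+]<\infty$ and $E[|Q|+|\zeta|]<\infty$; (c) $\mathcal{E}_n=\frac1n\sum_{i=1}^n\sum_{1\le j\le n,\,j\ne i}\big|p_{ij}^{(n)}-(r_{ij}^{(n)}\wedge 1)\big|\xrightarrow{P}0$, where $r_{ij}^{(n)}=W_i^+W_j^-/(\theta n)$; (d) there is a constant $c<1$ such that $|\zeta_i|\le c$ for all $i=1,\dots,n$; (e) $\frac1n\sum_{i=1}^n W_i^-W_i^+\xrightarrow{P}E[W^+W^-]$ and $\frac1n\sum_{i=1}^n W_i^+|Q_i|\xrightarrow{P}E[W^+|Q|]$,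 with $E[W^+W^-+W^+|Q|]<\infty$; (f) the vectors $(W^-,Q)$ and $(W^+,\zeta)$ are independent. Let $R_\xi$ denote the (scale-free, generalized PageRank) rank of a uniformly chosen vertex $\xi$ of $\mathcal{G}(V_n,E_n)$. Then, as $n\to\infty$, $R_\xi\Rightarrow\mathcal{R}$ (weak convergence), where $\mathcal{R}$ is the attracting endogenous solution to the stochastic fixed-point equation $$\mathcal{R}\stackrel{\mathcal D}{=}\sum_{j=1}^{\mathcal N}\mathcal{C}_j\mathcal{R}_j+\mathcal{Q},$$ in which the $\{\mathcal{R}_j\}$ are i.i.d. copies of $\mathcal{R}$ independent of $(\mathcal N,\mathcal Q,\{\mathcal C_j\}_{j\ge1})$, the $\{\mathcal{C}_j\}$ are i.i.d. and independent of $(\mathcal N,\mathcal Q)$, and $$P(\mathcal N=m,\mathcal Q\in dq)=E\left[1(Q\in dq)\,\frac{e^{-E[W^+]W^-/\theta}(E[W^+]W^-/\theta)^m}{m!}\right],\quad m=0,1,\dots,$$ $$P(\mathcal C_1\in dt)=\frac{E\left[1(\zeta/(Z^++1)\in dt)\,W^+\right]}{E[W^+]},$$ with $Z^+$ a mixed Poisson random variable with mixing parameter $E[W^-]W^+/\theta$.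
   Context: Random digraph: each vertex $i\in V_n=\{1,\dots,n\}$ has an extended type $\mathbf W_i=(W_i^-,W_i^+,Q_i,\zeta_i)\in\mathbb R_+^2\times\mathbb R^2$ (possibly random; $-$ and $+$ are labels for inbound/outbound). Let $\mathscr F_n=\sigma(\mathbf W_i:1\le i\le n)$ and $\mathbb P_n(\cdot)=P(\cdot|\mathscr F_n)$. Conditionally on $\mathscr F_n$ the events $\{(i,j)\in E_n\}$, $1\le i\ne j\le n$, are independent, with $$p_{ij}^{(n)}=\mathbb P_n((i,j)\in E_n)=1\wedge\frac{W_i^+W_j^-}{\theta n}\big(1+\varphi_n(\mathbf W_i,\mathbf W_j)\big),\qquad 1\le i\neq j\le n,$$ where $\varphi_n(\mathbf W_i,\mathbf W_j)>-1$ a.s. (it may depend on $n$, on the types of $i,j$, and on the whole sequence $\{\mathbf W_l:1\le l\le n\}$), and $\frac1n\sum_{i=1}^n(W_i^-+W_i^+)\xrightarrow{P}\theta>0$. There are no self-loops. $x\wedge y=\min\{x,y\}$. Generalized PageRank: with $D_j^+$ the out-degree of vertex $j$ and $C_j=\zeta_j/D_j^+$ (only needed when $D_j^+\ge1$), the rank vector $(R_1,\dots,R_n)$ is the unique solution of $R_i=\sum_{j:(j,i)\in E_n}C_jR_j+Q_i$, $i=1,\dots,n$. The index $\xi$ is uniform on $\{1,\dots,n\}$, independent of everything else. Mixed Poisson: conditionally on $(W^-,W^+,Q,\zeta)$, $Z^+$ is Poisson with mean $E[W^-]W^+/\theta$. Attracting endogenous solution: let $\mathcal U=\bigcup_{k\ge0}\mathbb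 N_+^k$ with $\mathbb N_+^0=\{\emptyset\}$; let $\{(\mathcal N_{\mathbf i},\mathcal Q_{\mathbf i}):\mathbf i\in\mathcal U\}$ be i.i.d. copies of $(\mathcal N,\mathcal Q)$ and, independently, $\{\mathcal C_{\mathbf i}:\mathbf i\in\mathcal U,\mathbf i\ne\emptyset\}$ i.i.d. copies of $\mathcal C_1$. Set $\mathcal A_0=\{\emptyset\}$, $\mathcal A_{r+1}=\{(\mathbf i,j):\mathbf i\in\mathcal A_r,1\le j\le\mathcal N_{\mathbf i}\}$, $\Pi_\emptyset=1$, $\Pi_{(\mathbf i,j)}=\Pi_{\mathbf i}\mathcal C_{(\mathbf i,j)}$. Then $\mathcal R=\sum_{r=0}^\infty\sum_{\mathbf i\in\mathcal A_r}\Pi_{\mathbf i}\mathcal Q_{\mathbf i}$ (the a.s. limit of the partial sums over $r$). It is implicit that $E[W^+]>0$, so that the law of $\mathcal C_1$ is defined. *)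

theory Defs
  imports "HOL-Probability.Probability"
begin

section \<open>Extended types, random digraphs and PageRank\<close>

text \<open>An extended type is a quadruple $(W^-, W^+, Q, \zeta)$; vertices are the numbers
  \<open>1, \<dots>, n\<close>.\<close>

type_synonym ext_type = "real \<times> real \<times> real \<times> real"

definition w_in :: "ext_type \<Rightarrow> real" where "w_in w = fst w"
definition w_out :: "ext_type \<Rightarrow> real" where "w_out w = fst (snd w)"
definition w_Q :: "ext_type \<Rightarrow> real" where "w_Q w = fst (snd (snd w))"
definition w_zeta :: "ext_type \<Rightarrow> real" where "w_zeta w = snd (snd (snd w))"

lemma measurable_ext_type [measurable]:
  "w_in \<in> borel_measurable borel" "w_out \<in> borel_measurable borel"
  "w_Q \<in> borel_measurable borel" "w_zeta \<in> borel_measurable borel"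
  unfolding w_in_def[abs_def] w_out_def[abs_def] w_Q_def[abs_def] w_zeta_def[abs_def]
  by (auto intro!: borel_measurable_continuous_onI continuous_intros)

definition tends_in_prob :: "'a measure \<Rightarrow> (nat \<Rightarrow> 'a \<Rightarrow> real) \<Rightarrow> real \<Rightarrow> bool" where
  "tends_in_prob M X c \<longleftrightarrow>
     (\<forall>\<epsilon>>0. (\<lambda>n. \<P>(\<omega> in M. \<bar>X n \<omega> - c\<bar> > \<epsilon>)) \<longlonglongrightarrow> 0)"

definition types_upto :: "(nat \<Rightarrow> 'a \<Rightarrow> ext_type) \<Rightarrow> nat \<Rightarrow> 'a \<Rightarrow> (nat \<Rightarrow> ext_type)" where
  "types_upto W n \<omega> = (\<lambda>i\<in>{1..n}. W i \<omega>)"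

text \<open>The $\sigma$-algebra $\mathscr{F}_n = \sigma(W_1, \dots, W_n)$.\<close>

definition types_sigma :: "'a measure \<Rightarrow> (nat \<Rightarrow> 'a \<Rightarrow> ext_type) \<Rightarrow> nat \<Rightarrow> 'a measure" where
  "types_sigma M W n =
     vimage_algebra (space M) (types_upto W n) (PiM {1..n} (\<lambda>_. borel))"

definition cond_probability :: "'a measure \<Rightarrow> 'a measure \<Rightarrow> 'a set \<Rightarrow> 'a \<Rightarrow> real" where
  "cond_probability M F A = real_cond_exp M F (indicator A)"

definition cond_indep_events ::
    "'a measure \<Rightarrow> 'a measure \<Rightarrow> ('i \<Rightarrow> 'a set) \<Rightarrow> 'i set \<Rightarrow> bool" where
  "cond_indep_events M F A I \<longleftrightarrow>
     (\<forall>J\<subseteq>I. finite J \<longrightarrow> J \<noteq> {} \<longrightarrow>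
        (AE \<omega> in M. cond_probability M F (\<Inter>i\<in>J. A i) \<omega> = (\<Prod>i\<in>J. cond_probability M F (A i) \<omega>)))"

definition vertex_pairs :: "nat \<Rightarrow> (nat \<times> nat) set" where
  "vertex_pairs n = {(i, j). i \<in> {1..n} \<and> j \<in> {1..n} \<and> i \<noteq> j}"

text \<open>The kernel argument \<open>\<phi> n \<w> u v\<close> stands for $\varphi_n(u, v)$, where \<open>\<w>\<close> is the
  whole vector \<open>(W\<^sub>1, \<dots>, W\<^sub>n)\<close>, on which $\varphi_n$ is allowed to depend.\<close>

type_synonym kernel_pert = "nat \<Rightarrow> (nat \<Rightarrow> ext_type) \<Rightarrow> ext_type \<Rightarrow> ext_type \<Rightarrow> real"

definition edge_ratio :: "real \<Rightarrow> nat \<Rightarrow> (nat \<Rightarrow> ext_type) \<Rightarrow> nat \<Rightarrow> nat \<Rightarrow> real" where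
  "edge_ratio \<theta> n w i j = w_out (w i) * w_in (w j) / (\<theta> * real n)"

definition edge_prob ::
    "kernel_pert \<Rightarrow> real \<Rightarrow> nat \<Rightarrow> (nat \<Rightarrow> ext_type) \<Rightarrow> nat \<Rightarrow> nat \<Rightarrow> real" where
  "edge_prob \<phi> \<theta> n w i j = min 1 (edge_ratio \<theta> n w i j * (1 + \<phi> n w (w i) (w j)))"

text \<open>Here \<open>W i\<close> is the type of vertex \<open>i\<close> (\<open>W 0\<close> is never used), \<open>E n\<close> is the random edge set
  and \<open>\<xi> n\<close> the uniformly chosen vertex of the graph on \<open>{1..n}\<close>.  Nothing is required of the
  joint law of the graphs for different \<open>n\<close>.\<close>

locale inhom_random_digraph = prob_space M
  for M :: "'a measure" +
  fixes W :: "nat \<Rightarrow> 'a \<Rightarrow> ext_type"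
    and \<phi> :: kernel_pert
    and \<theta> :: real
    and E :: "nat \<Rightarrow> 'a \<Rightarrow> (nat \<times> nat) set"
    and \<xi> :: "nat \<Rightarrow> 'a \<Rightarrow> nat"
  assumes type_measurable: "\<And>i. i \<ge> 1 \<Longrightarrow> W i \<in> borel_measurable M"
    and type_nonneg: "\<And>i \<omega>. i \<ge> 1 \<Longrightarrow> \<omega> \<in> space M \<Longrightarrow> w_in (W i \<omega>) \<ge> 0 \<and> w_out (W i \<omega>) \<ge> 0"
    and theta_pos: "\<theta> > 0"
    and theta_lim: "tends_in_prob M (\<lambda>n \<omega>. (\<Sum>i=1..n. w_in (W i \<omega>) + w_out (W i \<omega>)) / real n) \<theta>"
    and phi_measurable: "\<And>n i j. (i, j) \<in> vertex_pairs n \<Longrightarrow>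
          (\<lambda>\<omega>. \<phi> n (types_upto W n \<omega>) (W i \<omega>) (W j \<omega>)) \<in> borel_measurable (types_sigma M W n)"
    and phi_gt: "\<And>n i j. (i, j) \<in> vertex_pairs n \<Longrightarrow>
          AE \<omega> in M. \<phi> n (types_upto W n \<omega>) (W i \<omega>) (W j \<omega>) > - 1"
    and edges_measurable: "\<And>n. n \<ge> 1 \<Longrightarrow> E n \<in> measurable M (count_space (Pow (vertex_pairs n)))"
    and edges_prob: "\<And>n i j. (i, j) \<in> vertex_pairs n \<Longrightarrow>
          AE \<omega> in M. cond_probability M (types_sigma M W n) {\<omega>' \<in> space M. (i, j) \<in> E n \<omega>'} \<omega>
                      = edge_prob \<phi> \<theta> n (types_upto W n \<omega>) i j"
    and edges_cond_indep: "\<And>n. n \<ge> 1 \<Longrightarrow>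
          cond_indep_events M (types_sigma M W n) (\<lambda>e. {\<omega> \<in> space M. e \<in> E n \<omega>}) (vertex_pairs n)"
    and vertex_measurable: "\<And>n. n \<ge> 1 \<Longrightarrow> \<xi> n \<in> measurable M (count_space {1..n})"
    and vertex_uniform: "\<And>n. n \<ge> 1 \<Longrightarrow>
          distr M (count_space {1..n}) (\<xi> n) = uniform_count_measure {1..n}"
    and vertex_indep: "\<And>n. n \<ge> 1 \<Longrightarrow>
          indep_set (sets (vimage_algebra (space M) (\<xi> n) (count_space {1..n})))
            (sets (vimage_algebra (space M) (\<lambda>\<omega>. (types_upto W n \<omega>, E n \<omega>))
               (PiM {1..n} (\<lambda>_. borel) \<Otimes>\<^sub>M count_space (Pow (vertex_pairs n)))))"

definition out_degree :: "(nat \<times> nat) set \<Rightarrow> nat \<Rightarrow> nat" where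
  "out_degree G j = card {k. (j, k) \<in> G}"

definition is_rank_vector ::
    "nat \<Rightarrow> (nat \<times> nat) set \<Rightarrow> (nat \<Rightarrow> ext_type) \<Rightarrow> (nat \<Rightarrow> real) \<Rightarrow> bool" where
  "is_rank_vector n G w R \<longleftrightarrow>
     (\<forall>i\<in>{1..n}. R i = (\<Sum>j | (j, i) \<in> G. w_zeta (w j) / real (out_degree G j) * R j) + w_Q (w i))"

text \<open>The rank vector is a function on \<open>{1..n}\<close>; extensionality makes the unique solution unique as
  a function on \<open>nat\<close>.\<close>

definition page_rank :: "nat \<Rightarrow> (nat \<times> nat) set \<Rightarrow> (nat \<Rightarrow> ext_type) \<Rightarrow> nat \<Rightarrow> real" where
  "page_rank n G w = (THE R. R \<in> extensional {1..n} \<and> is_rank_vector n G w R)"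

section \<open>The limiting distribution\<close>

definition type_cdf :: "ext_type measure \<Rightarrow> ext_type \<Rightarrow> real" where
  "type_cdf H = (\<lambda>(u, v, q, t). measure H ({..u} \<times> {..v} \<times> {..q} \<times> {..t}))"

definition empirical_cdf :: "nat \<Rightarrow> (nat \<Rightarrow> ext_type) \<Rightarrow> ext_type \<Rightarrow> real" where
  "empirical_cdf n w = (\<lambda>(u, v, q, t).
     (\<Sum>i=1..n. of_bool (w_in (w i) \<le> u \<and> w_out (w i) \<le> v \<and> w_Q (w i) \<le> q \<and> w_zeta (w i) \<le> t))
       / real n)"

text \<open>Joint law of \<open>(Z, w)\<close> where \<open>w\<close> has law \<open>H\<close> and, given \<open>w\<close>, \<open>Z\<close> is Poisson with mean
  \<open>rate w\<close>.  The library's \<open>poisson_pmf\<close> needs a positive rate, whereas \<open>rate w = 0\<close> is possible here;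
  \<open>0 ^ 0 = 1\<close> then makes \<open>Z = 0\<close>.\<close>

definition mixed_poisson_joint ::
    "ext_type measure \<Rightarrow> (ext_type \<Rightarrow> real) \<Rightarrow> (nat \<times> ext_type) measure" where
  "mixed_poisson_joint H rate =
     density (count_space UNIV \<Otimes>\<^sub>M H) (\<lambda>(k, w). ennreal (exp (- rate w) * rate w ^ k / fact k))"

text \<open>Law of $(\mathcal N, \mathcal Q)$.\<close>

definition law_NQ :: "ext_type measure \<Rightarrow> real \<Rightarrow> (nat \<times> real) measure" where
  "law_NQ H \<theta> =
     distr (mixed_poisson_joint H (\<lambda>w. (\<integral>v. w_out v \<partial>H) * w_in w / \<theta>))
       (count_space UNIV \<Otimes>\<^sub>M borel) (\<lambda>(m, w). (m, w_Q w))"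

text \<open>Law of $\mathcal C_1$: the law of $\zeta / (Z^+ + 1)$, size-biased by $W^+$.\<close>

definition law_C :: "ext_type measure \<Rightarrow> real \<Rightarrow> real measure" where
  "law_C H \<theta> =
     distr (density (mixed_poisson_joint H (\<lambda>w. (\<integral>v. w_in v \<partial>H) * w_out w / \<theta>))
              (\<lambda>(k, w). ennreal (w_out w / (\<integral>v. w_out v \<partial>H))))
       borel (\<lambda>(k, w). w_zeta w / (real k + 1))"

lemma emeasure_distr_density:
  assumes "g \<in> borel_measurable P" "T \<in> measurable P N" "A \<in> sets N"
  shows "emeasure (distr (density P g) N T) A = (\<integral>\<^sup>+x. g x * indicator A (T x) \<partial>P)"
proof -
  have "emeasure (distr (density P g) N T) A = emeasure (density P g) (T -` A \<inter> space P)"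
    using assms by (subst emeasure_distr) simp_all
  also have "\<dots> = (\<integral>\<^sup>+x. g x * indicator (T -` A \<inter> space P) x \<partial>P)"
    using assms by (intro emeasure_density measurable_sets) simp_all
  also have "\<dots> = (\<integral>\<^sup>+x. g x * indicator A (T x) \<partial>P)"
    by (intro nn_integral_cong) (simp split: split_indicator)
  finally show ?thesis .
qed

lemma emeasure_law_NQ:
  fixes H :: "ext_type measure" and \<theta> :: real
  assumes H: "prob_space H" "sets H = sets borel" and B: "B \<in> sets borel"
  defines "rate \<equiv> \<lambda>w. (\<integral>v. w_out v \<partial>H) * w_in w / \<theta>"
  shows "emeasure (law_NQ H \<theta>) ({m} \<times> B) =
    (\<integral>\<^sup>+w. indicator B (w_Q w) * ennreal (exp (- rate w) * rate w ^ m / fact m) \<partial>H)"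
proof -
  interpret H: prob_space H by fact
  note [measurable_cong] = H(2)
  note [measurable] = B
  have [measurable]: "rate \<in> borel_measurable H" unfolding rate_def by measurable
  let ?g = "\<lambda>k w. ennreal (exp (- rate w) * rate w ^ k / fact k)"
  have g [measurable]: "(\<lambda>(k, w). ?g k w) \<in> borel_measurable (count_space UNIV \<Otimes>\<^sub>M H)"
    by measurable
  have 1 [measurable]: "(\<lambda>(m, w). (m, w_Q w)) \<in> count_space (UNIV :: nat set) \<Otimes>\<^sub>M H \<rightarrow>\<^sub>M count_space UNIV \<Otimes>\<^sub>M borel"
    by measurable
  have 2 [measurable]: "{m} \<times> B \<in> sets (count_space (UNIV :: nat set) \<Otimes>\<^sub>M borel)"
    by (intro pair_measureI) (auto simp: B)
  have "emeasure (law_NQ H \<theta>) ({m} \<times> B) =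
     (\<integral>\<^sup>+x. (case x of (k, w) \<Rightarrow> ?g k w) * indicator ({m} \<times> B) (case x of (k, w) \<Rightarrow> (k, w_Q w)) \<partial>(count_space UNIV \<Otimes>\<^sub>M H))"
    unfolding law_NQ_def mixed_poisson_joint_def rate_def[symmetric]
    by (rule emeasure_distr_density[OF g 1 2])
  also have "\<dots> = (\<integral>\<^sup>+k. \<integral>\<^sup>+w. ?g k w * indicator ({m} \<times> B) (k, w_Q w) \<partial>H \<partial>count_space UNIV)"
  proof -
    have "(\<lambda>x. (case x of (k, w) \<Rightarrow> ?g k w) * indicator ({m} \<times> B) (case x of (k, w) \<Rightarrow> (k, w_Q w)))
        \<in> borel_measurable (count_space UNIV \<Otimes>\<^sub>M H)"
      by (intro borel_measurable_times_ennreal g measurable_compose[OF 1 borel_measurable_indicator[OF 2]])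
    from H.nn_integral_fst[OF this] show ?thesis by simp
  qed
  also have "\<dots> = (\<integral>\<^sup>+k. indicator {m} k * (\<integral>\<^sup>+w. indicator B (w_Q w) * ?g m w \<partial>H) \<partial>count_space UNIV)"
    by (intro nn_integral_cong) (auto simp: indicator_times mult.commute split: split_indicator)
  also have "\<dots> = (\<integral>\<^sup>+w. indicator B (w_Q w) * ?g m w \<partial>H)"
    by (subst nn_integral_multc) simp_all
  finally show ?thesis .
qed

lemma emeasure_law_C:
  fixes H :: "ext_type measure" and \<theta> :: real
  assumes H: "prob_space H" "sets H = sets borel" and B: "B \<in> sets borel"
  defines "rate \<equiv> \<lambda>w. (\<integral>v. w_in v \<partial>H) * w_out w / \<theta>"
  shows "emeasure (law_C H \<theta>) B =
    (\<Sum>k. \<integral>\<^sup>+w. indicator B (w_zeta w / (real k + 1)) * ennreal (exp (- rate w) * rate w ^ k / fact k)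
                * ennreal (w_out w / (\<integral>v. w_out v \<partial>H)) \<partial>H)"
proof -
  interpret H: prob_space H by fact
  note [measurable_cong] = H(2)
  note [measurable] = B
  have [measurable]: "rate \<in> borel_measurable H" unfolding rate_def by measurable
  let ?g = "\<lambda>k w. ennreal (exp (- rate w) * rate w ^ k / fact k)"
  let ?h = "\<lambda>w. ennreal (w_out w / (\<integral>v. w_out v \<partial>H))"
  let ?P = "count_space (UNIV :: nat set) \<Otimes>\<^sub>M H"
  have g [measurable]: "(\<lambda>(k, w). ?g k w) \<in> borel_measurable ?P"
    by measurable
  have h [measurable]: "(\<lambda>(k, w). ?h w) \<in> borel_measurable ?P"
    by measurable
  have T: "(\<lambda>(k, w). w_zeta w / (real k + 1)) \<in> borel_measurable ?P"
    by measurable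
  have gh: "(\<lambda>x. (case x of (k, w) \<Rightarrow> ?g k w) * (case x of (k, w) \<Rightarrow> ?h w)) \<in> borel_measurable ?P"
    by measurable
  have dens: "law_C H \<theta> = distr (density ?P (\<lambda>x. (case x of (k, w) \<Rightarrow> ?g k w) * (case x of (k, w) \<Rightarrow> ?h w)))
      borel (\<lambda>(k, w). w_zeta w / (real k + 1))"
    unfolding law_C_def mixed_poisson_joint_def rate_def[symmetric]
    by (subst density_density_eq[OF g h]) (rule refl)
  have "emeasure (law_C H \<theta>) B =
     (\<integral>\<^sup>+x. (case x of (k, w) \<Rightarrow> ?g k w) * (case x of (k, w) \<Rightarrow> ?h w) *
        indicator B (case x of (k, w) \<Rightarrow> w_zeta w / (real k + 1)) \<partial>?P)"
    unfolding dens by (rule emeasure_distr_density[OF gh T B])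
  also have "\<dots> = (\<integral>\<^sup>+k. \<integral>\<^sup>+w. ?g k w * ?h w * indicator B (w_zeta w / (real k + 1)) \<partial>H \<partial>count_space UNIV)"
  proof -
    have "(\<lambda>x. (case x of (k, w) \<Rightarrow> ?g k w) * (case x of (k, w) \<Rightarrow> ?h w) *
        indicator B (case x of (k, w) \<Rightarrow> w_zeta w / (real k + 1))) \<in> borel_measurable ?P"
      by (intro borel_measurable_times_ennreal gh measurable_compose[OF T borel_measurable_indicator[OF B]])
    from H.nn_integral_fst[OF this] show ?thesis by simp
  qed
  also have "\<dots> = (\<Sum>k. \<integral>\<^sup>+w. ?g k w * ?h w * indicator B (w_zeta w / (real k + 1)) \<partial>H)"
    by (rule nn_integral_count_space_nat)
  finally show ?thesis by (simp add: mult_ac)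
qed

text \<open>Node $(i_1, \dots, i_r)$ of the tree is encoded as the reversed list \<open>[i\<^sub>r, \<dots>, i\<^sub>1]\<close>, so
  that the children of \<open>i\<close> are the lists \<open>j # i\<close>; siblings are numbered from \<open>0\<close>.  The weight
  attached to the root is not used.\<close>

primrec generation :: "(nat list \<Rightarrow> nat) \<Rightarrow> nat \<Rightarrow> nat list set" where
  "generation N 0 = {[]}"
| "generation N (Suc r) = {j # i | i j. i \<in> generation N r \<and> j < N i}"

primrec branch_weight :: "(nat list \<Rightarrow> real) \<Rightarrow> nat list \<Rightarrow> real" where
  "branch_weight C [] = 1"
| "branch_weight C (j # i) = branch_weight C i * C (j # i)"

definition generation_sum ::
    "(nat list \<Rightarrow> nat \<times> real) \<times> (nat list \<Rightarrow> real) \<Rightarrow> nat \<Rightarrow> real" where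
  "generation_sum = (\<lambda>(NQ, C) r.
     (\<Sum>i\<in>generation (\<lambda>k. fst (NQ k)) r. branch_weight C i * snd (NQ i)))"

text \<open>The canonical space carrying the i.i.d. copies of $(\mathcal N, \mathcal Q)$ and,
  independently, of $\mathcal C_1$.\<close>

definition tree_space ::
    "(nat \<times> real) measure \<Rightarrow> real measure
       \<Rightarrow> ((nat list \<Rightarrow> nat \<times> real) \<times> (nat list \<Rightarrow> real)) measure" where
  "tree_space \<nu> \<kappa> = PiM UNIV (\<lambda>_. \<nu>) \<Otimes>\<^sub>M PiM UNIV (\<lambda>_. \<kappa>)"

definition law_endogenous :: "(nat \<times> real) measure \<Rightarrow> real measure \<Rightarrow> real measure" where
  "law_endogenous \<nu> \<kappa> = distr (tree_space \<nu> \<kappa>) borel (\<lambda>x. \<Sum>r. generation_sum x r)"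

definition solves_sfpe :: "(nat \<times> real) measure \<Rightarrow> real measure \<Rightarrow> real measure \<Rightarrow> bool" where
  "solves_sfpe \<nu> \<kappa> \<mu> \<longleftrightarrow>
     prob_space \<mu> \<and> sets \<mu> = sets borel \<and>
     distr (\<nu> \<Otimes>\<^sub>M PiM UNIV (\<lambda>_::nat. \<kappa>) \<Otimes>\<^sub>M PiM UNIV (\<lambda>_::nat. \<mu>)) borel
       (\<lambda>((m, q), c, r). (\<Sum>j<m. c j * r j) + q) = \<mu>"

end

theory Submission
 imports Defs
begin

text \<open>Given the types, the edges are independent, so expectations over the graph are finite sums.  If
 there are finitely many types, remove a vertex \<open>i\<close>: as short cycles are rare, the ranks of its
 in-neighbours hardly notice, its out-degree is asymptotically Poisson and independent of its
 in-edges, and its rank becomes a compound Poisson sum whose characteristic function, by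
 concentration, obeys a deterministic recursion.  General types are rounded to a finite grid; the
 error is controlled by the sensitivity of clipped ranks to single edges and to the types and by
 uniform integrability of the in-degrees.  Since $(W^-, Q)$ and $(W^+, \zeta)$ are independent, the
 recursion is that of the weighted branching tree, and $|\zeta| \le c < 1$ makes the iterations on
 the graph and on the tree converge geometrically.  Convergence in probability is reduced to
 deterministic sequences of types along which countably many quantities converge.\<close>

text \<open>Ranks are unbounded, and a vertex of large in-degree reacts strongly to its neighbours,
  so no pointwise control is available. The way out is the averaged \<open>l1\<close> norm: the
  weight \<open>zeta_j/D_j\<close> of \<open>j\<close> is spread over exactly \<open>D_j\<close>
  out-neighbours, hence propagation never increases an average, whatever the in-degrees are. What
  remains is the effect of a changed matrix on the current ranks; this is why ranks are clipped at a
  level \<open>L\<close>. The recursion has to carry type, out-degree and rank of a vertex jointly,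
  because the contribution of \<open>j\<close> is divided by \<open>D_j\<close>. Deleting the
  receiving vertex lowers \<open>D_j\<close> by one at each of its in-neighbours: this is the origin
  of \<open>Z^+ + 1\<close>. The factor \<open>w_out\<close> in the probability of the edge is the
  origin of the size bias in the law of the weights. Limits are taken in a strict order at a fixed
  number of iterations: graph size, then mesh of the grid, then \<open>L\<close>. Only at the end
  does the number of iterations grow, and there the strict inequality \<open>c < 1\<close>
  enters.\<close>

abbreviation (input) ev_seq :: "(nat => bool) => bool" (binder "EV " 10) where
 "ev_seq P \<equiv> eventually P sequentially"

section \<open>Expectations over independent edges\<close>

text \<open>A finite sum instead of an integral: linearity and independence become algebraic
  identities valid for every \<open>p\<close>, with real or complex values, and only the
  inequalities require \<open>p\<close> to lie in \<open>[0, 1]\<close>. Most proofs are inductions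
  that reveal one edge at a time through \<open>gexp_insert\<close>.\<close>

definition gexp :: "'e set => ('e => real) => ('e set => 'b::real_vector) => 'b" where
 "gexp V p F = (\<Sum>G\<in>Pow V. ((\<Prod>e\<in>G. p e)*(\<Prod>e\<in>V - G. 1 - p e)) *\<^sub>R F G)"

lemma gexp_empty [simp]: "gexp {} p F = F {}"
 by (simp add: gexp_def)

lemma gexp_insert:
 assumes "finite V" "e \<notin> V"
 shows "gexp (insert e V) p F = p e *\<^sub>R gexp V p (\<lambda>G. F (insert e G)) + (1 - p e) *\<^sub>R gexp V p F"
proof -
 let ?w = "\<lambda>V G. (\<Prod>e\<in>G. p e)*(\<Prod>e\<in>V - G. 1 - p e)"
 have inj: "inj_on (insert e) (Pow V)" using assms(2) by (auto simp: inj_on_def)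
 have disj: "Pow V \<inter> insert e ` Pow V = {}" using assms(2) by auto
 have "gexp (insert e V) p F = (\<Sum>G\<in>Pow V. ?w (insert e V) G *\<^sub>R F G)
   + (\<Sum>G\<in>Pow V. ?w (insert e V) (insert e G) *\<^sub>R F (insert e G))"
  unfolding gexp_def Pow_insert using assms disj inj
  by (subst sum.union_disjoint) (simp_all add: sum.reindex o_def)
 also have "(\<Sum>G\<in>Pow V. ?w (insert e V) G *\<^sub>R F G) = (1 - p e) *\<^sub>R gexp V p F"
  unfolding gexp_def scaleR_sum_right
 proof (rule sum.cong[OF refl])
  fix G assume "G \<in> Pow V"
  with assms have "insert e V - G = insert e (V - G)" "e \<notin> V - G" "finite (V - G)" by auto
  then show "?w (insert e V) G *\<^sub>R F G = (1 - p e) *\<^sub>R ?w V G *\<^sub>R F G" by simp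
 qed
 also have "(\<Sum>G\<in>Pow V. ?w (insert e V) (insert e G) *\<^sub>R F (insert e G))
   = p e *\<^sub>R gexp V p (\<lambda>G. F (insert e G))"
  unfolding gexp_def scaleR_sum_right
 proof (rule sum.cong[OF refl])
  fix G assume G: "G \<in> Pow V"
  with assms have "insert e V - insert e G = V - G" "e \<notin> G" "finite G"
   by (auto intro: finite_subset)
  then show "?w (insert e V) (insert e G) *\<^sub>R F (insert e G) = p e *\<^sub>R ?w V G *\<^sub>R F (insert e G)" by simp
 qed
 finally show ?thesis by simp
qed

lemma gexp_cong:
 assumes "\<And>G. G \<subseteq> V ==> F G = F' G" "\<And>e. e \<in> V ==> p e = p' e"
 shows "gexp V p F = gexp V p' F'"
 unfolding gexp_def
proof (rule sum.cong[OF refl])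
 fix G assume G: "G \<in> Pow V"
 have "(\<Prod>e\<in>G. p e) = (\<Prod>e\<in>G. p' e)" "(\<Prod>e\<in>V-G. 1 - p e) = (\<Prod>e\<in>V-G. 1 - p' e)"
  using G assms(2) by (auto intro!: prod.cong)
 then show "((\<Prod>e\<in>G. p e)*(\<Prod>e\<in>V - G. 1 - p e)) *\<^sub>R F G = ((\<Prod>e\<in>G. p' e)*(\<Prod>e\<in>V - G. 1 - p' e)) *\<^sub>R F' G"
  using G assms(1) by simp
qed

lemma gexp_add: "gexp V p (\<lambda>G. F G + F' G) = gexp V p F + gexp V p F'"
 by (simp add: gexp_def scaleR_add_right sum.distrib)

lemma gexp_diff: "gexp V p (\<lambda>G. F G - F' G) = gexp V p F - gexp V p F'"
 by (simp add: gexp_def scaleR_diff_right sum_subtractf)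

lemma gexp_scaleR: "gexp V p (\<lambda>G. a *\<^sub>R F G) = a *\<^sub>R gexp V p F"
 by (simp add: gexp_def scaleR_sum_right mult.commute)

lemma gexp_cmult: "gexp V p (\<lambda>G. a * F G) = a * gexp V p F"
 for a :: "'b::real_algebra"
 by (simp add: gexp_def sum_distrib_left)

lemma gexp_divide: "gexp V p (\<lambda>G. F G/a) = gexp V p F/a"
 for a :: "'b::real_field"
 using gexp_cmult[of V p "inverse a" F] by (simp add: field_simps)

lemma gexp_sum: "gexp V p (\<lambda>G. \<Sum>i\<in>I. F i G) = (\<Sum>i\<in>I. gexp V p (F i))"
 unfolding gexp_def scaleR_sum_right by (rule sum.swap)

lemma gexp_const [simp]: "finite V ==> gexp V p (\<lambda>_. c) = c"
 by (induction V rule: finite_induct) (simp_all add: gexp_insert flip: scaleR_add_left)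

lemma gexp_mono:
 fixes F :: "'e set => real"
 assumes "\<And>e. e \<in> V ==> 0 \<le> p e \<and> p e \<le> 1" "\<And>G. G \<subseteq> V ==> F G \<le> F' G"
 shows "gexp V p F \<le> gexp V p F'"
 unfolding gexp_def
proof (rule sum_mono)
 fix G assume G: "G \<in> Pow V"
 then have "0 \<le> (\<Prod>e\<in>G. p e)*(\<Prod>e\<in>V - G. 1 - p e)"
  using assms(1) by (intro mult_nonneg_nonneg prod_nonneg) auto
 with G assms(2)[of G]
 show "((\<Prod>e\<in>G. p e)*(\<Prod>e\<in>V - G. 1 - p e)) *\<^sub>R F G \<le> ((\<Prod>e\<in>G. p e)*(\<Prod>e\<in>V - G. 1 - p e)) *\<^sub>R F' G"
  by (auto intro: mult_left_mono)
qed

lemma gexp_nonneg: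
 fixes F :: "'e set => real"
 assumes "finite V" "\<And>e. e \<in> V ==> 0 \<le> p e \<and> p e \<le> 1" "\<And>G. G \<subseteq> V ==> 0 \<le> F G"
 shows "0 \<le> gexp V p F"
 using gexp_mono[of V p "\<lambda>_. 0" F] assms by simp

lemma gexp_le_const:
 fixes F :: "'e set => real"
 assumes "finite V" "\<And>e. e \<in> V ==> 0 \<le> p e \<and> p e \<le> 1" "\<And>G. G \<subseteq> V ==> F G \<le> c"
 shows "gexp V p F \<le> c"
 using gexp_mono[of V p F "\<lambda>_. c"] assms by simp

lemma norm_gexp_le:
 fixes F :: "'e set => 'b::real_normed_vector"
 assumes "\<And>e. e \<in> V ==> 0 \<le> p e \<and> p e \<le> 1"
 shows "norm (gexp V p F) \<le> gexp V p (\<lambda>G. norm (F G))"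
 unfolding gexp_def
proof (rule order_trans[OF norm_sum], rule sum_mono)
 fix G assume G: "G \<in> Pow V"
 then have "0 \<le> (\<Prod>e\<in>G. p e)*(\<Prod>e\<in>V - G. 1 - p e)"
  using assms(1) by (intro mult_nonneg_nonneg prod_nonneg) auto
 then show "norm (((\<Prod>e\<in>G. p e)*(\<Prod>e\<in>V - G. 1 - p e)) *\<^sub>R F G) \<le> ((\<Prod>e\<in>G. p e)*(\<Prod>e\<in>V - G. 1 - p e)) *\<^sub>R norm (F G)"
  by simp
qed

lemma gexp_diff_le:
 fixes F F' :: "'e set => 'b::real_normed_vector"
 assumes "\<And>e. e \<in> V ==> 0 \<le> p e \<and> p e \<le> 1" "\<And>G. G \<subseteq> V ==> norm (F G - F' G) \<le> B G"
 shows "norm (gexp V p F - gexp V p F') \<le> gexp V p B"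
 unfolding gexp_diff[symmetric]
 by (rule order_trans[OF norm_gexp_le[OF assms(1)] gexp_mono]) (use assms in auto)

lemma gexp_Un:
 assumes "finite A" "finite B" "A \<inter> B = {}"
 shows "gexp (A \<union> B) p F = gexp A p (\<lambda>G. gexp B p (\<lambda>G'. F (G \<union> G')))"
 using assms
proof (induction A arbitrary: F rule: finite_induct)
 case (insert a A)
 then show ?case by (simp add: gexp_insert)
qed simp

lemma gexp_Int:
 assumes "finite V"
 shows "gexp V p (\<lambda>G. F (G \<inter> A)) = gexp (V \<inter> A) p F"
proof -
 have "gexp ((V \<inter> A) \<union> (V - A)) p (\<lambda>G. F (G \<inter> A))
   = gexp (V \<inter> A) p (\<lambda>G. gexp (V - A) p (\<lambda>G'. F ((G \<union> G') \<inter> A)))"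
  by (rule gexp_Un) (use assms in auto)
 also have "\<dots> = gexp (V \<inter> A) p (\<lambda>G. gexp (V - A) p (\<lambda>G'. F G))"
 proof (intro gexp_cong refl)
  fix G G' assume "G \<subseteq> V \<inter> A" "G' \<subseteq> V - A"
  then have "(G \<union> G') \<inter> A = G" by blast
  then show "F ((G \<union> G') \<inter> A) = F G" by simp
 qed
 also have "\<dots> = gexp (V \<inter> A) p F" using assms by simp
 finally show ?thesis by (simp add: Int_Diff_Un)
qed

lemma gexp_prod:
 fixes a :: "'e => 'b::{real_algebra_1,comm_ring_1}"
 assumes "finite V"
 shows "gexp V p (\<lambda>G. \<Prod>e\<in>V. if e \<in> G then a e else 1) = (\<Prod>e\<in>V. 1 + p e *\<^sub>R (a e - 1))"
 using assms
proof (induction V rule: finite_induct)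
 case (insert e V)
 have 1: "gexp V p (\<lambda>G. \<Prod>f\<in>insert e V. if f \<in> insert e G then a f else 1)
   = a e * gexp V p (\<lambda>G. \<Prod>e\<in>V. if e \<in> G then a e else 1)"
  unfolding gexp_cmult[symmetric]
 proof (rule gexp_cong[OF _ refl])
  fix G assume "G \<subseteq> V"
  show "(\<Prod>f\<in>insert e V. if f \<in> insert e G then a f else 1) = a e*(\<Prod>e\<in>V. if e \<in> G then a e else 1)"
   using insert.hyps by simp (intro arg_cong2[of _ _ _ _ "(*)"] prod.cong refl, auto)
 qed
 have 2: "gexp V p (\<lambda>G. \<Prod>f\<in>insert e V. if f \<in> G then a f else 1)
   = gexp V p (\<lambda>G. \<Prod>e\<in>V. if e \<in> G then a e else 1)"
 proof (rule gexp_cong[OF _ refl])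
  fix G assume "G \<subseteq> V"
  then show "(\<Prod>f\<in>insert e V. if f \<in> G then a f else 1) = (\<Prod>e\<in>V. if e \<in> G then a e else 1)"
   using insert.hyps by auto
 qed
 show ?case
  unfolding gexp_insert[OF insert.hyps] 1 2 insert.IH
  using insert.hyps by (simp add: algebra_simps scaleR_diff_left)
qed simp

text \<open>The hypothesis on \<open>F\<close> expresses that \<open>F\<close> ignores whether
  \<open>e\<close> is present, so that it is independent of the indicator.\<close>

lemma gexp_edge:
 fixes F :: "'e set => 'b::real_algebra_1"
 assumes "finite V" "e \<in> V" "\<And>G. G \<subseteq> V ==> F (insert e G) = F (G - {e})"
 shows "gexp V p (\<lambda>G. of_bool (e \<in> G) * F G) = p e *\<^sub>R gexp V p F"
proof -
 define V' where "V' = V - {e}"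
 have V: "V = insert e V'" "e \<notin> V'" "finite V'" using assms by (auto simp: V'_def)
 have 1: "gexp V' p (\<lambda>G. of_bool (e \<in> insert e G) * F (insert e G)) = gexp V' p F"
 proof (rule gexp_cong[OF _ refl])
  fix G assume "G \<subseteq> V'"
  then have "G \<subseteq> V" "G - {e} = G" using V by auto
  with assms(3)[of G] show "of_bool (e \<in> insert e G) * F (insert e G) = F G" by simp
 qed
 have 2: "gexp V' p (\<lambda>G. of_bool (e \<in> G) * F G) = gexp V' p (\<lambda>_. 0)"
  by (rule gexp_cong[OF _ refl]) (use V in auto)
 have 3: "gexp V' p (\<lambda>G. F (insert e G)) = gexp V' p F"
  using 1 by simp
 show ?thesis
  unfolding V(1) gexp_insert[OF V(3,2)] 1 2 3 using V(3) by (simp flip: scaleR_add_left)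
qed

text \<open>Replacing the law of one edge costs \<open>d\<close> times the change of its
  probability. The induction on \<open>V\<close> telescopes over the edges; it plays the role of a
  coupling of the two random graphs.\<close>

lemma gexp_change_prob:
 fixes F :: "'e set => 'b::real_normed_vector"
 assumes "finite V" "\<And>e. e \<in> V ==> 0 \<le> p e \<and> p e \<le> 1" "\<And>e. e \<in> V ==> 0 \<le> p' e \<and> p' e \<le> 1"
  and "\<And>e G. e \<in> V ==> G \<subseteq> V ==> norm (F (insert e G) - F G) \<le> d"
 shows "norm (gexp V p F - gexp V p' F) \<le> d*(\<Sum>e\<in>V. abs (p e - p' e))"
 using assms
proof (induction V arbitrary: F rule: finite_induct)
 case (insert e V)
 have d: "norm (F (insert e G) - F G) \<le> d" if "G \<subseteq> V" for G
  using insert.prems(3)[of e G] that by auto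
 have IH1: "norm (gexp V p (\<lambda>G. F (insert e G)) - gexp V p' (\<lambda>G. F (insert e G))) \<le> d*(\<Sum>e\<in>V. abs (p e - p' e))"
 proof (rule insert.IH)
  fix f G assume "f \<in> V" "G \<subseteq> V"
  then show "norm (F (insert e (insert f G)) - F (insert e G)) \<le> d"
   using insert.prems(3)[of f "insert e G"] by (auto simp: insert_commute)
 qed (use insert.prems in auto)
 have IH2: "norm (gexp V p F - gexp V p' F) \<le> d*(\<Sum>e\<in>V. abs (p e - p' e))"
  by (rule insert.IH) (use insert.prems in "simp_all add: subset_insertI2")
 have D: "norm (gexp V p' (\<lambda>G. F (insert e G)) - gexp V p' F) \<le> d"
  using gexp_diff_le[of V p' "\<lambda>G. F (insert e G)" F "\<lambda>_. d"] d insert.prems insert.hyps by auto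
 let ?A = "gexp V p (\<lambda>G. F (insert e G))" and ?A' = "gexp V p' (\<lambda>G. F (insert e G))"
  and ?B = "gexp V p F" and ?B' = "gexp V p' F" and ?S = "d*(\<Sum>e\<in>V. abs (p e - p' e))"
 have "p e *\<^sub>R ?A + (1 - p e) *\<^sub>R ?B - (p' e *\<^sub>R ?A' + (1 - p' e) *\<^sub>R ?B')
   = p e *\<^sub>R (?A - ?A') + (1 - p e) *\<^sub>R (?B - ?B') + (p e - p' e) *\<^sub>R (?A' - ?B')"
  by (simp add: algebra_simps)
 also have "norm \<dots> \<le> norm (p e *\<^sub>R (?A - ?A') + (1 - p e) *\<^sub>R (?B - ?B')) + norm ((p e - p' e) *\<^sub>R (?A' - ?B'))"
  by (rule norm_triangle_ineq)
 also have "\<dots> \<le> norm (p e *\<^sub>R (?A - ?A')) + norm ((1 - p e) *\<^sub>R (?B - ?B')) + norm ((p e - p' e) *\<^sub>R (?A' - ?B'))"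
  by (intro add_right_mono norm_triangle_ineq)
 also have "\<dots> = p e * norm (?A - ?A') + (1 - p e) * norm (?B - ?B') + abs (p e - p' e) * norm (?A' - ?B')"
  using insert.prems(1)[of e] by simp
 also have "\<dots> \<le> p e*?S + (1 - p e)*?S + abs (p e - p' e)*d"
  using insert.prems(1)[of e] by (intro add_mono mult_left_mono IH1 IH2 D) auto
 also have "\<dots> = d*(\<Sum>e\<in>insert e V. abs (p e - p' e))"
  using insert.hyps by (simp add: algebra_simps)
 finally show ?case by (simp add: gexp_insert insert.hyps)
qed simp

text \<open>A bounded difference inequality of Efron-Stein type. Conditioning on one edge splits the
  variance into the mean of the conditional variances and the variance of a two-point variable,
  which is \<open>p (1 - p)\<close> times the squared gap of the conditional means, a gap of at most
  \<open>d\<close>.\<close>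

lemma gexp_variance:
 fixes F :: "'e set => real"
 assumes "finite V" "\<And>e. e \<in> V ==> 0 \<le> p e \<and> p e \<le> 1"
  and "\<And>e G. e \<in> V ==> G \<subseteq> V ==> abs (F (insert e G) - F G) \<le> d"
 shows "gexp V p (\<lambda>G. (F G)\<^sup>2) - (gexp V p F)\<^sup>2 \<le> d\<^sup>2*(\<Sum>e\<in>V. p e)"
 using assms
proof (induction V arbitrary: F rule: finite_induct)
 case (insert e V)
 have d: "abs (F (insert e G) - F G) \<le> d" if "G \<subseteq> V" for G
  using insert.prems(2)[of e G] that by auto
 let ?A = "gexp V p (\<lambda>G. F (insert e G))" and ?B = "gexp V p F"
  and ?A2 = "gexp V p (\<lambda>G. (F (insert e G))\<^sup>2)" and ?B2 = "gexp V p (\<lambda>G. (F G)\<^sup>2)" and ?S = "d\<^sup>2*(\<Sum>e\<in>V. p e)"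
 have IH1: "?A2 - ?A\<^sup>2 \<le> ?S"
 proof (rule insert.IH)
  fix f G assume "f \<in> V" "G \<subseteq> V"
  then show "abs (F (insert e (insert f G)) - F (insert e G)) \<le> d"
   using insert.prems(2)[of f "insert e G"] by (auto simp: insert_commute)
 qed (use insert.prems in auto)
 have IH2: "?B2 - ?B\<^sup>2 \<le> ?S"
  by (rule insert.IH) (use insert.prems in "simp_all add: subset_insertI2")
 have D: "abs (?A - ?B) \<le> d"
  using gexp_diff_le[of V p "\<lambda>G. F (insert e G)" F "\<lambda>_. d"] d insert.prems insert.hyps by auto
 have D2: "(?A - ?B)\<^sup>2 \<le> d\<^sup>2" using D by (metis abs_ge_zero power2_abs power_mono)
 have p: "0 \<le> p e" "p e \<le> 1" using insert.prems by auto
 have "p e*?A2 + (1 - p e)*?B2 - (p e*?A + (1 - p e)*?B)\<^sup>2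
   = p e*(?A2 - ?A\<^sup>2) + (1 - p e)*(?B2 - ?B\<^sup>2) + (p e*(1 - p e))*(?A - ?B)\<^sup>2"
  by (simp add: algebra_simps power2_eq_square)
 also have "\<dots> \<le> p e*?S + (1 - p e)*?S + p e*d\<^sup>2"
 proof (intro add_mono mult_left_mono IH1 IH2)
  show "p e*(1 - p e)*(?A - ?B)\<^sup>2 \<le> p e*d\<^sup>2"
   using p D2 by (intro mult_mono) (auto simp: mult_left_le)
 qed (use p in auto)
 also have "\<dots> = d\<^sup>2*(\<Sum>e\<in>insert e V. p e)"
  using insert.hyps by (simp add: algebra_simps)
 finally show ?case by (simp add: gexp_insert insert.hyps)
qed simp

text \<open>The mean absolute deviation is at most the standard deviation, because the variance of
  \<open>|F - m|\<close> is nonnegative.\<close>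

lemma gexp_abs_centered:
 fixes F :: "'e set => real"
 assumes V: "finite V" and p: "\<And>e. e \<in> V ==> 0 \<le> p e \<and> p e \<le> 1"
  and d: "\<And>e G. e \<in> V ==> G \<subseteq> V ==> abs (F (insert e G) - F G) \<le> d" "0 \<le> d"
 shows "gexp V p (\<lambda>G. abs (F G - gexp V p F)) \<le> d * sqrt (\<Sum>e\<in>V. p e)"
proof -
 let ?m = "gexp V p F"
 let ?Y = "\<lambda>G. abs (F G - ?m)"
 have "0 \<le> gexp V p (\<lambda>G. (?Y G - gexp V p ?Y)\<^sup>2)"
  by (intro gexp_nonneg V p) auto
 also have "gexp V p (\<lambda>G. (?Y G - gexp V p ?Y)\<^sup>2)
   = gexp V p (\<lambda>G. (?Y G)\<^sup>2 - (2 * gexp V p ?Y)*?Y G + (gexp V p ?Y)\<^sup>2)"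
  by (simp add: power2_diff algebra_simps)
 also have "\<dots> = gexp V p (\<lambda>G. (?Y G)\<^sup>2) - (gexp V p ?Y)\<^sup>2"
  unfolding gexp_add gexp_diff gexp_cmult using V by (simp add: power2_eq_square)
 finally have "(gexp V p ?Y)\<^sup>2 \<le> gexp V p (\<lambda>G. (?Y G)\<^sup>2)" by simp
 also have "\<dots> = gexp V p (\<lambda>G. (F G)\<^sup>2 - (2*?m) * F G + ?m\<^sup>2)"
  by (simp add: power2_diff algebra_simps)
 also have "\<dots> = gexp V p (\<lambda>G. (F G)\<^sup>2) - ?m\<^sup>2"
  unfolding gexp_add gexp_diff gexp_cmult using V by (simp add: power2_eq_square)
 also have "\<dots> \<le> d\<^sup>2*(\<Sum>e\<in>V. p e)"
  by (rule gexp_variance) (use V p d in auto)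
 finally have "sqrt ((gexp V p ?Y)\<^sup>2) \<le> sqrt (d\<^sup>2*(\<Sum>e\<in>V. p e))" by (rule real_sqrt_le_mono)
 then show ?thesis using d(2) by (simp add: real_sqrt_mult)
qed

text \<open>The factor 2 comes from treating real and imaginary parts separately.\<close>

lemma gexp_norm_centered:
 fixes F :: "'e set => complex"
 assumes V: "finite V" and p: "\<And>e. e \<in> V ==> 0 \<le> p e \<and> p e \<le> 1"
  and d: "\<And>e G. e \<in> V ==> G \<subseteq> V ==> norm (F (insert e G) - F G) \<le> d" "0 \<le> d"
 shows "gexp V p (\<lambda>G. norm (F G - gexp V p F)) \<le> 2*d * sqrt (\<Sum>e\<in>V. p e)"
proof -
 have Re: "Re (gexp V p F) = gexp V p (\<lambda>G. Re (F G))" and Im: "Im (gexp V p F) = gexp V p (\<lambda>G. Im (F G))"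
  by (simp_all add: gexp_def)
 have dRe: "abs (Re (F (insert e G)) - Re (F G)) \<le> d" "abs (Im (F (insert e G)) - Im (F G)) \<le> d" if "e \<in> V" "G \<subseteq> V" for e G
  using order_trans[OF abs_Re_le_cmod d(1)[OF that]] order_trans[OF abs_Im_le_cmod d(1)[OF that]] by simp_all
 have "gexp V p (\<lambda>G. norm (F G - gexp V p F))
   \<le> gexp V p (\<lambda>G. abs (Re (F G) - gexp V p (\<lambda>G. Re (F G))) + abs (Im (F G) - gexp V p (\<lambda>G. Im (F G))))"
  by (rule gexp_mono[OF p]) (auto simp: Re[symmetric] Im[symmetric] cmod_le[of "F _ - gexp V p F", simplified])
 also have "\<dots> \<le> d * sqrt (\<Sum>e\<in>V. p e) + d * sqrt (\<Sum>e\<in>V. p e)"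
  unfolding gexp_add
  by (intro add_mono gexp_abs_centered V p dRe d(2))
 finally show ?thesis by simp
qed

section \<open>Iterated ranks\<close>

text \<open>The index order is receiver, sender, so that an iteration step is a matrix-vector
  product. A vertex without out-edges has a zero column, and the division by its out-degree 0 is
  harmless.\<close>

definition amat :: "(nat \<times> nat) set => (nat => ext_type) => nat => nat => real" where
 "amat G w i j = of_bool ((j, i) \<in> G)*(w_zeta (w j)/real (out_degree G j))"

text \<open>With \<open>g\<close> the identity these are the partial sums of the Neumann series for
  PageRank, collecting the contributions of paths of length at most \<open>k\<close>; with
  \<open>g = clip L\<close> every intermediate value is clipped, not only the last one.\<close>

primrec rk :: "(real => real) => nat => (nat \<times> nat) set => (nat => ext_type) => nat => nat => real" where
 "rk g n G w 0 i = g (w_Q (w i))"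
| "rk g n G w (Suc k) i = g (w_Q (w i) + (\<Sum>j=1..n. amat G w i j * rk g n G w k j))"

definition clip :: "real => real => real" where
 "clip L x = max (- L) (min L x)"

definition excess :: "real => real => real" where
 "excess L x = max 0 (abs x - L)"

definition in_deg :: "nat => (nat \<times> nat) set => nat => real" where
 "in_deg n G i = (\<Sum>j=1..n. of_bool ((j, i) \<in> G))"

abbreviation deg_tail :: "nat => real => (nat \<times> nat) set => real" where
 "deg_tail n x G \<equiv> \<Sum>i=1..n. max 0 (in_deg n G i - x)"

abbreviation odeg :: "(nat \<times> nat) set => nat => nat => 'a::zero_neq_one" where
 "odeg G i m \<equiv> of_bool (out_degree G i = m)"

lemma finite_vertex_pairs [simp]: "finite (vertex_pairs n)"
 by (rule finite_subset[of _ "{1..n} \<times> {1..n}"]) (auto simp: vertex_pairs_def)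

lemma abs_clip_le: "0 \<le> L ==> abs (clip L x) \<le> L"
 by (auto simp: clip_def)

lemma clip_lipschitz: "abs (clip L x - clip L y) \<le> abs (x - y)"
 by (auto simp: clip_def max_def min_def)

lemma clip_diff: "0 \<le> L ==> abs (x - clip L x) = excess L x"
 by (auto simp: clip_def excess_def max_def min_def)

lemma excess_lipschitz: "excess L x \<le> excess L y + abs (x - y)"
 by (auto simp: excess_def max_def)

lemma excess_nonneg [simp]: "0 \<le> excess L x"
 by (simp add: excess_def)

lemma excess_antimono: "L \<le> L' ==> excess L' x \<le> excess L x"
 by (auto simp: excess_def)

lemma sum_out_edges:
 assumes "G \<subseteq> vertex_pairs n"
 shows "(\<Sum>i=1..n. of_bool ((j, i) \<in> G)) = real (out_degree G j)"
proof -
 have "{i \<in> {1..n}. (j, i) \<in> G} = {k. (j, k) \<in> G}"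
  using assms by (auto simp: vertex_pairs_def)
 then show ?thesis
  by (simp add: out_degree_def of_bool_def sum.If_cases Int_def)
qed

lemma finite_out: "G \<subseteq> vertex_pairs n ==> finite {k. (j, k) \<in> G}"
 by (rule finite_subset[of _ "{1..n}"]) (auto simp: vertex_pairs_def)

lemma out_degree_pos: "G \<subseteq> vertex_pairs n ==> (j, i) \<in> G ==> 1 \<le> out_degree G j"
 unfolding out_degree_def using finite_out[of G n j] by (auto simp: Suc_le_eq card_gt_0_iff)

lemma abs_amat: "abs (amat G w i j) = of_bool ((j, i) \<in> G)*(abs (w_zeta (w j))/real (out_degree G j))"
 by (simp add: amat_def abs_mult)

lemma abs_amat_le:
 assumes "G \<subseteq> vertex_pairs n" "abs (w_zeta (w j)) \<le> 1"
 shows "abs (amat G w i j) \<le> of_bool ((j, i) \<in> G)"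
proof (cases "(j, i) \<in> G")
 case True
 with out_degree_pos[OF assms(1)] assms(2) show ?thesis
  by (simp add: abs_amat divide_le_eq)
qed (simp add: amat_def)

text \<open>A sender divides its weight equally among its out-neighbours. Row sums, by contrast,
  grow with the in-degree, which is why vectors of ranks are compared in \<open>l1\<close>.\<close>

lemma amat_col_sum:
 assumes "G \<subseteq> vertex_pairs n"
 shows "(\<Sum>i=1..n. abs (amat G w i j)) \<le> abs (w_zeta (w j))"
 unfolding abs_amat sum_distrib_right[symmetric] sum_out_edges[OF assms] by simp

lemma l1_contract:
 fixes a :: "nat => nat => real"
 assumes "\<And>j. j \<in> {1..n} ==> (\<Sum>i=1..n. abs (a i j)) \<le> b j" "\<And>j. j \<in> {1..n} ==> 0 \<le> x j"
 shows "(\<Sum>i=1..n. \<Sum>j=1..n. abs (a i j)*x j) \<le> (\<Sum>j=1..n. b j*x j)"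
proof -
 have "(\<Sum>i=1..n. \<Sum>j=1..n. abs (a i j)*x j) = (\<Sum>j=1..n. (\<Sum>i=1..n. abs (a i j))*x j)"
  by (subst sum.swap) (simp add: sum_distrib_right)
 also have "\<dots> \<le> (\<Sum>j=1..n. b j*x j)"
  by (intro sum_mono mult_right_mono assms) auto
 finally show ?thesis .
qed

lemma amat_contract:
 assumes "G \<subseteq> vertex_pairs n" "\<And>j. j \<in> {1..n} ==> abs (w_zeta (w j)) \<le> c" "\<And>j. j \<in> {1..n} ==> 0 \<le> x j"
 shows "(\<Sum>i=1..n. \<Sum>j=1..n. abs (amat G w i j)*x j) \<le> c*(\<Sum>j=1..n. x j)"
 unfolding sum_distrib_left
 by (rule l1_contract) (use assms amat_col_sum[OF assms(1)] order_trans in blast)+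

lemma amat_contract_abs:
 assumes "G \<subseteq> vertex_pairs n" "\<And>j. j \<in> {1..n} ==> abs (w_zeta (w j)) \<le> c"
 shows "(\<Sum>i=1..n. abs (\<Sum>j=1..n. amat G w i j*x j)) \<le> c*(\<Sum>j=1..n. abs (x j))"
proof -
 have "(\<Sum>i=1..n. abs (\<Sum>j=1..n. amat G w i j*x j)) \<le> (\<Sum>i=1..n. \<Sum>j=1..n. abs (amat G w i j)*abs (x j))"
  by (intro sum_mono order_trans[OF sum_abs]) (simp add: abs_mult)
 also have "\<dots> \<le> c*(\<Sum>j=1..n. abs (x j))"
  by (rule amat_contract) (use assms in auto)
 finally show ?thesis .
qed

text \<open>One new out-edge of \<open>j\<close> changes all weights of \<open>j\<close> through the
  out-degree, but the old and the new column have absolute sum at most 1 each.\<close>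

lemma amat_change_rows:
 assumes "G \<subseteq> vertex_pairs n" "G' \<subseteq> vertex_pairs n" "abs (w_zeta (w j)) \<le> 1"
  and "\<And>j k. j \<notin> J ==> (j, k) \<in> G \<longleftrightarrow> (j, k) \<in> G'"
 shows "(\<Sum>i=1..n. abs (amat G w i j - amat G' w i j)) \<le> 2 * of_bool (j \<in> J)"
proof (cases "j \<in> J")
 case True
 have "(\<Sum>i=1..n. abs (amat G w i j - amat G' w i j)) \<le> (\<Sum>i=1..n. abs (amat G w i j)) + (\<Sum>i=1..n. abs (amat G' w i j))"
  unfolding sum.distrib[symmetric] by (rule sum_mono) simp
 also have "\<dots> \<le> 2"
  using amat_col_sum[OF assms(1), of w j] amat_col_sum[OF assms(2), of w j] assms(3) by linarith
 finally show ?thesis using True by simp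
next
 case False
 then have "out_degree G j = out_degree G' j" "\<And>i. (j, i) \<in> G \<longleftrightarrow> (j, i) \<in> G'"
  using assms(4) by (auto simp: out_degree_def)
 then show ?thesis by (simp add: amat_def)
qed

lemma amat_change_types:
 assumes "G \<subseteq> vertex_pairs n"
 shows "(\<Sum>i=1..n. abs (amat G w i j - amat G w' i j)) \<le> abs (w_zeta (w j) - w_zeta (w' j))"
proof -
 have "amat G w i j - amat G w' i j = of_bool ((j, i) \<in> G)*((w_zeta (w j) - w_zeta (w' j))/real (out_degree G j))" for i
  by (simp add: amat_def diff_divide_distrib)
 then have "(\<Sum>i=1..n. abs (amat G w i j - amat G w' i j))
   = (\<Sum>i=1..n. of_bool ((j, i) \<in> G))*(abs (w_zeta (w j) - w_zeta (w' j))/real (out_degree G j))"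
  by (simp only: abs_mult abs_divide abs_of_nat sum_distrib_right) simp
 then show ?thesis unfolding sum_out_edges[OF assms] by simp
qed

lemma abs_rk_clip_le: "0 \<le> L ==> abs (rk (clip L) n G w k i) \<le> L"
 by (cases k) (simp_all add: abs_clip_le)

text \<open>The perturbation has three sources: the change of \<open>w_Q\<close>, the previous
  difference propagated without growth by one matrix, and the change of the matrix applied to ranks
  that clipping bounds by \<open>L\<close>.\<close>

lemma rk_clip_step:
 assumes G: "G \<subseteq> vertex_pairs n" and zeta: "\<And>j. j \<in> {1..n} ==> abs (w_zeta (w j)) \<le> 1" and L: "0 \<le> L"
 shows "(\<Sum>i=1..n. abs (rk (clip L) n G w (Suc k) i - rk (clip L) n G' w' (Suc k) i))
  \<le> (\<Sum>i=1..n. abs (w_Q (w i) - w_Q (w' i)))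
   + (\<Sum>j=1..n. abs (rk (clip L) n G w k j - rk (clip L) n G' w' k j))
   + L*(\<Sum>j=1..n. \<Sum>i=1..n. abs (amat G w i j - amat G' w' i j))"
proof -
 let ?A = "\<Sum>i=1..n. \<Sum>j=1..n. abs (amat G w i j - amat G' w' i j)"
 let ?x = "rk (clip L) n G w k" and ?y = "rk (clip L) n G' w' k"
 have "abs (rk (clip L) n G w (Suc k) i - rk (clip L) n G' w' (Suc k) i)
   \<le> abs (w_Q (w i) - w_Q (w' i)) + abs (\<Sum>j=1..n. amat G w i j*(?x j - ?y j))
    + L*(\<Sum>j=1..n. abs (amat G w i j - amat G' w' i j))" for i
 proof -
  have "abs (rk (clip L) n G w (Suc k) i - rk (clip L) n G' w' (Suc k) i)
   \<le> abs ((w_Q (w i) + (\<Sum>j=1..n. amat G w i j*?x j)) - (w_Q (w' i) + (\<Sum>j=1..n. amat G' w' i j*?y j)))"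
   by (simp add: clip_lipschitz)
  also have "\<dots> = abs ((w_Q (w i) - w_Q (w' i)) + (\<Sum>j=1..n. amat G w i j*(?x j - ?y j))
    + (\<Sum>j=1..n. (amat G w i j - amat G' w' i j)*?y j))"
   by (simp add: algebra_simps sum_subtractf sum.distrib)
  also have "\<dots> \<le> abs (w_Q (w i) - w_Q (w' i)) + abs (\<Sum>j=1..n. amat G w i j*(?x j - ?y j))
    + abs (\<Sum>j=1..n. (amat G w i j - amat G' w' i j)*?y j)"
   by linarith
  also have "abs (\<Sum>j=1..n. (amat G w i j - amat G' w' i j)*?y j) \<le> L*(\<Sum>j=1..n. abs (amat G w i j - amat G' w' i j))"
  proof -
   have "abs (\<Sum>j=1..n. (amat G w i j - amat G' w' i j)*?y j) \<le> (\<Sum>j=1..n. abs (amat G w i j - amat G' w' i j)*L)"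
    by (rule order_trans[OF sum_abs], rule sum_mono) (auto simp: abs_mult intro!: mult_left_mono abs_rk_clip_le L)
   then show ?thesis by (simp add: sum_distrib_left mult.commute)
  qed
  finally show ?thesis by simp
 qed
 then have "(\<Sum>i=1..n. abs (rk (clip L) n G w (Suc k) i - rk (clip L) n G' w' (Suc k) i))
  \<le> (\<Sum>i=1..n. abs (w_Q (w i) - w_Q (w' i)) + abs (\<Sum>j=1..n. amat G w i j*(?x j - ?y j))
    + L*(\<Sum>j=1..n. abs (amat G w i j - amat G' w' i j)))"
  by (intro sum_mono)
 also have "\<dots> = (\<Sum>i=1..n. abs (w_Q (w i) - w_Q (w' i))) + (\<Sum>i=1..n. abs (\<Sum>j=1..n. amat G w i j*(?x j - ?y j)))
    + L*?A"
  by (simp only: sum.distrib sum_distrib_left)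
 also have "?A = (\<Sum>j=1..n. \<Sum>i=1..n. abs (amat G w i j - amat G' w' i j))"
  by (rule sum.swap)
 also have "(\<Sum>i=1..n. abs (\<Sum>j=1..n. amat G w i j*(?x j - ?y j))) \<le> (\<Sum>j=1..n. abs (?x j - ?y j))"
  using amat_contract_abs[where w = w, OF G zeta, where x = "\<lambda>j. ?x j - ?y j"] by simp
 finally show ?thesis by simp
qed

text \<open>The bounded difference property: with \<open>J\<close> a single vertex, one edge changes
  the clipped ranks by a total of at most \<open>2 L k\<close>, independently of all degrees and of
  \<open>n\<close>. It feeds both the concentration of averages and the change of edge
  probabilities.\<close>

lemma rk_change_rows:
 assumes "G \<subseteq> vertex_pairs n" "G' \<subseteq> vertex_pairs n" "\<And>j. j \<in> {1..n} ==> abs (w_zeta (w j)) \<le> 1" "0 \<le> L"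
  and J: "finite J" "\<And>j k. j \<notin> J ==> (j, k) \<in> G \<longleftrightarrow> (j, k) \<in> G'"
 shows "(\<Sum>i=1..n. abs (rk (clip L) n G w k i - rk (clip L) n G' w k i)) \<le> 2*L * real k * real (card J)"
proof (induction k)
 case (Suc k)
 have "(\<Sum>j=1..n. \<Sum>i=1..n. abs (amat G w i j - amat G' w i j)) \<le> (\<Sum>j=1..n. 2 * of_bool (j \<in> J))"
  by (intro sum_mono amat_change_rows assms) auto
 also have "\<dots> = 2 * real (card ({1..n} \<inter> J))"
  by (simp add: of_bool_def sum.If_cases Int_def flip: sum_distrib_left)
 also have "\<dots> \<le> 2 * real (card J)"
  using J(1) by (auto intro: card_mono)
 finally have "L*(\<Sum>j=1..n. \<Sum>i=1..n. abs (amat G w i j - amat G' w i j)) \<le> L*(2 * real (card J))"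
  using assms(4) by (intro mult_left_mono)
 then have "(\<Sum>i=1..n. abs (rk (clip L) n G w (Suc k) i - rk (clip L) n G' w (Suc k) i)) \<le>
   0 + 2*L * real k * real (card J) + L*(2 * real (card J))"
  by (intro order_trans[OF rk_clip_step] add_mono Suc assms) auto
 then show ?case by (simp add: algebra_simps)
qed simp

lemma rk_change_types:
 assumes "G \<subseteq> vertex_pairs n" "\<And>j. j \<in> {1..n} ==> abs (w_zeta (w j)) \<le> 1" "0 \<le> L"
 shows "(\<Sum>i=1..n. abs (rk (clip L) n G w k i - rk (clip L) n G w' k i))
  \<le> real (Suc k)*(\<Sum>i=1..n. abs (w_Q (w i) - w_Q (w' i))) + L * real k*(\<Sum>i=1..n. abs (w_zeta (w i) - w_zeta (w' i)))"
proof (induction k)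
 case 0
 show ?case by (simp add: sum_mono clip_lipschitz)
next
 case (Suc k)
 have "L*(\<Sum>j=1..n. \<Sum>i=1..n. abs (amat G w i j - amat G w' i j)) \<le> L*(\<Sum>j=1..n. abs (w_zeta (w j) - w_zeta (w' j)))"
  by (intro mult_left_mono sum_mono amat_change_types assms)
 then have "(\<Sum>i=1..n. abs (rk (clip L) n G w (Suc k) i - rk (clip L) n G w' (Suc k) i)) \<le>
   (\<Sum>i=1..n. abs (w_Q (w i) - w_Q (w' i)))
   + (real (Suc k)*(\<Sum>i=1..n. abs (w_Q (w i) - w_Q (w' i))) + L * real k*(\<Sum>i=1..n. abs (w_zeta (w i) - w_zeta (w' i))))
   + L*(\<Sum>j=1..n. abs (w_zeta (w j) - w_zeta (w' j)))"
  by (intro order_trans[OF rk_clip_step] add_mono Suc assms) auto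
 then show ?case by (simp add: algebra_simps)
qed

abbreviation rank_iter :: "nat => (nat \<times> nat) set => (nat => ext_type) => nat => nat => real" where
 "rank_iter \<equiv> rk (\<lambda>x. x)"

text \<open>If \<open>|Q| \<le> q\<close>, all in-neighbours have rank at most \<open>L\<close> and
  there are at most \<open>m\<close> of them, then the new rank is at most \<open>q + L m\<close>.
  So each excess is paid by one of three sources, and the excess of the neighbours is transported in
  \<open>l1\<close> without growth.\<close>

lemma sum_excess_rank_iter:
 assumes G: "G \<subseteq> vertex_pairs n" and zeta: "\<And>j. j \<in> {1..n} ==> abs (w_zeta (w j)) \<le> 1" and L: "0 \<le> L"
 shows "(\<Sum>i=1..n. excess (q + L * m) (rank_iter n G w (Suc k) i))
  \<le> (\<Sum>i=1..n. excess q (w_Q (w i))) + (\<Sum>i=1..n. excess L (rank_iter n G w k i))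
   + L*(deg_tail n m G)"
proof -
 let ?x = "rank_iter n G w k"
 have "excess (q + L * m) (rank_iter n G w (Suc k) i)
   \<le> excess q (w_Q (w i)) + (\<Sum>j=1..n. abs (amat G w i j)*excess L (?x j)) + L * max 0 (in_deg n G i - m)" for i
 proof -
  have "abs (\<Sum>j=1..n. amat G w i j*?x j) \<le> (\<Sum>j=1..n. abs (amat G w i j)*excess L (?x j) + L * of_bool ((j, i) \<in> G))"
  proof (rule order_trans[OF sum_abs], rule sum_mono)
   fix j assume "j \<in> {1..n}"
   have "abs (amat G w i j*?x j) \<le> abs (amat G w i j)*(excess L (?x j) + L)"
    unfolding abs_mult by (rule mult_left_mono) (auto simp: excess_def)
   also have "\<dots> \<le> abs (amat G w i j)*excess L (?x j) + L * of_bool ((j, i) \<in> G)"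
    using abs_amat_le[OF G zeta, where j = j and i = i] \<open>j \<in> {1..n}\<close> L
    by (simp add: distrib_left mult.commute mult_left_mono)
   finally show "abs (amat G w i j*?x j) \<le> abs (amat G w i j)*excess L (?x j) + L * of_bool ((j, i) \<in> G)" .
  qed
  then have 1: "abs (\<Sum>j=1..n. amat G w i j*?x j) \<le> (\<Sum>j=1..n. abs (amat G w i j)*excess L (?x j)) + L*in_deg n G i"
   by (simp only: in_deg_def sum.distrib sum_distrib_left)
  have 2: "L*in_deg n G i - L * m \<le> L * max 0 (in_deg n G i - m)"
   unfolding right_diff_distrib[symmetric] using L by (intro mult_left_mono) auto
  have 3: "0 \<le> (\<Sum>j=1..n. abs (amat G w i j)*excess L (?x j))" "0 \<le> L * max 0 (in_deg n G i - m)"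
   using L by (auto intro!: sum_nonneg)
  have 4: "abs (w_Q (w i)) \<le> excess q (w_Q (w i)) + q" by (simp add: excess_def)
  have "abs (rank_iter n G w (Suc k) i) - (q + L * m)
    \<le> excess q (w_Q (w i)) + (\<Sum>j=1..n. abs (amat G w i j)*excess L (?x j)) + L * max 0 (in_deg n G i - m)"
   using 1 2 4 unfolding rk.simps by linarith
  then show ?thesis unfolding excess_def[of "q + L * m"] using 3 excess_nonneg[of q "w_Q (w i)"] by linarith
 qed
 then have "(\<Sum>i=1..n. excess (q + L * m) (rank_iter n G w (Suc k) i)) \<le> (\<Sum>i=1..n.
   excess q (w_Q (w i)) + (\<Sum>j=1..n. abs (amat G w i j)*excess L (?x j)) + L * max 0 (in_deg n G i - m))"
  by (intro sum_mono)
 also have "\<dots> = (\<Sum>i=1..n. excess q (w_Q (w i))) + (\<Sum>i=1..n. \<Sum>j=1..n. abs (amat G w i j)*excess L (?x j))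
    + L*(deg_tail n m G)"
  by (simp only: sum.distrib sum_distrib_left)
 also have "(\<Sum>i=1..n. \<Sum>j=1..n. abs (amat G w i j)*excess L (?x j)) \<le> (\<Sum>i=1..n. excess L (?x i))"
  using amat_contract[where w = w, OF G zeta, where x = "\<lambda>j. excess L (?x j)"] by simp
 finally show ?thesis by simp
qed

lemma rank_iter_clip_0:
 assumes "0 \<le> L"
 shows "(\<Sum>i=1..n. abs (rank_iter n G w 0 i - rk (clip L) n G w 0 i)) = (\<Sum>i=1..n. excess L (rank_iter n G w 0 i))"
 using assms by (simp add: clip_diff)

text \<open>The clipping loss is charged to the excess of the unclipped rank, for which uniform
  integrability is available. Passing to it from the rank that is actually clipped costs the
  propagated difference a second time, hence the factor 2.\<close>

lemma rank_iter_clip_Suc: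
 assumes G: "G \<subseteq> vertex_pairs n" and zeta: "\<And>j. j \<in> {1..n} ==> abs (w_zeta (w j)) \<le> 1" and L: "0 \<le> L"
 shows "(\<Sum>i=1..n. abs (rank_iter n G w (Suc k) i - rk (clip L) n G w (Suc k) i))
  \<le> 2*(\<Sum>i=1..n. abs (rank_iter n G w k i - rk (clip L) n G w k i)) + (\<Sum>i=1..n. excess L (rank_iter n G w (Suc k) i))"
proof -
 let ?x = "rank_iter n G w k" and ?y = "rk (clip L) n G w k"
 let ?d = "\<lambda>i. abs (\<Sum>j=1..n. amat G w i j*(?x j - ?y j))"
 have "abs (rank_iter n G w (Suc k) i - rk (clip L) n G w (Suc k) i) \<le> 2*?d i + excess L (rank_iter n G w (Suc k) i)" for i
 proof -
  define a b where "a = w_Q (w i) + (\<Sum>j=1..n. amat G w i j*?x j)" and "b = w_Q (w i) + (\<Sum>j=1..n. amat G w i j*?y j)"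
  have "abs (a - b) = ?d i" by (simp add: a_def b_def algebra_simps sum_subtractf)
  then have "abs (a - clip L b) \<le> 2*?d i + excess L a"
   using clip_diff[OF L, of b] excess_lipschitz[of L b a] by linarith
  then show ?thesis by (simp add: a_def b_def)
 qed
 then have "(\<Sum>i=1..n. abs (rank_iter n G w (Suc k) i - rk (clip L) n G w (Suc k) i))
   \<le> 2*(\<Sum>i=1..n. ?d i) + (\<Sum>i=1..n. excess L (rank_iter n G w (Suc k) i))"
  unfolding sum_distrib_left sum.distrib[symmetric] by (intro sum_mono)
 moreover have "(\<Sum>i=1..n. ?d i) \<le> 1*(\<Sum>i=1..n. abs (?x i - ?y i))"
  by (rule amat_contract_abs[OF G zeta])
 ultimately show ?thesis by linarith
qed

section \<open>PageRank as the limit of its iterates\<close>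

lemma is_rank_vector_iff:
 assumes "G \<subseteq> vertex_pairs n"
 shows "is_rank_vector n G w R \<longleftrightarrow> (\<forall>i\<in>{1..n}. R i = w_Q (w i) + (\<Sum>j=1..n. amat G w i j * R j))"
proof -
 have "(\<Sum>j | (j, i) \<in> G. w_zeta (w j)/real (out_degree G j) * R j) = (\<Sum>j=1..n. amat G w i j * R j)" for i
 proof (rule sum.mono_neutral_cong_left)
  show "{j. (j, i) \<in> G} \<subseteq> {1..n}" using assms by (auto simp: vertex_pairs_def)
 qed (auto simp: amat_def)
 then show ?thesis by (simp add: is_rank_vector_def add.commute)
qed

context
 fixes n :: nat and G :: "(nat \<times> nat) set" and w :: "nat => ext_type" and c :: real
 assumes G: "G \<subseteq> vertex_pairs n" and zeta: "\<And>j. j \<in> {1..n} ==> abs (w_zeta (w j)) \<le> c" and c: "0 \<le> c" "c < 1"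
begin

lemma rank_iter_increment:
 "(\<Sum>i=1..n. abs (rank_iter n G w (Suc k) i - rank_iter n G w k i)) \<le> c ^ Suc k*(\<Sum>i=1..n. abs (w_Q (w i)))"
proof (induction k)
 case 0
 show ?case using amat_contract_abs[where w = w, OF G zeta, where x = "\<lambda>j. w_Q (w j)"] by simp
next
 case (Suc k)
 have eq: "rank_iter n G w (Suc (Suc k)) i - rank_iter n G w (Suc k) i
   = (\<Sum>j=1..n. amat G w i j*(rank_iter n G w (Suc k) j - rank_iter n G w k j))" for i
  by (subst (1) rk.simps(2), subst (2) rk.simps(2)) (simp add: sum_subtractf right_diff_distrib del: rk.simps)
 have "(\<Sum>i=1..n. abs (rank_iter n G w (Suc (Suc k)) i - rank_iter n G w (Suc k) i))
   \<le> c*(\<Sum>i=1..n. abs (rank_iter n G w (Suc k) i - rank_iter n G w k i))"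
  unfolding eq by (rule amat_contract_abs[OF G zeta])
 also have "\<dots> \<le> c*(c ^ Suc k*(\<Sum>i=1..n. abs (w_Q (w i))))"
  using Suc c by (intro mult_left_mono)
 finally show ?case by (simp only: power_Suc mult.assoc)
qed

lemma rank_iter_convergent:
 assumes "i \<in> {1..n}" shows "convergent (\<lambda>k. rank_iter n G w k i)"
proof -
 let ?d = "\<lambda>k. rank_iter n G w (Suc k) i - rank_iter n G w k i"
 have "summable ?d"
 proof (rule summable_comparison_test')
  show "summable (\<lambda>k. c ^ Suc k*(\<Sum>i=1..n. abs (w_Q (w i))))"
   using c by (intro summable_mult2) (simp add: summable_geometric summable_mult)
  fix k :: nat assume "0 \<le> k"
  have "abs (?d k) \<le> (\<Sum>i=1..n. abs (rank_iter n G w (Suc k) i - rank_iter n G w k i))"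
   by (rule member_le_sum[OF assms, where f = "\<lambda>i. abs (rank_iter n G w (Suc k) i - rank_iter n G w k i)"]) auto
  also note rank_iter_increment
  finally show "norm (?d k) \<le> c ^ Suc k*(\<Sum>i=1..n. abs (w_Q (w i)))" by simp
 qed
 then have "convergent (\<lambda>m. \<Sum>k<m. ?d k)" by (simp add: summable_iff_convergent)
 then have "convergent (\<lambda>m. (\<Sum>k<m. ?d k) + rank_iter n G w 0 i)"
  by (intro convergent_add convergent_const)
 moreover have "(\<lambda>m. (\<Sum>k<m. ?d k) + rank_iter n G w 0 i) = (\<lambda>m. rank_iter n G w m i)"
  by (subst sum_lessThan_telescope[of "\<lambda>k. rank_iter n G w k i"]) simp
 ultimately show ?thesis by (simp only:)
qed

lemma fixed_point_unique:
 assumes "is_rank_vector n G w R" "is_rank_vector n G w R'" "i \<in> {1..n}"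
 shows "R i = R' i"
proof -
 have "(\<Sum>i=1..n. abs (R i - R' i)) = (\<Sum>i=1..n. abs (\<Sum>j=1..n. amat G w i j*(R j - R' j)))"
 proof (rule sum.cong[OF refl])
  fix i assume i: "i \<in> {1..n}"
  have "R i - R' i = (\<Sum>j=1..n. amat G w i j*(R j - R' j))"
   unfolding bspec[OF assms(1)[unfolded is_rank_vector_iff[OF G]] i] bspec[OF assms(2)[unfolded is_rank_vector_iff[OF G]] i]
   by (simp add: sum_subtractf right_diff_distrib)
  then show "abs (R i - R' i) = abs (\<Sum>j=1..n. amat G w i j*(R j - R' j))" by simp
 qed
 also have "\<dots> \<le> c*(\<Sum>i=1..n. abs (R i - R' i))"
  by (rule amat_contract_abs[OF G zeta])
 finally have "(1 - c)*(\<Sum>i=1..n. abs (R i - R' i)) \<le> 0" by (simp add: algebra_simps)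
 then have "(\<Sum>i=1..n. abs (R i - R' i)) \<le> 0" using c by (simp add: mult_le_0_iff)
 then have "(\<Sum>i=1..n. abs (R i - R' i)) = 0" by (simp add: antisym sum_nonneg)
 then have "abs (R i - R' i) = 0" using assms(3) by (subst (asm) sum_nonneg_eq_0_iff) auto
 then show ?thesis by simp
qed

text \<open>This justifies the definite description in \<open>page_rank\<close>: the limit of the
  iterates solves the equations, its restriction to \<open>{1..n}\<close> makes it extensional, and
  the contraction excludes a second solution.\<close>

lemma page_rank_limit:
 "is_rank_vector n G w (page_rank n G w)"
 "i \<in> {1..n} ==> (\<lambda>k. rank_iter n G w k i) \<longlonglongrightarrow> page_rank n G w i"
proof -
 define R where "R = (\<lambda>i\<in>{1..n}. lim (\<lambda>k. rank_iter n G w k i))"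
 have lim: "(\<lambda>k. rank_iter n G w k i) \<longlonglongrightarrow> R i" if "i \<in> {1..n}" for i
  using rank_iter_convergent[OF that] that by (simp add: R_def convergent_LIMSEQ_iff)
 have R: "is_rank_vector n G w R"
  unfolding is_rank_vector_iff[OF G]
 proof
  fix i assume i: "i \<in> {1..n}"
  have "(\<lambda>k. rank_iter n G w (Suc k) i) \<longlonglongrightarrow> w_Q (w i) + (\<Sum>j=1..n. amat G w i j * R j)"
   unfolding rk.simps by (intro tendsto_intros lim) auto
  then have "(\<lambda>k. rank_iter n G w k i) \<longlonglongrightarrow> w_Q (w i) + (\<Sum>j=1..n. amat G w i j * R j)"
   by (rule LIMSEQ_imp_Suc)
  with lim[OF i] show "R i = w_Q (w i) + (\<Sum>j=1..n. amat G w i j * R j)"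
   using LIMSEQ_unique by blast
 qed
 have "page_rank n G w = R"
  unfolding page_rank_def
 proof (rule the_equality)
  show "R \<in> extensional {1..n} \<and> is_rank_vector n G w R" using R by (simp add: R_def)
  fix R' assume R': "R' \<in> extensional {1..n} \<and> is_rank_vector n G w R'"
  show "R' = R"
   using R R' fixed_point_unique[of R' R]
   by (intro extensionalityI[of _ "{1..n}"]) (auto simp: R_def)
 qed
 with R lim show "is_rank_vector n G w (page_rank n G w)"
  "i \<in> {1..n} ==> (\<lambda>k. rank_iter n G w k i) \<longlonglongrightarrow> page_rank n G w i" by auto
qed

text \<open>Each iteration multiplies the \<open>l1\<close> distance to the fixed point by at most
  \<open>c\<close>. The initial distance is at most the norm of the fixed point, which its own
  equation bounds by the norm of \<open>w_Q\<close> divided by \<open>1 - c\<close>.\<close>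

lemma page_rank_approx:
 "(\<Sum>i=1..n. abs (page_rank n G w i - rank_iter n G w k i)) \<le> c ^ k/(1 - c)*(\<Sum>i=1..n. abs (w_Q (w i)))"
proof -
 define R where "R = page_rank n G w"
 have R: "R i = w_Q (w i) + (\<Sum>j=1..n. amat G w i j * R j)" if "i \<in> {1..n}" for i
  using page_rank_limit(1) that unfolding is_rank_vector_iff[OF G] R_def by blast
 have AR: "(\<Sum>i=1..n. abs (\<Sum>j=1..n. amat G w i j * R j)) \<le> c*(\<Sum>j=1..n. abs (R j))"
  by (rule amat_contract_abs[OF G zeta])
 have "(\<Sum>i=1..n. abs (R i)) \<le> (\<Sum>i=1..n. abs (w_Q (w i)) + abs (\<Sum>j=1..n. amat G w i j * R j))"
  by (rule sum_mono) (subst R, auto)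
 also have "\<dots> \<le> (\<Sum>i=1..n. abs (w_Q (w i))) + c*(\<Sum>j=1..n. abs (R j))"
  using AR by (simp add: sum.distrib)
 finally have le: "(\<Sum>i=1..n. abs (R i)) \<le> (\<Sum>i=1..n. abs (w_Q (w i)))/(1 - c)"
  using c by (simp add: field_simps)
 have "(\<Sum>i=1..n. abs (R i - rank_iter n G w k i)) \<le> c ^ k*(\<Sum>i=1..n. abs (R i))"
 proof (induction k)
  case 0
  have "(\<Sum>i=1..n. abs (R i - rank_iter n G w 0 i)) = (\<Sum>i=1..n. abs (\<Sum>j=1..n. amat G w i j * R j))"
   by (rule sum.cong[OF refl]) (use R in "simp add: field_simps")
  also note AR
  also have "c*(\<Sum>j=1..n. abs (R j)) \<le> 1*(\<Sum>j=1..n. abs (R j))" using c by (intro mult_right_mono sum_nonneg) auto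
  finally show ?case by simp
 next
  case (Suc k)
  have "(\<Sum>i=1..n. abs (R i - rank_iter n G w (Suc k) i)) = (\<Sum>i=1..n. abs (\<Sum>j=1..n. amat G w i j*(R j - rank_iter n G w k j)))"
   by (rule sum.cong[OF refl], subst R) (simp_all add: sum_subtractf right_diff_distrib)
  also have "\<dots> \<le> c*(\<Sum>i=1..n. abs (R i - rank_iter n G w k i))" by (rule amat_contract_abs[OF G zeta])
  also have "\<dots> \<le> c*(c ^ k*(\<Sum>i=1..n. abs (R i)))" using Suc c by (intro mult_left_mono)
  finally show ?case by simp
 qed
 also have "\<dots> \<le> c ^ k*((\<Sum>i=1..n. abs (w_Q (w i)))/(1 - c))"
  using le c by (intro mult_left_mono) auto
 finally show ?thesis by (simp add: R_def)
qed

end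

section \<open>Cycles\<close>

text \<open>The entry \<open>(i, j)\<close> of the matrix power \<open>B ^ s\<close>. For the rank
  matrix it weighs the paths of length \<open>s\<close> in the graph from \<open>j\<close> to
  \<open>i\<close>, since the first index is the receiver.\<close>

primrec walk :: "nat => (nat => nat => real) => nat => nat => nat => real" where
 "walk n B 0 i j = of_bool (i = j)"
| "walk n B (Suc s) i j = (\<Sum>k=1..n. B i k*walk n B s k j)"

lemma walk_nonneg: "(\<And>i j. 0 \<le> B i j) ==> 0 \<le> walk n B s i j"
 by (induction s arbitrary: i) (auto intro!: sum_nonneg)

lemma walk_Suc_right:
 assumes "i \<in> {1..n}" "j \<in> {1..n}"
 shows "walk n B (Suc s) i j = (\<Sum>k=1..n. walk n B s i k*B k j)"
 using assms(1)
proof (induction s arbitrary: i)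
 case 0
 have "(\<Sum>k=1..n. B i k * of_bool (k = j)) = (\<Sum>k=1..n. if k = j then B i j else 0)"
  "(\<Sum>k=1..n. of_bool (i = k)*B k j) = (\<Sum>k=1..n. if i = k then B i j else 0)"
  by (auto intro: sum.cong)
 then show ?case using assms(2) 0 by simp
next
 case (Suc s)
 have "walk n B (Suc (Suc s)) i j = (\<Sum>k=1..n. B i k*(\<Sum>l=1..n. walk n B s k l*B l j))"
  by (subst walk.simps(2)) (use Suc.IH in simp)
 also have "\<dots> = (\<Sum>l=1..n. \<Sum>k=1..n. B i k*walk n B s k l*B l j)"
  unfolding sum_distrib_left mult.assoc by (rule sum.swap)
 finally show ?case by (simp add: sum_distrib_right)
qed

lemma walk_mono:
 assumes "\<And>i j. 0 \<le> C i j" "\<And>i j. C i j \<le> B i j"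
 shows "walk n C s i j \<le> walk n B s i j"
proof (induction s arbitrary: i)
 case (Suc s)
 have "0 \<le> B i j" for i j using assms(1)[of i j] assms(2)[of i j] by linarith
 then show ?case
  unfolding walk.simps by (intro sum_mono mult_mono walk_nonneg assms Suc)
qed simp

lemma walk_col_sum:
 assumes "\<And>i j. 0 \<le> B i j" "\<And>j. j \<in> {1..n} ==> (\<Sum>i=1..n. B i j) \<le> 1" "j \<in> {1..n}"
 shows "(\<Sum>i=1..n. walk n B s i j) \<le> 1"
proof (induction s)
 case 0
 show ?case using assms(3) by (simp add: of_bool_def sum.delta)
next
 case (Suc s)
 have "(\<Sum>i=1..n. walk n B (Suc s) i j) = (\<Sum>k=1..n. (\<Sum>i=1..n. B i k)*walk n B s k j)"
  by (simp add: sum_distrib_right) (rule sum.swap)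
 also have "\<dots> \<le> (\<Sum>k=1..n. 1*walk n B s k j)"
  by (intro sum_mono mult_right_mono assms walk_nonneg)
 finally show ?case using Suc by simp
qed

lemma walk_le_1:
 assumes "\<And>i j. 0 \<le> B i j" "\<And>j. j \<in> {1..n} ==> (\<Sum>i=1..n. B i j) \<le> 1" "i \<in> {1..n}" "j \<in> {1..n}"
 shows "walk n B s i j \<le> 1"
 using member_le_sum[of i "{1..n}" "\<lambda>i. walk n B s i j"] walk_col_sum[where B = B and s = s and j = j and n = n, OF assms(1,2,4)] assms(3) walk_nonneg[where B = B and n = n and s = s, OF assms(1)]
 by (meson finite_atLeastAtMost order_trans)

text \<open>A walk ending in \<open>j\<close> is cut at its first visit to \<open>j\<close>.\<close>

lemma walk_first_return:
 assumes B: "\<And>i j. 0 \<le> B i j" "\<And>j. j \<in> {1..n} ==> (\<Sum>i=1..n. B i j) \<le> 1"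
  and C: "\<And>i k. C i k = (if k = j then 0 else B i k)" and y: "\<And>i. B i j \<le> y i"
  and j: "j \<in> {1..n}" and i: "i \<in> {1..n}"
 shows "walk n B (Suc s) i j \<le> (\<Sum>t\<le>s. \<Sum>l=1..n. walk n C t i l*y l)"
 using i
proof (induction s arbitrary: i)
 case 0
 have "(\<Sum>k=1..n. B i k * of_bool (k = j)) = (\<Sum>k=1..n. if k = j then B i j else 0)"
  "(\<Sum>k=1..n. of_bool (i = k)*y k) = (\<Sum>k=1..n. if i = k then y i else 0)"
  by (auto intro: sum.cong)
 then show ?case using y[of i] j 0 by simp
next
 case (Suc s)
 have C0: "0 \<le> C i k" for i k using B by (simp add: C)
 have y0: "0 \<le> y i" for i using B(1)[of i j] y[of i] by linarith
 let ?u = "\<lambda>k. walk n B (Suc s) k j"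
 \<comment> \<open>The first step either avoids \<open>j\<close> and stays in \<open>C\<close>, or
   enters \<open>j\<close>; in the second case the rest of the walk weighs at most 1.\<close>
 have "walk n B (Suc (Suc s)) i j = (\<Sum>k=1..n. C i k*?u k + (if k = j then B i j*?u j else 0))"
  by (subst walk.simps(2), rule sum.cong[OF refl]) (simp add: C del: walk.simps)
 also have "\<dots> = (\<Sum>k=1..n. C i k*?u k) + B i j*?u j"
  using j by (simp add: sum.distrib del: walk.simps)
 also have "\<dots> \<le> (\<Sum>k=1..n. C i k*(\<Sum>t\<le>s. \<Sum>l=1..n. walk n C t k l*y l)) + y i"
 proof (intro add_mono sum_mono mult_left_mono Suc.IH C0)
  have "B i j*?u j \<le> y i*1"
   using B y y0 j by (intro mult_mono walk_le_1 walk_nonneg) auto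
  then show "B i j*?u j \<le> y i" by simp
 qed
 also have "(\<Sum>k=1..n. C i k*(\<Sum>t\<le>s. \<Sum>l=1..n. walk n C t k l*y l)) = (\<Sum>t\<le>s. \<Sum>l=1..n. walk n C (Suc t) i l*y l)"
 proof -
  have "(\<Sum>k=1..n. C i k*(\<Sum>t\<le>s. \<Sum>l=1..n. walk n C t k l*y l))
    = (\<Sum>k=1..n. \<Sum>t\<le>s. \<Sum>l=1..n. C i k*walk n C t k l*y l)"
   by (simp add: sum_distrib_left mult.assoc)
  also have "\<dots> = (\<Sum>t\<le>s. \<Sum>k=1..n. \<Sum>l=1..n. C i k*walk n C t k l*y l)"
   by (rule sum.swap)
  also have "\<dots> = (\<Sum>t\<le>s. \<Sum>l=1..n. \<Sum>k=1..n. C i k*walk n C t k l*y l)"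
   by (intro sum.cong refl sum.swap)
  finally show ?thesis by (simp add: sum_distrib_right)
 qed
 also have "y i = (\<Sum>l=1..n. walk n C 0 i l*y l)"
 proof -
  have "(\<Sum>l=1..n. walk n C 0 i l*y l) = (\<Sum>l=1..n. if i = l then y i else 0)"
   by (rule sum.cong) auto
  then show ?thesis using Suc.prems by simp
 qed
 also have "(\<Sum>t\<le>s. \<Sum>l=1..n. walk n C (Suc t) i l*y l) + (\<Sum>l=1..n. walk n C 0 i l*y l)
   = (\<Sum>t\<le>Suc s. \<Sum>l=1..n. walk n C t i l*y l)"
  by (simp only: sum.atMost_Suc_shift add.commute)
 finally show ?case .
qed

lemma gexp_edge_le:
 fixes F :: "'e set => real"
 assumes "finite V" "\<And>e. e \<in> V ==> 0 \<le> p e \<and> p e \<le> 1" "e \<in> V ==> p e \<le> q" "0 \<le> q"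
  and "\<And>G. G \<subseteq> V ==> F (insert e G) = F (G - {e})" "\<And>G. G \<subseteq> V ==> 0 \<le> F G"
 shows "gexp V p (\<lambda>G. of_bool (e \<in> G) * F G) \<le> q * gexp V p F"
proof (cases "e \<in> V")
 case True
 then have "gexp V p (\<lambda>G. of_bool (e \<in> G) * F G) = p e * gexp V p F"
  using assms by (subst gexp_edge) auto
 also have "\<dots> \<le> q * gexp V p F"
  using True assms by (intro mult_right_mono gexp_nonneg) auto
 finally show ?thesis .
next
 case False
 then have "gexp V p (\<lambda>G. of_bool (e \<in> G) * F G) = gexp V p (\<lambda>_. 0)"
  by (intro gexp_cong) auto
 then show ?thesis using assms by (auto intro!: mult_nonneg_nonneg gexp_nonneg)
qed

definition bmat :: "(nat \<times> nat) set => (nat => ext_type) => nat => nat => real" where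
 "bmat G w i j = abs (amat G w i j)"

lemma bmat_nonneg [simp]: "0 \<le> bmat G w i j"
 by (simp add: bmat_def)

lemma bmat_col_sum:
 "G \<subseteq> vertex_pairs n ==> abs (w_zeta (w j)) \<le> 1 ==> (\<Sum>i=1..n. bmat G w i j) \<le> 1"
 using amat_col_sum[of G n w j] by (simp add: bmat_def)

text \<open>Closed walks are rare: in total over all \<open>n\<close> starting points their expected
  weight stays bounded. Cut at its first return, a closed walk at \<open>j\<close> ends with an
  entry of column \<open>j\<close>, that is with an edge out of \<open>j\<close>. The part before
  uses no edge out of \<open>j\<close>, so it is independent of this edge, which has probability at
  most \<open>K/n\<close>. The column sums then absorb the sum over \<open>j\<close>.\<close>

lemma trace_bound:
 assumes V: "V \<subseteq> vertex_pairs n" and p: "\<And>e. e \<in> V ==> 0 \<le> p e \<and> p e \<le> 1"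
  and K: "\<And>e. e \<in> V ==> p e \<le> K/real n" "0 \<le> K" and zeta: "\<And>j. j \<in> {1..n} ==> abs (w_zeta (w j)) \<le> 1"
 shows "(\<Sum>j=1..n. gexp V p (\<lambda>G. walk n (bmat G w) (Suc s) j j)) \<le> K * real (Suc s)"
proof -
 have fin: "finite V" using V finite_vertex_pairs by (rule finite_subset)
 let ?C = "\<lambda>j G. bmat {e \<in> G. fst e \<noteq> j} w"
 \<comment> \<open>Deleting the edges out of \<open>j\<close> empties column \<open>j\<close> and
   leaves the out-degrees of the other vertices, hence their columns, unchanged.\<close>
 have C: "?C j G i k = (if k = j then 0 else bmat G w i k)" for j G i k
  by (auto simp: bmat_def amat_def out_degree_def intro!: arg_cong[where f = card])
 have "gexp V p (\<lambda>G. walk n (bmat G w) (Suc s) j j)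
   \<le> (\<Sum>t\<le>s. \<Sum>l=1..n. K/real n * gexp V p (\<lambda>G. walk n (bmat G w) t j l))" if j: "j \<in> {1..n}" for j
 proof -
  have "gexp V p (\<lambda>G. walk n (bmat G w) (Suc s) j j)
    \<le> gexp V p (\<lambda>G. \<Sum>t\<le>s. \<Sum>l=1..n. of_bool ((j, l) \<in> G)*walk n (?C j G) t j l)"
  proof (rule gexp_mono[OF p])
   fix G assume "G \<subseteq> V"
   then have G: "G \<subseteq> vertex_pairs n" using V by auto
   have "walk n (bmat G w) (Suc s) j j \<le> (\<Sum>t\<le>s. \<Sum>l=1..n. walk n (?C j G) t j l * of_bool ((j, l) \<in> G))"
   proof (rule walk_first_return)
    show "bmat G w i j \<le> of_bool ((j, i) \<in> G)" for i
     using abs_amat_le[where w = w and j = j, OF G zeta[OF j]] by (simp add: bmat_def)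
   qed (use j C bmat_col_sum[of G n w] G zeta in auto)
   then show "walk n (bmat G w) (Suc s) j j \<le> (\<Sum>t\<le>s. \<Sum>l=1..n. of_bool ((j, l) \<in> G)*walk n (?C j G) t j l)"
    by (simp only: mult.commute)
  qed auto
  also have "\<dots> = (\<Sum>t\<le>s. \<Sum>l=1..n. gexp V p (\<lambda>G. of_bool ((j, l) \<in> G)*walk n (?C j G) t j l))"
   by (simp only: gexp_sum)
  also have "\<dots> \<le> (\<Sum>t\<le>s. \<Sum>l=1..n. K/real n * gexp V p (\<lambda>G. walk n (bmat G w) t j l))"
  proof (intro sum_mono)
   fix t l
   have "gexp V p (\<lambda>G. of_bool ((j, l) \<in> G)*walk n (?C j G) t j l) \<le> K/real n * gexp V p (\<lambda>G. walk n (?C j G) t j l)"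
   proof (rule gexp_edge_le[OF fin p])
    fix G
    have "{e \<in> insert (j, l) G. fst e \<noteq> j} = {e \<in> G - {(j, l)}. fst e \<noteq> j}" by auto
    then show "walk n (?C j (insert (j, l) G)) t j l = walk n (?C j (G - {(j, l)})) t j l" by simp
   qed (use K in "auto intro!: walk_nonneg")
   also have "\<dots> \<le> K/real n * gexp V p (\<lambda>G. walk n (bmat G w) t j l)"
    using K by (intro mult_left_mono gexp_mono p walk_mono) (auto simp: C)
   finally show "gexp V p (\<lambda>G. of_bool ((j, l) \<in> G)*walk n (?C j G) t j l) \<le> \<dots>" .
  qed
  finally show ?thesis .
 qed
 then have "(\<Sum>j=1..n. gexp V p (\<lambda>G. walk n (bmat G w) (Suc s) j j))
   \<le> (\<Sum>j=1..n. \<Sum>t\<le>s. \<Sum>l=1..n. K/real n * gexp V p (\<lambda>G. walk n (bmat G w) t j l))"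
  by (intro sum_mono)
 also have "\<dots> = (\<Sum>t\<le>s. \<Sum>j=1..n. \<Sum>l=1..n. K/real n * gexp V p (\<lambda>G. walk n (bmat G w) t j l))"
  by (rule sum.swap)
 also have "\<dots> = (\<Sum>t\<le>s. \<Sum>l=1..n. \<Sum>j=1..n. K/real n * gexp V p (\<lambda>G. walk n (bmat G w) t j l))"
  by (intro sum.cong refl sum.swap)
 also have "\<dots> = (\<Sum>t\<le>s. \<Sum>l=1..n. K/real n * gexp V p (\<lambda>G. \<Sum>j=1..n. walk n (bmat G w) t j l))"
  by (simp only: gexp_sum sum_distrib_left)
 also have "\<dots> \<le> (\<Sum>t\<le>s. \<Sum>l=1..n. K/real n*1)"
 proof (intro sum_mono mult_left_mono gexp_le_const fin p)
  fix l G assume "l \<in> {1..n}" "G \<subseteq> V"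
  then show "(\<Sum>j=1..n. walk n (bmat G w) t j l) \<le> 1" for t
   using V zeta by (intro walk_col_sum bmat_col_sum) auto
 qed (use K in auto)
 also have "\<dots> \<le> K * real (Suc s)" using K by (cases "n = 0") (auto simp: field_simps)
 finally show ?thesis .
qed

section \<open>Effect of deleting a vertex on the ranks\<close>

definition del :: "nat => (nat \<times> nat) set => (nat \<times> nat) set" where
 "del i G = G \<inter> {e. fst e \<noteq> i \<and> snd e \<noteq> i}"

lemma del_subset: "del i G \<subseteq> G" by (auto simp: del_def)

lemma del_insert:
 assumes "fst e = i \<or> snd e = i"
 shows "del i (insert e G) = del i (G - {e})"
 using assms by (auto simp: del_def)

lemma out_degree_del:
 assumes "G \<subseteq> vertex_pairs n" "k \<noteq> i"
 shows "real (out_degree G k) = real (out_degree (del i G) k) + of_bool ((k, i) \<in> G)"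
proof -
 have 1: "{l. (k, l) \<in> G} = (if (k, i) \<in> G then insert i {l. (k, l) \<in> del i G} else {l. (k, l) \<in> del i G})"
  using assms(2) by (auto simp: del_def)
 have 2: "finite {l. (k, l) \<in> del i G}"
  by (rule finite_out[of _ n]) (use assms(1) del_subset in blast)
 have 3: "i \<notin> {l. (k, l) \<in> del i G}" by (simp add: del_def)
 show ?thesis
  unfolding out_degree_def 1 using card_insert_disjoint[OF 2 3] by simp
qed

text \<open>Column \<open>i\<close> and row \<open>i\<close> disappear, and the column of an
  in-neighbour \<open>k\<close> of \<open>i\<close> is rescaled from \<open>1/(D + 1)\<close> to
  \<open>1/D\<close>, a change bounded by the entry of the smaller graph. All bounds are products of
  an indicator of an edge at \<open>i\<close> with something that does not see the edges at
  \<open>i\<close>.\<close>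

lemma amat_del_diff:
 assumes G: "G \<subseteq> vertex_pairs n" and zeta: "\<And>j. j \<in> {1..n} ==> abs (w_zeta (w j)) \<le> 1"
  and i: "i \<in> {1..n}" and k: "k \<in> {1..n}"
 shows "abs (amat G w m k - amat (del i G) w m k)
  \<le> of_bool (k = i) * of_bool ((i, m) \<in> G) + bmat (del i G) w m k * of_bool ((k, i) \<in> G) + of_bool (m = i) * of_bool ((k, i) \<in> G)"
proof -
 let ?A = "amat (del i G) w m k"
 have le: "abs (amat G w m k) \<le> of_bool ((k, m) \<in> G)" by (rule abs_amat_le[where w = w and j = k, OF G zeta[OF k]])
 consider "k = i" | "k \<noteq> i" "m = i" | "k \<noteq> i" "m \<noteq> i" "(k, i) \<notin> G" | "k \<noteq> i" "m \<noteq> i" "(k, i) \<in> G" by blast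
 then show ?thesis
 proof cases
  case 1
  then have "?A = 0" by (simp add: amat_def del_def)
  moreover have "0 \<le> bmat (del i G) w m k" by simp
  ultimately show ?thesis using le 1 by (auto simp: add_increasing2)
 next
  case 2
  then have "?A = 0" by (simp add: amat_def del_def)
  then show ?thesis using le 2 by (auto intro: add_increasing)
 next
  case 3
  then have "amat G w m k = ?A"
   using out_degree_del[OF G, of k i] by (auto simp: amat_def del_def)
  then show ?thesis by auto
 next
  case 4
  show ?thesis
  proof (cases "(k, m) \<in> G")
   case True
   define D where "D = real (out_degree (del i G) k)"
   have "(k, m) \<in> del i G" using True 4 by (simp add: del_def)
   then have D: "1 \<le> D"
    using out_degree_pos[of "del i G" n k m] del_subset[of i G] G by (simp add: D_def)
   have DG: "real (out_degree G k) = D + 1" using out_degree_del[OF G, of k i] 4 by (simp add: D_def)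
   have "amat G w m k = w_zeta (w k)/(D + 1)" "?A = w_zeta (w k)/D"
    using True \<open>(k, m) \<in> del i G\<close> DG by (simp_all add: amat_def D_def)
   then have "amat G w m k - ?A = - (w_zeta (w k)*(1/D - 1/(D + 1)))"
    by (simp add: algebra_simps)
   then have "abs (amat G w m k - ?A) = abs (w_zeta (w k))*abs (1/D - 1/(D + 1))"
    by (simp only: abs_minus_cancel abs_mult)
   also have "abs (1/D - 1/(D + 1)) = 1/D - 1/(D + 1)"
    using D by (intro abs_of_nonneg) (simp add: field_simps)
   also have "abs (w_zeta (w k))*(1/D - 1/(D + 1)) \<le> abs (w_zeta (w k))*(1/D)" using D by (intro mult_left_mono) auto
   also have "\<dots> = bmat (del i G) w m k" using \<open>(k, m) \<in> del i G\<close> D by (simp add: bmat_def amat_def D_def)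
   finally show ?thesis using 4 by simp
  qed (use 4 in "auto simp: amat_def del_def")
 qed
qed

text \<open>Unrolling the iteration transports each defect of the matrix, located at
  \<open>l\<close>, along walks to \<open>m\<close>. The walks are taken in the graph without
  \<open>i\<close>, so that they are independent of the edges at \<open>i\<close> that occur in
  \<open>\<Delta>\<close>.\<close>

lemma rk_del_diff:
 assumes G: "G \<subseteq> vertex_pairs n" and zeta: "\<And>j. j \<in> {1..n} ==> abs (w_zeta (w j)) \<le> 1"
  and i: "i \<in> {1..n}" and L: "0 \<le> L" and m: "m \<in> {1..n}"
 defines "B \<equiv> bmat (del i G) w"
 defines "\<Delta> \<equiv> \<lambda>l. of_bool ((i, l) \<in> G) + (\<Sum>k=1..n. B l k * of_bool ((k, i) \<in> G)) + of_bool (l = i)*(\<Sum>k=1..n. of_bool ((k, i) \<in> G))"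
 shows "abs (rk (clip L) n G w r m - rk (clip L) n (del i G) w r m) \<le> L*(\<Sum>s<r. \<Sum>l=1..n. walk n B s m l*\<Delta> l)"
 using m
proof (induction r arbitrary: m)
 case (Suc r)
 let ?x = "rk (clip L) n G w r" and ?y = "rk (clip L) n (del i G) w r"
 let ?d = "\<lambda>k. abs (?x k - ?y k)"
 have "abs (rk (clip L) n G w (Suc r) m - rk (clip L) n (del i G) w (Suc r) m)
   \<le> abs ((\<Sum>k=1..n. amat G w m k*?x k) - (\<Sum>k=1..n. amat (del i G) w m k*?y k))"
  by (simp del: One_nat_def) (rule order_trans[OF clip_lipschitz], simp)
 also have "\<dots> = abs (\<Sum>k=1..n. amat (del i G) w m k*(?x k - ?y k) + (amat G w m k - amat (del i G) w m k)*?x k)"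
  by (simp add: algebra_simps sum_subtractf sum.distrib)
 also have "\<dots> \<le> (\<Sum>k=1..n. B m k*?d k + abs (amat G w m k - amat (del i G) w m k)*L)"
 proof (rule order_trans[OF sum_abs], rule sum_mono)
  fix k
  have "abs (amat (del i G) w m k*(?x k - ?y k) + (amat G w m k - amat (del i G) w m k)*?x k)
    \<le> B m k*?d k + abs (amat G w m k - amat (del i G) w m k)*abs (?x k)"
   by (rule order_trans[OF abs_triangle_ineq]) (simp add: abs_mult B_def bmat_def)
  also have "\<dots> \<le> B m k*?d k + abs (amat G w m k - amat (del i G) w m k)*L"
   by (intro add_left_mono mult_left_mono abs_rk_clip_le L) auto
  finally show "abs (amat (del i G) w m k*(?x k - ?y k) + (amat G w m k - amat (del i G) w m k)*?x k) \<le> \<dots>" .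
 qed
 also have "\<dots> \<le> (\<Sum>k=1..n. B m k*(L*(\<Sum>s<r. \<Sum>l=1..n. walk n B s k l*\<Delta> l)) +
   (of_bool (k = i) * of_bool ((i, m) \<in> G) + B m k * of_bool ((k, i) \<in> G) + of_bool (m = i) * of_bool ((k, i) \<in> G))*L)"
  unfolding B_def
  by (intro sum_mono add_mono mult_left_mono mult_right_mono amat_del_diff[OF G zeta i] Suc.IH[unfolded B_def] L) auto
 also have "\<dots> = L*(\<Sum>k=1..n. B m k*(\<Sum>s<r. \<Sum>l=1..n. walk n B s k l*\<Delta> l)) + L*\<Delta> m"
 proof -
  have "(\<Sum>k=1..n. of_bool (k = i) * of_bool ((i, m) \<in> G)) = (\<Sum>k=1..n. if k = i then of_bool ((i, m) \<in> G) else (0::real))"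
   by (rule sum.cong) auto
  then have 1: "(\<Sum>k=1..n. of_bool (k = i) * of_bool ((i, m) \<in> G)) = (of_bool ((i, m) \<in> G) :: real)" using i by simp
  have "\<Delta> m = (\<Sum>k=1..n. of_bool (k = i) * of_bool ((i, m) \<in> G) + B m k * of_bool ((k, i) \<in> G) + of_bool (m = i) * of_bool ((k, i) \<in> G))"
   unfolding sum.distrib 1 \<Delta>_def by (simp add: sum_distrib_left)
  define S where "S k = (\<Sum>s<r. \<Sum>l=1..n. walk n B s k l*\<Delta> l)" for k
  show ?thesis
   unfolding \<open>\<Delta> m = _\<close> S_def[symmetric] sum_distrib_left[of L] sum.distrib[symmetric]
   by (rule sum.cong[OF refl]) (simp add: algebra_simps)
 qed
 also have "(\<Sum>k=1..n. B m k*(\<Sum>s<r. \<Sum>l=1..n. walk n B s k l*\<Delta> l)) = (\<Sum>s<r. \<Sum>l=1..n. walk n B (Suc s) m l*\<Delta> l)"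
 proof -
  have "(\<Sum>k=1..n. B m k*(\<Sum>s<r. \<Sum>l=1..n. walk n B s k l*\<Delta> l))
    = (\<Sum>k=1..n. \<Sum>s<r. \<Sum>l=1..n. B m k*walk n B s k l*\<Delta> l)"
   by (simp add: sum_distrib_left mult.assoc)
  also have "\<dots> = (\<Sum>s<r. \<Sum>k=1..n. \<Sum>l=1..n. B m k*walk n B s k l*\<Delta> l)"
   by (rule sum.swap)
  also have "\<dots> = (\<Sum>s<r. \<Sum>l=1..n. \<Sum>k=1..n. B m k*walk n B s k l*\<Delta> l)"
   by (intro sum.cong refl sum.swap)
  finally show ?thesis by (simp add: sum_distrib_right)
 qed
 also have "\<Delta> m = (\<Sum>l=1..n. walk n B 0 m l*\<Delta> l)"
 proof -
  have "(\<Sum>l=1..n. walk n B 0 m l*\<Delta> l) = (\<Sum>l=1..n. if m = l then \<Delta> m else 0)"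
   by (rule sum.cong) auto
  then show ?thesis using Suc.prems by simp
 qed
 also have "L*(\<Sum>s<r. \<Sum>l=1..n. walk n B (Suc s) m l*\<Delta> l) + L*(\<Sum>l=1..n. walk n B 0 m l*\<Delta> l)
   = L*(\<Sum>s<Suc r. \<Sum>l=1..n. walk n B s m l*\<Delta> l)"
  by (simp only: sum.lessThan_Suc_shift distrib_left add.commute)
 finally show ?case .
qed simp

lemma sum_of_bool_mult:
 fixes f :: "nat => real"
 shows "i \<in> {1..n} ==> (\<Sum>l=1..n. f l * of_bool (l = i)) = f i"
proof -
 assume "i \<in> {1..n}"
 moreover have "(\<Sum>l=1..n. f l * of_bool (l = i)) = (\<Sum>l=1..n. if l = i then f i else 0)"
  by (rule sum.cong) auto
 ultimately show ?thesis by simp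
qed

lemma walk_del_into:
 assumes "m \<in> {1..n}" "i \<in> {1..n}" "m \<noteq> i"
 shows "walk n (bmat (del i G) w) s m i = 0"
proof (cases s)
 case (Suc s')
 have "bmat (del i G) w i k = 0" "bmat (del i G) w k i = 0" for k by (auto simp: bmat_def amat_def del_def)
 have out: "walk n (bmat (del i G) w) s i k = 0" if "k \<noteq> i" for s k
  using that \<open>\<And>k. bmat (del i G) w i k = 0\<close> by (cases s) auto
 have "walk n (bmat (del i G) w) t m i = 0" if "m \<in> {1..n}" "m \<noteq> i" for t m
  using that
 proof (induction t arbitrary: m)
  case (Suc t)
  show ?case
   unfolding walk.simps
  proof (rule sum.neutral, intro ballI)
   fix k assume "k \<in> {1..n}"
   show "bmat (del i G) w m k*walk n (bmat (del i G) w) t k i = 0"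
    using Suc.IH[OF \<open>k \<in> {1..n}\<close>] \<open>\<And>k. bmat (del i G) w k i = 0\<close>
    by (cases "k = i") simp_all
  qed
 qed simp
 then show ?thesis using assms by blast
qed (use assms in simp)

text \<open>Only the in-neighbours \<open>m\<close> of \<open>i\<close> pass their rank on to
  \<open>i\<close>, and for them every surviving term describes a cycle through \<open>i\<close>:
  the first sum a directed one that leaves \<open>i\<close> for \<open>l\<close> and comes back
  through \<open>m\<close>, the second one two edges into \<open>i\<close>, from \<open>k\<close>
  and from \<open>m\<close>, joined by a path from \<open>k\<close> to \<open>m\<close>.\<close>

lemma rk_del_weighted:
 assumes G: "G \<subseteq> vertex_pairs n" and zeta: "\<And>j. j \<in> {1..n} ==> abs (w_zeta (w j)) \<le> 1"
  and i: "i \<in> {1..n}" and L: "0 \<le> L"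
 defines "B \<equiv> bmat (del i G) w"
 shows "(\<Sum>m=1..n. of_bool ((m, i) \<in> G)*abs (rk (clip L) n G w r m - rk (clip L) n (del i G) w r m))
  \<le> L*(\<Sum>s<r. (\<Sum>m=1..n. \<Sum>l=1..n. of_bool ((m, i) \<in> G)*(of_bool ((i, l) \<in> G)*walk n B s m l))
        + (\<Sum>m=1..n. \<Sum>k=1..n. of_bool ((m, i) \<in> G)*(of_bool ((k, i) \<in> G)*walk n B (Suc s) m k)))"
proof -
 define x y :: "nat => real" where "x m = of_bool ((m, i) \<in> G)" and "y l = of_bool ((i, l) \<in> G)" for m l
 define X where "X = (\<Sum>k=1..n. x k)"
 have x0: "0 \<le> x m" for m by (simp add: x_def)
 have xi: "x i = 0" using G by (auto simp: x_def vertex_pairs_def)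
 have "x m*abs (rk (clip L) n G w r m - rk (clip L) n (del i G) w r m)
   \<le> L*(\<Sum>s<r. (\<Sum>l=1..n. x m*(y l*walk n B s m l)) + (\<Sum>k=1..n. x m*(x k*walk n B (Suc s) m k)))"
  if m: "m \<in> {1..n}" for m
 proof -
  have "x m*abs (rk (clip L) n G w r m - rk (clip L) n (del i G) w r m)
    \<le> x m*(L*(\<Sum>s<r. \<Sum>l=1..n. walk n B s m l*(y l + (\<Sum>k=1..n. B l k*x k) + of_bool (l = i) * X)))"
   unfolding X_def x_def y_def B_def by (intro mult_left_mono rk_del_diff[OF G zeta i L m]) auto
  also have "\<dots> = L*(\<Sum>s<r. x m*(\<Sum>l=1..n. walk n B s m l*(y l + (\<Sum>k=1..n. B l k*x k) + of_bool (l = i) * X)))"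
   by (simp add: sum_distrib_left mult.left_commute)
  also have "\<dots> = L*(\<Sum>s<r. (\<Sum>l=1..n. x m*(y l*walk n B s m l)) + (\<Sum>k=1..n. x m*(x k*walk n B (Suc s) m k)))"
  proof (intro arg_cong[where f = "(*) L"] sum.cong refl)
   fix s
   have "(\<Sum>l=1..n. walk n B s m l*(y l + (\<Sum>k=1..n. B l k*x k) + of_bool (l = i) * X))
     = (\<Sum>l=1..n. walk n B s m l*y l) + (\<Sum>l=1..n. walk n B s m l*(\<Sum>k=1..n. B l k*x k))
      + (\<Sum>l=1..n. walk n B s m l * X * of_bool (l = i))"
    by (simp only: sum.distrib[symmetric]) (rule sum.cong, simp_all add: algebra_simps)
   also have "(\<Sum>l=1..n. walk n B s m l * X * of_bool (l = i)) = walk n B s m i * X"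
    by (rule sum_of_bool_mult[OF i])
   also have "(\<Sum>l=1..n. walk n B s m l*(\<Sum>k=1..n. B l k*x k)) = (\<Sum>k=1..n. walk n B (Suc s) m k*x k)"
   proof -
    have "(\<Sum>l=1..n. walk n B s m l*(\<Sum>k=1..n. B l k*x k)) = (\<Sum>l=1..n. \<Sum>k=1..n. walk n B s m l*B l k*x k)"
     by (simp add: sum_distrib_left mult.assoc)
    also have "\<dots> = (\<Sum>k=1..n. (\<Sum>l=1..n. walk n B s m l*B l k)*x k)"
     unfolding sum_distrib_right by (rule sum.swap)
    also have "\<dots> = (\<Sum>k=1..n. walk n B (Suc s) m k*x k)"
     by (rule sum.cong[OF refl]) (simp add: walk_Suc_right[OF m] del: walk.simps)
    finally show ?thesis .
   qed
   finally have S: "(\<Sum>l=1..n. walk n B s m l*(y l + (\<Sum>k=1..n. B l k*x k) + of_bool (l = i) * X))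
     = (\<Sum>l=1..n. walk n B s m l*y l) + (\<Sum>k=1..n. walk n B (Suc s) m k*x k) + walk n B s m i * X" .
   have "x m*(walk n B s m i * X) = 0"
    using walk_del_into[OF m i, of G w s] xi by (cases "m = i") (auto simp: B_def)
   then show "x m*(\<Sum>l=1..n. walk n B s m l*(y l + (\<Sum>k=1..n. B l k*x k) + of_bool (l = i) * X))
    = (\<Sum>l=1..n. x m*(y l*walk n B s m l)) + (\<Sum>k=1..n. x m*(x k*walk n B (Suc s) m k))"
    unfolding S by (simp add: distrib_left sum_distrib_left mult_ac del: walk.simps)
  qed
  finally show ?thesis .
 qed
 then have "(\<Sum>m=1..n. x m*abs (rk (clip L) n G w r m - rk (clip L) n (del i G) w r m))
   \<le> (\<Sum>m=1..n. L*(\<Sum>s<r. (\<Sum>l=1..n. x m*(y l*walk n B s m l)) + (\<Sum>k=1..n. x m*(x k*walk n B (Suc s) m k))))"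
  by (intro sum_mono)
 also have "\<dots> = L*(\<Sum>s<r. \<Sum>m=1..n. (\<Sum>l=1..n. x m*(y l*walk n B s m l)) + (\<Sum>k=1..n. x m*(x k*walk n B (Suc s) m k)))"
  unfolding sum_distrib_left[symmetric] by (subst sum.swap) (rule refl)
 finally show ?thesis unfolding sum.distrib x_def y_def .
qed

text \<open>The two edges at \<open>i\<close> are independent of the walks in the graph without
  \<open>i\<close> and contribute \<open>(K/n)^2\<close>, while column sums bound the total weight
  of the walks by \<open>n\<close>; this leaves \<open>K^2/n\<close> for each of the two kinds of
  cycles. If \<open>k = m\<close> in the second kind, both indicators are the same edge and only one
  factor \<open>K/n\<close> is gained; then the walk is closed, and \<open>trace_bound\<close>
  compensates for the loss.\<close>

lemma cycle_estimate:
 assumes p: "\<And>e. e \<in> vertex_pairs n ==> 0 \<le> p e \<and> p e \<le> 1"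
  and K: "\<And>e. e \<in> vertex_pairs n ==> p e \<le> K/real n" "0 \<le> K"
  and zeta: "\<And>j. j \<in> {1..n} ==> abs (w_zeta (w j)) \<le> 1"
  and i: "i \<in> {1..n}" and L: "0 \<le> L"
 shows "gexp (vertex_pairs n) p (\<lambda>G. \<Sum>m=1..n. of_bool ((m, i) \<in> G)*abs (rk (clip L) n G w r m - rk (clip L) n (del i G) w r m))
  \<le> L * real r*(2 + real r)*K\<^sup>2/real n"
proof -
 let ?V = "vertex_pairs n"
 let ?E = "gexp ?V p"
 let ?B = "\<lambda>G. bmat (del i G) w"
 define q where "q = K/real n"
 have n: "n > 0" and q: "0 \<le> q" using i K by (auto simp: q_def)
 have Kq: "K = q * real n" using n by (simp add: q_def)
 have delV: "del i G \<subseteq> ?V" if "G \<subseteq> ?V" for G using that del_subset by blast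
 have col: "?E (\<lambda>G. \<Sum>m=1..n. walk n (?B G) s m l) \<le> 1" if "l \<in> {1..n}" for s l
  using that by (intro gexp_le_const p walk_col_sum bmat_col_sum delV zeta finite_vertex_pairs) auto
 have tot: "(\<Sum>m=1..n. \<Sum>l=1..n. ?E (\<lambda>G. walk n (?B G) s m l)) \<le> real n" for s
 proof -
  have "(\<Sum>m=1..n. \<Sum>l=1..n. ?E (\<lambda>G. walk n (?B G) s m l)) = (\<Sum>l=1..n. ?E (\<lambda>G. \<Sum>m=1..n. walk n (?B G) s m l))"
   unfolding gexp_sum by (rule sum.swap)
  also have "\<dots> \<le> (\<Sum>l=1..n. 1)" by (intro sum_mono col)
  finally show ?thesis by simp
 qed
 have w0: "0 \<le> walk n (?B G) s m l" for G s m l by (rule walk_nonneg) simp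
 have two: "?E (\<lambda>G. of_bool (e \<in> G)*(of_bool (f \<in> G)*walk n (?B G) s m l)) \<le> q*(q*?E (\<lambda>G. walk n (?B G) s m l))"
  if "e \<noteq> f" "fst e = i \<or> snd e = i" "fst f = i \<or> snd f = i" for e f s m l
 proof -
  have "?E (\<lambda>G. of_bool (e \<in> G)*(of_bool (f \<in> G)*walk n (?B G) s m l)) \<le> q*?E (\<lambda>G. of_bool (f \<in> G)*walk n (?B G) s m l)"
   by (rule gexp_edge_le) (use p K that q w0 in "auto simp: q_def del_insert")
  also have "\<dots> \<le> q*(q*?E (\<lambda>G. walk n (?B G) s m l))"
   by (intro mult_left_mono q gexp_edge_le) (use p K that q w0 in "auto simp: q_def del_insert")
  finally show ?thesis .
 qed
 have one: "?E (\<lambda>G. of_bool (e \<in> G)*(of_bool (e \<in> G)*walk n (?B G) s m l)) \<le> q*?E (\<lambda>G. walk n (?B G) s m l)"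
  if "fst e = i \<or> snd e = i" for e s m l
 proof -
  have "?E (\<lambda>G. of_bool (e \<in> G)*(of_bool (e \<in> G)*walk n (?B G) s m l)) = ?E (\<lambda>G. of_bool (e \<in> G)*walk n (?B G) s m l)"
   by (rule gexp_cong) auto
  also have "\<dots> \<le> q*?E (\<lambda>G. walk n (?B G) s m l)"
   by (rule gexp_edge_le) (use p K that q w0 in "auto simp: q_def del_insert")
  finally show ?thesis .
 qed
 have first: "(\<Sum>m=1..n. \<Sum>l=1..n. ?E (\<lambda>G. of_bool ((m, i) \<in> G)*(of_bool ((i, l) \<in> G)*walk n (?B G) s m l))) \<le> q*(q * real n)" for s
 proof -
  have "(\<Sum>m=1..n. \<Sum>l=1..n. ?E (\<lambda>G. of_bool ((m, i) \<in> G)*(of_bool ((i, l) \<in> G)*walk n (?B G) s m l)))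
    \<le> (\<Sum>m=1..n. \<Sum>l=1..n. q*(q*?E (\<lambda>G. walk n (?B G) s m l)))"
  proof (intro sum_mono)
   fix m l
   show "?E (\<lambda>G. of_bool ((m, i) \<in> G)*(of_bool ((i, l) \<in> G)*walk n (?B G) s m l)) \<le> q*(q*?E (\<lambda>G. walk n (?B G) s m l))"
   proof (cases "(m, i) = (i, l)")
    case True
    then have "?E (\<lambda>G. of_bool ((m, i) \<in> G)*(of_bool ((i, l) \<in> G)*walk n (?B G) s m l)) = ?E (\<lambda>_. 0)"
     by (intro gexp_cong) (auto simp: vertex_pairs_def)
    then show ?thesis using q p w0 by (auto intro!: mult_nonneg_nonneg gexp_nonneg)
   qed (rule two, auto)
  qed
  also have "\<dots> = q*(q*(\<Sum>m=1..n. \<Sum>l=1..n. ?E (\<lambda>G. walk n (?B G) s m l)))"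
   by (simp add: sum_distrib_left)
  also have "\<dots> \<le> q*(q * real n)" by (intro mult_left_mono tot q)
  finally show ?thesis .
 qed
 have diag: "(\<Sum>m=1..n. ?E (\<lambda>G. walk n (?B G) (Suc s) m m)) \<le> K * real (Suc s)" for s
  unfolding del_def
  by (subst gexp_Int, simp, rule trace_bound) (use p K zeta in auto)
 have second: "(\<Sum>m=1..n. \<Sum>k=1..n. ?E (\<lambda>G. of_bool ((m, i) \<in> G)*(of_bool ((k, i) \<in> G)*walk n (?B G) (Suc s) m k)))
   \<le> q*(q * real n) + q*(K * real (Suc s))" for s
 proof -
  have "(\<Sum>m=1..n. \<Sum>k=1..n. ?E (\<lambda>G. of_bool ((m, i) \<in> G)*(of_bool ((k, i) \<in> G)*walk n (?B G) (Suc s) m k)))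
    \<le> (\<Sum>m=1..n. \<Sum>k=1..n. q*(q*?E (\<lambda>G. walk n (?B G) (Suc s) m k)) + q*?E (\<lambda>G. walk n (?B G) (Suc s) m m) * of_bool (k = m))"
  proof (intro sum_mono)
   fix m k
   have nn: "0 \<le> q*(q*?E (\<lambda>G. walk n (?B G) (Suc s) m k))"
    using q p w0 by (auto intro!: mult_nonneg_nonneg gexp_nonneg simp del: walk.simps)
   show "?E (\<lambda>G. of_bool ((m, i) \<in> G)*(of_bool ((k, i) \<in> G)*walk n (?B G) (Suc s) m k))
    \<le> q*(q*?E (\<lambda>G. walk n (?B G) (Suc s) m k)) + q*?E (\<lambda>G. walk n (?B G) (Suc s) m m) * of_bool (k = m)"
   proof (cases "k = m")
    case True
    then show ?thesis using one[of "(m, i)" "Suc s" m m] nn by (simp del: walk.simps)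
   next
    case False
    then show ?thesis using two[of "(m, i)" "(k, i)" "Suc s" m k] by (simp del: walk.simps)
   qed
  qed
  also have "\<dots> = q*(q*(\<Sum>m=1..n. \<Sum>k=1..n. ?E (\<lambda>G. walk n (?B G) (Suc s) m k)))
     + (\<Sum>m=1..n. \<Sum>k=1..n. q*?E (\<lambda>G. walk n (?B G) (Suc s) m m) * of_bool (k = m))"
   by (simp add: sum.distrib sum_distrib_left del: walk.simps)
  also have "(\<Sum>m=1..n. \<Sum>k=1..n. q*?E (\<lambda>G. walk n (?B G) (Suc s) m m) * of_bool (k = m))
    = q*(\<Sum>m=1..n. ?E (\<lambda>G. walk n (?B G) (Suc s) m m))"
   unfolding sum_distrib_left by (rule sum.cong[OF refl], rule sum_of_bool_mult)
  also have "q*(q*(\<Sum>m=1..n. \<Sum>k=1..n. ?E (\<lambda>G. walk n (?B G) (Suc s) m k)))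
     + q*(\<Sum>m=1..n. ?E (\<lambda>G. walk n (?B G) (Suc s) m m)) \<le> q*(q * real n) + q*(K * real (Suc s))"
   by (intro add_mono mult_left_mono tot diag q)
  finally show ?thesis .
 qed
 have "?E (\<lambda>G. \<Sum>m=1..n. of_bool ((m, i) \<in> G)*abs (rk (clip L) n G w r m - rk (clip L) n (del i G) w r m))
   \<le> ?E (\<lambda>G. L*(\<Sum>s<r. (\<Sum>m=1..n. \<Sum>l=1..n. of_bool ((m, i) \<in> G)*(of_bool ((i, l) \<in> G)*walk n (?B G) s m l))
        + (\<Sum>m=1..n. \<Sum>k=1..n. of_bool ((m, i) \<in> G)*(of_bool ((k, i) \<in> G)*walk n (?B G) (Suc s) m k))))"
  by (intro gexp_mono p rk_del_weighted zeta i L)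
 also have "\<dots> = L*(\<Sum>s<r. (\<Sum>m=1..n. \<Sum>l=1..n. ?E (\<lambda>G. of_bool ((m, i) \<in> G)*(of_bool ((i, l) \<in> G)*walk n (?B G) s m l)))
        + (\<Sum>m=1..n. \<Sum>k=1..n. ?E (\<lambda>G. of_bool ((m, i) \<in> G)*(of_bool ((k, i) \<in> G)*walk n (?B G) (Suc s) m k))))"
  unfolding gexp_cmult gexp_sum gexp_add ..
 also have "\<dots> \<le> L*(\<Sum>s<r. q*(q * real n) + (q*(q * real n) + q*(K * real r)))"
 proof (intro mult_left_mono sum_mono add_mono first order_trans[OF second] add_left_mono L q K)
  fix s assume "s \<in> {..<r}" then show "real (Suc s) \<le> real r" by simp
 qed simp
 also have "\<dots> = L * real r*(2 + real r)*K\<^sup>2/real n"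
  using n unfolding Kq by (simp add: power2_eq_square field_simps)
 finally show ?thesis .
qed

section \<open>Poisson approximation and compound Poisson characteristic functions\<close>

definition pois :: "real => nat => real" where
 "pois l m = exp (- l)*l ^ m/fact m"

lemma pois_nonneg: "0 \<le> l ==> 0 \<le> pois l m"
 by (simp add: pois_def)

lemma pois_sums: "pois l sums 1"
proof -
 have "(\<lambda>m. exp (- l)*(l ^ m /\<^sub>R fact m)) sums (exp (- l)*exp l)"
  by (intro sums_mult exp_converges)
 then show ?thesis by (simp add: pois_def[abs_def] field_simps exp_minus)
qed

lemma pois_le_1: "0 \<le> l ==> pois l m \<le> 1"
 using sum_le_suminf[of "pois l" "{m}"] pois_sums[of l] pois_nonneg[of l]
 by (auto simp: sums_iff)

definition dpois :: "real => nat => real" where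
 "dpois l m = (if m = 0 then 0 else pois l (m - 1)) - pois l m"

lemma pois_deriv: "((\<lambda>l. pois l m) has_real_derivative dpois l m) (at l)"
proof (cases m)
 case 0
 then show ?thesis by (auto simp: pois_def dpois_def intro!: derivative_eq_intros)
next
 case (Suc k)
 have 1: "((\<lambda>l. exp (- l)) has_real_derivative - exp (- l)) (at l)"
  by (auto intro!: derivative_eq_intros)
 have "((\<lambda>l. l ^ Suc k/fact (Suc k)) has_real_derivative (1 + real k)*l ^ k*1/fact (Suc k)) (at l)"
  using DERIV_cdivide[OF DERIV_pow[of "Suc k" l], of "fact (Suc k)"] by (simp add: add.commute)
 also have "(1 + real k)*l ^ k*1/fact (Suc k) = l ^ k/fact k"
 proof -
  have "fact (Suc k) = (1 + real k)*fact k" "1 + real k \<noteq> 0" by simp_all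
  moreover have "c*y*1/(c*z) = y/z" if "c \<noteq> 0" for c y z :: real using that by simp
  ultimately show ?thesis by (simp only:)
 qed
 finally have "((\<lambda>l. exp (- l)*(l ^ Suc k/fact (Suc k))) has_real_derivative
   - exp (- l)*(l ^ Suc k/fact (Suc k)) + l ^ k/fact k*exp (- l)) (at l)"
  by (intro DERIV_mult 1)
 also have "- exp (- l)*(l ^ Suc k/fact (Suc k)) + l ^ k/fact k*exp (- l) = dpois l (Suc k)"
  by (simp add: dpois_def pois_def)
 finally show ?thesis using Suc by (simp add: pois_def)
qed

lemma abs_dpois_le: "0 \<le> l ==> abs (dpois l m) \<le> 1"
 using pois_nonneg[of l m] pois_le_1[of l m] pois_nonneg[of l "m - 1"] pois_le_1[of l "m - 1"]
 by (auto simp: dpois_def abs_if)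

lemma pois_lipschitz:
 assumes "0 \<le> l" "0 \<le> l'"
 shows "abs (pois l m - pois l' m) \<le> abs (l - l')"
proof -
 have "norm (pois l m - pois l' m) \<le> 1 * norm (l - l')"
  by (rule field_differentiable_bound[of "{0..}" "\<lambda>l. pois l m" "\<lambda>l. dpois l m"])
    (use assms in "auto intro: DERIV_subset[OF pois_deriv] abs_dpois_le")
 then show ?thesis by simp
qed

lemma dpois_lipschitz:
 assumes "0 \<le> l" "0 \<le> l'"
 shows "abs (dpois l m - dpois l' m) \<le> 2*abs (l - l')"
 using pois_lipschitz[OF assms, of m] pois_lipschitz[OF assms, of "m - 1"]
 by (auto simp: dpois_def abs_if split: if_splits)

lemma pois_taylor:
 assumes "0 \<le> l" "0 \<le> p"
 shows "abs (pois (l + p) m - pois l m - p*dpois l m) \<le> 2*p\<^sup>2"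
proof (cases "p = 0")
 case False
 with assms obtain z where z: "l < z" "z < l + p" "pois (l + p) m - pois l m = (l + p - l)*dpois z m"
  using MVT2[of l "l + p" "\<lambda>l. pois l m" "\<lambda>l. dpois l m"] pois_deriv by auto
 have "abs (pois (l + p) m - pois l m - p*dpois l m) = p*abs (dpois z m - dpois l m)"
  using assms by (simp add: z(3) abs_mult flip: right_diff_distrib)
 also have "\<dots> \<le> p*(2*abs (z - l))"
  using assms z by (intro mult_left_mono dpois_lipschitz) auto
 also have "\<dots> \<le> p*(2*p)" using assms z by (intro mult_left_mono) auto
 finally show ?thesis by (simp add: power2_eq_square)
qed simp

text \<open>Le Cam's bound, proved edge by edge. An independent trial with success probability
  \<open>p\<close> changes the mass at \<open>m\<close> by \<open>p\<close> times the mass at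
  \<open>m - 1\<close> minus the mass at \<open>m\<close>; this is the derivative of the Poisson
  weight in its parameter, so by \<open>pois_taylor\<close> only an error of order
  \<open>p^2\<close> arises.\<close>

lemma poisson_approx:
 assumes "finite V" "\<And>e. e \<in> V ==> 0 \<le> p e \<and> p e \<le> 1"
 shows "abs (gexp V p (\<lambda>G. of_bool (card G = m)) - pois (\<Sum>e\<in>V. p e) m) \<le> 2*(\<Sum>e\<in>V. (p e)\<^sup>2)"
 using assms
proof (induction V arbitrary: m rule: finite_induct)
 case empty
 then show ?case by (simp add: pois_def power_0_left)
next
 case (insert e V)
 let ?P = "\<lambda>m. gexp V p (\<lambda>G. of_bool (card G = m) :: real)" and ?l = "\<Sum>e\<in>V. p e" and ?S = "2*(\<Sum>e\<in>V. (p e)\<^sup>2)"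
 have p: "0 \<le> p e" "p e \<le> 1" using insert.prems by auto
 have l: "0 \<le> ?l" using insert.prems by (auto intro: sum_nonneg)
 have IH: "abs (?P m - pois ?l m) \<le> ?S" for m using insert.IH insert.prems by auto
 have "gexp V p (\<lambda>G. of_bool (card (insert e G) = m)) = (if m = 0 then 0 else ?P (m - 1))"
 proof -
  have "gexp V p (\<lambda>G. of_bool (card (insert e G) = m) :: real) = gexp V p (\<lambda>G. if m = 0 then 0 else of_bool (card G = m - 1))"
  proof (rule gexp_cong[OF _ refl])
   fix G assume "G \<subseteq> V"
   then have "card (insert e G) = Suc (card G)"
    using insert.hyps by (subst card_insert_disjoint) (auto intro: finite_subset)
   then show "(of_bool (card (insert e G) = m) :: real) = (if m = 0 then 0 else of_bool (card G = m - 1))"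
    by (cases m) auto
  qed
  then show ?thesis using insert.hyps by (cases m) auto
 qed
 then have eq: "gexp (insert e V) p (\<lambda>G. of_bool (card G = m)) = p e*(if m = 0 then 0 else ?P (m - 1)) + (1 - p e)*?P m"
  using insert.hyps by (simp add: gexp_insert)
 define a a' where "a = (if m = 0 then 0 else ?P (m - 1))" and "a' = (if m = 0 then 0 else pois ?l (m - 1))"
 have aa': "abs (a - a') \<le> ?S" using IH[of "m - 1"] by (auto simp: a_def a'_def intro!: sum_nonneg)
 have "p e*a + (1 - p e)*?P m - pois (?l + p e) m
   = p e*(a - a') + (1 - p e)*(?P m - pois ?l m) - (pois (?l + p e) m - pois ?l m - p e*dpois ?l m)"
  by (simp add: dpois_def a'_def algebra_simps)
 also have "abs \<dots> \<le> abs (p e*(a - a')) + abs ((1 - p e)*(?P m - pois ?l m)) + abs (pois (?l + p e) m - pois ?l m - p e*dpois ?l m)"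
  by linarith
 also have "\<dots> \<le> p e*?S + (1 - p e)*?S + 2*(p e)\<^sup>2"
  unfolding abs_mult using p l aa' IH pois_taylor[OF l p(1), of m]
  by (intro add_mono mult_mono) auto
 finally show ?case
  using insert.hyps by (simp add: eq a_def[symmetric] algebra_simps)
qed

lemma norm_exp_diff_le:
 fixes a b :: complex
 assumes "Re a \<le> 0" "Re b \<le> 0"
 shows "norm (exp a - exp b) \<le> norm (a - b)"
proof -
 have "norm (exp a - exp b) \<le> 1 * norm (a - b)"
  by (rule field_differentiable_bound[of "{z. Re z \<le> 0}" exp exp])
    (use assms in "auto intro: convex_halfspace_Re_le derivative_eq_intros")
 then show ?thesis by simp
qed

lemma norm_cis_diff_le: "norm (cis a - cis b) \<le> abs (a - b)"
proof -
 have "norm (cis a - cis b) \<le> norm (\<i> * of_real a - \<i> * of_real b)"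
  unfolding cis_conv_exp by (rule norm_exp_diff_le) auto
 also have "\<dots> = abs (a - b)" by (simp add: norm_mult flip: right_diff_distrib of_real_diff)
 finally show ?thesis .
qed

lemma norm_cis_diff_le_2: "norm (cis a - cis b) \<le> 2"
 using norm_triangle_ineq4[of "cis a" "cis b"] by simp

lemma norm_cis_minus_1_le: "norm (cis a - 1) \<le> 2"
 using norm_cis_diff_le_2[of a 0] by simp

text \<open>The product is the characteristic function of a sum of independent terms, each present
  with probability \<open>p i\<close>; the exponential is the compound Poisson one. All factors lie
  in the unit disc, so the errors of the single factors add up.\<close>

lemma compound_product_bound:
 fixes u :: "'i => complex"
 assumes "finite I" "\<And>i. i \<in> I ==> norm (u i) \<le> 1" "\<And>i. i \<in> I ==> 0 \<le> p i \<and> p i \<le> 1"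
 shows "norm ((\<Prod>i\<in>I. 1 + p i *\<^sub>R (u i - 1)) - exp (\<Sum>i\<in>I. p i *\<^sub>R (u i - 1))) \<le> 4*exp 2*(\<Sum>i\<in>I. (p i)\<^sup>2)"
proof -
 have Re: "Re (u i) \<le> 1" if "i \<in> I" for i
  using assms(2)[OF that] abs_Re_le_cmod[of "u i"] by linarith
 have "norm ((\<Prod>i\<in>I. 1 + p i *\<^sub>R (u i - 1)) - (\<Prod>i\<in>I. exp (p i *\<^sub>R (u i - 1))))
   \<le> (\<Sum>i\<in>I. norm ((1 + p i *\<^sub>R (u i - 1)) - exp (p i *\<^sub>R (u i - 1))))"
 proof (rule norm_prod_diff)
  fix i assume i: "i \<in> I"
  have "norm (1 + p i *\<^sub>R (u i - 1)) = norm ((1 - p i) *\<^sub>R 1 + p i *\<^sub>R u i)"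
   by (simp add: algebra_simps)
  also have "\<dots> \<le> (1 - p i) + p i * norm (u i)"
   by (rule order_trans[OF norm_triangle_ineq]) (use assms(3)[OF i] in simp)
  also have "\<dots> \<le> (1 - p i) + p i*1" using assms(2,3)[OF i] by (intro add_left_mono mult_left_mono) auto
  finally show "norm (1 + p i *\<^sub>R (u i - 1)) \<le> 1" by simp
  show "norm (exp (p i *\<^sub>R (u i - 1))) \<le> 1"
   using assms(3)[OF i] Re[OF i] by (simp add: mult_nonneg_nonpos)
 qed
 also have "\<dots> \<le> (\<Sum>i\<in>I. 4*exp 2*(p i)\<^sup>2)"
 proof (rule sum_mono)
  fix i assume i: "i \<in> I"
  let ?z = "p i *\<^sub>R (u i - 1)"
  \<comment> \<open>Hence \<open>norm ?z \<le> 2 p i \<le> 2\<close>, and the second-order remainder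
    of the exponential is at most \<open>exp 2 (2 p i)^2\<close>: this is the constant
    \<open>4 exp 2\<close>.\<close>
  have "norm (u i - 1) \<le> 2" using norm_triangle_ineq4[of "u i" 1] assms(2)[OF i] by simp
  then have z: "norm ?z \<le> p i*2" using assms(3)[OF i] by (auto intro: mult_left_mono)
  have "norm (exp ?z - (\<Sum>k\<le>1. ?z ^ k/fact k)) \<le> exp (abs (Re ?z)) * norm ?z ^ Suc 1/fact 1"
   by (rule Taylor_exp)
  moreover have "(1 + ?z) - exp ?z = - (exp ?z - (\<Sum>k\<le>1. ?z ^ k/fact k))" by simp
  ultimately have "norm ((1 + ?z) - exp ?z) \<le> exp (abs (Re ?z)) * norm ?z ^ 2"
   by (simp only: norm_minus_cancel) (simp add: numeral_2_eq_2)
  also have "\<dots> \<le> exp 2*(p i*2) ^ 2"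
  proof (intro mult_mono power_mono z)
   have "abs (Re ?z) \<le> norm ?z" by (rule abs_Re_le_cmod)
   also have "\<dots> \<le> 2" using z assms(3)[OF i] by linarith
   finally show "exp (abs (Re ?z)) \<le> exp 2" by simp
  qed auto
  finally show "norm ((1 + ?z) - exp ?z) \<le> 4*exp 2*(p i)\<^sup>2" by (simp add: power_mult_distrib)
 qed
 finally show ?thesis using assms(1) by (simp add: exp_sum sum_distrib_left)
qed

section \<open>Removing one vertex\<close>

lemma gexp_of_real: "gexp V p (\<lambda>G. of_real (F G)) = (of_real (gexp V p F) :: complex)"
 by (simp add: gexp_def scaleR_conv_of_real)

lemma gexp_cmult_right: "gexp V p (\<lambda>G. F G*a) = gexp V p F*a"
 for a :: "'b::real_algebra"
 by (simp add: gexp_def sum_distrib_right)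

lemma sum_in_edges:
 assumes "G \<subseteq> vertex_pairs n"
 shows "(\<Sum>j=1..n. of_bool ((j, i) \<in> G)) = real (card {j. (j, i) \<in> G})"
proof -
 have "{j \<in> {1..n}. (j, i) \<in> G} = {j. (j, i) \<in> G}"
  using assms by (auto simp: vertex_pairs_def)
 then show ?thesis
  by (simp add: of_bool_def sum.If_cases Int_def)
qed

lemma column_image:
 assumes "i \<in> {1..n}"
 shows "(\<lambda>j. (j, i)) ` ({1..n} - {i}) = {e \<in> vertex_pairs n. snd e = i}"
 using assms by (auto simp: vertex_pairs_def image_iff)

text \<open>The out-edges of \<open>i\<close>, the in-edges of \<open>i\<close> and all the remaining edges are independent.\<close>

lemma gexp_split_vertex:
 fixes a :: "nat => (nat \<times> nat) set => complex"
 assumes i: "i \<in> {1..n}"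
 shows "gexp (vertex_pairs n) p (\<lambda>G. odeg G i m*(\<Prod>j\<in>{1..n} - {i}. if (j, i) \<in> G then a j (del i G) else 1))
  = of_real (gexp (vertex_pairs n) p (\<lambda>G. odeg G i m))
   * gexp (vertex_pairs n) p (\<lambda>G. \<Prod>j\<in>{1..n} - {i}. 1 + p (j, i) *\<^sub>R (a j (del i G) - 1))" (is "?lhs = _")
  and "gexp (vertex_pairs n) p (\<lambda>G. odeg G i m :: real)
   = gexp {e \<in> vertex_pairs n. fst e = i} p (\<lambda>G. of_bool (card G = m))"
proof -
 let ?B = "\<lambda>Gr. of_bool (card Gr = m)"
 let ?C = "\<lambda>G. \<Prod>j\<in>{1..n} - {i}. 1 + p (j, i) *\<^sub>R (a j (del i G) - 1)"
 let ?V = "vertex_pairs n"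
 let ?A = "{e. fst e \<noteq> i \<and> snd e \<noteq> i}"
 let ?U = "?V \<inter> ?A" and ?Vr = "{e \<in> ?V. fst e = i}" and ?Vc = "{e \<in> ?V. snd e = i}"
 have V: "?V = ?U \<union> (?Vr \<union> ?Vc)" by (intro equalityI subsetI) auto
 have disj: "?U \<inter> (?Vr \<union> ?Vc) = {}" "?Vr \<inter> ?Vc = {}" by (auto simp: vertex_pairs_def)
 have split: "gexp ?V p F = gexp ?U p (\<lambda>G0. gexp ?Vr p (\<lambda>Gr. gexp ?Vc p (\<lambda>Gc. F (G0 \<union> (Gr \<union> Gc)))))"
  for F :: "(nat \<times> nat) set => 'c::real_vector"
  by (subst V, subst gexp_Un[OF _ _ disj(1)], simp, simp, subst gexp_Un[OF _ _ disj(2)], simp_all)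
 have sub: "out_degree (G0 \<union> (Gr \<union> Gc)) i = card Gr" "del i (G0 \<union> (Gr \<union> Gc)) = G0"
  "(j, i) \<in> G0 \<union> (Gr \<union> Gc) \<longleftrightarrow> (j, i) \<in> Gc" if "G0 \<subseteq> ?U" "Gr \<subseteq> ?Vr" "Gc \<subseteq> ?Vc" for G0 Gr Gc j
 proof -
  have "{k. (i, k) \<in> G0 \<union> (Gr \<union> Gc)} = snd ` Gr"
   using that by (auto simp: vertex_pairs_def image_iff) (metis fst_conv snd_conv prod.collapse subsetD mem_Collect_eq)+
  moreover have "inj_on snd Gr" using that(2) by (intro inj_onI prod_eqI) auto
  ultimately show "out_degree (G0 \<union> (Gr \<union> Gc)) i = card Gr"
   by (simp add: out_degree_def card_image)
  show "del i (G0 \<union> (Gr \<union> Gc)) = G0" using that by (auto simp: del_def)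
  show "(j, i) \<in> G0 \<union> (Gr \<union> Gc) \<longleftrightarrow> (j, i) \<in> Gc" using that by (auto simp: vertex_pairs_def subset_iff)
 qed
 show P: "gexp ?V p (\<lambda>G. odeg G i m :: real) = gexp ?Vr p (\<lambda>G. of_bool (card G = m))"
  unfolding split
  by (subst gexp_cong[where F' = "\<lambda>_. gexp ?Vr p (\<lambda>G. of_bool (card G = m))" and p' = p], intro gexp_cong refl)
    (subst gexp_cong[where F' = "\<lambda>_. of_bool (card _ = m)" and p' = p], auto simp: sub)
 have col: "gexp ?Vc p (\<lambda>Gc. \<Prod>j\<in>{1..n} - {i}. if (j, i) \<in> Gc then a j G0 else 1) = (\<Prod>j\<in>{1..n} - {i}. 1 + p (j, i) *\<^sub>R (a j G0 - 1))" for G0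
 proof -
  have re: "(\<Prod>e\<in>?Vc. f e) = (\<Prod>j\<in>{1..n} - {i}. f (j, i))" for f :: "nat \<times> nat => complex"
   unfolding column_image[OF i, symmetric] by (subst prod.reindex) (auto simp: inj_on_def)
  show ?thesis
   using gexp_prod[where V = ?Vc and p = p and a = "\<lambda>e. a (fst e) G0", OF finite_subset[OF _ finite_vertex_pairs]]
   unfolding re fst_conv by blast
 qed
 have "?lhs = gexp ?U p (\<lambda>G0. gexp ?Vr p (\<lambda>Gr. gexp ?Vc p (\<lambda>Gc. of_bool (card Gr = m)*(\<Prod>j\<in>{1..n} - {i}. if (j, i) \<in> Gc then a j G0 else 1))))"
  unfolding split by (intro gexp_cong refl) (simp only: sub)
 also have "\<dots> = gexp ?U p (\<lambda>G0. gexp ?Vr p ?B*(\<Prod>j\<in>{1..n} - {i}. 1 + p (j, i) *\<^sub>R (a j G0 - 1)))"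
  unfolding gexp_cmult col gexp_cmult_right ..
 \<comment> \<open>What is left depends on the graph only through \<open>del i\<close>, so the mean
   over the edges away from \<open>i\<close> may be written as a mean over the whole graph
   again.\<close>
 also have "\<dots> = gexp ?Vr p ?B * gexp ?V p ?C"
  unfolding gexp_cmult del_def by (subst gexp_Int) (simp_all add: gexp_cmult)
 also have "gexp ?Vr p ?B = (of_real (gexp ?Vr p ?B) :: complex)"
  unfolding gexp_of_real[symmetric] by (intro gexp_cong refl) (simp add: of_bool_def)
 finally show "?lhs = of_real (gexp ?V p (\<lambda>G. odeg G i m))
   * gexp ?V p ?C"
  unfolding P .
qed

text \<open>Multiplied by \<open>w_in (w i)/th\<close>, this is the exponent of the compound Poisson
  characteristic function of the sum that \<open>i\<close> receives. As an average over all vertices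
  it does not depend on \<open>i\<close> and it concentrates. The \<open>1 +\<close> in the
  denominator stands for the edge into the receiving vertex, which is missing in the graph
  \<open>G\<close> without that vertex.\<close>

definition Gam :: "(real => real) => nat => (nat => ext_type) => nat => real => (nat \<times> nat) set => complex" where
 "Gam g n w r s G = (\<Sum>j=1..n. w_out (w j) *\<^sub>R (cis (s*(w_zeta (w j)/(1 + real (out_degree G j)) * rk g n G w r j)) - 1)) /\<^sub>R real n"

text \<open>For types bounded by \<open>b\<close>, the condition \<open>n_large\<close> keeps all
  ratios at most 1, which is why \<open>p_def\<close> contains no minimum. The constant
  \<open>b^2/th\<close> bounds \<open>n p\<close> and hence all mean degrees.\<close>

locale bounded_digraph =
 fixes n :: nat and w :: "nat => ext_type" and p :: "nat \<times> nat => real" and th b :: real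
 assumes n_pos: "n > 0" and theta_pos: "th > 0" and b_nonneg: "0 \<le> b"
  and types: "\<And>i. i \<in> {1..n} ==> 0 \<le> w_in (w i) \<and> w_in (w i) \<le> b \<and> 0 \<le> w_out (w i) \<and> w_out (w i) \<le> b"
  and zeta: "\<And>i. i \<in> {1..n} ==> abs (w_zeta (w i)) \<le> 1"
  and p_def: "\<And>i j. (i, j) \<in> vertex_pairs n ==> p (i, j) = w_out (w i)*w_in (w j)/(th * real n)"
  and n_large: "b\<^sup>2/th \<le> real n"
begin

abbreviation "V \<equiv> vertex_pairs n"
abbreviation "K \<equiv> b\<^sup>2/th"

lemma K_nonneg: "0 \<le> K" using theta_pos by simp

lemma p_bounds: "e \<in> V ==> 0 \<le> p e \<and> p e \<le> K/real n"
 and p_prob: "e \<in> V ==> 0 \<le> p e \<and> p e \<le> 1"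
proof -
 assume e: "e \<in> V"
 obtain i j where ij: "e = (i, j)" by (cases e)
 have i: "i \<in> {1..n}" "j \<in> {1..n}" using e ij by (auto simp: vertex_pairs_def)
 have "w_out (w i)*w_in (w j) \<le> b*b" "0 \<le> w_out (w i)*w_in (w j)"
  using types[OF i(1)] types[OF i(2)] by (auto intro!: mult_mono)
 then have *: "0 \<le> p e" "p e \<le> b*b/(th * real n)"
  using e p_def[of i j] n_pos theta_pos by (auto simp: ij divide_right_mono)
 moreover have "b*b/(th * real n) = K/real n" by (simp add: power2_eq_square)
 ultimately show "0 \<le> p e \<and> p e \<le> K/real n" by simp
 moreover have "K/real n \<le> 1" using n_large n_pos by (intro divide_le_eq_1_pos[THEN iffD2]) auto
 ultimately show "0 \<le> p e \<and> p e \<le> 1" by simp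
qed

lemma expected_in_degree:
 assumes "i \<in> {1..n}"
 shows "gexp V p (\<lambda>G. \<Sum>j=1..n. of_bool ((j, i) \<in> G)) \<le> K"
proof -
 have "gexp V p (\<lambda>G. of_bool ((j, i) \<in> G)*1) \<le> K/real n * gexp V p (\<lambda>_. 1)" for j
  by (rule gexp_edge_le) (use p_bounds p_prob theta_pos in auto)
 then have "gexp V p (\<lambda>G. of_bool ((j, i) \<in> G)) \<le> K/real n" for j
  by (simp only: mult_1_right gexp_const[OF finite_vertex_pairs])
 then have "gexp V p (\<lambda>G. \<Sum>j=1..n. of_bool ((j, i) \<in> G)) \<le> (\<Sum>j=1..n. K/real n)"
  unfolding gexp_sum by (intro sum_mono)
 then show ?thesis using n_pos by simp
qed

text \<open>Where the out-degrees agree, so do the weights, and \<open>cis\<close> is Lipschitz in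
  the rank; elsewhere the distance of two points of the unit circle is bounded by 2.\<close>

lemma Gam_diff:
 assumes "G \<subseteq> V" "G' \<subseteq> V"
 shows "norm (Gam g n w r s G - Gam g' n w r s G')
  \<le> b*(\<Sum>j=1..n. if out_degree G j = out_degree G' j then abs s*abs (rk g n G w r j - rk g' n G' w r j) else 2)/real n"
proof -
 let ?c = "\<lambda>g G j. cis (s*(w_zeta (w j)/(1 + real (out_degree G j)) * rk g n G w r j))"
 have "norm (Gam g n w r s G - Gam g' n w r s G') = norm (\<Sum>j=1..n. w_out (w j) *\<^sub>R (?c g G j - ?c g' G' j))/real n"
 proof -
  have "Gam g n w r s G - Gam g' n w r s G' = (\<Sum>j=1..n. w_out (w j) *\<^sub>R (?c g G j - ?c g' G' j)) /\<^sub>R real n"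
   unfolding Gam_def scaleR_diff_right[symmetric] sum_subtractf[symmetric] by simp
  then show ?thesis by (simp only: norm_scaleR abs_inverse abs_of_nat divide_inverse_commute)
 qed
 also have "\<dots> \<le> (\<Sum>j=1..n. b*(if out_degree G j = out_degree G' j then abs s*abs (rk g n G w r j - rk g' n G' w r j) else 2))/real n"
 proof (intro divide_right_mono sum_norm_le)
  fix j assume j: "j \<in> {1..n}"
  have "norm (?c g G j - ?c g' G' j) \<le> (if out_degree G j = out_degree G' j then abs s*abs (rk g n G w r j - rk g' n G' w r j) else 2)"
  proof (cases "out_degree G j = out_degree G' j")
   case True
   have "norm (?c g G j - ?c g' G' j) \<le> abs s*(abs (w_zeta (w j))/(1 + real (out_degree G' j))*abs (rk g n G w r j - rk g' n G' w r j))"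
   proof -
    have "s*(w_zeta (w j)/(1 + real (out_degree G' j)) * rk g n G w r j) - s*(w_zeta (w j)/(1 + real (out_degree G' j)) * rk g' n G' w r j)
     = s*(w_zeta (w j)/(1 + real (out_degree G' j))*(rk g n G w r j - rk g' n G' w r j))"
     by (simp add: algebra_simps)
    then have "abs (s*(w_zeta (w j)/(1 + real (out_degree G' j)) * rk g n G w r j) - s*(w_zeta (w j)/(1 + real (out_degree G' j)) * rk g' n G' w r j))
     = abs s*(abs (w_zeta (w j))/(1 + real (out_degree G' j))*abs (rk g n G w r j - rk g' n G' w r j))"
     by (simp add: abs_mult)
    then show ?thesis unfolding True using norm_cis_diff_le by metis
   qed
   also have "\<dots> \<le> abs s*(1*abs (rk g n G w r j - rk g' n G' w r j))"
    using zeta[OF j] by (intro mult_left_mono mult_right_mono) (auto simp: divide_le_eq)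
   finally show ?thesis using True by simp
  qed (simp add: norm_cis_diff_le_2)
  then show "norm (w_out (w j) *\<^sub>R (?c g G j - ?c g' G' j)) \<le> b*(if out_degree G j = out_degree G' j then abs s*abs (rk g n G w r j - rk g' n G' w r j) else 2)"
   using types[OF j] by (auto intro!: mult_mono)
 qed simp
 finally show ?thesis by (simp only: sum_distrib_left)
qed

text \<open>One edge changes the clipped ranks by \<open>2 L r\<close> in total and the out-degree
  of a single vertex, so it moves \<open>Gam\<close> by \<open>O(1/n)\<close>. The mean number of
  edges is at most \<open>K n\<close>, and the variance bound gives fluctuations of order
  \<open>1/sqrt n\<close>.\<close>

lemma Gam_concentration:
 assumes L: "0 \<le> L"
 shows "gexp V p (\<lambda>G. norm (Gam (clip L) n w r s G - gexp V p (Gam (clip L) n w r s))) \<le> 2*(b*(abs s*(2*L * real r) + 2)) * sqrt K/sqrt (real n)"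
proof -
 define d where "d = b*(abs s*(2*L * real r) + 2)/real n"
 have d0: "0 \<le> d" using b_nonneg L n_pos by (auto simp: d_def intro!: divide_nonneg_nonneg mult_nonneg_nonneg add_nonneg_nonneg)
 have "gexp V p (\<lambda>G. norm (Gam (clip L) n w r s G - gexp V p (Gam (clip L) n w r s))) \<le> 2*d * sqrt (\<Sum>e\<in>V. p e)"
 proof (rule gexp_norm_centered)
  fix e G assume e: "e \<in> V" and G: "G \<subseteq> V"
  then have G': "insert e G \<subseteq> V" by auto
  let ?x = "rk (clip L) n (insert e G) w r" and ?y = "rk (clip L) n G w r"
  have same: "out_degree (insert e G) j = out_degree G j" if "j \<noteq> fst e" for j
   using that by (auto simp: out_degree_def intro!: arg_cong[where f = card])
  have "norm (Gam (clip L) n w r s (insert e G) - Gam (clip L) n w r s G)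
   \<le> b*(\<Sum>j=1..n. if out_degree (insert e G) j = out_degree G j then abs s*abs (?x j - ?y j) else 2)/real n"
   by (rule Gam_diff[OF G' G])
  also have "\<dots> \<le> b*(\<Sum>j=1..n. abs s*abs (?x j - ?y j) + 2 * of_bool (j = fst e))/real n"
   using b_nonneg same by (intro divide_right_mono mult_left_mono sum_mono) auto
  also have "(\<Sum>j=1..n. abs s*abs (?x j - ?y j) + 2 * of_bool (j = fst e)) = abs s*(\<Sum>j=1..n. abs (?x j - ?y j)) + 2"
   using e sum_of_bool_mult[of "fst e" n "\<lambda>_. 2"] by (auto simp: sum.distrib sum_distrib_left vertex_pairs_def)
  also have "b*(abs s*(\<Sum>j=1..n. abs (?x j - ?y j)) + 2)/real n \<le> b*(abs s*(2*L * real r * real (card {fst e})) + 2)/real n"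
   using b_nonneg
   by (intro divide_right_mono mult_left_mono add_right_mono rk_change_rows[OF G' G zeta L]) auto
  finally show "norm (Gam (clip L) n w r s (insert e G) - Gam (clip L) n w r s G) \<le> d"
   by (simp add: d_def)
 qed (use p_prob d0 in auto)
 also have "2*d * sqrt (\<Sum>e\<in>V. p e) \<le> 2*d * sqrt (K * real n)"
 proof (intro mult_left_mono real_sqrt_le_mono)
  have "(\<Sum>e\<in>V. p e) \<le> (\<Sum>e\<in>V. K/real n)" using p_bounds by (intro sum_mono) auto
  also have "\<dots> = real (card V)*(K/real n)" by simp
  also have "\<dots> \<le> real (n * n)*(K/real n)"
  proof (intro mult_right_mono)
   have "card V \<le> card ({1..n} \<times> {1..n})"
    by (rule card_mono) (auto simp: vertex_pairs_def)
   then have "card V \<le> n * n" by (simp add: card_cartesian_product)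
   then show "real (card V) \<le> real (n * n)" by (rule of_nat_mono)
  qed (use theta_pos in simp)
  also have "\<dots> = K * real n" using n_pos by simp
  finally show "(\<Sum>e\<in>V. p e) \<le> K * real n" .
 qed (use d0 in auto)
 also have "\<dots> = 2*(b*(abs s*(2*L * real r) + 2)) * sqrt K/sqrt (real n)"
 proof -
  define q where "q = sqrt (real n)"
  have "real n = q*q" "q > 0" using n_pos by (simp_all add: q_def)
  then show ?thesis unfolding d_def real_sqrt_mult q_def[symmetric] by simp
 qed
 finally show ?thesis .
qed

text \<open>The part \<open>2 K^2/n\<close> is the error of the Poisson approximation; the part
  \<open>K/n\<close> accounts for the self-loop, which is absent from the graph but included in the
  mean over all \<open>j\<close>.\<close>

lemma out_degree_poisson:
 assumes i: "i \<in> {1..n}"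
 shows "abs (gexp V p (\<lambda>G. odeg G i m) - pois (w_out (w i)/th*((\<Sum>j=1..n. w_in (w j))/real n)) m)
  \<le> (2*K\<^sup>2 + K)/real n"
proof -
 let ?A = "th * real n"
 let ?B = "w_out (w i)"
 let ?Vr = "{e \<in> V. fst e = i}"
 have im: "?Vr = (\<lambda>l. (i, l)) ` ({1..n} - {i})" using i by (auto simp: vertex_pairs_def image_iff)
 have re: "(\<Sum>e\<in>?Vr. f e) = (\<Sum>l\<in>{1..n} - {i}. f (i, l))" for f :: "nat \<times> nat => real"
  unfolding im by (subst sum.reindex) (auto simp: inj_on_def)
 let ?l = "?B/th*((\<Sum>j=1..n. w_in (w j))/real n)"
 have A: "abs (gexp ?Vr p (\<lambda>G. of_bool (card G = m)) - pois (\<Sum>e\<in>?Vr. p e) m) \<le> 2*(\<Sum>e\<in>?Vr. (p e)\<^sup>2)"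
  by (rule poisson_approx) (use p_prob in auto)
 have B: "(\<Sum>e\<in>?Vr. (p e)\<^sup>2) \<le> K\<^sup>2/real n"
 proof -
  have "(\<Sum>e\<in>?Vr. (p e)\<^sup>2) \<le> (\<Sum>l\<in>{1..n} - {i}. (K/real n)\<^sup>2)"
   unfolding re using p_bounds i by (intro sum_mono power_mono) (auto simp: vertex_pairs_def)
  also have "\<dots> \<le> (\<Sum>l\<in>{1..n}. (K/real n)\<^sup>2)" by (intro sum_mono2) auto
  also have "\<dots> = K\<^sup>2/real n" using n_pos by (simp add: power2_eq_square)
  finally show ?thesis .
 qed
 have sum_eq: "(\<Sum>e\<in>?Vr. p e) = ?l - ?B*w_in (w i)/?A"
 proof -
  have "(\<Sum>e\<in>?Vr. p e) = (\<Sum>l\<in>{1..n} - {i}. ?B*w_in (w l)/?A)"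
   unfolding re using i by (intro sum.cong refl p_def) (auto simp: vertex_pairs_def)
  also have "\<dots> = (\<Sum>l\<in>{1..n}. ?B*w_in (w l)/?A) - ?B*w_in (w i)/?A"
   using i by (subst (2) sum.remove[of _ i]) auto
  also have "(\<Sum>l\<in>{1..n}. ?B*w_in (w l)/?A) = ?l"
   by (simp add: sum_distrib_left sum_divide_distrib)
  finally show ?thesis .
 qed
 have ii: "0 \<le> ?B*w_in (w i)/?A" "?B*w_in (w i)/?A \<le> K/real n"
 proof -
  have "?B*w_in (w i) \<le> b*b" using types[OF i] by (intro mult_mono) auto
  then have "?B*w_in (w i)/?A \<le> b*b/?A"
   using theta_pos by (intro divide_right_mono) auto
  also have "b*b/?A = K/real n" by (simp add: power2_eq_square)
  finally show "?B*w_in (w i)/?A \<le> K/real n" .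
  show "0 \<le> ?B*w_in (w i)/?A" using types[OF i] theta_pos by simp
 qed
 have s0: "0 \<le> (\<Sum>e\<in>?Vr. p e)" using p_prob by (intro sum_nonneg) auto
 have "abs (pois (\<Sum>e\<in>?Vr. p e) m - pois ?l m) \<le> abs ((\<Sum>e\<in>?Vr. p e) - ?l)"
  using s0 ii by (intro pois_lipschitz) (auto simp: sum_eq)
 also have "\<dots> \<le> K/real n" using ii unfolding sum_eq by simp
 finally have "abs (pois (\<Sum>e\<in>?Vr. p e) m - pois ?l m) \<le> K/real n" .
 with A B have "abs (gexp ?Vr p (\<lambda>G. of_bool (card G = m)) - pois ?l m) \<le> 2*(K\<^sup>2/real n) + K/real n"
  by linarith
 then show ?thesis unfolding gexp_split_vertex(2)[OF i] by (simp add: add_divide_distrib)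
qed

text \<open>A second moment bound by Markov's inequality. It dominates the out-degree probabilities
  by a multiple of \<open>1/m^2\<close> uniformly in the size of the graph, which later allows
  limits to be taken inside the sum over \<open>m\<close>.\<close>

lemma out_degree_tail:
 assumes i: "i \<in> {1..n}"
 shows "gexp V p (\<lambda>G. odeg G i m)*(real m)\<^sup>2 \<le> K\<^sup>2 + K"
proof -
 have edge: "gexp V p (\<lambda>G. of_bool ((i, l) \<in> G)*(F G :: real)) \<le> K/real n * gexp V p F"
  if "\<And>G. F (insert (i, l) G) = F (G - {(i, l)})" "\<And>G. 0 \<le> F G" for l F
  by (rule gexp_edge_le) (use that p_prob p_bounds theta_pos in auto)
 have two: "gexp V p (\<lambda>G. of_bool ((i, l) \<in> G) * of_bool ((i, k) \<in> G)) \<le> (K/real n)\<^sup>2 + K/real n * of_bool (k = l)" for l k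
 proof (cases "k = l")
  case True
  have "gexp V p (\<lambda>G. of_bool ((i, l) \<in> G) * of_bool ((i, l) \<in> G)) = gexp V p (\<lambda>G. of_bool ((i, l) \<in> G)*(1 :: real))"
   by (rule gexp_cong) auto
  also have "\<dots> \<le> K/real n * gexp V p (\<lambda>_. 1)" by (rule edge) auto
  finally show ?thesis using True by (simp add: add_increasing)
 next
  case False
  have "gexp V p (\<lambda>G. of_bool ((i, l) \<in> G) * of_bool ((i, k) \<in> G)) \<le> K/real n * gexp V p (\<lambda>G. of_bool ((i, k) \<in> G)*1)"
   using edge[where l = l and F = "\<lambda>G. of_bool ((i, k) \<in> G)"] False by auto
  also have "\<dots> \<le> K/real n*(K/real n * gexp V p (\<lambda>_. 1))"
   by (rule mult_left_mono, rule edge) (use theta_pos in auto)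
  finally show ?thesis using False by (simp add: power2_eq_square)
 qed
 have "gexp V p (\<lambda>G. odeg G i m)*(real m)\<^sup>2 = gexp V p (\<lambda>G. (real m)\<^sup>2 * odeg G i m)"
  by (simp add: gexp_cmult)
 also have "\<dots> \<le> gexp V p (\<lambda>G. (real (out_degree G i))\<^sup>2)"
  by (rule gexp_mono[OF p_prob]) auto
 also have "\<dots> = gexp V p (\<lambda>G. \<Sum>l=1..n. \<Sum>k=1..n. of_bool ((i, l) \<in> G) * of_bool ((i, k) \<in> G))"
 proof (rule gexp_cong[OF _ refl])
  fix G assume "G \<subseteq> V"
  then show "(real (out_degree G i))\<^sup>2 = (\<Sum>l=1..n. \<Sum>k=1..n. of_bool ((i, l) \<in> G) * of_bool ((i, k) \<in> G))"
   by (simp only: sum_out_edges[symmetric] power2_eq_square sum_product)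
 qed
 also have "\<dots> \<le> (\<Sum>l=1..n. \<Sum>k=1..n. (K/real n)\<^sup>2 + K/real n * of_bool (k = l))"
  unfolding gexp_sum by (intro sum_mono two)
 also have "\<dots> = (\<Sum>l=1..n. \<Sum>k=1..n. (K/real n)\<^sup>2) + (\<Sum>l=1..n. K/real n)"
  unfolding sum.distrib by (intro arg_cong2[of _ _ _ _ "(+)"] sum.cong refl sum_of_bool_mult)
 also have "\<dots> = K\<^sup>2 + K" using n_pos by (simp add: power2_eq_square)
 finally show ?thesis .
qed

text \<open>Conditionally on the graph without the edges at \<open>i\<close>, the contributions of the vertices to
 the rank of \<open>i\<close> are independent, so that the characteristic function factorizes.\<close>

lemma leave_one_out:
 assumes i: "i \<in> {1..n}" and L: "0 \<le> L" and g: "Re g \<le> 0"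
 shows "norm (gexp V p (\<lambda>G. odeg G i m*cis (s * rank_iter n G w (Suc r) i))
   - of_real (gexp V p (\<lambda>G. odeg G i m))*(cis (s*w_Q (w i))*exp ((w_in (w i)/th) *\<^sub>R g)))
  \<le> abs s * gexp V p (\<lambda>G. \<Sum>j=1..n. abs (amat G w i j)*abs (rank_iter n G w r j - rk (clip L) n G w r j))
   + b/th * gexp V p (\<lambda>G. norm (Gam (clip L) n w r s G - g))
   + (abs s*(L * real r*(2 + real r)*K\<^sup>2) + 4*exp 2*K\<^sup>2 + b/th*(b*(4 + abs s*(2*L * real r*(1 + K)) + 2*K)))/real n"
proof -
 let ?A = "L * real r*(2 + real r)*K\<^sup>2/real n"
 let ?I = "{1..n} - {i}"
 let ?T = "\<lambda>G. rk (clip L) n G w r" and ?R = "\<lambda>G. rank_iter n G w r"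
 define \<beta> where "\<beta> G j = w_zeta (w j)/(1 + real (out_degree G j))*?T G j" for G j
 \<comment> \<open>\<open>Y\<close> is the rank of \<open>i\<close> computed from the clipped ranks
   in the graph without \<open>i\<close>. Given that graph it is a sum of constants over the
   independent in-edges of \<open>i\<close>.\<close>
 define Y where "Y G = w_Q (w i) + (\<Sum>j\<in>?I. of_bool ((j, i) \<in> G)*\<beta> (del i G) j)" for G
 define a where "a j G = cis (s*\<beta> G j)" for j G
 let ?M = "\<lambda>G. \<Prod>j\<in>?I. 1 + p (j, i) *\<^sub>R (a j (del i G) - 1)"
 define P :: real where "P = gexp V p (\<lambda>G. odeg G i m)"
 have ii: "(i, i) \<notin> G" if "G \<subseteq> V" for G using that by (auto simp: vertex_pairs_def)
 have P: "0 \<le> P" "P \<le> 1"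
  unfolding P_def by (auto intro!: gexp_nonneg gexp_le_const p_prob)

 have RY: "abs (rank_iter n G w (Suc r) i - Y G) \<le> (\<Sum>j=1..n. abs (amat G w i j)*abs (?R G j - ?T G j))
   + (\<Sum>j=1..n. of_bool ((j, i) \<in> G)*abs (?T G j - ?T (del i G) j))" if G: "G \<subseteq> V" for G
 proof -
  have am: "amat G w i j = of_bool ((j, i) \<in> G)*(w_zeta (w j)/(1 + real (out_degree (del i G) j)))" if "j \<noteq> i" for j
   using out_degree_del[OF G that] by (auto simp: amat_def)
  have "(\<Sum>j\<in>?I. of_bool ((j, i) \<in> G)*\<beta> (del i G) j) = (\<Sum>j\<in>?I. amat G w i j*?T (del i G) j)"
   by (rule sum.cong) (auto simp: am \<beta>_def)
  also have "\<dots> = (\<Sum>j=1..n. amat G w i j*?T (del i G) j)"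
   using ii[OF G] by (intro sum.mono_neutral_left) (auto simp: amat_def)
  finally have "rank_iter n G w (Suc r) i - Y G = (\<Sum>j=1..n. amat G w i j*(?R G j - ?T (del i G) j))"
   by (simp add: Y_def sum_subtractf right_diff_distrib)
  then have "abs (rank_iter n G w (Suc r) i - Y G) = abs (\<Sum>j=1..n. amat G w i j*(?R G j - ?T (del i G) j))"
   by (simp only:)
  also have "\<dots> \<le> (\<Sum>j=1..n. abs (amat G w i j)*abs (?R G j - ?T G j) + of_bool ((j, i) \<in> G)*abs (?T G j - ?T (del i G) j))"
  proof (rule order_trans[OF sum_abs], rule sum_mono)
   fix j assume j: "j \<in> {1..n}"
   have "abs (amat G w i j*(?R G j - ?T (del i G) j)) \<le> abs (amat G w i j)*(abs (?R G j - ?T G j) + abs (?T G j - ?T (del i G) j))"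
    unfolding abs_mult by (rule mult_left_mono) auto
   also have "\<dots> \<le> abs (amat G w i j)*abs (?R G j - ?T G j) + of_bool ((j, i) \<in> G)*abs (?T G j - ?T (del i G) j)"
    unfolding distrib_left by (intro add_left_mono mult_right_mono abs_amat_le[where w = w and j = j, OF G zeta[OF j]]) auto
   finally show "abs (amat G w i j*(?R G j - ?T (del i G) j)) \<le> \<dots>" .
  qed
  finally show ?thesis by (simp add: sum.distrib)
 qed

 \<comment> \<open>The clipping error is kept as it is: it is small only after averaging over
   \<open>i\<close>. The effect of deleting \<open>i\<close> is the cycle estimate
   \<open>?A\<close>.\<close>
 have step1: "norm (gexp V p (\<lambda>G. odeg G i m*cis (s * rank_iter n G w (Suc r) i))
   - gexp V p (\<lambda>G. odeg G i m*cis (s * Y G)))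
  \<le> abs s * gexp V p (\<lambda>G. \<Sum>j=1..n. abs (amat G w i j)*abs (?R G j - ?T G j)) + abs s*?A"
 proof -
  have "norm (gexp V p (\<lambda>G. odeg G i m*cis (s * rank_iter n G w (Suc r) i))
   - gexp V p (\<lambda>G. odeg G i m*cis (s * Y G)))
   \<le> gexp V p (\<lambda>G. abs s*((\<Sum>j=1..n. abs (amat G w i j)*abs (?R G j - ?T G j))
   + (\<Sum>j=1..n. of_bool ((j, i) \<in> G)*abs (?T G j - ?T (del i G) j))))"
  proof (rule gexp_diff_le[OF p_prob])
   fix G assume G: "G \<subseteq> V"
   have "norm (cis (s * rank_iter n G w (Suc r) i) - cis (s * Y G)) \<le> abs s*abs (rank_iter n G w (Suc r) i - Y G)"
    by (rule order_trans[OF norm_cis_diff_le]) (simp add: abs_mult flip: right_diff_distrib del: rk.simps)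
   also have "\<dots> \<le> abs s*((\<Sum>j=1..n. abs (amat G w i j)*abs (?R G j - ?T G j))
     + (\<Sum>j=1..n. of_bool ((j, i) \<in> G)*abs (?T G j - ?T (del i G) j)))"
    by (intro mult_left_mono RY G) auto
   finally show "norm (odeg G i m*cis (s * rank_iter n G w (Suc r) i) - odeg G i m*cis (s * Y G)) \<le> \<dots>"
    by (cases "out_degree G i = m") (auto intro: order_trans[rotated] simp del: rk.simps)
  qed auto
  also have "\<dots> \<le> abs s * gexp V p (\<lambda>G. \<Sum>j=1..n. abs (amat G w i j)*abs (?R G j - ?T G j)) + abs s*?A"
  proof -
   have "gexp V p (\<lambda>G. \<Sum>j=1..n. of_bool ((j, i) \<in> G)*abs (?T G j - ?T (del i G) j)) \<le> L * real r*(2 + real r)*K\<^sup>2/real n"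
    by (rule cycle_estimate[OF p_prob _ K_nonneg zeta i L]) (use p_bounds in blast)+
   then show ?thesis
    unfolding gexp_cmult gexp_add distrib_left by (intro add_left_mono mult_left_mono) auto
  qed
  finally show ?thesis .
 qed

 have step2: "gexp V p (\<lambda>G. odeg G i m*cis (s * Y G))
   = of_real P*(cis (s*w_Q (w i)) * gexp V p ?M)"
 proof -
  have cisY: "cis (s * Y G) = cis (s*w_Q (w i))*(\<Prod>j\<in>?I. if (j, i) \<in> G then a j (del i G) else 1)" for G
  proof -
   have "cis (s * Y G) = cis (s*w_Q (w i))*exp (\<Sum>j\<in>?I. \<i> * of_real (s*(of_bool ((j, i) \<in> G)*\<beta> (del i G) j)))"
    unfolding Y_def cis_conv_exp exp_add[symmetric] by (simp only: distrib_left sum_distrib_left of_real_add of_real_sum)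
   also have "exp (\<Sum>j\<in>?I. \<i> * of_real (s*(of_bool ((j, i) \<in> G)*\<beta> (del i G) j))) = (\<Prod>j\<in>?I. if (j, i) \<in> G then a j (del i G) else 1)"
    by (subst exp_sum, simp, rule prod.cong) (auto simp: a_def cis_conv_exp)
   finally show ?thesis .
  qed
  have "gexp V p (\<lambda>G. odeg G i m*cis (s * Y G))
    = cis (s*w_Q (w i)) * gexp V p (\<lambda>G. odeg G i m*(\<Prod>j\<in>?I. if (j, i) \<in> G then a j (del i G) else 1))"
   unfolding cisY gexp_cmult[symmetric] by (simp only: mult.left_commute)
  then show ?thesis unfolding gexp_split_vertex(1)[OF i] P_def by simp
 qed

 \<comment> \<open>The errors come from replacing the product by an exponential, from the summand
   \<open>i\<close> present in \<open>Gam\<close> only, from going back from \<open>del i G\<close>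
   to \<open>G\<close>, and from replacing \<open>Gam\<close> by the deterministic
   \<open>g\<close>.\<close>
 have prod_approx: "norm (?M G - exp ((w_in (w i)/th) *\<^sub>R g))
   \<le> 4*exp 2*K\<^sup>2/real n + b/th * norm (Gam (clip L) n w r s G - g)
    + b/th*(b*(4 + abs s*(2*L * real r*(1 + real (card {j. (j, i) \<in> G}))) + 2 * real (card {j. (j, i) \<in> G}))/real n)"
  if G: "G \<subseteq> V" for G
 proof -
  let ?D = "del i G" and ?X = "{j. (j, i) \<in> G}"
  let ?S = "(\<Sum>j\<in>?I. w_out (w j) *\<^sub>R (a j ?D - 1)) /\<^sub>R real n"
  have D: "?D \<subseteq> V" using G del_subset by blast
  have finX: "finite ?X" by (rule finite_subset[of _ "{1..n}"]) (use G in "auto simp: vertex_pairs_def")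
  define A where "A = (\<Sum>j\<in>?I. p (j, i) *\<^sub>R (a j ?D - 1))"
  have pj: "(j, i) \<in> V" if "j \<in> ?I" for j using that i by (auto simp: vertex_pairs_def)
  have 1: "norm (?M G - exp A) \<le> 4*exp 2*K\<^sup>2/real n"
  proof -
   have "norm (?M G - exp A) \<le> 4*exp 2*(\<Sum>j\<in>?I. (p (j, i))\<^sup>2)"
    unfolding A_def by (rule compound_product_bound) (use p_prob pj in "auto simp: a_def")
   also have "(\<Sum>j\<in>?I. (p (j, i))\<^sup>2) \<le> (\<Sum>j\<in>?I. (K/real n)\<^sup>2)"
    using p_bounds pj by (intro sum_mono power_mono) auto
   also have "\<dots> \<le> (\<Sum>j\<in>{1..n}. (K/real n)\<^sup>2)" by (intro sum_mono2) auto
   also have "\<dots> = K\<^sup>2/real n" using n_pos by (simp add: power2_eq_square)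
   finally show ?thesis by simp
  qed
  have A_eq: "A = (w_in (w i)/th) *\<^sub>R ?S"
  proof -
   have "A = (\<Sum>j\<in>?I. (w_in (w i)/th) *\<^sub>R (inverse (real n) *\<^sub>R (w_out (w j) *\<^sub>R (a j ?D - 1))))"
    unfolding A_def by (intro sum.cong refl) (use pj p_def in "simp add: field_simps")
   then show ?thesis by (simp only: scaleR_sum_right)
  qed
  \<comment> \<open>Both exponents lie in the left half-plane, where the exponential is Lipschitz
    with constant 1.\<close>
  have ReA: "Re A \<le> 0"
   unfolding A_def by (auto simp: Re_sum a_def p_prob pj intro!: sum_nonpos mult_nonneg_nonpos)
  have wi: "0 \<le> w_in (w i)/th" "w_in (w i)/th \<le> b/th" using types[OF i] theta_pos by (auto intro: divide_right_mono)
  have 2: "norm (?S - Gam (clip L) n w r s ?D) \<le> b*2/real n"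
  proof -
   have eq: "Gam (clip L) n w r s ?D = (w_out (w i) *\<^sub>R (a i ?D - 1)) /\<^sub>R real n + ?S"
    unfolding Gam_def a_def \<beta>_def using i by (subst sum.remove[of _ i]) (auto simp: scaleR_right_distrib)
   have "norm (w_out (w i) *\<^sub>R (a i ?D - 1)) \<le> b*2"
    unfolding norm_scaleR using types[OF i] norm_cis_minus_1_le by (intro mult_mono) (auto simp: a_def)
   moreover have "norm (S - (Z /\<^sub>R real n + S)) = norm Z/real n" for S Z :: complex
    by (simp add: divide_inverse_commute)
   ultimately show ?thesis unfolding eq by (simp only: divide_right_mono of_nat_0_le_iff)
  qed
  \<comment> \<open>The out-edges differ only for \<open>i\<close> and its in-neighbours, so the
    number of changed rows is at most 1 plus the in-degree of \<open>i\<close>; its mean is at most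
    \<open>K\<close>.\<close>
  have 3: "norm (Gam (clip L) n w r s ?D - Gam (clip L) n w r s G)
    \<le> b*(abs s*(2*L * real r*(1 + real (card ?X))) + 2*(1 + real (card ?X)))/real n"
  proof -
   have "norm (Gam (clip L) n w r s ?D - Gam (clip L) n w r s G)
    \<le> b*(\<Sum>j=1..n. if out_degree ?D j = out_degree G j then abs s*abs (?T ?D j - ?T G j) else 2)/real n"
    by (rule Gam_diff[OF D G])
   also have "\<dots> \<le> b*(\<Sum>j=1..n. abs s*abs (?T ?D j - ?T G j) + 2*(of_bool (j = i) + of_bool ((j, i) \<in> G)))/real n"
   proof (intro divide_right_mono mult_left_mono sum_mono)
    fix j
    show "(if out_degree ?D j = out_degree G j then abs s*abs (?T ?D j - ?T G j) else 2)
     \<le> abs s*abs (?T ?D j - ?T G j) + 2*(of_bool (j = i) + of_bool ((j, i) \<in> G))"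
     using out_degree_del[OF G, of j i] by auto
   qed (use b_nonneg in auto)
   also have "(\<Sum>j=1..n. abs s*abs (?T ?D j - ?T G j) + 2*(of_bool (j = i) + of_bool ((j, i) \<in> G)))
     = abs s*(\<Sum>j=1..n. abs (?T ?D j - ?T G j)) + 2*(1 + real (card ?X))"
   proof -
    have "(\<Sum>j=1..n. of_bool (j = i)) = (1::real)" using sum_of_bool_mult[OF i, of "\<lambda>_. 1"] by simp
    then show ?thesis unfolding sum_in_edges[OF G, symmetric] sum.distrib sum_distrib_left[symmetric] by (simp only:)
   qed
   also have "b*(abs s*(\<Sum>j=1..n. abs (?T ?D j - ?T G j)) + 2*(1 + real (card ?X)))/real n
    \<le> b*(abs s*(2*L * real r*(1 + real (card ?X))) + 2*(1 + real (card ?X)))/real n"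
   proof (intro divide_right_mono mult_left_mono add_right_mono)
    have "(\<Sum>j=1..n. abs (?T ?D j - ?T G j)) \<le> 2*L * real r * real (card (insert i ?X))"
     by (rule rk_change_rows[OF D G zeta L]) (use finX in "auto simp: del_def")
    also have "\<dots> \<le> 2*L * real r*(1 + real (card ?X))"
     using L finX by (intro mult_left_mono) (auto simp: card_insert_if)
    finally show "(\<Sum>j=1..n. abs (?T ?D j - ?T G j)) \<le> 2*L * real r*(1 + real (card ?X))" .
   qed (use b_nonneg in auto)
   finally show ?thesis .
  qed
  have "norm (exp A - exp ((w_in (w i)/th) *\<^sub>R g)) \<le> norm (A - (w_in (w i)/th) *\<^sub>R g)"
   by (rule norm_exp_diff_le[OF ReA]) (use mult_nonneg_nonpos[OF wi(1) g] in simp)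
  also have "\<dots> = w_in (w i)/th * norm (?S - g)"
   unfolding A_eq scaleR_diff_right[symmetric] norm_scaleR using wi by (simp only: abs_of_nonneg)
  also have "\<dots> \<le> b/th * norm (?S - g)"
   by (intro mult_right_mono wi) simp
  also have "\<dots> \<le> b/th*(b*2/real n
    + b*(abs s*(2*L * real r*(1 + real (card ?X))) + 2*(1 + real (card ?X)))/real n + norm (Gam (clip L) n w r s G - g))"
  proof (intro mult_left_mono)
   have "norm (?S - g) = norm ((?S - Gam (clip L) n w r s ?D) + (Gam (clip L) n w r s ?D - Gam (clip L) n w r s G) + (Gam (clip L) n w r s G - g))"
    by simp
   also have "\<dots> \<le> norm (?S - Gam (clip L) n w r s ?D) + norm (Gam (clip L) n w r s ?D - Gam (clip L) n w r s G) + norm (Gam (clip L) n w r s G - g)"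
    by (intro order_trans[OF norm_triangle_ineq] add_right_mono norm_triangle_ineq)
   finally show "norm (?S - g) \<le> b*2/real n
    + b*(abs s*(2*L * real r*(1 + real (card ?X))) + 2*(1 + real (card ?X)))/real n + norm (Gam (clip L) n w r s G - g)"
    using 2 3 by linarith
  qed (use b_nonneg theta_pos in auto)
  finally have 4: "norm (exp A - exp ((w_in (w i)/th) *\<^sub>R g)) \<le> \<dots>" .
  have 5: "norm (?M G - exp ((w_in (w i)/th) *\<^sub>R g))
   \<le> norm (?M G - exp A) + norm (exp A - exp ((w_in (w i)/th) *\<^sub>R g))"
   using norm_triangle_ineq[of "?M G - exp A" "exp A - exp ((w_in (w i)/th) *\<^sub>R g)"] by simp
  have "norm (?M G - exp ((w_in (w i)/th) *\<^sub>R g))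
    \<le> 4*exp 2*K\<^sup>2/real n + b/th*(b*2/real n
    + b*(abs s*(2*L * real r*(1 + real (card ?X))) + 2*(1 + real (card ?X)))/real n + norm (Gam (clip L) n w r s G - g))"
   using 1 4 5 by linarith
  also have "\<dots> = 4*exp 2*K\<^sup>2/real n + b/th * norm (Gam (clip L) n w r s G - g)
    + b/th*(b*(4 + abs s*(2*L * real r*(1 + real (card ?X))) + 2 * real (card ?X))/real n)"
   using n_pos theta_pos by (simp add: field_simps)
  finally show ?thesis .
 qed
 have EX: "gexp V p (\<lambda>G. real (card {j. (j, i) \<in> G})) \<le> K"
 proof -
  have "gexp V p (\<lambda>G. real (card {j. (j, i) \<in> G})) = gexp V p (\<lambda>G. \<Sum>j=1..n. of_bool ((j, i) \<in> G))"
   by (rule gexp_cong[OF _ refl]) (simp only: sum_in_edges)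
  then show ?thesis using expected_in_degree[OF i] by simp
 qed
 define X where "X = gexp V p (\<lambda>G. real (card {j. (j, i) \<in> G}))"
 define \<Gamma> where "\<Gamma> = gexp V p (\<lambda>G. norm (Gam (clip L) n w r s G - g))"
 have "norm (gexp V p ?M - gexp V p (\<lambda>_. exp ((w_in (w i)/th) *\<^sub>R g)))
   \<le> gexp V p (\<lambda>G. 4*exp 2*K\<^sup>2/real n + b/th * norm (Gam (clip L) n w r s G - g)
    + b/th*(b*(4 + abs s*(2*L * real r*(1 + real (card {j. (j, i) \<in> G}))) + 2 * real (card {j. (j, i) \<in> G}))/real n))"
  by (rule gexp_diff_le[OF p_prob prod_approx])
 also have "\<dots> = 4*exp 2*K\<^sup>2/real n + b/th*\<Gamma>
    + b/th*(b*(4 + abs s*(2*L * real r*(1 + X)) + 2 * X)/real n)"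
  unfolding gexp_add gexp_cmult gexp_divide X_def \<Gamma>_def by simp
 also have "\<dots> \<le> 4*exp 2*K\<^sup>2/real n + b/th*\<Gamma>
    + b/th*(b*(4 + abs s*(2*L * real r*(1 + K)) + 2*K)/real n)"
  using b_nonneg theta_pos L EX[folded X_def]
  by (intro add_left_mono mult_left_mono divide_right_mono add_mono) auto
 finally have prod: "norm (gexp V p ?M - exp ((w_in (w i)/th) *\<^sub>R g)) \<le> \<dots>"
  by (simp only: gexp_const[OF finite_vertex_pairs])
 let ?E = "gexp V p ?M"
 let ?c = "cis (s*w_Q (w i))" and ?e = "exp ((w_in (w i)/th) *\<^sub>R g)"
 have "norm (of_real P*(?c*?E) - of_real P*(?c*?e)) = P * norm (?E - ?e)"
  unfolding right_diff_distrib[symmetric] norm_mult using P by simp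
 also have "\<dots> \<le> 1 * norm (?E - ?e)" by (intro mult_right_mono P) auto
 finally have step3: "norm (of_real P*(?c*?E) - of_real P*(?c*?e)) \<le> norm (?E - ?e)" by simp
 have "norm (gexp V p (\<lambda>G. odeg G i m*cis (s * rank_iter n G w (Suc r) i)) - of_real P*(?c*?e))
  \<le> abs s * gexp V p (\<lambda>G. \<Sum>j=1..n. abs (amat G w i j)*abs (?R G j - ?T G j)) + abs s*?A
   + (4*exp 2*K\<^sup>2/real n + b/th*\<Gamma>
    + b/th*(b*(4 + abs s*(2*L * real r*(1 + K)) + 2*K)/real n))"
  using norm_triangle_ineq[of "gexp V p (\<lambda>G. odeg G i m*cis (s * rank_iter n G w (Suc r) i)) - of_real P*(?c*?E)"
    "of_real P*(?c*?E) - of_real P*(?c*?e)"] step1[unfolded step2] step3 prod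
  by simp
 also have "\<dots> = abs s * gexp V p (\<lambda>G. \<Sum>j=1..n. abs (amat G w i j)*abs (?R G j - ?T G j)) + b/th*\<Gamma>
   + (abs s*(L * real r*(2 + real r)*K\<^sup>2) + 4*exp 2*K\<^sup>2 + b/th*(b*(4 + abs s*(2*L * real r*(1 + K)) + 2*K)))/real n"
  by (simp add: add_divide_distrib)
 finally show ?thesis by (simp only: P_def \<Gamma>_def)
qed

end

section \<open>Unbounded types\<close>

text \<open>A general filter, because the result is used along a sequence of graphs and along the
  iterated limit \<open>nested_filter\<close>. In the induction step the in-degree threshold
  \<open>m\<close> is chosen after the rank level \<open>L\<close>, since the excess in-degree is
  multiplied by \<open>L\<close>.\<close>

lemma uniform_integrability:
 fixes F :: "'x filter" and N :: "'x => nat" and w :: "'x => nat => ext_type" and p :: "'x => nat \<times> nat => real"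
 assumes model: "\<forall>\<^sub>F x in F. (\<forall>e\<in>vertex_pairs (N x). 0 \<le> p x e \<and> p x e \<le> 1) \<and> (\<forall>j\<in>{1..N x}. abs (w_zeta (w x j)) \<le> 1)"
  and tail_Q: "\<And>eps. eps > 0 ==> \<exists>q\<ge>0. \<forall>\<^sub>F x in F. (\<Sum>i=1..N x. excess q (w_Q (w x i)))/real (N x) \<le> eps"
  and tail_D: "\<And>eps. eps > 0 ==> \<exists>m\<ge>0. \<forall>\<^sub>F x in F.
    gexp (vertex_pairs (N x)) (p x) (\<lambda>G. deg_tail (N x) m G)/real (N x) \<le> eps"
  and "eps > 0"
 shows "\<exists>L\<ge>0. \<forall>\<^sub>F x in F.
    gexp (vertex_pairs (N x)) (p x) (\<lambda>G. \<Sum>i=1..N x. excess L (rank_iter (N x) G (w x) r i))/real (N x) \<le> eps"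
 using \<open>eps > 0\<close>
proof (induction r arbitrary: eps)
 case 0
 then show ?case using tail_Q[of eps] by simp
next
 case (Suc r)
 let ?E = "\<lambda>x. gexp (vertex_pairs (N x)) (p x)"
 obtain L where L: "0 \<le> L" "\<forall>\<^sub>F x in F. ?E x (\<lambda>G. \<Sum>i=1..N x. excess L (rank_iter (N x) G (w x) r i))/real (N x) \<le> eps/3"
  using Suc.IH[of "eps/3"] Suc.prems by auto
 obtain q where q: "0 \<le> q" "\<forall>\<^sub>F x in F. (\<Sum>i=1..N x. excess q (w_Q (w x i)))/real (N x) \<le> eps/3"
  using tail_Q[of "eps/3"] Suc.prems by auto
 obtain m where m: "0 \<le> m" "\<forall>\<^sub>F x in F. ?E x (\<lambda>G. deg_tail (N x) m G)/real (N x) \<le> eps/(3*(L + 1))"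
  using tail_D[of "eps/(3*(L + 1))"] Suc.prems L(1) by auto
 have "\<forall>\<^sub>F x in F. ?E x (\<lambda>G. \<Sum>i=1..N x. excess (q + L * m) (rank_iter (N x) G (w x) (Suc r) i))/real (N x) \<le> eps"
  using L(2) q(2) m(2) model
 proof eventually_elim
  case (elim x)
  have "?E x (\<lambda>G. \<Sum>i=1..N x. excess (q + L * m) (rank_iter (N x) G (w x) (Suc r) i))
   \<le> ?E x (\<lambda>G. (\<Sum>i=1..N x. excess q (w_Q (w x i))) + (\<Sum>i=1..N x. excess L (rank_iter (N x) G (w x) r i))
     + L*(deg_tail (N x) m G))"
   by (rule gexp_mono, use elim in blast, rule sum_excess_rank_iter[OF _ _ L(1)]) (use elim in auto)
  also have "\<dots> = (\<Sum>i=1..N x. excess q (w_Q (w x i))) + ?E x (\<lambda>G. \<Sum>i=1..N x. excess L (rank_iter (N x) G (w x) r i))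
     + L*?E x (\<lambda>G. deg_tail (N x) m G)"
   unfolding gexp_add gexp_cmult by simp
  finally have "?E x (\<lambda>G. \<Sum>i=1..N x. excess (q + L * m) (rank_iter (N x) G (w x) (Suc r) i))/real (N x)
   \<le> ((\<Sum>i=1..N x. excess q (w_Q (w x i))) + ?E x (\<lambda>G. \<Sum>i=1..N x. excess L (rank_iter (N x) G (w x) r i))
     + L*?E x (\<lambda>G. deg_tail (N x) m G))/real (N x)"
   by (rule divide_right_mono) simp
  also have "\<dots> = (\<Sum>i=1..N x. excess q (w_Q (w x i)))/real (N x) + ?E x (\<lambda>G. \<Sum>i=1..N x. excess L (rank_iter (N x) G (w x) r i))/real (N x)
     + L*(?E x (\<lambda>G. deg_tail (N x) m G)/real (N x))"
   by (simp add: add_divide_distrib)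
  also have "\<dots> \<le> eps/3 + eps/3 + L*(eps/(3*(L + 1)))"
   using elim L(1) by (intro add_mono mult_left_mono) auto
  also have "L*(eps/(3*(L + 1))) \<le> eps/3"
   using L(1) Suc.prems by (simp add: field_simps)
  finally show ?case by simp
 qed
 moreover have "0 \<le> q + L * m" using q(1) L(1) m(1) by simp
 ultimately show ?case by blast
qed

text \<open>In the step \<open>eps/4\<close> is doubled by \<open>rank_iter_clip_Suc\<close>, and
  the other half of \<open>eps\<close> is the excess of the unclipped rank. The claim covers all
  larger levels, so that a common level can be chosen for the original and for the rounded
  types.\<close>

lemma clip_approximation:
 fixes F :: "'x filter" and N :: "'x => nat" and w :: "'x => nat => ext_type" and p :: "'x => nat \<times> nat => real"
 assumes model: "\<forall>\<^sub>F x in F. (\<forall>e\<in>vertex_pairs (N x). 0 \<le> p x e \<and> p x e \<le> 1) \<and> (\<forall>j\<in>{1..N x}. abs (w_zeta (w x j)) \<le> 1)"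
  and tail_Q: "\<And>eps. eps > 0 ==> \<exists>q\<ge>0. \<forall>\<^sub>F x in F. (\<Sum>i=1..N x. excess q (w_Q (w x i)))/real (N x) \<le> eps"
  and tail_D: "\<And>eps. eps > 0 ==> \<exists>m\<ge>0. \<forall>\<^sub>F x in F.
    gexp (vertex_pairs (N x)) (p x) (\<lambda>G. deg_tail (N x) m G)/real (N x) \<le> eps"
  and "eps > 0"
 shows "\<exists>L0\<ge>0. \<forall>L\<ge>L0. \<forall>\<^sub>F x in F.
    gexp (vertex_pairs (N x)) (p x) (\<lambda>G. \<Sum>i=1..N x. abs (rank_iter (N x) G (w x) r i - rk (clip L) (N x) G (w x) r i))/real (N x) \<le> eps"
 using \<open>eps > 0\<close>
proof (induction r arbitrary: eps)
 let ?E = "\<lambda>x. gexp (vertex_pairs (N x)) (p x)"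
 case 0
 obtain q where q: "0 \<le> q" "\<forall>\<^sub>F x in F. (\<Sum>i=1..N x. excess q (w_Q (w x i)))/real (N x) \<le> eps"
  using tail_Q[of eps] 0 by auto
 show ?case
 proof (intro exI conjI allI impI)
  fix L assume "q \<le> L"
  show "\<forall>\<^sub>F x in F. ?E x (\<lambda>G. \<Sum>i=1..N x. abs (rank_iter (N x) G (w x) 0 i - rk (clip L) (N x) G (w x) 0 i))/real (N x) \<le> eps"
   using q(2)
  proof eventually_elim
   case (elim x)
   have "(\<Sum>i=1..N x. excess L (w_Q (w x i)))/real (N x) \<le> (\<Sum>i=1..N x. excess q (w_Q (w x i)))/real (N x)"
    using \<open>q \<le> L\<close> by (intro divide_right_mono sum_mono excess_antimono) auto
   then show ?case using elim q(1) \<open>q \<le> L\<close> by (simp add: clip_diff)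
  qed
 qed fact
next
 let ?E = "\<lambda>x. gexp (vertex_pairs (N x)) (p x)"
 case (Suc r)
 obtain L0 where L0: "0 \<le> L0" "\<And>L. L0 \<le> L ==> \<forall>\<^sub>F x in F.
   ?E x (\<lambda>G. \<Sum>i=1..N x. abs (rank_iter (N x) G (w x) r i - rk (clip L) (N x) G (w x) r i))/real (N x) \<le> eps/4"
  using Suc.IH[of "eps/4"] Suc.prems by auto
 obtain L1 where L1: "0 \<le> L1" "\<forall>\<^sub>F x in F. ?E x (\<lambda>G. \<Sum>i=1..N x. excess L1 (rank_iter (N x) G (w x) (Suc r) i))/real (N x) \<le> eps/2"
  using uniform_integrability[OF model tail_Q tail_D, of "eps/2" "Suc r"] Suc.prems by auto
 show ?case
 proof (intro exI conjI allI impI)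
  fix L assume "max L0 L1 \<le> L"
  then have L: "L0 \<le> L" "L1 \<le> L" "0 \<le> L" using L0(1) by auto
  show "\<forall>\<^sub>F x in F. ?E x (\<lambda>G. \<Sum>i=1..N x. abs (rank_iter (N x) G (w x) (Suc r) i - rk (clip L) (N x) G (w x) (Suc r) i))/real (N x) \<le> eps"
   using L0(2)[OF L(1)] L1(2) model
  proof eventually_elim
   case (elim x)
   have "?E x (\<lambda>G. \<Sum>i=1..N x. abs (rank_iter (N x) G (w x) (Suc r) i - rk (clip L) (N x) G (w x) (Suc r) i))
     \<le> ?E x (\<lambda>G. 2*(\<Sum>i=1..N x. abs (rank_iter (N x) G (w x) r i - rk (clip L) (N x) G (w x) r i))
       + (\<Sum>i=1..N x. excess L1 (rank_iter (N x) G (w x) (Suc r) i)))"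
   proof (rule gexp_mono)
    fix G assume G: "G \<subseteq> vertex_pairs (N x)"
    have "(\<Sum>i=1..N x. abs (rank_iter (N x) G (w x) (Suc r) i - rk (clip L) (N x) G (w x) (Suc r) i))
      \<le> 2*(\<Sum>i=1..N x. abs (rank_iter (N x) G (w x) r i - rk (clip L) (N x) G (w x) r i))
       + (\<Sum>i=1..N x. excess L (rank_iter (N x) G (w x) (Suc r) i))"
     by (rule rank_iter_clip_Suc[OF G _ L(3)]) (use elim in auto)
    also have "(\<Sum>i=1..N x. excess L (rank_iter (N x) G (w x) (Suc r) i)) \<le> (\<Sum>i=1..N x. excess L1 (rank_iter (N x) G (w x) (Suc r) i))"
     using L by (intro sum_mono excess_antimono)
    finally show "(\<Sum>i=1..N x. abs (rank_iter (N x) G (w x) (Suc r) i - rk (clip L) (N x) G (w x) (Suc r) i))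
      \<le> 2*(\<Sum>i=1..N x. abs (rank_iter (N x) G (w x) r i - rk (clip L) (N x) G (w x) r i))
       + (\<Sum>i=1..N x. excess L1 (rank_iter (N x) G (w x) (Suc r) i))" by simp
   qed (use elim in blast)
   also have "\<dots> = 2*?E x (\<lambda>G. \<Sum>i=1..N x. abs (rank_iter (N x) G (w x) r i - rk (clip L) (N x) G (w x) r i))
       + ?E x (\<lambda>G. \<Sum>i=1..N x. excess L1 (rank_iter (N x) G (w x) (Suc r) i))"
    unfolding gexp_add gexp_cmult ..
   finally have "?E x (\<lambda>G. \<Sum>i=1..N x. abs (rank_iter (N x) G (w x) (Suc r) i - rk (clip L) (N x) G (w x) (Suc r) i))/real (N x)
     \<le> (2*?E x (\<lambda>G. \<Sum>i=1..N x. abs (rank_iter (N x) G (w x) r i - rk (clip L) (N x) G (w x) r i))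
       + ?E x (\<lambda>G. \<Sum>i=1..N x. excess L1 (rank_iter (N x) G (w x) (Suc r) i)))/real (N x)"
    by (rule divide_right_mono) simp
   also have "\<dots> = 2*(?E x (\<lambda>G. \<Sum>i=1..N x. abs (rank_iter (N x) G (w x) r i - rk (clip L) (N x) G (w x) r i))/real (N x))
       + ?E x (\<lambda>G. \<Sum>i=1..N x. excess L1 (rank_iter (N x) G (w x) (Suc r) i))/real (N x)"
    by (simp only: add_divide_distrib times_divide_eq_right)
   also have "\<dots> \<le> 2*(eps/4) + eps/2"
    using elim by (intro add_mono mult_left_mono) auto
   finally show ?case by simp
  qed
 qed (use L0(1) in auto)
qed

text \<open>The limit of the contribution of a vertex of type \<open>v\<close> to
  \<open>Gam\<close>, before the factor \<open>w_out v\<close>: a mean over its Poisson number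
  \<open>m\<close> of out-edges other than the one along which it contributes.\<close>

definition offspring :: "ext_type measure => real => (real => ext_type => complex) => real => ext_type => complex" where
 "offspring M th f s v = (\<Sum>m. pois ((\<integral>x. w_in x \<partial>M)*w_out v/th) m *\<^sub>R (f (s*(w_zeta v/(1 + real m))) v - 1))"

text \<open>\<open>psi M th r s u\<close> is the characteristic function at \<open>s\<close> of the rank computed from the first
 \<open>r\<close> generations of the multitype limiting tree whose root has type \<open>u\<close>, for the type law \<open>M\<close>.\<close>

primrec psi :: "ext_type measure => real => nat => real => ext_type => complex" where
 "psi M th 0 s u = cis (s*w_Q u)"
| "psi M th (Suc r) s u = cis (s*w_Q u)*exp ((w_in u/th) *\<^sub>R (\<integral>v. w_out v *\<^sub>R offspring M th (psi M th r) s v \<partial>M))"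

lemma measurable_cis [measurable]: "cis \<in> borel_measurable borel"
 by (intro borel_measurable_continuous_onI continuous_intros)

lemma pois_measurable [measurable]: "(\<lambda>l. pois l m) \<in> borel_measurable borel"
 unfolding pois_def by measurable

lemma offspring_measurable:
 assumes "(\<lambda>(s, u). f s u) \<in> borel_measurable (borel \<Otimes>\<^sub>M borel)"
 shows "(\<lambda>(s, u). offspring M th f s u) \<in> borel_measurable (borel \<Otimes>\<^sub>M borel)"
proof -
 have [measurable]: "(\<lambda>x. f (g x) (h x)) \<in> borel_measurable N"
  if "g \<in> borel_measurable N" "h \<in> borel_measurable N" for g h and N :: "'z measure"
  using measurable_compose[OF measurable_Pair[OF that] assms] by simp
 show ?thesis unfolding offspring_def split_beta' by measurable
qed

lemma psi_measurable:
 assumes "prob_space M" "sets M = sets borel"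
 shows "(\<lambda>(s, u). psi M th r s u) \<in> borel_measurable (borel \<Otimes>\<^sub>M borel)"
proof (induction r)
 case 0
 show ?case unfolding psi.simps split_beta' by measurable
next
 case (Suc r)
 interpret prob_space M by fact
 note [measurable_cong] = assms(2)
 have [measurable]: "(\<lambda>x. offspring M th (psi M th r) (g x) (h x)) \<in> borel_measurable N"
  if "g \<in> borel_measurable N" "h \<in> borel_measurable N" for g h and N :: "'z measure"
  using measurable_compose[OF measurable_Pair[OF that] offspring_measurable[OF Suc]] by simp
 have [measurable]: "exp \<in> borel_measurable (borel :: complex measure)"
  by (intro borel_measurable_continuous_onI continuous_intros)
 show ?case unfolding psi.simps split_beta' by measurable
qed

lemma psi_0: "psi M th r 0 u = 1"
 by (induction r arbitrary: u) (simp_all add: offspring_def cis_zero)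

lemma summable_pois: "summable (pois l)"
 using pois_sums by (auto simp: sums_iff)

lemma norm_pois_scale_le:
 fixes z :: complex
 assumes "0 \<le> l" "norm z \<le> 1"
 shows "norm (pois l m *\<^sub>R (z - 1)) \<le> 2*pois l m"
proof -
 have "norm (z - 1) \<le> 2" using norm_triangle_ineq4[of z 1] assms(2) by simp
 then show ?thesis using mult_left_mono[of "norm (z - 1)" 2 "pois l m"] pois_nonneg[OF assms(1), of m] by simp
qed

context
 fixes M :: "ext_type measure" and th :: real
 assumes M: "prob_space M" "sets M = sets borel" and nonneg: "AE v in M. 0 \<le> w_in v \<and> 0 \<le> w_out v" and theta: "0 < th"
begin

lemma mean_in_nonneg: "0 \<le> (\<integral>x. w_in x \<partial>M)"
 by (rule integral_nonneg_AE) (use nonneg in auto)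

lemma rate_nonneg: "0 \<le> w_out v ==> 0 \<le> (\<integral>x. w_in x \<partial>M)*w_out v/th"
 using mean_in_nonneg theta by simp

lemma offspring_bounds:
 assumes v: "0 \<le> w_out v" and f: "\<And>s. norm (f s v) \<le> 1"
 shows "summable (\<lambda>m. pois ((\<integral>x. w_in x \<partial>M)*w_out v/th) m *\<^sub>R (f (s*(w_zeta v/(1 + real m))) v - 1))"
  and "norm (offspring M th f s v) \<le> 2" "Re (offspring M th f s v) \<le> 0"
proof -
 let ?l = "(\<integral>x. w_in x \<partial>M)*w_out v/th"
 let ?t = "\<lambda>m. pois ?l m *\<^sub>R (f (s*(w_zeta v/(1 + real m))) v - 1)"
 have l: "0 \<le> ?l" by (rule rate_nonneg[OF v])
 have t: "norm (?t m) \<le> 2*pois ?l m" for m by (rule norm_pois_scale_le[OF l f])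
 have s2: "summable (\<lambda>m. 2*pois ?l m)" by (intro summable_mult summable_pois)
 then show sm: "summable ?t" using t by (rule summable_comparison_test'[where N = 0])
 have "norm (offspring M th f s v) \<le> (\<Sum>m. 2*pois ?l m)"
  unfolding offspring_def by (rule norm_suminf_le[OF t s2])
 also have "\<dots> = 2" using pois_sums[of ?l] by (simp add: suminf_mult summable_pois sums_iff)
 finally show "norm (offspring M th f s v) \<le> 2" .
 have "Re (offspring M th f s v) = (\<Sum>m. Re (?t m))"
  unfolding offspring_def by (rule Re_suminf[OF sm])
 also have "\<dots> \<le> (\<Sum>m. 0)"
 proof (rule suminf_le)
  fix m
  have "Re (f (s*(w_zeta v/(1 + real m))) v) \<le> 1"
   using f[of "s*(w_zeta v/(1 + real m))"] abs_Re_le_cmod order_trans by (metis abs_le_D1)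
  then show "Re (?t m) \<le> 0" using pois_nonneg[OF l, of m] by (simp add: mult_nonneg_nonpos)
 qed (use summable_Re[OF sm] in simp_all)
 finally show "Re (offspring M th f s v) \<le> 0" by simp
qed

lemma norm_psi_le: "0 \<le> w_in u ==> norm (psi M th r s u) \<le> 1"
proof (induction r arbitrary: s u)
 case (Suc r)
 let ?I = "\<integral>v. w_out v *\<^sub>R offspring M th (psi M th r) s v \<partial>M"
 have "Re ?I \<le> 0"
 proof (cases "integrable M (\<lambda>v. w_out v *\<^sub>R offspring M th (psi M th r) s v)")
  case True
  have "Re ?I = (\<integral>v. Re (w_out v *\<^sub>R offspring M th (psi M th r) s v) \<partial>M)"
   using True by (rule integral_bounded_linear[OF bounded_linear_Re, symmetric])
  also have "\<dots> \<le> 0"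
  proof -
   have "AE v in M. Re (w_out v *\<^sub>R offspring M th (psi M th r) s v) \<le> 0"
    using nonneg
   proof eventually_elim
    case (elim v)
    then have "Re (offspring M th (psi M th r) s v) \<le> 0"
     by (intro offspring_bounds(3) Suc.IH) auto
    then show ?case using elim by (simp add: mult_nonneg_nonpos)
   qed
   then have "0 \<le> (\<integral>v. - Re (w_out v *\<^sub>R offspring M th (psi M th r) s v) \<partial>M)"
    by (intro integral_nonneg_AE) auto
   then show ?thesis by simp
  qed
  finally show ?thesis .
 \<comment> \<open>If the integrand is not integrable, its integral is 0 by convention.\<close>
 qed (simp add: not_integrable_integral_eq)
 then show ?case using Suc.prems theta by (auto simp: norm_mult intro!: divide_nonpos_nonneg mult_nonneg_nonpos)
qed simp

end

section \<open>Finitely many types\<close>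

text \<open>The inequality \<open>max 0 (x - m) \<le> x^2/m\<close> converts the second moment
  \<open>K^2 + K\<close> of the in-degree into a tail bound.\<close>

lemma (in bounded_digraph) in_degree_tail:
 assumes i: "i \<in> {1..n}" and m: "0 < m"
 shows "gexp V p (\<lambda>G. max 0 (in_deg n G i - m)) \<le> (K\<^sup>2 + K)/m"
proof -
 have edge: "gexp V p (\<lambda>G. of_bool ((l, i) \<in> G)*(F G :: real)) \<le> K/real n * gexp V p F"
  if "\<And>G. F (insert (l, i) G) = F (G - {(l, i)})" "\<And>G. 0 \<le> F G" for l F
  by (rule gexp_edge_le) (use that p_prob p_bounds theta_pos in auto)
 have two: "gexp V p (\<lambda>G. of_bool ((l, i) \<in> G) * of_bool ((k, i) \<in> G)) \<le> (K/real n)\<^sup>2 + K/real n * of_bool (k = l)" for l k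
 proof (cases "k = l")
  case True
  have "gexp V p (\<lambda>G. of_bool ((l, i) \<in> G) * of_bool ((l, i) \<in> G)) = gexp V p (\<lambda>G. of_bool ((l, i) \<in> G)*(1 :: real))"
   by (rule gexp_cong) auto
  also have "\<dots> \<le> K/real n * gexp V p (\<lambda>_. 1)" by (rule edge) auto
  finally show ?thesis using True by (simp add: add_increasing)
 next
  case False
  have "gexp V p (\<lambda>G. of_bool ((l, i) \<in> G) * of_bool ((k, i) \<in> G)) \<le> K/real n * gexp V p (\<lambda>G. of_bool ((k, i) \<in> G)*1)"
   using edge[where l = l and F = "\<lambda>G. of_bool ((k, i) \<in> G)"] False by auto
  also have "\<dots> \<le> K/real n*(K/real n * gexp V p (\<lambda>_. 1))"
   by (rule mult_left_mono, rule edge) (use theta_pos in auto)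
  finally show ?thesis using False by (simp add: power2_eq_square)
 qed
 have "gexp V p (\<lambda>G. max 0 (in_deg n G i - m)) \<le> gexp V p (\<lambda>G. (\<Sum>l=1..n. \<Sum>k=1..n. of_bool ((l, i) \<in> G) * of_bool ((k, i) \<in> G))/m)"
 proof (rule gexp_mono[OF p_prob])
  fix G
  have "max 0 (x - m) \<le> x*x/m" if "0 \<le> x" for x :: real
  proof (cases "x \<le> m")
   case False
   then have "(x - m) * m \<le> x*x" using m that by (intro mult_mono) auto
   then show ?thesis using m False by (simp add: pos_le_divide_eq)
  qed (use m that in simp)
  from this[of "in_deg n G i"] show "max 0 (in_deg n G i - m) \<le> (\<Sum>l=1..n. \<Sum>k=1..n. of_bool ((l, i) \<in> G) * of_bool ((k, i) \<in> G))/m"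
   unfolding in_deg_def sum_product[symmetric] by (simp add: sum_nonneg)
 qed auto
 also have "\<dots> = gexp V p (\<lambda>G. \<Sum>l=1..n. \<Sum>k=1..n. of_bool ((l, i) \<in> G) * of_bool ((k, i) \<in> G))/m"
  by (rule gexp_divide)
 also have "\<dots> \<le> (\<Sum>l=1..n. \<Sum>k=1..n. (K/real n)\<^sup>2 + K/real n * of_bool (k = l))/m"
  unfolding gexp_sum using m by (intro divide_right_mono sum_mono two) auto
 also have "(\<Sum>l=1..n. \<Sum>k=1..n. (K/real n)\<^sup>2 + K/real n * of_bool (k = l)) = (\<Sum>l=1..n. \<Sum>k=1..n. (K/real n)\<^sup>2) + (\<Sum>l=1..n. K/real n)"
  unfolding sum.distrib by (intro arg_cong2[of _ _ _ _ "(+)"] sum.cong refl sum_of_bool_mult)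
 also have "\<dots> = K\<^sup>2 + K" using n_pos by (simp add: power2_eq_square)
 finally show ?thesis .
qed

lemma gexp_of_bool: "gexp V p (\<lambda>G. of_bool (P G)) = complex_of_real (gexp V p (\<lambda>G. of_bool (P G)))"
 unfolding gexp_of_real[symmetric] by (intro gexp_cong refl) (simp add: of_bool_def)

text \<open>The limiting law is present twice, by its weights \<open>h\<close> and as a measure
  \<open>M\<close>: averages over vertices converge to sums over \<open>T\<close>, while
  \<open>psi\<close> is defined by integrals.\<close>

locale finite_type_digraphs =
 fixes N :: "nat => nat" and w :: "nat => nat => ext_type" and p :: "nat => nat \<times> nat => real" and th b :: real
  and T :: "ext_type set" and h :: "ext_type => real" and M :: "ext_type measure"
 assumes size: "filterlim N at_top sequentially" and T_finite: "finite T" and theta_pos: "0 < th"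
  and in_T: "\<And>k i. i \<in> {1..N k} ==> w k i \<in> T"
  and T_bounds: "\<And>ty. ty \<in> T ==> 0 \<le> w_in ty \<and> w_in ty \<le> b \<and> 0 \<le> w_out ty \<and> w_out ty \<le> b \<and> abs (w_zeta ty) \<le> 1"
  and b_nonneg: "0 \<le> b"
  and edge_prob: "\<And>k i j. (i, j) \<in> vertex_pairs (N k) ==>
    p k (i, j) = min 1 (w_out (w k i)*w_in (w k j)/(th * real (N k)))"
  and freq: "\<And>ty. ty \<in> T ==> (\<lambda>k. (\<Sum>i=1..N k. of_bool (w k i = ty))/real (N k)) \<longlonglongrightarrow> h ty"
  and M: "prob_space M" "sets M = sets borel" "AE v in M. v \<in> T"
  and M_integral: "\<And>f :: ext_type => complex. f \<in> borel_measurable borel ==> (\<integral>v. f v \<partial>M) = (\<Sum>ty\<in>T. h ty *\<^sub>R f ty)"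
begin

abbreviation "Kb \<equiv> b\<^sup>2/th"
abbreviation "E k \<equiv> gexp (vertex_pairs (N k)) (p k)"
abbreviation "abar \<equiv> \<integral>v. w_in v \<partial>M"

lemma eventually_large: "EV k. x \<le> real (N k)"
proof -
 have "EV k. nat \<lceil>x\<rceil> \<le> N k" using size unfolding filterlim_at_top by blast
 then show ?thesis by eventually_elim linarith
qed

lemma eventually_bounded: "EV k. bounded_digraph (N k) (w k) (p k) th b"
 using eventually_large[of 1] eventually_large[of Kb]
proof eventually_elim
 case (elim k)
 show ?case
 proof
  show "0 < N k" using elim by simp
  show "0 < th" "0 \<le> b" by (rule theta_pos b_nonneg)+
  show "b\<^sup>2/th \<le> real (N k)" using elim by simp
  fix i assume "i \<in> {1..N k}"
  then show "0 \<le> w_in (w k i) \<and> w_in (w k i) \<le> b \<and> 0 \<le> w_out (w k i) \<and> w_out (w k i) \<le> b" "abs (w_zeta (w k i)) \<le> 1"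
   using T_bounds in_T by auto
 next
  fix i j assume ij: "(i, j) \<in> vertex_pairs (N k)"
  then have "w k i \<in> T" "w k j \<in> T" using in_T by (auto simp: vertex_pairs_def)
  then have "w_out (w k i)*w_in (w k j) \<le> b*b" using T_bounds b_nonneg by (intro mult_mono) auto
  also have "\<dots> \<le> th * real (N k)" using elim theta_pos by (simp add: power2_eq_square field_simps)
  finally have "w_out (w k i)*w_in (w k j)/(th * real (N k)) \<le> 1"
   using theta_pos elim by (simp add: divide_le_eq)
  then show "p k (i, j) = w_out (w k i)*w_in (w k j)/(th * real (N k))"
   by (simp add: edge_prob[OF ij])
 qed
qed

lemma N_tendsto: "(\<lambda>k. c/real (N k)) \<longlonglongrightarrow> 0"
 by (rule real_tendsto_divide_at_top[OF tendsto_const]) (rule filterlim_compose[OF filterlim_real_sequentially size])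

lemma sqrt_N_tendsto: "(\<lambda>k. c/sqrt (real (N k))) \<longlonglongrightarrow> 0"
 by (rule real_tendsto_divide_at_top[OF tendsto_const])
   (rule filterlim_compose[OF sqrt_at_top filterlim_compose[OF filterlim_real_sequentially size]])

lemma average_types:
 fixes f :: "ext_type => real"
 shows "(\<lambda>k. (\<Sum>i=1..N k. f (w k i))/real (N k)) \<longlonglongrightarrow> (\<Sum>ty\<in>T. h ty*f ty)"
proof -
 have "(\<Sum>i=1..N k. f (w k i))/real (N k) = (\<Sum>ty\<in>T. (\<Sum>i=1..N k. of_bool (w k i = ty))/real (N k)*f ty)" for k
 proof -
  have "(\<Sum>i=1..N k. f (w k i)) = (\<Sum>i=1..N k. \<Sum>ty\<in>T. of_bool (w k i = ty)*f ty)"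
  proof (rule sum.cong[OF refl])
   fix i assume "i \<in> {1..N k}"
   then have "w k i \<in> T" by (rule in_T)
   moreover have "(\<Sum>ty\<in>T. of_bool (w k i = ty)*f ty) = (\<Sum>ty\<in>T. if w k i = ty then f (w k i) else 0)"
    by (rule sum.cong) auto
   ultimately show "f (w k i) = (\<Sum>ty\<in>T. of_bool (w k i = ty)*f ty)" using T_finite by simp
  qed
  also have "\<dots> = (\<Sum>ty\<in>T. (\<Sum>i=1..N k. of_bool (w k i = ty))*f ty)"
   unfolding sum_distrib_right by (rule sum.swap)
  finally show ?thesis by (simp add: sum_divide_distrib)
 qed
 then show ?thesis by (simp only:) (intro tendsto_intros freq)
qed

lemma M_integral_real:
 assumes "f \<in> borel_measurable borel"
 shows "(\<integral>v. f v \<partial>M) = (\<Sum>ty\<in>T. h ty*f ty)"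
proof -
 have "complex_of_real (\<integral>v. f v \<partial>M) = (\<integral>v. complex_of_real (f v) \<partial>M)" by simp
 also have "\<dots> = (\<Sum>ty\<in>T. h ty *\<^sub>R complex_of_real (f ty))" by (rule M_integral) (use assms in measurable)
 also have "\<dots> = complex_of_real (\<Sum>ty\<in>T. h ty*f ty)" by (simp add: scaleR_conv_of_real)
 finally show ?thesis using of_real_eq_iff by blast
qed

lemma abar_eq: "abar = (\<Sum>ty\<in>T. h ty*w_in ty)"
 by (rule M_integral_real) measurable

lemma M_nonneg: "AE v in M. 0 \<le> w_in v \<and> 0 \<le> w_out v"
 using M(3) by eventually_elim (use T_bounds in auto)

lemma norm_psi: "ty \<in> T ==> norm (psi M th r s ty) \<le> 1"
 by (rule norm_psi_le[OF M(1,2) M_nonneg theta_pos]) (use T_bounds in auto)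

lemma tail_D:
 assumes "eps > 0"
 shows "\<exists>m\<ge>0. EV k. E k (\<lambda>G. deg_tail (N k) m G)/real (N k) \<le> eps"
proof (intro exI conjI)
 \<comment> \<open>The summand 1 keeps \<open>m\<close> positive even if
   \<open>b = 0\<close>.\<close>
 define m where "m = (Kb\<^sup>2 + Kb + 1)/eps"
 have m: "m > 0" using assms theta_pos by (auto simp: m_def intro!: divide_pos_pos add_nonneg_pos)
 show "0 \<le> m" using m by simp
 show "EV k. E k (\<lambda>G. deg_tail (N k) m G)/real (N k) \<le> eps"
  using eventually_bounded
 proof eventually_elim
  case (elim k)
  interpret bounded_digraph "N k" "w k" "p k" th b by fact
  have "E k (\<lambda>G. deg_tail (N k) m G) \<le> (\<Sum>i=1..N k. (Kb\<^sup>2 + Kb)/m)"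
   unfolding gexp_sum by (intro sum_mono in_degree_tail m)
  also have "\<dots> = real (N k)*((Kb\<^sup>2 + Kb)/m)" by simp
  finally have "E k (\<lambda>G. deg_tail (N k) m G)/real (N k) \<le> (Kb\<^sup>2 + Kb)/m"
   using n_pos by (simp add: field_simps)
  also have "\<dots> \<le> eps"
  proof -
   have "Kb\<^sup>2 + Kb \<le> eps * m" using assms by (simp add: m_def)
   then show ?thesis using m by (simp add: pos_divide_le_eq)
  qed
  finally show ?case .
 qed
qed

lemma clip_approx:
 assumes "eps > 0"
 shows "\<exists>L\<ge>0. \<forall>\<^sub>F k in sequentially.
  E k (\<lambda>G. \<Sum>i=1..N k. abs (rank_iter (N k) G (w k) r i - rk (clip L) (N k) G (w k) r i))/real (N k) \<le> eps"
proof -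
 have 1: "EV k. (\<forall>e\<in>vertex_pairs (N k). 0 \<le> p k e \<and> p k e \<le> 1) \<and> (\<forall>j\<in>{1..N k}. abs (w_zeta (w k j)) \<le> 1)"
  using eventually_bounded
 proof eventually_elim
  case (elim k)
  interpret bounded_digraph "N k" "w k" "p k" th b by fact
  show ?case using p_prob zeta by blast
 qed
 have 2: "\<exists>q\<ge>0. EV k. (\<Sum>i=1..N k. excess q (w_Q (w k i)))/real (N k) \<le> eps" if "eps > 0" for eps :: real
 proof (intro exI conjI)
  let ?q = "\<Sum>ty\<in>T. abs (w_Q ty)"
  show "0 \<le> ?q" by (rule sum_nonneg) simp
  have "excess ?q (w_Q (w k i)) = 0" if "i \<in> {1..N k}" for k i
   using member_le_sum[OF in_T[OF that], of "\<lambda>ty. abs (w_Q ty)"] T_finite by (simp add: excess_def)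
  then show "EV k. (\<Sum>i=1..N k. excess ?q (w_Q (w k i)))/real (N k) \<le> eps"
   using that by simp
 qed
 show ?thesis
  using clip_approximation[where F = sequentially and N = N and w = w and p = p, OF 1 2 tail_D assms, of r] by blast
qed

text \<open>The quantity for the induction on \<open>r\<close>. Type and out-degree are recorded
  together with the rank because they determine the weight with which the rank is passed on. In the
  limit the out-degree turns out to be independent of the rank given the type.\<close>

definition stat :: "nat => nat => ext_type => nat => real => complex" where
 "stat k r ty m s = (\<Sum>i=1..N k. of_bool (w k i = ty)*E k (\<lambda>G. odeg G i m*cis (s * rank_iter (N k) G (w k) r i)))/of_nat (N k)"

text \<open>The frequency may depend on the out-degree, so that the contribution with weight
  \<open>zeta/(1 + m)\<close> is covered.\<close>

definition stat_all :: "nat => nat => ext_type => (nat => real) => complex" where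
 "stat_all k r ty s = (\<Sum>i=1..N k. of_bool (w k i = ty)*E k (\<lambda>G. cis (s (out_degree G i) * rank_iter (N k) G (w k) r i)))/of_nat (N k)"

definition "tpois ty = pois (abar*w_out ty/th)"

lemma out_degree_less:
 assumes "G \<subseteq> vertex_pairs n" shows "out_degree G i < Suc n"
proof -
 have "{k. (i, k) \<in> G} \<subseteq> {1..n}" using assms by (auto simp: vertex_pairs_def)
 then have "card {k. (i, k) \<in> G} \<le> card {1..n}" by (intro card_mono) auto
 then show ?thesis by (simp add: out_degree_def)
qed

lemma stat_all_eq: "stat_all k r ty s = (\<Sum>m. stat k r ty m (s m))" "summable (\<lambda>m. stat k r ty m (s m))"
proof -
 have zero: "stat k r ty m (s m) = 0" if "m \<notin> {..N k}" for m
 proof -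
  have "E k (\<lambda>G. odeg G i m*cis (s m * rank_iter (N k) G (w k) r i)) = E k (\<lambda>_. 0)" for i
  proof (intro gexp_cong refl)
   fix G assume "G \<subseteq> vertex_pairs (N k)"
   from out_degree_less[OF this, of i] that
   show "odeg G i m*cis (s m * rank_iter (N k) G (w k) r i) = 0" by auto
  qed
  then show ?thesis by (simp add: stat_def)
 qed
 have "(\<Sum>m. stat k r ty m (s m)) = (\<Sum>m\<le>N k. stat k r ty m (s m))"
  by (rule suminf_finite) (use zero in auto)
 also have "\<dots> = stat_all k r ty s"
 proof -
  have "E k (\<lambda>G. cis (s (out_degree G i) * rank_iter (N k) G (w k) r i))
    = (\<Sum>m\<le>N k. E k (\<lambda>G. odeg G i m*cis (s m * rank_iter (N k) G (w k) r i)))" for i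
   unfolding gexp_sum[symmetric]
  proof (intro gexp_cong refl)
   fix G assume "G \<subseteq> vertex_pairs (N k)"
   then have "out_degree G i \<in> {..N k}" using out_degree_less[of G "N k" i] by simp
   moreover have "(\<Sum>m\<le>N k. odeg G i m*cis (s m * rank_iter (N k) G (w k) r i))
     = (\<Sum>m\<le>N k. if out_degree G i = m then cis (s m * rank_iter (N k) G (w k) r i) else 0)"
    by (rule sum.cong) auto
   ultimately show "cis (s (out_degree G i) * rank_iter (N k) G (w k) r i) = (\<Sum>m\<le>N k. odeg G i m*cis (s m * rank_iter (N k) G (w k) r i))"
    by simp
  qed
  then have "stat_all k r ty s = (\<Sum>i=1..N k. \<Sum>m\<le>N k. of_bool (w k i = ty)*E k (\<lambda>G. odeg G i m*cis (s m * rank_iter (N k) G (w k) r i)))/of_nat (N k)"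
   by (simp only: stat_all_def sum_distrib_left)
  also have "\<dots> = (\<Sum>m\<le>N k. \<Sum>i=1..N k. of_bool (w k i = ty)*E k (\<lambda>G. odeg G i m*cis (s m * rank_iter (N k) G (w k) r i)))/of_nat (N k)"
   by (subst sum.swap) (rule refl)
  finally show ?thesis by (simp only: stat_def sum_divide_distrib)
 qed
 finally show "stat_all k r ty s = (\<Sum>m. stat k r ty m (s m))" by simp
 show "summable (\<lambda>m. stat k r ty m (s m))"
  by (rule summable_finite[of "{..N k}"]) (use zero in auto)
qed

lemma norm_stat_le:
 assumes "bounded_digraph (N k) (w k) (p k) th b"
 shows "norm (stat k r ty m s) \<le> of_bool (m = 0) + (Kb\<^sup>2 + Kb)*inverse (real m ^ 2)"
proof -
 interpret bounded_digraph "N k" "w k" "p k" th b by fact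
 \<comment> \<open>At \<open>m = 0\<close> the inverse is 0 by convention; there the trivial bound 1
   is supplied by the first term.\<close>
 let ?B = "of_bool (m = 0) + (Kb\<^sup>2 + Kb)*inverse (real m ^ 2)"
 have B0: "0 \<le> ?B" using K_nonneg by simp
 have "norm (stat k r ty m s) \<le> (\<Sum>i=1..N k. ?B)/real (N k)"
  unfolding stat_def norm_divide norm_of_nat
 proof (intro divide_right_mono sum_norm_le)
  fix i assume i: "i \<in> {1..N k}"
  have "norm (E k (\<lambda>G. odeg G i m*cis (s * rank_iter (N k) G (w k) r i)))
    \<le> E k (\<lambda>G. norm (odeg G i m*cis (s * rank_iter (N k) G (w k) r i)))"
   by (rule norm_gexp_le[OF p_prob])
  also have "\<dots> = E k (\<lambda>G. odeg G i m)"
   by (rule gexp_cong) (auto simp: norm_mult)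
  also have "\<dots> \<le> ?B"
  proof (cases "m = 0")
   case True
   then show ?thesis by (auto intro!: gexp_le_const p_prob)
  next
   case False
   then show ?thesis using out_degree_tail[OF i, of m] by (simp add: field_simps)
  qed
  finally show "norm (of_bool (w k i = ty)*E k (\<lambda>G. odeg G i m*cis (s * rank_iter (N k) G (w k) r i))) \<le> ?B"
   using B0 by (auto simp: norm_mult)
 qed simp
 then show ?thesis using n_pos by simp
qed

text \<open>The limit is taken for each out-degree separately and summed by Tannery's theorem; the
  dominating series \<open>1/m^2\<close> stems from the second moment of the out-degree.\<close>

lemma stat_all_limit:
 assumes "\<And>m. (\<lambda>k. stat k r ty m (s m)) \<longlonglongrightarrow> l m"
 shows "(\<lambda>k. stat_all k r ty s) \<longlonglongrightarrow> (\<Sum>m. l m)" "summable l"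
proof -
 let ?B = "\<lambda>m. of_bool (m = 0) + (Kb\<^sup>2 + Kb)*inverse (real m ^ 2)"
 have "summable ?B"
  using summable_finite[of "{0::nat}" "\<lambda>m. of_bool (m = 0) :: real"]
  by (intro summable_add summable_mult inverse_power_summable) auto
 moreover have "\<forall>\<^sub>F (m, k) in at_top \<times>\<^sub>F sequentially. norm (stat k r ty m (s m)) \<le> ?B m"
  unfolding eventually_prod_filter
 proof (intro exI conjI allI impI)
  show "\<forall>\<^sub>F m in at_top. (\<lambda>_. True) (m :: nat)" by simp
  show "EV k. bounded_digraph (N k) (w k) (p k) th b" by (rule eventually_bounded)
 qed (simp only: prod.case, rule norm_stat_le)
 ultimately have "summable (\<lambda>n. norm (l n)) \<and> ((\<lambda>k. \<Sum>m. stat k r ty m (s m)) \<longlonglongrightarrow> suminf l)"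
  using tannerys_theorem[of "\<lambda>m k. stat k r ty m (s m)" l sequentially ?B] assms by auto
 then show "(\<lambda>k. stat_all k r ty s) \<longlonglongrightarrow> (\<Sum>m. l m)" "summable l"
  by (auto simp: stat_all_eq(1) intro: summable_norm_cancel)
qed

lemma degree_limit:
 assumes "ty \<in> T"
 shows "(\<lambda>k. (\<Sum>i=1..N k. of_bool (w k i = ty)*E k (\<lambda>G. odeg G i m))/real (N k)) \<longlonglongrightarrow> h ty * tpois ty m"
proof -
 let ?l = "\<lambda>k. w_out ty/th*((\<Sum>j=1..N k. w_in (w k j))/real (N k))"
 let ?f = "\<lambda>k. (\<Sum>i=1..N k. of_bool (w k i = ty))/real (N k)"
 have cont: "isCont (\<lambda>l. pois l m) l" for l by (rule DERIV_isCont[OF pois_deriv])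
 have "(\<lambda>k. ?f k*pois (?l k) m) \<longlonglongrightarrow> h ty * tpois ty m"
 proof (intro tendsto_mult freq assms)
  have "?l \<longlonglongrightarrow> w_out ty/th*(\<Sum>ty\<in>T. h ty*w_in ty)" by (intro tendsto_intros average_types)
  also have "w_out ty/th*(\<Sum>ty\<in>T. h ty*w_in ty) = abar*w_out ty/th" by (simp add: abar_eq)
  finally show "(\<lambda>k. pois (?l k) m) \<longlonglongrightarrow> tpois ty m"
   unfolding tpois_def by (rule isCont_tendsto_compose[OF cont])
 qed
 moreover have "(\<lambda>k. (\<Sum>i=1..N k. of_bool (w k i = ty)*E k (\<lambda>G. odeg G i m))/real (N k) - ?f k*pois (?l k) m) \<longlonglongrightarrow> 0"
 proof (rule Lim_null_comparison[OF _ N_tendsto])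
  show "EV k. norm ((\<Sum>i=1..N k. of_bool (w k i = ty)*E k (\<lambda>G. odeg G i m))/real (N k) - ?f k*pois (?l k) m)
    \<le> (2*Kb\<^sup>2 + Kb)/real (N k)"
   using eventually_bounded
  proof eventually_elim
   case (elim k)
   interpret bounded_digraph "N k" "w k" "p k" th b by fact
   have "(\<Sum>i=1..N k. of_bool (w k i = ty)*E k (\<lambda>G. odeg G i m))/real (N k) - ?f k*pois (?l k) m
     = (\<Sum>i=1..N k. of_bool (w k i = ty)*(E k (\<lambda>G. odeg G i m) - pois (?l k) m))/real (N k)"
    by (simp only: right_diff_distrib sum_subtractf diff_divide_distrib sum_distrib_right times_divide_eq_left)
   also have "norm \<dots> \<le> (\<Sum>i=1..N k. (2*Kb\<^sup>2 + Kb)/real (N k))/real (N k)"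
    unfolding norm_divide norm_of_nat
   proof (intro divide_right_mono sum_norm_le)
    fix i assume i: "i \<in> {1..N k}"
    show "norm (of_bool (w k i = ty)*(E k (\<lambda>G. odeg G i m) - pois (?l k) m)) \<le> (2*Kb\<^sup>2 + Kb)/real (N k)"
     using out_degree_poisson[OF i, of m] K_nonneg by auto
   qed simp
   also have "\<dots> = (2*Kb\<^sup>2 + Kb)/real (N k)" using n_pos by simp
   finally show ?case .
  qed
 qed
 ultimately show ?thesis using tendsto_add by fastforce
qed

definition "Glim r s = (\<integral>v. w_out v *\<^sub>R offspring M th (psi M th r) s v \<partial>M)"

lemma Glim_eq: "Glim r s = (\<Sum>ty\<in>T. h ty *\<^sub>R (w_out ty *\<^sub>R offspring M th (psi M th r) s ty))"
 unfolding Glim_def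
proof (rule M_integral)
 have "(\<lambda>v. offspring M th (psi M th r) s v) \<in> borel_measurable borel"
  using measurable_compose[OF measurable_Pair1' offspring_measurable[OF psi_measurable[OF M(1,2)]], of s] by simp
 then show "(\<lambda>v. w_out v *\<^sub>R offspring M th (psi M th r) s v) \<in> borel_measurable borel" by measurable
qed

lemma Re_Glim: "Re (Glim r s) \<le> 0"
proof -
 have h: "0 \<le> h ty" if "ty \<in> T" for ty
  by (rule LIMSEQ_le_const[OF freq[OF that]]) (auto intro!: sum_nonneg divide_nonneg_nonneg exI[of _ 0])
 have "Re (offspring M th (psi M th r) s ty) \<le> 0" if "ty \<in> T" for ty
  by (rule offspring_bounds(3)[OF M(1,2) M_nonneg theta_pos]) (use that T_bounds norm_psi in auto)
 then show ?thesis unfolding Glim_eq Re_sum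
  by (intro sum_nonpos) (use h T_bounds in "auto intro!: mult_nonneg_nonpos")
qed

text \<open>At frequency 0 \<open>stat_all\<close> is the proportion of vertices of the given type,
  which supplies the \<open>- 1\<close> in \<open>Gam\<close>.\<close>

lemma expected_Gam: "E k (Gam (\<lambda>x. x) (N k) (w k) r s)
  = (\<Sum>ty\<in>T. w_out ty *\<^sub>R (stat_all k r ty (\<lambda>m. s*(w_zeta ty/(1 + real m))) - stat_all k r ty (\<lambda>_. 0)))"
proof -
 let ?c = "\<lambda>i ty. E k (\<lambda>G. cis (s*(w_zeta ty/(1 + real (out_degree G i))) * rank_iter (N k) G (w k) r i)) - 1"
 have "E k (Gam (\<lambda>x. x) (N k) (w k) r s) = (\<Sum>i=1..N k. w_out (w k i) *\<^sub>R ?c i (w k i)) /\<^sub>R real (N k)"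
  unfolding Gam_def gexp_scaleR gexp_sum gexp_diff by (simp add: mult.assoc)
 also have "(\<Sum>i=1..N k. w_out (w k i) *\<^sub>R ?c i (w k i)) = (\<Sum>i=1..N k. \<Sum>ty\<in>T. w_out ty *\<^sub>R (of_bool (w k i = ty)*?c i ty))"
 proof (rule sum.cong[OF refl])
  fix i assume "i \<in> {1..N k}"
  then have "w k i \<in> T" by (rule in_T)
  moreover have "(\<Sum>ty\<in>T. w_out ty *\<^sub>R (of_bool (w k i = ty)*?c i ty)) = (\<Sum>ty\<in>T. if w k i = ty then w_out (w k i) *\<^sub>R ?c i (w k i) else 0)"
   by (rule sum.cong) auto
  ultimately show "w_out (w k i) *\<^sub>R ?c i (w k i) = (\<Sum>ty\<in>T. w_out ty *\<^sub>R (of_bool (w k i = ty)*?c i ty))"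
   using T_finite by simp
 qed
 also have "\<dots> = (\<Sum>ty\<in>T. w_out ty *\<^sub>R (\<Sum>i=1..N k. of_bool (w k i = ty)*?c i ty))"
  unfolding scaleR_sum_right by (rule sum.swap)
 also have "\<dots> /\<^sub>R real (N k) = (\<Sum>ty\<in>T. w_out ty *\<^sub>R ((\<Sum>i=1..N k. of_bool (w k i = ty)*?c i ty)/of_nat (N k)))"
 proof -
  have "(\<Sum>ty\<in>T. a ty *\<^sub>R X ty) /\<^sub>R real n = (\<Sum>ty\<in>T. a ty *\<^sub>R (X ty/of_nat n))" for a n and X :: "ext_type => complex"
   unfolding scaleR_sum_right by (rule sum.cong[OF refl]) (simp add: scaleR_conv_of_real divide_inverse)
  then show ?thesis .
 qed
 also have "\<dots> = (\<Sum>ty\<in>T. w_out ty *\<^sub>R (stat_all k r ty (\<lambda>m. s*(w_zeta ty/(1 + real m))) - stat_all k r ty (\<lambda>_. 0)))"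
 proof (rule sum.cong[OF refl])
  fix ty
  have "stat_all k r ty (\<lambda>_. 0) = (\<Sum>i=1..N k. of_bool (w k i = ty)*1)/of_nat (N k)"
   unfolding stat_all_def mult_zero_left cis_zero by (simp only: gexp_const[OF finite_vertex_pairs])
  then show "w_out ty *\<^sub>R ((\<Sum>i=1..N k. of_bool (w k i = ty)*?c i ty)/of_nat (N k))
   = w_out ty *\<^sub>R (stat_all k r ty (\<lambda>m. s*(w_zeta ty/(1 + real m))) - stat_all k r ty (\<lambda>_. 0))"
   unfolding stat_all_def by (simp only: right_diff_distrib sum_subtractf diff_divide_distrib)
 qed
 finally show ?thesis .
qed

lemma Gam_limit:
 assumes IH: "\<And>ty m s. ty \<in> T ==> (\<lambda>k. stat k r ty m s) \<longlonglongrightarrow> (h ty * tpois ty m) *\<^sub>R psi M th r s ty"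
 shows "(\<lambda>k. E k (Gam (\<lambda>x. x) (N k) (w k) r s)) \<longlonglongrightarrow> Glim r s"
proof -
 let ?A = "\<Sum>ty\<in>T. w_out ty *\<^sub>R ((\<Sum>m. (h ty * tpois ty m) *\<^sub>R psi M th r (s*(w_zeta ty/(1 + real m))) ty) - (\<Sum>m. (h ty * tpois ty m) *\<^sub>R psi M th r 0 ty))"
 have "(\<lambda>k. E k (Gam (\<lambda>x. x) (N k) (w k) r s)) \<longlonglongrightarrow> ?A"
  unfolding expected_Gam by (intro tendsto_intros stat_all_limit IH)
 also have "?A = Glim r s"
  unfolding Glim_eq
 proof (rule sum.cong[OF refl])
  fix ty assume ty: "ty \<in> T"
  let ?a = "\<lambda>m. (h ty * tpois ty m) *\<^sub>R psi M th r (s*(w_zeta ty/(1 + real m))) ty" and ?b = "\<lambda>m. (h ty * tpois ty m) *\<^sub>R psi M th r 0 ty"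
  have "summable ?a" by (rule stat_all_limit(2)[where s = "\<lambda>m. s*(w_zeta ty/(1 + real m))"]) (rule IH[OF ty])
  moreover have "summable ?b" by (rule stat_all_limit(2)[where s = "\<lambda>_. 0"]) (rule IH[OF ty])
  ultimately have "(\<Sum>m. ?a m) - (\<Sum>m. ?b m) = (\<Sum>m. ?a m - ?b m)" by (rule suminf_diff)
  also have "\<dots> = (\<Sum>m. h ty *\<^sub>R (tpois ty m *\<^sub>R (psi M th r (s*(w_zeta ty/(1 + real m))) ty - 1)))"
   by (simp add: psi_0 scaleR_diff_right)
  also have "\<dots> = h ty *\<^sub>R offspring M th (psi M th r) s ty"
   unfolding offspring_def tpois_def
   by (rule suminf_scaleR_right[symmetric])
     (rule offspring_bounds(1)[OF M(1,2) M_nonneg theta_pos], use ty T_bounds norm_psi in auto)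
  finally show "w_out ty *\<^sub>R ((\<Sum>m. ?a m) - (\<Sum>m. ?b m)) = h ty *\<^sub>R (w_out ty *\<^sub>R offspring M th (psi M th r) s ty)"
   by simp
 qed
 finally show ?thesis .
qed

lemma Gam_clip_diff:
 assumes "bounded_digraph (N k) (w k) (p k) th b"
 shows "norm (E k (Gam (clip L) (N k) (w k) r s) - E k (Gam (\<lambda>x. x) (N k) (w k) r s))
  \<le> b*abs s*(E k (\<lambda>G. \<Sum>i=1..N k. abs (rank_iter (N k) G (w k) r i - rk (clip L) (N k) G (w k) r i))/real (N k))"
proof -
 interpret bounded_digraph "N k" "w k" "p k" th b by fact
 have "norm (E k (Gam (clip L) (N k) (w k) r s) - E k (Gam (\<lambda>x. x) (N k) (w k) r s))
  \<le> E k (\<lambda>G. b*abs s/real (N k)*(\<Sum>i=1..N k. abs (rank_iter (N k) G (w k) r i - rk (clip L) (N k) G (w k) r i)))"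
 proof (rule gexp_diff_le[OF p_prob])
  fix G assume G: "G \<subseteq> vertex_pairs (N k)"
  have "norm (Gam (\<lambda>x. x) (N k) (w k) r s G - Gam (clip L) (N k) (w k) r s G)
   \<le> b*(\<Sum>j=1..N k. if out_degree G j = out_degree G j then abs s*abs (rank_iter (N k) G (w k) r j - rk (clip L) (N k) G (w k) r j) else 2)/real (N k)"
   by (rule Gam_diff[OF G G])
  then show "norm (Gam (clip L) (N k) (w k) r s G - Gam (\<lambda>x. x) (N k) (w k) r s G)
   \<le> b*abs s/real (N k)*(\<Sum>i=1..N k. abs (rank_iter (N k) G (w k) r i - rk (clip L) (N k) G (w k) r i))"
   by (subst norm_minus_commute) (simp add: sum_distrib_left[symmetric] mult.assoc)
 qed auto
 then show ?thesis by (simp add: gexp_cmult gexp_divide)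
qed

text \<open>The clipping error that reaches an individual vertex through its in-edges is not
  controlled, but its average over the vertices is at most \<open>\<delta>\<close> by the column
  sums.\<close>

lemma leave_one_out_average:
 fixes r :: nat and s :: real
 assumes k: "bounded_digraph (N k) (w k) (p k) th b" and L: "0 \<le> L" and ty: "ty \<in> T"
 defines "\<delta> \<equiv> E k (\<lambda>G. \<Sum>i=1..N k. abs (rank_iter (N k) G (w k) r i - rk (clip L) (N k) G (w k) r i))/real (N k)"
 shows "norm (stat k (Suc r) ty m s
   - ((\<Sum>i=1..N k. of_bool (w k i = ty)*E k (\<lambda>G. odeg G i m))/real (N k)) *\<^sub>R psi M th (Suc r) s ty)
  \<le> (abs s + b/th*(b*abs s))*\<delta> + b/th * norm (E k (Gam (\<lambda>x. x) (N k) (w k) r s) - Glim r s)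
   + b/th*(2*(b*(abs s*(2*L * real r) + 2)) * sqrt Kb/sqrt (real (N k)))
   + (abs s*(L * real r*(2 + real r)*Kb\<^sup>2) + 4*exp 2*Kb\<^sup>2 + b/th*(b*(4 + abs s*(2*L * real r*(1 + Kb)) + 2*Kb)))/real (N k)"
  (is "_ \<le> _ + _ + _ + ?C/_")
proof -
 let ?A = "\<lambda>x. x"
 interpret bounded_digraph "N k" "w k" "p k" th b by fact
 let ?n = "N k"
 let ?P = "\<lambda>i. E k (\<lambda>G. odeg G i m)"
 let ?S = "\<lambda>i. E k (\<lambda>G. odeg G i m*cis (s * rank_iter ?n G (w k) (Suc r) i))"
 let ?\<psi> = "psi M th (Suc r) s ty"
 define \<gamma> where "\<gamma> = E k (\<lambda>G. norm (Gam (clip L) ?n (w k) r s G - Glim r s))"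
 define e where "e i = E k (\<lambda>G. \<Sum>j=1..?n. abs (amat G (w k) i j)*abs (rank_iter ?n G (w k) r j - rk (clip L) ?n G (w k) r j))" for i
 have e0: "0 \<le> e i" for i unfolding e_def by (intro gexp_nonneg p_prob sum_nonneg) auto
 have \<gamma>0: "0 \<le> \<gamma>" unfolding \<gamma>_def by (intro gexp_nonneg p_prob) auto
 have C0: "0 \<le> ?C" using L theta_pos b_nonneg by (intro add_nonneg_nonneg mult_nonneg_nonneg) auto
 have one: "norm (of_bool (w k i = ty)*(?S i - of_real (?P i)*?\<psi>)) \<le> abs s*e i + b/th*\<gamma> + ?C/real ?n" if i: "i \<in> {1..?n}" for i
 proof (cases "w k i = ty")
  case True
  have "?\<psi> = cis (s*w_Q (w k i))*exp ((w_in (w k i)/th) *\<^sub>R Glim r s)"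
   by (simp add: True Glim_def)
  then show ?thesis
   using leave_one_out[OF i L Re_Glim[of r s], where m = m and s = s and r = r] True by (simp only: e_def \<gamma>_def of_bool_eq mult_1_left simp_thms)
 next
  case False
  then show ?thesis using e0[of i] \<gamma>0 C0 b_nonneg theta_pos by (auto intro!: add_nonneg_nonneg mult_nonneg_nonneg divide_nonneg_nonneg)
 qed
 have sum_e: "(\<Sum>i=1..?n. e i) \<le> real ?n*\<delta>"
 proof -
  have "(\<Sum>i=1..?n. e i) = E k (\<lambda>G. \<Sum>i=1..?n. \<Sum>j=1..?n. abs (amat G (w k) i j)*abs (rank_iter ?n G (w k) r j - rk (clip L) ?n G (w k) r j))"
   unfolding e_def by (rule gexp_sum[symmetric])
  also have "\<dots> \<le> E k (\<lambda>G. 1*(\<Sum>j=1..?n. abs (rank_iter ?n G (w k) r j - rk (clip L) ?n G (w k) r j)))"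
   by (rule gexp_mono[OF p_prob], simp, rule amat_contract) (use zeta in auto)
  finally show ?thesis using n_pos by (simp add: \<delta>_def)
 qed
 \<comment> \<open>Concentration holds for the clipped \<open>Gam\<close> only, whereas the limit of
   the mean is known for the unclipped one; the clipping error thus enters a second time.\<close>
 have \<gamma>: "\<gamma> \<le> 2*(b*(abs s*(2*L * real r) + 2)) * sqrt Kb/sqrt (real ?n) + b*abs s*\<delta> + norm (E k (Gam ?A ?n (w k) r s) - Glim r s)"
 proof -
  have "\<gamma> \<le> E k (\<lambda>G. norm (Gam (clip L) ?n (w k) r s G - E k (Gam (clip L) ?n (w k) r s))
    + (norm (E k (Gam (clip L) ?n (w k) r s) - E k (Gam ?A ?n (w k) r s)) + norm (E k (Gam ?A ?n (w k) r s) - Glim r s)))"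
   unfolding \<gamma>_def
  proof (rule gexp_mono[OF p_prob])
   fix G
   show "norm (Gam (clip L) ?n (w k) r s G - Glim r s) \<le> norm (Gam (clip L) ?n (w k) r s G - E k (Gam (clip L) ?n (w k) r s))
    + (norm (E k (Gam (clip L) ?n (w k) r s) - E k (Gam ?A ?n (w k) r s)) + norm (E k (Gam ?A ?n (w k) r s) - Glim r s))"
    using norm_triangle_ineq[of "Gam (clip L) ?n (w k) r s G - E k (Gam (clip L) ?n (w k) r s)" "E k (Gam (clip L) ?n (w k) r s) - Glim r s"]
     norm_triangle_ineq[of "E k (Gam (clip L) ?n (w k) r s) - E k (Gam ?A ?n (w k) r s)" "E k (Gam ?A ?n (w k) r s) - Glim r s"]
    by simp
  qed auto
  also have "\<dots> = E k (\<lambda>G. norm (Gam (clip L) ?n (w k) r s G - E k (Gam (clip L) ?n (w k) r s)))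
    + (norm (E k (Gam (clip L) ?n (w k) r s) - E k (Gam ?A ?n (w k) r s)) + norm (E k (Gam ?A ?n (w k) r s) - Glim r s))"
   unfolding gexp_add by simp
  finally show ?thesis
   using Gam_concentration[OF L, of r s] Gam_clip_diff[OF k, of L r s, folded \<delta>_def] by linarith
 qed
 have eq: "stat k (Suc r) ty m s - ((\<Sum>i=1..?n. of_bool (w k i = ty)*?P i)/real ?n) *\<^sub>R ?\<psi>
   = (\<Sum>i=1..?n. of_bool (w k i = ty)*(?S i - of_real (?P i)*?\<psi>))/of_nat ?n"
 proof -
  have "((\<Sum>i=1..?n. of_bool (w k i = ty)*?P i)/real ?n) *\<^sub>R ?\<psi> = (\<Sum>i=1..?n. of_bool (w k i = ty)*(of_real (?P i)*?\<psi>))/of_nat ?n"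
  proof -
   have "of_real (of_bool (w k i = ty)*?P i)*?\<psi> = of_bool (w k i = ty)*(of_real (?P i)*?\<psi>)" for i by simp
   then show ?thesis
    unfolding scaleR_conv_of_real of_real_divide of_real_sum of_real_of_nat_eq times_divide_eq_left sum_distrib_right
    by (simp only:)
  qed
  then show ?thesis by (simp only: stat_def right_diff_distrib sum_subtractf diff_divide_distrib)
 qed
 have "norm (stat k (Suc r) ty m s - ((\<Sum>i=1..?n. of_bool (w k i = ty)*?P i)/real ?n) *\<^sub>R ?\<psi>)
   \<le> (\<Sum>i=1..?n. abs s*e i + b/th*\<gamma> + ?C/real ?n)/real ?n"
  unfolding eq norm_divide norm_of_nat by (intro divide_right_mono sum_norm_le one) auto
 also have "\<dots> = (abs s*(\<Sum>i=1..?n. e i) + real ?n*(b/th*\<gamma> + ?C/real ?n))/real ?n"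
  by (simp only: add.assoc sum.distrib[of "\<lambda>i. abs s*e i"] sum_distrib_left[symmetric] sum_constant card_atLeastAtMost) simp
 also have "\<dots> \<le> (abs s*(real ?n*\<delta>) + real ?n*(b/th*\<gamma> + ?C/real ?n))/real ?n"
  by (intro divide_right_mono add_right_mono mult_left_mono sum_e) auto
 also have "\<dots> = abs s*\<delta> + b/th*\<gamma> + ?C/real ?n"
 proof -
  have "(x*(y*d) + y*z)/y = x*d + z" if "y \<noteq> 0" for x y z d :: real using that by (simp add: field_simps)
  then show ?thesis using n_pos by (simp only: of_nat_eq_0_iff less_not_refl2 add.assoc not_False_eq_True)
 qed
 also have "\<dots> \<le> abs s*\<delta> + b/th*(2*(b*(abs s*(2*L * real r) + 2)) * sqrt Kb/sqrt (real ?n) + b*abs s*\<delta> + norm (E k (Gam ?A ?n (w k) r s) - Glim r s)) + ?C/real ?n"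
  by (intro add_right_mono add_left_mono mult_left_mono \<gamma>) (use b_nonneg theta_pos in auto)
 finally show ?thesis by (simp only: distrib_left distrib_right mult.assoc add.assoc add.commute add.left_commute)
qed

lemma stat_limit: "ty \<in> T ==> (\<lambda>k. stat k r ty m s) \<longlonglongrightarrow> (h ty * tpois ty m) *\<^sub>R psi M th r s ty"
proof (induction r arbitrary: ty m s)
 case 0
 let ?P = "\<lambda>k. (\<Sum>i=1..N k. of_bool (w k i = ty)*E k (\<lambda>G. odeg G i m))/real (N k)"
 have "stat k 0 ty m s = ?P k *\<^sub>R cis (s*w_Q ty)" for k
 proof -
  have "of_bool (w k i = ty)*E k (\<lambda>G. odeg G i m*cis (s*w_Q (w k i)))
    = of_real (of_bool (w k i = ty)*E k (\<lambda>G. odeg G i m))*cis (s*w_Q ty)" for i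
   by (cases "w k i = ty") (simp_all add: gexp_cmult_right gexp_of_bool)
  then show ?thesis
   unfolding stat_def rk.simps scaleR_conv_of_real of_real_divide of_real_sum of_real_of_nat_eq times_divide_eq_left sum_distrib_right
   by (simp only:)
 qed
 then show ?case by (simp only: psi.simps) (intro tendsto_intros degree_limit 0)
next
 case (Suc r)
 let ?P = "\<lambda>k. (\<Sum>i=1..N k. of_bool (w k i = ty)*E k (\<lambda>G. odeg G i m))/real (N k)"
 have "(\<lambda>k. stat k (Suc r) ty m s - ?P k *\<^sub>R psi M th (Suc r) s ty) \<longlonglongrightarrow> 0"
  unfolding tendsto_iff
 proof (intro allI impI)
  fix eps :: real assume eps: "0 < eps"
  \<comment> \<open>The coefficient of the clipping error does not involve \<open>L\<close>. So
    \<open>L\<close> is fixed first to make this error small, and all other terms vanish as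
    \<open>k\<close> grows with that \<open>L\<close>; the induction hypothesis enters through
    \<open>Gam_limit\<close>.\<close>
  define A where "A = abs s + b/th*(b*abs s)"
  have A: "0 \<le> A" using b_nonneg theta_pos by (auto simp: A_def)
  have "eps/(2*(A + 1)) > 0" using eps A by simp
  from clip_approx[OF this, of r] obtain L where L: "0 \<le> L" and small: "\<forall>\<^sub>F k in sequentially.
    E k (\<lambda>G. \<Sum>i=1..N k. abs (rank_iter (N k) G (w k) r i - rk (clip L) (N k) G (w k) r i))/real (N k) \<le> eps/(2*(A + 1))" by blast
  let ?rest = "\<lambda>k. b/th * norm (E k (Gam (\<lambda>x. x) (N k) (w k) r s) - Glim r s)
   + b/th*(2*(b*(abs s*(2*L * real r) + 2)) * sqrt Kb/sqrt (real (N k)))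
   + (abs s*(L * real r*(2 + real r)*Kb\<^sup>2) + 4*exp 2*Kb\<^sup>2 + b/th*(b*(4 + abs s*(2*L * real r*(1 + Kb)) + 2*Kb)))/real (N k)"
  have "?rest \<longlonglongrightarrow> b/th * norm (Glim r s - Glim r s) + b/th*0 + 0"
   by (intro tendsto_add tendsto_mult tendsto_const tendsto_norm tendsto_diff Gam_limit N_tendsto sqrt_N_tendsto Suc.IH)
  then have "?rest \<longlonglongrightarrow> 0" by simp
  then have "EV k. ?rest k < eps/2"
   by (rule order_tendstoD) (use eps in simp)
  then show "EV k. dist (stat k (Suc r) ty m s - ?P k *\<^sub>R psi M th (Suc r) s ty) 0 < eps"
   using small eventually_bounded
  proof eventually_elim
   case (elim k)
   have "norm (stat k (Suc r) ty m s - ?P k *\<^sub>R psi M th (Suc r) s ty)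
     \<le> A*(E k (\<lambda>G. \<Sum>i=1..N k. abs (rank_iter (N k) G (w k) r i - rk (clip L) (N k) G (w k) r i))/real (N k)) + ?rest k"
    using leave_one_out_average[OF elim(3) L Suc.prems, of r m s] unfolding A_def by linarith
   also have "\<dots> < A*(eps/(2*(A + 1))) + eps/2"
    using elim A by (intro add_le_less_mono mult_left_mono) auto
   also have "A*(eps/(2*(A + 1))) \<le> eps/2" using A eps by (simp add: field_simps)
   finally show ?case by simp
  qed
 qed
 moreover have "(\<lambda>k. ?P k *\<^sub>R psi M th (Suc r) s ty) \<longlonglongrightarrow> (h ty * tpois ty m) *\<^sub>R psi M th (Suc r) s ty"
  by (intro tendsto_intros degree_limit Suc.prems)
 ultimately show ?case using tendsto_add by fastforce
qed

theorem rank_iter_char_limit: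
 "(\<lambda>k. E k (\<lambda>G. (\<Sum>i=1..N k. cis (s * rank_iter (N k) G (w k) r i))/of_nat (N k))) \<longlonglongrightarrow> (\<integral>v. psi M th r s v \<partial>M)"
proof -
 let ?A = "\<Sum>ty\<in>T. \<Sum>m. (h ty * tpois ty m) *\<^sub>R psi M th r s ty"
 have eq: "E k (\<lambda>G. (\<Sum>i=1..N k. cis (s * rank_iter (N k) G (w k) r i))/of_nat (N k)) = (\<Sum>ty\<in>T. stat_all k r ty (\<lambda>_. s))" for k
 proof -
  have "(\<Sum>i=1..N k. E k (\<lambda>G. cis (s * rank_iter (N k) G (w k) r i)))
    = (\<Sum>i=1..N k. \<Sum>ty\<in>T. of_bool (w k i = ty)*E k (\<lambda>G. cis (s * rank_iter (N k) G (w k) r i)))"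
  proof (rule sum.cong[OF refl])
   fix i assume "i \<in> {1..N k}"
   then have "w k i \<in> T" by (rule in_T)
   then have "(\<Sum>ty\<in>T. of_bool (w k i = ty)) = (1::complex)"
    using T_finite by (simp add: of_bool_def)
   then show "E k (\<lambda>G. cis (s * rank_iter (N k) G (w k) r i)) = (\<Sum>ty\<in>T. of_bool (w k i = ty)*E k (\<lambda>G. cis (s * rank_iter (N k) G (w k) r i)))"
    unfolding sum_distrib_right[symmetric] by simp
  qed
  also have "\<dots> = (\<Sum>ty\<in>T. \<Sum>i=1..N k. of_bool (w k i = ty)*E k (\<lambda>G. cis (s * rank_iter (N k) G (w k) r i)))"
   by (rule sum.swap)
  finally show ?thesis unfolding gexp_divide gexp_sum stat_all_def by (simp only: sum_divide_distrib)
 qed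
 have "(\<lambda>k. \<Sum>ty\<in>T. stat_all k r ty (\<lambda>_. s)) \<longlonglongrightarrow> ?A"
  by (intro tendsto_sum stat_all_limit stat_limit)
 also have "?A = (\<Sum>ty\<in>T. h ty *\<^sub>R psi M th r s ty)"
 proof (rule sum.cong[OF refl])
  fix ty
  have "(\<lambda>m. tpois ty m *\<^sub>R (h ty *\<^sub>R psi M th r s ty)) sums (1 *\<^sub>R (h ty *\<^sub>R psi M th r s ty))"
   unfolding tpois_def by (rule sums_scaleR_left[OF pois_sums])
  then show "(\<Sum>m. (h ty * tpois ty m) *\<^sub>R psi M th r s ty) = h ty *\<^sub>R psi M th r s ty"
   by (simp add: sums_iff mult.commute)
 qed
 also have "\<dots> = (\<integral>v. psi M th r s v \<partial>M)"
 proof (rule M_integral[symmetric])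
  show "psi M th r s \<in> borel_measurable borel"
   using measurable_compose[OF measurable_Pair1' psi_measurable[OF M(1,2)], of s] by simp
 qed
 finally show ?thesis unfolding eq .
qed

end

section \<open>The weighted branching tree\<close>

text \<open>Nodes are reversed lists: the last entry names the child of the root, and the entries
  before it are the address inside the subtree of that child.\<close>

definition asm :: "'a \<times> (nat => nat list => 'a) => nat list => 'a" where
 "asm x l = (if l = [] then fst x else snd x (last l) (butlast l))"

lemma asm_Nil [simp]: "asm x [] = fst x" and asm_snoc [simp]: "asm x (i @ [j]) = snd x j i"
 by (simp_all add: asm_def)

lemma asm_measurable [measurable]:
 "asm \<in> \<nu> \<Otimes>\<^sub>M PiM UNIV (\<lambda>_. PiM UNIV (\<lambda>_. \<nu>)) \<rightarrow>\<^sub>M PiM UNIV (\<lambda>_. \<nu>)"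
proof (rule measurable_PiM_single')
 fix l :: "nat list"
 have "(\<lambda>x. snd x (last l)) \<in> \<nu> \<Otimes>\<^sub>M PiM UNIV (\<lambda>_. PiM UNIV (\<lambda>_. \<nu>)) \<rightarrow>\<^sub>M PiM UNIV (\<lambda>_. \<nu>)"
  by (rule measurable_compose[OF measurable_snd]) (rule measurable_component_singleton, simp)
 then have "(\<lambda>x. snd x (last l) (butlast l)) \<in> \<nu> \<Otimes>\<^sub>M PiM UNIV (\<lambda>_. PiM UNIV (\<lambda>_. \<nu>)) \<rightarrow>\<^sub>M \<nu>"
  by (rule measurable_compose) (rule measurable_component_singleton, simp)
 then show "(\<lambda>x. asm x l) \<in> \<nu> \<Otimes>\<^sub>M PiM UNIV (\<lambda>_. PiM UNIV (\<lambda>_. \<nu>)) \<rightarrow>\<^sub>M \<nu>"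
  by (cases "l = []") (simp_all add: asm_def)
qed (auto simp: asm_def space_pair_measure space_PiM PiE_iff)

text \<open>An i.i.d. family indexed by the tree consists of the root and of i.i.d. families indexed by
 the subtrees of the children of the root.\<close>

lemma distr_asm:
 assumes \<nu>: "prob_space \<nu>"
 shows "distr (\<nu> \<Otimes>\<^sub>M PiM UNIV (\<lambda>_. PiM UNIV (\<lambda>_. \<nu>))) (PiM UNIV (\<lambda>_. \<nu>)) asm = PiM UNIV (\<lambda>_. \<nu>)"
proof (rule measure_eqI_PiM_infinite[symmetric, OF refl])
 let ?B = "space \<nu>"
 let ?A = "PiM (UNIV :: nat list set) (\<lambda>_. \<nu>)"
 let ?P = "PiM (UNIV :: nat set) (\<lambda>_. ?A)"
 interpret \<nu>: prob_space \<nu> by fact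
 interpret A: prob_space ?A by (intro prob_space_PiM \<nu>)
 interpret P: prob_space ?P by (intro prob_space_PiM A.prob_space_axioms)
 show "finite_measure ?A" by unfold_locales
 fix B and J :: "nat list set"
 assume J: "finite J" and B: "\<And>l. l \<in> J ==> B l \<in> sets \<nu>"
 let ?X = "prod_emb UNIV (\<lambda>_. \<nu>) J (Pi\<^sub>E J B)"
 \<comment> \<open>\<open>?L\<close> consists of the children of the root whose subtrees meet
   \<open>J\<close>, and \<open>?I j\<close> of the addresses of \<open>J\<close> inside the subtree
   of \<open>j\<close>. Only these coordinates are constrained, so the preimage of the cylinder is
   again a product.\<close>
 let ?L = "last ` (J - {[]})"
 let ?I = "\<lambda>j. {i. i @ [j] \<in> J}"
 let ?C = "\<lambda>j. prod_emb UNIV (\<lambda>_. \<nu>) (?I j) (Pi\<^sub>E (?I j) (\<lambda>i. B (i @ [j])))"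
 have finI: "finite (?I j)" for j
  by (rule finite_subset[of _ "butlast ` J"]) (use J in "force simp: image_iff")+
 have X: "?X \<in> sets ?A" using J B by (intro sets_PiM_I) auto
 have C: "?C j \<in> sets ?A" for j using finI B by (intro sets_PiM_I) auto
 have memX: "f \<in> ?X \<longleftrightarrow> f \<in> space ?A \<and> (\<forall>l\<in>J. f l \<in> B l)" for f
  by (auto simp: prod_emb_def space_PiM PiE_iff)
 have memC: "f \<in> ?C j \<longleftrightarrow> f \<in> space ?A \<and> (\<forall>i. i @ [j] \<in> J \<longrightarrow> f i \<in> B (i @ [j]))" for f j
  by (auto simp: prod_emb_def space_PiM PiE_iff)
 have snocJ: "(\<exists>i. l = i @ [last l]) \<and> last l \<in> ?L" if "l \<in> J" "l \<noteq> []" for l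
  using that append_butlast_last_id by (metis DiffI imageI singletonD)
 have eq: "asm -` ?X \<inter> space (\<nu> \<Otimes>\<^sub>M ?P) = (if [] \<in> J then B [] else ?B) \<times> prod_emb UNIV (\<lambda>_. ?A) ?L (Pi\<^sub>E ?L ?C)"
 proof (intro set_eqI iffI)
  fix x assume x: "x \<in> asm -` ?X \<inter> space (\<nu> \<Otimes>\<^sub>M ?P)"
  then have sp: "fst x \<in> ?B" "\<And>j. snd x j \<in> space ?A" and B': "\<And>l. l \<in> J ==> asm x l \<in> B l"
   by (auto simp: memX space_pair_measure space_PiM PiE_iff)
  have "snd x j \<in> ?C j" for j
   unfolding memC using sp B'[of "_ @ [j]"] by auto
  then show "x \<in> (if [] \<in> J then B [] else ?B) \<times> prod_emb UNIV (\<lambda>_. ?A) ?L (Pi\<^sub>E ?L ?C)"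
   using sp B'[of "[]"] by (cases x) (auto simp: prod_emb_def PiE_iff)
 next
  fix x assume x: "x \<in> (if [] \<in> J then B [] else ?B) \<times> prod_emb UNIV (\<lambda>_. ?A) ?L (Pi\<^sub>E ?L ?C)"
  then have f: "fst x \<in> (if [] \<in> J then B [] else ?B)" and s: "\<And>j. snd x j \<in> space ?A" "\<And>j. j \<in> ?L ==> snd x j \<in> ?C j"
   by (auto simp: prod_emb_def PiE_iff)
  have f': "fst x \<in> ?B" using f B[of "[]"] sets.sets_into_space by (auto split: if_splits)
  have xs: "x \<in> space (\<nu> \<Otimes>\<^sub>M ?P)" using f' s(1) by (cases x) (auto simp: space_pair_measure space_PiM PiE_iff)
  have "asm x l \<in> B l" if l: "l \<in> J" for l
  proof (cases "l = []")
   case True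
   then show ?thesis using f l by simp
  next
   case False
   obtain i where i: "l = i @ [last l]" and L: "last l \<in> ?L" using snocJ[OF l False] by blast
   have "snd x (last l) i \<in> B (i @ [last l])" using s(2)[OF L] l i unfolding memC by metis
   then show ?thesis using i asm_snoc by metis
  qed
  moreover have "asm x \<in> space ?A" using measurable_space[OF asm_measurable xs] .
  ultimately show "x \<in> asm -` ?X \<inter> space (\<nu> \<Otimes>\<^sub>M ?P)" using xs by (auto simp: memX)
 qed
 have "emeasure (distr (\<nu> \<Otimes>\<^sub>M ?P) ?A asm) ?X = emeasure (\<nu> \<Otimes>\<^sub>M ?P) (asm -` ?X \<inter> space (\<nu> \<Otimes>\<^sub>M ?P))"
  by (rule emeasure_distr[OF asm_measurable X])
 also have "\<dots> = emeasure \<nu> (if [] \<in> J then B [] else ?B)*emeasure ?P (prod_emb UNIV (\<lambda>_. ?A) ?L (Pi\<^sub>E ?L ?C))"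
  unfolding eq by (rule P.emeasure_pair_measure_Times) (use B J C in "auto intro!: sets_PiM_I")
 also have "emeasure ?P (prod_emb UNIV (\<lambda>_. ?A) ?L (Pi\<^sub>E ?L ?C)) = (\<Prod>j\<in>?L. emeasure ?A (?C j))"
  by (rule emeasure_PiM_emb) (use J C A.prob_space_axioms in auto)
 also have "\<dots> = (\<Prod>j\<in>?L. \<Prod>i\<in>?I j. emeasure \<nu> (B (i @ [j])))"
  by (intro prod.cong refl emeasure_PiM_emb \<nu> finI) (use B in auto)
 also have "\<dots> = (\<Prod>(j, i)\<in>Sigma ?L ?I. emeasure \<nu> (B (i @ [j])))"
  by (rule prod.Sigma) (use J finI in auto)
 also have "\<dots> = (\<Prod>l\<in>J - {[]}. emeasure \<nu> (B l))"
 proof (rule prod.reindex_bij_witness[of _ "\<lambda>l. (last l, butlast l)" "\<lambda>(j, i). i @ [j]"])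
  fix l assume "l \<in> J - {[]}"
  then show "(last l, butlast l) \<in> Sigma ?L ?I" by auto
 qed (auto simp: image_iff)
 also have "emeasure \<nu> (if [] \<in> J then B [] else ?B)*\<dots> = (\<Prod>l\<in>J. emeasure \<nu> (B l))"
  using J by (cases "[] \<in> J") (simp_all add: prod.remove \<nu>.emeasure_space_1)
 also have "\<dots> = emeasure ?A ?X"
  by (rule emeasure_PiM_emb[symmetric]) (use J B \<nu> in auto)
 finally show "emeasure ?A ?X = emeasure (distr (\<nu> \<Otimes>\<^sub>M ?P) ?A asm) ?X" by simp
qed simp

lemma cis_scale_measurable:
 assumes "u \<in> borel_measurable M"
 shows "(\<lambda>x. cis (s * u x)) \<in> borel_measurable M"
proof -
 have "(\<lambda>x. cis (s*x)) \<in> borel_measurable borel"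
  by (intro borel_measurable_continuous_onI continuous_intros)
 from measurable_compose[OF assms this] show ?thesis .
qed

lemma prod_components_measurable:
 fixes f :: "nat => 'a => complex"
 assumes "\<And>j. f j \<in> borel_measurable A" "{..<m} \<subseteq> I"
 shows "(\<lambda>x. \<Prod>j<m. f j (x j)) \<in> borel_measurable (PiM I (\<lambda>_. A))"
proof (rule borel_measurable_prod)
 fix j assume "j \<in> {..<m}"
 then have "j \<in> I" using assms(2) by blast
 from measurable_component_singleton[OF this] show "(\<lambda>x. f j (x j)) \<in> borel_measurable (PiM I (\<lambda>_. A))"
  by (rule measurable_compose) (rule assms(1))
qed

lemma integral_prod_PiM:
 fixes f :: "'a => complex"
 assumes A: "prob_space A" and f: "f \<in> borel_measurable A" "\<And>x. norm (f x) \<le> 1"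
 shows "(\<integral>x. (\<Prod>j<m. f (x j)) \<partial>PiM (UNIV :: nat set) (\<lambda>_. A)) = (\<integral>x. f x \<partial>A) ^ m"
proof -
 let ?A = "\<lambda>x. restrict x {..<m}"
 interpret A: prob_space A by fact
 interpret product_prob_space "\<lambda>_. A" UNIV by unfold_locales
 note [measurable] = f(1)
 have "(\<integral>x. (\<Prod>j<m. f (x j)) \<partial>PiM (UNIV :: nat set) (\<lambda>_. A)) = (\<integral>x. (\<Prod>j<m. f (restrict x {..<m} j)) \<partial>PiM UNIV (\<lambda>_. A))"
  by (intro Bochner_Integration.integral_cong prod.cong refl) simp
 also have "\<dots> = (\<integral>x. (\<Prod>j<m. f (x j)) \<partial>distr (PiM UNIV (\<lambda>_. A)) (PiM {..<m} (\<lambda>_. A)) ?A)"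
 proof (rule integral_distr[symmetric])
  show "?A \<in> PiM UNIV (\<lambda>_. A) \<rightarrow>\<^sub>M PiM {..<m} (\<lambda>_. A)"
   by (rule measurable_restrict_subset) auto
 qed (auto intro!: prod_components_measurable f)
 also have "distr (PiM UNIV (\<lambda>_. A)) (PiM {..<m} (\<lambda>_. A)) ?A = PiM {..<m} (\<lambda>_. A)"
  by (rule distr_PiM_restrict_finite) auto
 also have "(\<integral>x. (\<Prod>j<m. f (x j)) \<partial>PiM {..<m} (\<lambda>_. A)) = (\<Prod>j<m. \<integral>x. f x \<partial>A)"
  by (rule product_integral_prod) (auto intro!: A.integrable_const_bound[where B = 1] f)
 finally show ?thesis by simp
qed

lemma integral_pair_prob:
 fixes f :: "'a \<times> 'b => complex"
 assumes "prob_space A" "prob_space B" and f: "f \<in> borel_measurable (A \<Otimes>\<^sub>M B)" "\<And>x. norm (f x) \<le> 1"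
 shows "(\<integral>x. f x \<partial>(A \<Otimes>\<^sub>M B)) = (\<integral>x. \<integral>y. f (x, y) \<partial>B \<partial>A)"
proof -
 interpret A: prob_space A by fact
 interpret B: prob_space B by fact
 interpret pair_prob_space A B by unfold_locales
 have "integrable (A \<Otimes>\<^sub>M B) f" by (rule integrable_const_bound[where B = 1]) (use f in auto)
 from integral_fst'[OF this] show ?thesis by simp
qed

lemma norm_prob_integral_le:
 fixes f :: "'a => complex"
 assumes "prob_space A" "\<And>x. norm (f x) \<le> 1"
 shows "norm (\<integral>x. f x \<partial>A) \<le> 1"
proof -
 interpret prob_space A by fact
 have "norm (\<integral>x. f x \<partial>A) \<le> (\<integral>x. norm (f x) \<partial>A)" by (rule integral_norm_bound)
 also have "\<dots> \<le> (\<integral>x. 1 \<partial>A)"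
 proof (cases "integrable A (\<lambda>x. norm (f x))")
  case True
  then show ?thesis by (intro integral_mono) (use assms in auto)
 qed (simp add: not_integrable_integral_eq)
 finally show ?thesis by (simp add: prob_space)
qed

lemma char_distr:
 assumes "S \<in> borel_measurable T"
 shows "char (distr T borel S) t = (\<integral>x. cis (t * S x) \<partial>T)"
proof -
 have "char (distr T borel S) t = (\<integral>x. cis (t*x) \<partial>distr T borel S)"
  by (simp add: char_def cis_conv_exp)
 also have "\<dots> = (\<integral>x. cis (t * S x) \<partial>T)"
  by (rule integral_distr[OF assms]) (rule cis_scale_measurable, simp)
 finally show ?thesis .
qed

lemma cis_add_sum: "finite I ==> cis (s*(q + (\<Sum>j\<in>I. y j))) = cis (s*q)*(\<Prod>j\<in>I. cis (s*y j))"
proof -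
 have "finite I ==> cis (\<Sum>j\<in>I. s*y j) = (\<Prod>j\<in>I. cis (s*y j))"
  by (induction I rule: finite_induct) (simp_all flip: cis_mult)
 then show "finite I ==> ?thesis" by (simp add: distrib_left sum_distrib_left flip: cis_mult)
qed

definition unzip :: "('i => 'a \<times> 'b) => ('i => 'a) \<times> ('i => 'b)" where
 "unzip x = ((\<lambda>i. fst (x i)), (\<lambda>i. snd (x i)))"

lemma unzip_measurable [measurable]:
 "unzip \<in> PiM UNIV (\<lambda>_. M \<Otimes>\<^sub>M N) \<rightarrow>\<^sub>M PiM UNIV (\<lambda>_. M) \<Otimes>\<^sub>M PiM UNIV (\<lambda>_. N)"
 unfolding unzip_def[abs_def] by (intro measurable_Pair measurable_PiM_single') (auto simp: space_PiM space_pair_measure PiE_iff mem_Times_iff)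

text \<open>The inverse map sends a pair of independent families to a family of independent pairs;
  this is verified on cylinders by integrating the sections over the first family. It connects
  \<open>tree_space\<close>, built from two families, with a single family of pairs, to which
  \<open>distr_asm\<close> applies.\<close>

lemma distr_unzip:
 assumes M: "prob_space M" and N: "prob_space N"
 shows "distr (PiM UNIV (\<lambda>_. M \<Otimes>\<^sub>M N)) (PiM UNIV (\<lambda>_. M) \<Otimes>\<^sub>M PiM UNIV (\<lambda>_. N)) unzip = PiM (UNIV :: 'i set) (\<lambda>_. M) \<Otimes>\<^sub>M PiM UNIV (\<lambda>_. N)"
proof -
 let ?X = "PiM (UNIV :: 'i set) (\<lambda>_. M)" and ?Y = "PiM (UNIV :: 'i set) (\<lambda>_. N)" and ?Z = "PiM (UNIV :: 'i set) (\<lambda>_. M \<Otimes>\<^sub>M N)"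
 let ?zip = "\<lambda>p i. (fst p i, snd p i)"
 interpret M: prob_space M by (rule M)
 interpret N: prob_space N by (rule N)
 interpret MN: pair_prob_space M N ..
 interpret PM: product_prob_space "\<lambda>_ :: 'i. M" UNIV by unfold_locales
 interpret X: prob_space ?X by (intro prob_space_PiM M)
 interpret Y: prob_space ?Y by (intro prob_space_PiM N)
 have zip [measurable]: "?zip \<in> ?X \<Otimes>\<^sub>M ?Y \<rightarrow>\<^sub>M ?Z"
  by (intro measurable_PiM_single') (auto simp: space_PiM space_pair_measure PiE_iff)
 have "?Z = distr (?X \<Otimes>\<^sub>M ?Y) ?Z ?zip"
 proof (rule measure_eqI_PiM_infinite[OF refl])
  fix C and J :: "'i set" assume J: "finite J" and C: "\<And>i. i \<in> J ==> C i \<in> sets (M \<Otimes>\<^sub>M N)"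
  let ?E = "prod_emb UNIV (\<lambda>_. M \<Otimes>\<^sub>M N) J (Pi\<^sub>E J C)" and ?S = "\<lambda>f i. Pair (f i) -` C i"
  have E: "?E \<in> sets ?Z" using J C by (intro sets_PiM_I) auto
  have S: "?S f i \<in> sets N" if "i \<in> J" for f i using sets_Pair1[OF C[OF that]] .
  have sec [measurable]: "(\<lambda>x. emeasure N (Pair x -` C i)) \<in> borel_measurable M" if "i \<in> J" for i
   by (rule N.measurable_emeasure_Pair[OF C[OF that]])
  have m: "(\<lambda>f. \<Prod>i\<in>J. emeasure N (?S f i)) \<in> borel_measurable (PiM J (\<lambda>_. M))"
  proof (rule borel_measurable_prod_ennreal)
   show "(\<lambda>f. emeasure N (?S f i)) \<in> borel_measurable (PiM J (\<lambda>_. M))" if "i \<in> J" for i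
    using measurable_compose[OF measurable_component_singleton[OF that, of "\<lambda>_. M"] sec[OF that]] by simp
  qed
  have "emeasure (distr (?X \<Otimes>\<^sub>M ?Y) ?Z ?zip) ?E = (\<integral>\<^sup>+f. emeasure ?Y (Pair f -` (?zip -` ?E \<inter> space (?X \<Otimes>\<^sub>M ?Y))) \<partial>?X)"
   by (simp add: emeasure_distr[OF zip E] Y.emeasure_pair_measure_alt[OF measurable_sets[OF zip E]])
  also have "\<dots> = (\<integral>\<^sup>+f. (\<Prod>i\<in>J. emeasure N (?S f i)) \<partial>?X)"
  proof (rule nn_integral_cong)
   fix f assume f: "f \<in> space ?X"
   have "Pair f -` (?zip -` ?E \<inter> space (?X \<Otimes>\<^sub>M ?Y)) = prod_emb UNIV (\<lambda>_. N) J (Pi\<^sub>E J (?S f))"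
    using f by (auto simp: prod_emb_def space_PiM space_pair_measure PiE_iff)
   then show "emeasure ?Y (Pair f -` (?zip -` ?E \<inter> space (?X \<Otimes>\<^sub>M ?Y))) = (\<Prod>i\<in>J. emeasure N (?S f i))"
    using J S N by (simp add: emeasure_PiM_emb)
  qed
  also have "\<dots> = (\<integral>\<^sup>+f. (\<Prod>i\<in>J. emeasure N (?S f i)) \<partial>distr ?X (PiM J (\<lambda>_. M)) (\<lambda>f. restrict f J))"
  proof (subst nn_integral_distr)
   show "(\<lambda>f. restrict f J) \<in> ?X \<rightarrow>\<^sub>M PiM J (\<lambda>_. M)" by (rule measurable_restrict_subset) simp
  qed (simp_all add: m)
  also have "\<dots> = (\<Prod>i\<in>J. \<integral>\<^sup>+x. emeasure N (Pair x -` C i) \<partial>M)"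
   unfolding PM.distr_PiM_restrict_finite[OF J subset_UNIV]
   by (rule PM.product_nn_integral_prod[OF J]) (rule sec)
  also have "\<dots> = (\<Prod>i\<in>J. emeasure (M \<Otimes>\<^sub>M N) (C i))"
   using C by (simp add: N.emeasure_pair_measure_alt)
  also have "\<dots> = emeasure ?Z ?E"
   by (rule emeasure_PiM_emb[symmetric]) (use J C MN.prob_space_axioms in auto)
  finally show "emeasure ?Z ?E = emeasure (distr (?X \<Otimes>\<^sub>M ?Y) ?Z ?zip) ?E" by simp
 next
  show "finite_measure ?Z" by (rule prob_space.finite_measure) (intro prob_space_PiM MN.prob_space_axioms)
 qed simp
 then have "distr ?Z (?X \<Otimes>\<^sub>M ?Y) unzip = distr (distr (?X \<Otimes>\<^sub>M ?Y) ?Z ?zip) (?X \<Otimes>\<^sub>M ?Y) unzip"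
  by (rule arg_cong[where f = "\<lambda>Z. distr Z (?X \<Otimes>\<^sub>M ?Y) unzip"])
 also have "\<dots> = distr (?X \<Otimes>\<^sub>M ?Y) (?X \<Otimes>\<^sub>M ?Y) (\<lambda>x. x)"
  by (subst distr_distr) (auto simp: unzip_def comp_def intro!: distr_cong)
 finally show ?thesis by (simp add: distr_id2)
qed

text \<open>The definition adds a generation at the leaves, while the fixed-point equation needs the
  decomposition at the root.\<close>

lemma generation_Suc_snoc:
 "generation N (Suc r) = (\<Union>j<N []. (\<lambda>i. i @ [j]) ` generation (\<lambda>l. N (l @ [j])) r)"
proof (induction r)
 case (Suc r)
 have "generation N (Suc (Suc r)) = {k # i | i k. i \<in> generation N (Suc r) \<and> k < N i}" by simp
 also have "\<dots> = (\<Union>j<N []. (\<lambda>i. i @ [j]) ` generation (\<lambda>l. N (l @ [j])) (Suc r))"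
  unfolding Suc by (force simp: image_iff)
 finally show ?case .
qed auto

lemma finite_generation: "finite (generation N r)"
proof (induction r)
 case (Suc r)
 have "generation N (Suc r) = (\<Union>i\<in>generation N r. (\<lambda>j. j # i) ` {..<N i})" by auto
 then show ?case using Suc by auto
qed simp

lemma branch_weight_snoc: "branch_weight C (i @ [j]) = C [j] * branch_weight (\<lambda>l. C (l @ [j])) i"
 by (induction i) (simp_all add: mult.assoc)

lemma branch_weight_cong: "(\<And>l. l \<noteq> [] ==> C l = C' l) ==> branch_weight C i = branch_weight C' i"
 by (induction i) simp_all

section \<open>Functionals of the tree and the fixed-point map\<close>

locale iid_tree =
 fixes \<nu> :: "(nat \<times> real) measure" and \<kappa> :: "real measure"
 assumes nu: "prob_space \<nu>" "sets \<nu> = sets (count_space UNIV \<Otimes>\<^sub>M borel)"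
  and kappa: "prob_space \<kappa>" "sets \<kappa> = sets borel"
begin

sublocale nu: prob_space \<nu> by (rule nu)
sublocale kappa: prob_space \<kappa> by (rule kappa)
sublocale mark: pair_prob_space \<nu> \<kappa> ..

text \<open>\<open>U\<close> is the law of the tree with the pairs of marks at each node; \<open>Us\<close> is that of the
 i.i.d. subtrees of the children of the root.\<close>

abbreviation "U \<equiv> PiM (UNIV :: nat list set) (\<lambda>_. \<nu> \<Otimes>\<^sub>M \<kappa>)"
abbreviation "Us \<equiv> PiM (UNIV :: nat set) (\<lambda>_. U)"
abbreviation "T \<equiv> tree_space \<nu> \<kappa>"

sublocale U: prob_space U by (intro prob_space_PiM mark.prob_space_axioms)
sublocale Us: prob_space Us by (intro prob_space_PiM U.prob_space_axioms)

declare nu(2) [measurable_cong] kappa(2) [measurable_cong]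

lemma T_prob: "prob_space T"
 unfolding tree_space_def by (intro prob_space_pair prob_space_PiM nu kappa)

lemma unzip_T [measurable]: "unzip \<in> U \<rightarrow>\<^sub>M T"
 unfolding tree_space_def by (rule unzip_measurable)

lemma T_eq: "T = distr U T unzip"
 unfolding tree_space_def by (rule distr_unzip[OF nu(1) kappa(1), symmetric])

lemma U_eq: "U = distr ((\<nu> \<Otimes>\<^sub>M \<kappa>) \<Otimes>\<^sub>M Us) U asm"
 by (rule distr_asm[OF mark.prob_space_axioms, symmetric])

definition grow :: "((nat \<times> real) \<times> real) \<times> (nat => nat list => (nat \<times> real) \<times> real) => (nat list => nat \<times> real) \<times> (nat list => real)" where
 "grow x = unzip (asm x)"

lemma grow_measurable [measurable]: "grow \<in> (\<nu> \<Otimes>\<^sub>M \<kappa>) \<Otimes>\<^sub>M Us \<rightarrow>\<^sub>M T"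
 unfolding grow_def[abs_def] by measurable

lemma T_eq_grow: "T = distr ((\<nu> \<Otimes>\<^sub>M \<kappa>) \<Otimes>\<^sub>M Us) T grow"
proof -
 have "T = distr (distr ((\<nu> \<Otimes>\<^sub>M \<kappa>) \<Otimes>\<^sub>M Us) U asm) T unzip" using T_eq U_eq by simp
 also have "\<dots> = distr ((\<nu> \<Otimes>\<^sub>M \<kappa>) \<Otimes>\<^sub>M Us) T grow" by (subst distr_distr) (auto simp: grow_def[abs_def] comp_def)
 finally show ?thesis .
qed

lemma nn_integral_T: "u \<in> borel_measurable T ==> (\<integral>\<^sup>+x. u x \<partial>T) = (\<integral>\<^sup>+x. u (unzip x) \<partial>U)"
 by (subst T_eq, rule nn_integral_distr) auto

lemma nn_integral_grow:
 assumes [measurable]: "u \<in> borel_measurable T"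
 shows "(\<integral>\<^sup>+x. u x \<partial>T) = (\<integral>\<^sup>+a. \<integral>\<^sup>+F. u (grow (a, F)) \<partial>Us \<partial>(\<nu> \<Otimes>\<^sub>M \<kappa>))"
 by (subst T_eq_grow, subst nn_integral_distr, measurable, subst Us.nn_integral_fst[symmetric]) auto

definition subtree :: "nat => (nat list => nat \<times> real) \<times> (nat list => real) => (nat list => nat \<times> real) \<times> (nat list => real)" where
 "subtree j x = ((\<lambda>i. fst x (i @ [j])), (\<lambda>i. snd x (i @ [j])))"

lemma subtree_measurable [measurable]: "subtree j \<in> T \<rightarrow>\<^sub>M T"
 unfolding subtree_def tree_space_def
 by (intro measurable_Pair measurable_PiM_single')
   (auto simp: space_PiM space_pair_measure intro!: measurable_compose[OF measurable_fst] measurable_compose[OF measurable_snd])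

lemma subtree_grow: "subtree j (grow (a, F)) = unzip (F j)"
 by (simp add: subtree_def grow_def unzip_def)

lemma root_grow: "fst (grow (a, F)) [] = fst a" "snd (grow (a, F)) [] = snd a" "snd (grow (a, F)) [j] = snd (F j [])"
 using asm_snoc[of "(a, F)" "[]" j] by (simp_all add: grow_def unzip_def)

text \<open>The weight stored at the root of a subtree belongs to the link to its parent. A
  functional that ignores this weight is independent of it.\<close>

definition root_free :: "((nat list => nat \<times> real) \<times> (nat list => real) => real) => bool" where
 "root_free S \<longleftrightarrow> (\<forall>f g g'. (\<forall>l. l \<noteq> [] \<longrightarrow> g l = g' l) \<longrightarrow> S (f, g) = S (f, g'))"

lemma root_free_grow: "root_free S ==> S (grow ((a, c), F)) = S (grow ((a, 0), F))"
proof -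
 assume S: "root_free S"
 have "(\<lambda>l. fst (asm ((a, c), F) l)) = (\<lambda>l. fst (asm ((a, 0), F) l))" by (auto simp: asm_def)
 then show ?thesis unfolding grow_def unzip_def by (simp only:) (rule S[unfolded root_free_def, rule_format], simp add: asm_def)
qed

lemma root_measurable:
 shows "(\<lambda>x. fst (fst x [])) \<in> T \<rightarrow>\<^sub>M count_space UNIV" "(\<lambda>x. snd (fst x [])) \<in> borel_measurable T"
  "(\<lambda>x. snd x l) \<in> borel_measurable T"
proof -
 have 1: "(\<lambda>x. fst x []) \<in> T \<rightarrow>\<^sub>M count_space UNIV \<Otimes>\<^sub>M borel"
  unfolding tree_space_def using measurable_compose[OF measurable_fst measurable_component_singleton[of "[]" UNIV "\<lambda>_. \<nu>"]]
  measurable_cong_sets[OF refl nu(2)] by simp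
 show "(\<lambda>x. fst (fst x [])) \<in> T \<rightarrow>\<^sub>M count_space UNIV" by (rule measurable_compose[OF 1 measurable_fst])
 show "(\<lambda>x. snd (fst x [])) \<in> borel_measurable T" by (rule measurable_compose[OF 1 measurable_snd])
 show "(\<lambda>x. snd x l) \<in> borel_measurable T"
  unfolding tree_space_def using measurable_compose[OF measurable_snd measurable_component_singleton[of l UNIV "\<lambda>_. \<kappa>"]]
  measurable_cong_sets[OF refl kappa(2)] by simp
qed

lemma random_sum_measurable:
 fixes g :: "nat => 'a => 'b::{second_countable_topology,topological_comm_monoid_add}"
 assumes "n \<in> M \<rightarrow>\<^sub>M count_space UNIV" "\<And>j. g j \<in> borel_measurable M"
 shows "(\<lambda>x. \<Sum>j<n x. g j x) \<in> borel_measurable M"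
 by (rule measurable_compose_countable[where f = "\<lambda>m x. \<Sum>j<m. g j x", OF _ assms(1)]) (use assms(2) in measurable)

text \<open>In the decomposition of the tree into root marks and forest, a root-free functional does
  not see the weight coordinate of the root, which is independent of all the others.\<close>

lemma root_weight_indep:
 assumes S [measurable]: "S \<in> borel_measurable T" and free: "root_free S"
 shows "distr T (\<kappa> \<Otimes>\<^sub>M borel) (\<lambda>x. (snd x [], S x)) = \<kappa> \<Otimes>\<^sub>M distr T borel S"
proof (rule pair_measure_eqI[symmetric])
 let ?A = "distr T (\<kappa> \<Otimes>\<^sub>M borel) (\<lambda>x. (snd x [], S x))"
 let ?B = "\<nu> \<Otimes>\<^sub>M \<kappa>"
 interpret T: prob_space T by (rule T_prob)
 show "sigma_finite_measure \<kappa>" by unfold_locales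
 show "sigma_finite_measure (distr T borel S)"
  by (rule prob_space_imp_sigma_finite[OF T.prob_space_distr[OF S]])
 note [measurable] = root_measurable
 have root [measurable]: "(\<lambda>x. snd x []) \<in> T \<rightarrow>\<^sub>M \<kappa>"
  using root_measurable(3) measurable_cong_sets[OF refl kappa(2)] by blast
 fix C D assume C [measurable]: "C \<in> sets \<kappa>" and "D \<in> sets (distr T borel S)"
 then have D [measurable]: "D \<in> sets borel" by simp
 \<comment> \<open>The weight coordinate is frozen at the arbitrary value 0, as
   \<open>root_free_grow\<close> permits.\<close>
 define h where "h a = (\<integral>\<^sup>+F. indicator D (S (grow ((a, 0), F))) \<partial>Us)" for a
 have h [measurable]: "h \<in> borel_measurable \<nu>"
 proof -
  have "0 \<in> space \<kappa>" by (simp add: sets_eq_imp_space_eq[OF kappa(2)])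
  then have "(\<lambda>x. ((fst x, 0), snd x)) \<in> \<nu> \<Otimes>\<^sub>M Us \<rightarrow>\<^sub>M ?B \<Otimes>\<^sub>M Us"
   by (intro measurable_Pair measurable_fst measurable_snd measurable_const)
  from measurable_compose[OF this measurable_compose[OF grow_measurable S]]
  have "(\<lambda>(a, F). indicator D (S (grow ((a, 0), F))) :: ennreal) \<in> borel_measurable (\<nu> \<Otimes>\<^sub>M Us)"
   unfolding case_prod_beta' by (rule measurable_compose) simp
  then show ?thesis unfolding h_def by (rule Us.borel_measurable_nn_integral)
 qed
 have key: "(\<integral>\<^sup>+x. indicator C' (snd x [])*indicator D (S x) \<partial>T) = emeasure \<kappa> C'*(\<integral>\<^sup>+a. h a \<partial>\<nu>)"
  if C' [measurable]: "C' \<in> sets \<kappa>" for C'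
 proof -
  have "(\<integral>\<^sup>+x. indicator C' (snd x [])*indicator D (S x) \<partial>T)
   = (\<integral>\<^sup>+x. indicator C' (snd x)*h (fst x) \<partial>?B)"
  proof (subst nn_integral_grow, measurable, rule nn_integral_cong)
   fix x :: "(nat \<times> real) \<times> real" assume "x \<in> space ?B"
   obtain a c where x: "x = (a, c)" by (cases x)
   have "(\<integral>\<^sup>+F. indicator C' (snd (grow (x, F)) [])*indicator D (S (grow (x, F))) \<partial>Us) = (\<integral>\<^sup>+F. indicator C' c*indicator D (S (grow ((a, 0), F))) \<partial>Us)"
    unfolding x root_grow root_free_grow[OF free, of a c] by simp
   also have "\<dots> = indicator C' c*h a"
    unfolding h_def by (cases "c \<in> C'") simp_all
   finally show "(\<integral>\<^sup>+F. indicator C' (snd (grow (x, F)) [])*indicator D (S (grow (x, F))) \<partial>Us) = indicator C' (snd x)*h (fst x)" by (simp add: x)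
  qed
  also have "\<dots> = (\<integral>\<^sup>+a. \<integral>\<^sup>+c. indicator C' c*h a \<partial>\<kappa> \<partial>\<nu>)"
   by (subst kappa.nn_integral_fst[symmetric]) auto
  finally show ?thesis by (simp add: nn_integral_multc nn_integral_cmult)
 qed
 have "emeasure ?A (C \<times> D) = (\<integral>\<^sup>+y. indicator (C \<times> D) y \<partial>?A)"
  by simp
 also have "\<dots> = (\<integral>\<^sup>+x. indicator C (snd x [])*indicator D (S x) \<partial>T)"
  by (subst nn_integral_distr) (auto simp: indicator_times)
 also have "\<dots> = emeasure \<kappa> C*(\<integral>\<^sup>+a. h a \<partial>\<nu>)" by (rule key[OF C])
 also have "(\<integral>\<^sup>+a. h a \<partial>\<nu>) = (\<integral>\<^sup>+x. indicator (space \<kappa>) (snd x [])*indicator D (S x) \<partial>T)"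
  by (simp add: key kappa.emeasure_space_1)
 also have "\<dots> = (\<integral>\<^sup>+x. indicator D (S x) \<partial>T)"
  using measurable_space[OF root] by (intro nn_integral_cong) (simp add: indicator_def)
 also have "\<dots> = (\<integral>\<^sup>+y. indicator D y \<partial>distr T borel S)" by (subst nn_integral_distr) auto
 also have "\<dots> = emeasure (distr T borel S) D" by simp
 finally show "emeasure \<kappa> C*emeasure (distr T borel S) D = emeasure ?A (C \<times> D)" by simp
qed (simp only: sets_distr, rule sets_pair_measure_cong, simp_all)

text \<open>The right-hand side of the fixed-point equation, realised on one tree with
  \<open>S\<close> evaluated in the subtrees; \<open>sfpe_map\<close> is its counterpart on the
  level of laws.\<close>

definition combine :: "((nat list => nat \<times> real) \<times> (nat list => real) => real) => (nat list => nat \<times> real) \<times> (nat list => real) => real" where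
 "combine S x = snd (fst x []) + (\<Sum>j<fst (fst x []). snd x [j] * S (subtree j x))"

lemma combine_measurable:
 assumes "S \<in> borel_measurable T"
 shows "combine S \<in> borel_measurable T"
 unfolding combine_def[abs_def]
 by (intro borel_measurable_add root_measurable random_sum_measurable borel_measurable_times measurable_compose[OF subtree_measurable assms])

definition sfpe_map :: "real measure => real measure" where
 "sfpe_map \<mu> = distr (\<nu> \<Otimes>\<^sub>M PiM UNIV (\<lambda>_::nat. \<kappa>) \<Otimes>\<^sub>M PiM UNIV (\<lambda>_::nat. \<mu>)) borel
    (\<lambda>((m, q), c, r). (\<Sum>j<m. c j * r j) + q)"

lemma sfpe_map_measurable:
 assumes "sets \<mu> = sets borel"
 shows "(\<lambda>((m, q), c, r). (\<Sum>j<m. c j * r j) + q) \<in> borel_measurable (\<nu> \<Otimes>\<^sub>M PiM UNIV (\<lambda>_::nat. \<kappa>) \<Otimes>\<^sub>M PiM UNIV (\<lambda>_::nat. \<mu>))"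
proof -
 note [measurable_cong] = assms
 let ?M = "\<nu> \<Otimes>\<^sub>M PiM UNIV (\<lambda>_::nat. \<kappa>) \<Otimes>\<^sub>M PiM UNIV (\<lambda>_::nat. \<mu>)"
 have 0: "fst \<in> ?M \<rightarrow>\<^sub>M count_space UNIV \<Otimes>\<^sub>M borel"
  using measurable_fst[of \<nu>] measurable_cong_sets[OF refl nu(2)] by blast
 have 1: "(\<lambda>x. fst (fst x)) \<in> ?M \<rightarrow>\<^sub>M count_space UNIV" "(\<lambda>x. snd (fst x)) \<in> borel_measurable ?M"
  by (rule measurable_compose[OF 0 measurable_fst] measurable_compose[OF 0 measurable_snd])+
 have 2: "(\<lambda>x. fst (snd x) j) \<in> borel_measurable ?M" "(\<lambda>x. snd (snd x) j) \<in> borel_measurable ?M" for j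
  by measurable
 have "(\<lambda>x. (\<Sum>j<fst (fst x). fst (snd x) j * snd (snd x) j) + snd (fst x)) \<in> borel_measurable ?M"
  by (intro borel_measurable_add random_sum_measurable borel_measurable_times 1 2)
 then show ?thesis by (simp add: case_prod_beta')
qed

lemma char_combine:
 assumes S [measurable]: "S \<in> borel_measurable T" and free: "root_free S"
 shows "char (distr T borel (combine S)) s = (\<integral>a. cis (s * snd a)*(\<integral>x. cis (s*(fst x * snd x)) \<partial>(\<kappa> \<Otimes>\<^sub>M distr T borel S)) ^ fst a \<partial>\<nu>)"
proof -
 let ?A = "\<nu> \<Otimes>\<^sub>M \<kappa>"
 let ?B = "\<integral>x. cis (s*(fst x * snd x)) \<partial>(\<kappa> \<Otimes>\<^sub>M distr T borel S)"
 note [measurable] = combine_measurable[OF S] root_measurable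
 let ?\<phi> = "\<lambda>x. cis (s*(snd x [] * S x))"
 have \<phi>: "?\<phi> \<in> borel_measurable T" by (intro cis_scale_measurable) measurable
 have "char (distr T borel (combine S)) s = (\<integral>x. cis (s*combine S x) \<partial>distr (?A \<Otimes>\<^sub>M Us) T grow)"
  by (subst char_distr) (simp_all flip: T_eq_grow)
 also have "\<dots> = (\<integral>x. cis (s*combine S (grow x)) \<partial>(?A \<Otimes>\<^sub>M Us))"
  by (rule integral_distr[OF grow_measurable]) (rule cis_scale_measurable, measurable)
 also have "\<dots> = (\<integral>a. \<integral>F. cis (s*combine S (grow (a, F))) \<partial>Us \<partial>?A)"
  by (rule integral_pair_prob[OF mark.prob_space_axioms Us.prob_space_axioms cis_scale_measurable]) auto
 also have "\<dots> = (\<integral>a. cis (s * snd (fst a))*(\<integral>x. ?\<phi> (unzip x) \<partial>U) ^ fst (fst a) \<partial>?A)"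
 proof (rule Bochner_Integration.integral_cong[OF refl])
  fix a :: "(nat \<times> real) \<times> real"
  have "(\<integral>F. cis (s*combine S (grow (a, F))) \<partial>Us) = (\<integral>F. cis (s * snd (fst a))*(\<Prod>j<fst (fst a). ?\<phi> (unzip (F j))) \<partial>Us)"
   unfolding combine_def root_grow subtree_grow cis_add_sum[OF finite_lessThan] by (simp add: unzip_def)
  then show "(\<integral>F. cis (s*combine S (grow (a, F))) \<partial>Us) = cis (s * snd (fst a))*(\<integral>x. ?\<phi> (unzip x) \<partial>U) ^ fst (fst a)"
   using integral_prod_PiM[OF U.prob_space_axioms measurable_compose[OF unzip_T \<phi>]] by simp
 qed
 also have "(\<integral>x. ?\<phi> (unzip x) \<partial>U) = (\<integral>x. ?\<phi> x \<partial>distr U T unzip)"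
  by (rule integral_distr[OF unzip_T \<phi>, symmetric])
 also have "\<dots> = (\<integral>x. cis (s*(fst x * snd x)) \<partial>distr T (\<kappa> \<Otimes>\<^sub>M borel) (\<lambda>x. (snd x [], S x)))"
  unfolding T_eq[symmetric]
  by (subst integral_distr) (auto intro!: cis_scale_measurable measurable_Pair simp: measurable_cong_sets[OF refl kappa(2)])
 also have "\<dots> = ?B" unfolding root_weight_indep[OF S free] ..
 finally have "char (distr T borel (combine S)) s = (\<integral>a. cis (s * snd (fst a))*?B ^ fst (fst a) \<partial>?A)" .
 moreover have "\<nu> = distr ?A \<nu> fst" by (rule kappa.distr_pair_fst[symmetric])
 ultimately show ?thesis
  by (subst \<open>\<nu> = _\<close>) (subst integral_distr, auto intro!: borel_measurable_times cis_scale_measurable borel_measurable_power)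
qed

lemma char_sfpe_map:
 assumes mu: "prob_space \<mu>" "sets \<mu> = sets borel"
 shows "char (sfpe_map \<mu>) s = (\<integral>a. cis (s * snd a)*(\<integral>x. cis (s*(fst x * snd x)) \<partial>(\<kappa> \<Otimes>\<^sub>M \<mu>)) ^ fst a \<partial>\<nu>)"
proof -
 let ?A = "\<kappa> \<Otimes>\<^sub>M \<mu>"
 note [measurable_cong] = mu(2)
 let ?C = "PiM (UNIV :: nat set) (\<lambda>_. \<kappa>)" and ?R = "PiM (UNIV :: nat set) (\<lambda>_. \<mu>)" and ?D = "PiM (UNIV :: nat set) (\<lambda>_. \<kappa> \<Otimes>\<^sub>M \<mu>)"
 let ?u = "\<lambda>((m, q), c, r). (\<Sum>j<m. c j * r j) + q :: real" and ?\<phi> = "\<lambda>x. cis (s*(fst x * snd x))"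
 have CR: "prob_space (?C \<Otimes>\<^sub>M ?R)" and km: "prob_space ?A" by (intro prob_space_pair prob_space_PiM kappa mu)+
 note u [measurable] = sfpe_map_measurable[OF mu(2)]
 have \<phi>: "?\<phi> \<in> borel_measurable ?A" by (intro cis_scale_measurable) measurable
 have "char (sfpe_map \<mu>) s = (\<integral>x. cis (s*?u x) \<partial>(\<nu> \<Otimes>\<^sub>M ?C \<Otimes>\<^sub>M ?R))"
  unfolding sfpe_map_def by (rule char_distr[OF u])
 also have "\<dots> = (\<integral>a. \<integral>x. cis (s*?u (a, x)) \<partial>(?C \<Otimes>\<^sub>M ?R) \<partial>\<nu>)"
  by (rule integral_pair_prob[OF nu(1) CR]) (simp_all only: cis_scale_measurable u norm_cis order_refl)
 also have "\<dots> = (\<integral>a. cis (s * snd a)*(\<integral>x. ?\<phi> x \<partial>?A) ^ fst a \<partial>\<nu>)"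
 proof (rule Bochner_Integration.integral_cong[OF refl])
  fix a assume a: "a \<in> space \<nu>"
  have "(\<integral>x. cis (s*?u (a, x)) \<partial>(?C \<Otimes>\<^sub>M ?R)) = (\<integral>x. cis (s*?u (a, x)) \<partial>distr ?D (?C \<Otimes>\<^sub>M ?R) unzip)"
   by (simp only: distr_unzip[OF kappa(1) mu(1)])
  also have "\<dots> = (\<integral>x. cis (s*?u (a, unzip x)) \<partial>?D)"
   by (rule integral_distr[OF unzip_measurable cis_scale_measurable[OF measurable_compose[OF measurable_Pair1'[OF a] u]]])
  also have "\<dots> = (\<integral>x. cis (s * snd a)*(\<Prod>j<fst a. ?\<phi> (x j)) \<partial>?D)"
   by (simp add: case_prod_beta unzip_def add.commute[of _ "snd a"] cis_add_sum)
  finally show "(\<integral>x. cis (s*?u (a, x)) \<partial>(?C \<Otimes>\<^sub>M ?R)) = cis (s * snd a)*(\<integral>x. ?\<phi> x \<partial>?A) ^ fst a"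
   using integral_prod_PiM[OF km \<phi>] by simp
 qed
 finally show ?thesis .
qed

text \<open>Conditionally on the root mark \<open>(m, q)\<close>, both sides have the characteristic
  function \<open>cis (s q)\<close> times the \<open>m\<close>-th power of one common factor.
  Uniqueness of characteristic functions replaces an explicit map between the two product
  spaces.\<close>

theorem distr_combine:
 assumes S: "S \<in> borel_measurable T" and free: "root_free S"
 shows "distr T borel (combine S) = sfpe_map (distr T borel S)"
proof (rule Levy_uniqueness)
 interpret T: prob_space T by (rule T_prob)
 have mu: "prob_space (distr T borel S)" by (rule T.prob_space_distr[OF S])
 show "real_distribution (distr T borel (combine S))" by (rule T.real_distribution_distr[OF combine_measurable[OF S]])
 interpret M: prob_space "\<nu> \<Otimes>\<^sub>M PiM (UNIV :: nat set) (\<lambda>_. \<kappa>) \<Otimes>\<^sub>M PiM (UNIV :: nat set) (\<lambda>_. distr T borel S)"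
  by (intro prob_space_pair prob_space_PiM nu kappa mu)
 show "real_distribution (sfpe_map (distr T borel S))"
  unfolding sfpe_map_def by (rule M.real_distribution_distr[OF sfpe_map_measurable]) simp
 show "char (distr T borel (combine S)) = char (sfpe_map (distr T borel S))"
  using char_combine[OF S free] char_sfpe_map[OF mu] by auto
qed

lemma nn_integral_component:
 assumes "prob_space N" "f \<in> borel_measurable N"
 shows "(\<integral>\<^sup>+F. f (F j) \<partial>PiM (UNIV :: nat set) (\<lambda>_. N)) = (\<integral>\<^sup>+x. f x \<partial>N)"
proof -
 have "(\<integral>\<^sup>+F. f (F j) \<partial>PiM (UNIV :: nat set) (\<lambda>_. N)) = (\<integral>\<^sup>+x. f x \<partial>distr (PiM (UNIV :: nat set) (\<lambda>_. N)) N (\<lambda>F. F j))"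
  by (rule nn_integral_distr[symmetric]) (use assms(2) in auto)
 also have "distr (PiM (UNIV :: nat set) (\<lambda>_. N)) N (\<lambda>F. F j) = N"
  by (rule distr_PiM_component) (use assms(1) in auto)
 finally show ?thesis .
qed

lemma nn_integral_forest:
 assumes [measurable]: "\<phi> \<in> borel_measurable T"
 shows "(\<integral>\<^sup>+F. \<phi> (unzip (F j)) \<partial>Us) = (\<integral>\<^sup>+x. \<phi> x \<partial>T)"
 unfolding nn_integral_T[OF assms] by (rule nn_integral_component[OF U.prob_space_axioms, of "\<lambda>x. \<phi> (unzip x)"]) measurable

lemma nn_integral_subtree:
 assumes [measurable]: "\<phi> \<in> borel_measurable T"
 shows "(\<integral>\<^sup>+x. \<phi> (subtree j x) \<partial>T) = (\<integral>\<^sup>+x. \<phi> x \<partial>T)"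
 by (subst nn_integral_grow) (measurable, simp add: subtree_grow nn_integral_forest mark.emeasure_space_1)

text \<open>Passing to a subtree preserves the law of the tree, so preimages of null sets are null
  sets.\<close>

lemma AE_subtree:
 assumes "AE x in T. P x"
 shows "AE x in T. P (subtree j x)"
proof -
 obtain N where N: "{x \<in> space T. \<not> P x} \<subseteq> N" "emeasure T N = 0" "N \<in> sets T"
  using assms by (rule AE_E)
 have ind: "(indicator N :: _ => ennreal) \<in> borel_measurable T" using N(3) by measurable
 have "(\<integral>\<^sup>+x. indicator N (subtree j x) \<partial>T) = 0"
  unfolding nn_integral_subtree[OF ind] using N by simp
 then have "AE x in T. indicator N (subtree j x) = (0::ennreal)"
  by (subst (asm) nn_integral_0_iff_AE) (rule measurable_compose[OF subtree_measurable ind], simp)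
 then show ?thesis
 proof (rule AE_mp, intro AE_I2 impI)
  fix x assume x: "x \<in> space T" "indicator N (subtree j x) = (0::ennreal)"
  then have "subtree j x \<in> space T" using measurable_space[OF subtree_measurable] by blast
  then show "P (subtree j x)" using N(1) x(2) by (auto simp: indicator_def split: if_splits)
 qed
qed

lemma nn_integral_children:
 assumes \<phi> [measurable]: "\<phi> \<in> borel_measurable T"
 shows "(\<integral>\<^sup>+x. (\<Sum>j<fst (fst x []). \<phi> (subtree j x)) \<partial>T) = (\<integral>\<^sup>+a. of_nat (fst a) \<partial>\<nu>)*(\<integral>\<^sup>+x. \<phi> x \<partial>T)"
proof -
 let ?A = "\<integral>\<^sup>+x. \<phi> x \<partial>T"
 have N: "(\<lambda>a. of_nat (fst a) :: ennreal) \<in> borel_measurable \<nu>"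
  using measurable_cong_sets[OF nu(2) refl] by (auto intro!: measurable_compose[OF measurable_fst])
 have "(\<integral>\<^sup>+x. (\<Sum>j<fst (fst x []). \<phi> (subtree j x)) \<partial>T) = (\<integral>\<^sup>+a. \<integral>\<^sup>+F. (\<Sum>j<fst (fst a). \<phi> (unzip (F j))) \<partial>Us \<partial>(\<nu> \<Otimes>\<^sub>M \<kappa>))"
  by (subst nn_integral_grow)
    (auto intro!: random_sum_measurable root_measurable measurable_compose[OF subtree_measurable \<phi>] simp: root_grow subtree_grow)
 also have "\<dots> = (\<integral>\<^sup>+a. of_nat (fst (fst a))*?A \<partial>(\<nu> \<Otimes>\<^sub>M \<kappa>))"
 proof (rule nn_integral_cong)
  fix a :: "(nat \<times> real) \<times> real"
  have "(\<lambda>F. \<phi> (unzip (F j))) \<in> borel_measurable Us" for j by measurable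
  then show "(\<integral>\<^sup>+F. (\<Sum>j<fst (fst a). \<phi> (unzip (F j))) \<partial>Us) = of_nat (fst (fst a))*?A"
   by (simp add: nn_integral_sum nn_integral_forest)
 qed
 also have "\<dots> = (\<integral>\<^sup>+a. \<integral>\<^sup>+c. of_nat (fst a)*?A \<partial>\<kappa> \<partial>\<nu>)"
  using measurable_compose[OF measurable_fst N, of \<kappa>] by (subst kappa.nn_integral_fst[symmetric]) auto
 also have "\<dots> = (\<integral>\<^sup>+a. of_nat (fst a) \<partial>\<nu>)*?A"
  by (simp add: kappa.emeasure_space_1 nn_integral_multc[OF N])
 finally show ?thesis .
qed

lemma nn_integral_weight:
 assumes S [measurable]: "S \<in> borel_measurable T" and free: "root_free S"
 shows "(\<integral>\<^sup>+x. ennreal (abs (snd x []))*ennreal (abs (S x)) \<partial>T) = (\<integral>\<^sup>+c. ennreal (abs c) \<partial>\<kappa>)*(\<integral>\<^sup>+x. ennreal (abs (S x)) \<partial>T)"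
proof -
 interpret T: prob_space T by (rule T_prob)
 interpret mu: prob_space "distr T borel S" by (rule T.prob_space_distr[OF S])
 have "(\<integral>\<^sup>+x. ennreal (abs (snd x []))*ennreal (abs (S x)) \<partial>T) = (\<integral>\<^sup>+y. ennreal (abs (fst y))*ennreal (abs (snd y)) \<partial>distr T (\<kappa> \<Otimes>\<^sub>M borel) (\<lambda>x. (snd x [], S x)))"
  by (subst nn_integral_distr) (use S root_measurable(3) in "auto intro!: measurable_Pair simp: measurable_cong_sets[OF refl kappa(2)]")
 also have "\<dots> = (\<integral>\<^sup>+c. \<integral>\<^sup>+y. ennreal (abs c)*ennreal (abs y) \<partial>distr T borel S \<partial>\<kappa>)"
  unfolding root_weight_indep[OF S free] by (subst mu.nn_integral_fst[symmetric]) auto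
 also have "\<dots> = (\<integral>\<^sup>+c. ennreal (abs c)*(\<integral>\<^sup>+x. ennreal (abs (S x)) \<partial>T) \<partial>\<kappa>)"
  by (subst nn_integral_cmult, simp, subst nn_integral_distr, auto)
 finally show ?thesis by (simp add: nn_integral_multc)
qed

section \<open>Generation sums and the endogenous solution\<close>

lemma generation_sum_0: "generation_sum x 0 = snd (fst x [])"
 by (simp add: generation_sum_def case_prod_beta)

lemma generation_sum_Suc: "generation_sum x (Suc r) = (\<Sum>j<fst (fst x []). snd x [j] * generation_sum (subtree j x) r)"
proof -
 let ?N = "\<lambda>k. fst (fst x k)" and ?C = "snd x"
 let ?g = "\<lambda>j. generation (\<lambda>l. ?N (l @ [j])) r"
 have "generation_sum x (Suc r) = (\<Sum>i\<in>(\<Union>j<?N []. (\<lambda>i. i @ [j]) ` ?g j). branch_weight ?C i * snd (fst x i))"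
  unfolding generation_sum_def case_prod_beta generation_Suc_snoc ..
 also have "\<dots> = (\<Sum>j<?N []. \<Sum>i\<in>(\<lambda>i. i @ [j]) ` ?g j. branch_weight ?C i * snd (fst x i))"
  by (rule sum.UNION_disjoint) (auto simp: finite_generation)
 also have "\<dots> = (\<Sum>j<?N []. \<Sum>i\<in>?g j. branch_weight ?C (i @ [j]) * snd (fst x (i @ [j])))"
  by (rule sum.cong[OF refl], subst sum.reindex) (auto simp: inj_on_def)
 also have "\<dots> = (\<Sum>j<?N []. ?C [j] * generation_sum (subtree j x) r)"
  by (simp add: generation_sum_def subtree_def branch_weight_snoc sum_distrib_left mult.assoc)
 finally show ?thesis .
qed

lemma generation_sum_measurable: "(\<lambda>x. generation_sum x r) \<in> borel_measurable T"
proof (induction r)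
 case 0
 then show ?case unfolding generation_sum_0 by (rule root_measurable)
next
 case (Suc r)
 show ?case unfolding generation_sum_Suc
  by (intro random_sum_measurable root_measurable borel_measurable_times measurable_compose[OF subtree_measurable Suc])
qed

lemma generation_sum_root: "(\<forall>l. l \<noteq> [] \<longrightarrow> g l = g' l) ==> generation_sum (f, g) r = generation_sum (f, g') r"
 unfolding generation_sum_def using branch_weight_cong[of g g'] by simp

text \<open>By the decomposition at the root and the independence of a link weight from the subtree
  below it, each generation multiplies the expected absolute mass by at most the mean number of
  children times the mean absolute weight.\<close>

lemma nn_integral_generation_sum:
 "(\<integral>\<^sup>+x. ennreal (abs (generation_sum x r)) \<partial>T)
  \<le> ((\<integral>\<^sup>+a. of_nat (fst a) \<partial>\<nu>)*(\<integral>\<^sup>+c. ennreal (abs c) \<partial>\<kappa>)) ^ r*(\<integral>\<^sup>+a. ennreal (abs (snd a)) \<partial>\<nu>)"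
proof (induction r)
 case 0
 have N: "(\<lambda>a. ennreal (abs (snd a))) \<in> borel_measurable \<nu>"
  using measurable_cong_sets[OF nu(2) refl] by (auto intro!: measurable_compose[OF measurable_snd])
 have "(\<integral>\<^sup>+x. ennreal (abs (generation_sum x 0)) \<partial>T) = (\<integral>\<^sup>+a. \<integral>\<^sup>+F. ennreal (abs (snd (fst a))) \<partial>Us \<partial>(\<nu> \<Otimes>\<^sub>M \<kappa>))"
  unfolding generation_sum_0 by (subst nn_integral_grow) (use root_measurable(2) in "auto simp: root_grow")
 also have "\<dots> = (\<integral>\<^sup>+a. \<integral>\<^sup>+c. ennreal (abs (snd a)) \<partial>\<kappa> \<partial>\<nu>)"
  using measurable_compose[OF measurable_fst N, of \<kappa>] by (subst kappa.nn_integral_fst[symmetric]) (auto simp: Us.emeasure_space_1)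
 finally show ?case by (simp add: kappa.emeasure_space_1)
next
 case (Suc r)
 let ?\<phi> = "\<lambda>x. ennreal (abs (snd x []))*ennreal (abs (generation_sum x r))"
 have \<phi>: "?\<phi> \<in> borel_measurable T"
  using root_measurable(3)[of "[]"] generation_sum_measurable[of r] by measurable
 have "(\<integral>\<^sup>+x. ennreal (abs (generation_sum x (Suc r))) \<partial>T) \<le> (\<integral>\<^sup>+x. (\<Sum>j<fst (fst x []). ?\<phi> (subtree j x)) \<partial>T)"
 proof (rule nn_integral_mono)
  fix x
  have "ennreal (abs (generation_sum x (Suc r))) \<le> ennreal (\<Sum>j<fst (fst x []). abs (snd x [j])*abs (generation_sum (subtree j x) r))"
   unfolding generation_sum_Suc by (intro ennreal_leI order_trans[OF sum_abs]) (simp add: abs_mult)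
  also have "\<dots> = (\<Sum>j<fst (fst x []). ?\<phi> (subtree j x))"
   by (subst sum_ennreal[symmetric]) (auto simp: ennreal_mult subtree_def)
  finally show "ennreal (abs (generation_sum x (Suc r))) \<le> \<dots>" .
 qed
 also have "\<dots> = (\<integral>\<^sup>+a. of_nat (fst a) \<partial>\<nu>)*(\<integral>\<^sup>+x. ?\<phi> x \<partial>T)"
  by (rule nn_integral_children[OF \<phi>])
 also have "(\<integral>\<^sup>+x. ?\<phi> x \<partial>T) = (\<integral>\<^sup>+c. ennreal (abs c) \<partial>\<kappa>)*(\<integral>\<^sup>+x. ennreal (abs (generation_sum x r)) \<partial>T)"
  by (rule nn_integral_weight[OF generation_sum_measurable]) (unfold root_free_def, metis generation_sum_root)
 also have "(\<integral>\<^sup>+a. of_nat (fst a) \<partial>\<nu>)*((\<integral>\<^sup>+c. ennreal (abs c) \<partial>\<kappa>)*(\<integral>\<^sup>+x. ennreal (abs (generation_sum x r)) \<partial>T))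
   \<le> (\<integral>\<^sup>+a. of_nat (fst a) \<partial>\<nu>)*((\<integral>\<^sup>+c. ennreal (abs c) \<partial>\<kappa>)*(((\<integral>\<^sup>+a. of_nat (fst a) \<partial>\<nu>)*(\<integral>\<^sup>+c. ennreal (abs c) \<partial>\<kappa>)) ^ r*(\<integral>\<^sup>+a. ennreal (abs (snd a)) \<partial>\<nu>)))"
  by (intro mult_left_mono Suc) auto
 finally show ?case by (simp add: mult_ac)
qed

definition psum :: "nat => (nat list => nat \<times> real) \<times> (nat list => real) => real" where
 "psum k x = (\<Sum>r\<le>k. generation_sum x r)"

lemma psum_measurable: "psum k \<in> borel_measurable T"
 unfolding psum_def[abs_def] using generation_sum_measurable by measurable

lemma root_free_psum: "root_free (psum k)"
 unfolding root_free_def psum_def using generation_sum_root by (metis (no_types, lifting) sum.cong)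

lemma psum_Suc: "psum (Suc k) = combine (psum k)"
proof
 fix x
 have "psum (Suc k) x = generation_sum x 0 + (\<Sum>r\<le>k. generation_sum x (Suc r))"
  unfolding psum_def by (rule sum.atMost_Suc_shift)
 also have "(\<Sum>r\<le>k. generation_sum x (Suc r)) = (\<Sum>j<fst (fst x []). snd x [j] * psum k (subtree j x))"
  unfolding generation_sum_Suc psum_def sum_distrib_left by (rule sum.swap)
 finally show "psum (Suc k) x = combine (psum k) x" by (simp add: combine_def generation_sum_0)
qed

lemma char_psum_0: "char (distr T borel (psum 0)) s = (\<integral>a. cis (s * snd a) \<partial>\<nu>)"
proof -
 let ?A = "distr T \<nu> (\<lambda>x. fst x [])"
 have snd: "snd \<in> borel_measurable \<nu>" using measurable_cong_sets[OF nu(2) refl] by auto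
 have root: "(\<lambda>x. fst x []) \<in> T \<rightarrow>\<^sub>M \<nu>"
  unfolding tree_space_def by (rule measurable_compose[OF measurable_fst measurable_component_singleton]) simp
 have "?A = distr (distr T (PiM UNIV (\<lambda>_. \<nu>)) fst) \<nu> (\<lambda>f. f [])"
  unfolding tree_space_def by (subst distr_distr) (auto simp: comp_def)
 also have "distr T (PiM UNIV (\<lambda>_. \<nu>)) fst = PiM UNIV (\<lambda>_. \<nu>)"
  unfolding tree_space_def by (intro prob_space.distr_pair_fst prob_space_PiM kappa)
 also have "distr (PiM UNIV (\<lambda>_. \<nu>)) \<nu> (\<lambda>f. f []) = \<nu>"
  by (rule distr_PiM_component) (use nu in auto)
 finally have law: "?A = \<nu>" .
 have "char (distr T borel (psum 0)) s = (\<integral>x. cis (s * snd (fst x [])) \<partial>T)"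
  using char_distr[OF psum_measurable] by (simp add: psum_def generation_sum_0)
 also have "\<dots> = (\<integral>a. cis (s * snd a) \<partial>?A)"
  by (rule integral_distr[OF root cis_scale_measurable[OF snd], symmetric])
 finally show ?thesis unfolding law .
qed

text \<open>This recursion is later recognised in the characteristic functions of the graph limit,
  see \<open>Psi_eq_char\<close>.\<close>

lemma char_psum_Suc:
 "char (distr T borel (psum (Suc k))) s = (\<integral>a. cis (s * snd a)*(\<integral>c. char (distr T borel (psum k)) (s*c) \<partial>\<kappa>) ^ fst a \<partial>\<nu>)"
proof -
 interpret T: prob_space T by (rule T_prob)
 let ?\<mu> = "distr T borel (psum k)"
 have "(\<integral>x. cis (s*(fst x * snd x)) \<partial>(\<kappa> \<Otimes>\<^sub>M ?\<mu>)) = (\<integral>c. \<integral>y. cis (s*(c*y)) \<partial>?\<mu> \<partial>\<kappa>)"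
  by (subst integral_pair_prob[OF kappa(1) T.prob_space_distr[OF psum_measurable]]) (auto intro!: cis_scale_measurable)
 then show ?thesis unfolding psum_Suc char_combine[OF psum_measurable root_free_psum] by (simp add: char_def cis_conv_exp mult.assoc)
qed

definition rsum :: "(nat list => nat \<times> real) \<times> (nat list => real) => real" where
 "rsum x = (\<Sum>r. generation_sum x r)"

lemma rsum_measurable: "rsum \<in> borel_measurable T"
 unfolding rsum_def[abs_def] using generation_sum_measurable by measurable

lemma law_endogenous_eq: "law_endogenous \<nu> \<kappa> = distr T borel rsum"
 by (simp add: law_endogenous_def rsum_def[abs_def])

end

locale contractive_tree = iid_tree +
 fixes c :: real
 assumes c: "0 \<le> c" "c < 1"
  and contraction: "(\<integral>\<^sup>+a. of_nat (fst a) \<partial>\<nu>)*(\<integral>\<^sup>+c. ennreal (abs c) \<partial>\<kappa>) \<le> ennreal c"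
  and integrable_Q: "(\<integral>\<^sup>+a. ennreal (abs (snd a)) \<partial>\<nu>) < \<infinity>"
begin

text \<open>The expected sum of the absolute generation sums is dominated by a geometric
  series.\<close>

theorem AE_summable: "AE x in T. summable (generation_sum x)"
proof -
 let ?A = "\<integral>\<^sup>+x. (\<Sum>r. ennreal (abs (generation_sum x r))) \<partial>T"
 let ?Q = "\<integral>\<^sup>+a. ennreal (abs (snd a)) \<partial>\<nu>"
 obtain q where q: "?Q = ennreal q" "0 \<le> q" using integrable_Q by (cases ?Q) auto
 have le: "(\<integral>\<^sup>+x. ennreal (abs (generation_sum x r)) \<partial>T) \<le> ennreal (c ^ r*q)" for r
 proof -
  have "(\<integral>\<^sup>+x. ennreal (abs (generation_sum x r)) \<partial>T) \<le> ennreal c ^ r*?Q"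
   by (rule order_trans[OF nn_integral_generation_sum]) (intro mult_right_mono power_mono contraction, auto)
  then show ?thesis using c q by (simp add: ennreal_power ennreal_mult)
 qed
 have "?A = (\<Sum>r. \<integral>\<^sup>+x. ennreal (abs (generation_sum x r)) \<partial>T)"
  by (rule nn_integral_suminf) (use generation_sum_measurable in measurable)
 also have "\<dots> \<le> (\<Sum>r. ennreal (c ^ r*q))"
  by (intro suminf_le le) auto
 also have "\<dots> = ennreal (\<Sum>r. c ^ r*q)"
  by (rule suminf_ennreal2) (use c q in "auto intro!: summable_mult2 summable_geometric")
 also have "\<dots> < \<infinity>" by simp
 finally have fin: "?A < \<infinity>" .
 have "(\<lambda>x. \<Sum>r. ennreal (abs (generation_sum x r))) \<in> borel_measurable T"
  using generation_sum_measurable by measurable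
 then have "AE x in T. (\<Sum>r. ennreal (abs (generation_sum x r))) \<noteq> \<infinity>"
  by (rule nn_integral_PInf_AE) (use fin in auto)
 then show ?thesis
 proof eventually_elim
  case (elim x)
  then have "summable (\<lambda>r. abs (generation_sum x r))"
   by (intro summable_suminf_not_top) auto
  then show ?case by (rule summable_rabs_cancel)
 qed
qed

text \<open>Splitting off generation 0 and exchanging the series with the sum over the children
  requires summability in all subtrees at once, and these are countably many.\<close>

lemma AE_combine_rsum: "AE x in T. rsum x = combine rsum x"
proof -
 have "AE x in T. \<forall>j. summable (generation_sum (subtree j x))"
  unfolding AE_all_countable by (intro allI AE_subtree AE_summable)
 then show ?thesis
  using AE_summable
 proof eventually_elim
  case (elim x)
  have "rsum x = (\<Sum>r. generation_sum x (Suc r)) + generation_sum x 0"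
   unfolding rsum_def using suminf_split_head[OF elim(2)] by simp
  also have "(\<Sum>r. generation_sum x (Suc r)) = (\<Sum>j<fst (fst x []). \<Sum>r. snd x [j] * generation_sum (subtree j x) r)"
   unfolding generation_sum_Suc by (rule suminf_sum) (use elim in "auto intro: summable_mult")
  also have "\<dots> = (\<Sum>j<fst (fst x []). snd x [j] * rsum (subtree j x))"
   unfolding rsum_def by (intro sum.cong refl suminf_mult) (use elim in auto)
  finally show ?case by (simp add: combine_def generation_sum_0)
 qed
qed

lemma root_free_rsum: "root_free rsum"
 unfolding root_free_def rsum_def using generation_sum_root by (metis (no_types, lifting) suminf_cong)

theorem solves_sfpe_endogenous: "solves_sfpe \<nu> \<kappa> (law_endogenous \<nu> \<kappa>)"
proof -
 interpret T: prob_space T by (rule T_prob)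
 have "distr T borel rsum = distr T borel (combine rsum)"
  by (rule distr_cong_AE) (use AE_combine_rsum rsum_measurable combine_measurable in auto)
 also have "\<dots> = sfpe_map (distr T borel rsum)" by (rule distr_combine[OF rsum_measurable root_free_rsum])
 finally show ?thesis
  unfolding solves_sfpe_def law_endogenous_eq sfpe_map_def using T.prob_space_distr[OF rsum_measurable] by simp
qed

theorem char_psum_limit: "(\<lambda>k. char (distr T borel (psum k)) s) \<longlonglongrightarrow> char (law_endogenous \<nu> \<kappa>) s"
proof -
 interpret T: prob_space T by (rule T_prob)
 have "(\<lambda>k. \<integral>x. cis (s*psum k x) \<partial>T) \<longlonglongrightarrow> (\<integral>x. cis (s * rsum x) \<partial>T)"
 proof (rule integral_dominated_convergence[where w = "\<lambda>_. 1"])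
  show "AE x in T. (\<lambda>k. cis (s*psum k x)) \<longlonglongrightarrow> cis (s * rsum x)"
   using AE_summable
  proof eventually_elim
   case (elim x)
   then have "(\<lambda>k. psum k x) \<longlonglongrightarrow> rsum x"
    unfolding psum_def rsum_def by (rule summable_LIMSEQ')
   moreover have "isCont cis y" for y
    using continuous_on_eq_continuous_at[OF open_UNIV, of cis] continuous_on_cis[OF continuous_on_id, of UNIV] by auto
   ultimately show ?case by (intro isCont_tendsto_compose[of _ cis] tendsto_mult tendsto_const)
  qed
 qed (use psum_measurable rsum_measurable in "auto intro!: cis_scale_measurable")
 then show ?thesis
  unfolding law_endogenous_eq char_distr[OF psum_measurable] char_distr[OF rsum_measurable] .
qed

lemma real_distribution_endogenous: "real_distribution (law_endogenous \<nu> \<kappa>)"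
proof -
 interpret T: prob_space T by (rule T_prob)
 show ?thesis unfolding law_endogenous_eq by (rule T.real_distribution_distr[OF rsum_measurable])
qed

end

section \<open>The limiting laws\<close>

lemma pois_mean_sums: "(\<lambda>k. real k*pois l k) sums l"
proof -
 have "(\<lambda>k. l*pois l k) sums (l*1)" by (intro sums_mult pois_sums)
 moreover have "l*pois l k = real (Suc k)*pois l (Suc k)" for k
 proof -
  have "real (Suc k)*(x/(real (Suc k)*z)) = x/z" for x z :: real by simp
  then show ?thesis by (simp add: pois_def mult_ac del: of_nat_Suc)
 qed
 ultimately have "(\<lambda>k. real (Suc k)*pois l (Suc k)) sums l" by (simp only: mult_1_right)
 then show ?thesis using sums_Suc_iff[of "\<lambda>k. real k*pois l k" l] by (simp only: of_nat_0 mult_zero_left add_0_right)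
qed

text \<open>Multiplying by the rate and dividing by \<open>k + 1\<close> shifts the Poisson weights
  by one index; this is what makes the mean offspring number cancel in
  \<open>contraction\<close>.\<close>

lemma pois_shift: "l*pois l k/(real k + 1) = pois l (Suc k)"
proof -
 have "x/(1 + real k) = x/real (Suc k)" for x by simp
 then show ?thesis by (simp add: pois_def mult_ac add.commute del: of_nat_Suc)
qed

lemma pois_power_sums:
 fixes z :: complex
 shows "(\<lambda>m. pois l m *\<^sub>R z ^ m) sums exp (l *\<^sub>R (z - 1))"
proof -
 have "(\<lambda>m. of_real (exp (- l))*((l *\<^sub>R z) ^ m /\<^sub>R fact m)) sums (of_real (exp (- l))*exp (l *\<^sub>R z))"
  by (intro sums_mult exp_converges)
 moreover have "of_real (exp (- l))*exp (l *\<^sub>R z) = exp (l *\<^sub>R (z - 1))"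
  unfolding exp_of_real[symmetric] exp_add[symmetric] by (simp add: scaleR_conv_of_real algebra_simps)
 moreover have "of_real (exp (- l))*((l *\<^sub>R z) ^ m /\<^sub>R fact m) = pois l m *\<^sub>R z ^ m" for m
  by (simp add: pois_def scaleR_conv_of_real power_mult_distrib field_simps)
 ultimately show ?thesis by simp
qed

locale type_law =
 fixes H :: "ext_type measure"
 assumes H: "prob_space H" "sets H = sets borel" and nonneg: "AE w in H. 0 \<le> w_in w \<and> 0 \<le> w_out w"
begin

sublocale H: prob_space H by (rule H)
sublocale NH: pair_sigma_finite "count_space (UNIV :: nat set)" H
 by (intro pair_sigma_finite.intro sigma_finite_measure_count_space H.sigma_finite_measure_axioms)

declare H(2) [measurable_cong]

text \<open>The density of a mixed Poisson pair weighted by \<open>v\<close>; it covers both limiting laws.\<close>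

definition wmixed :: "(ext_type => real) => (ext_type => real) => (nat \<times> ext_type) measure" where
 "wmixed rate v = density (count_space UNIV \<Otimes>\<^sub>M H) (\<lambda>x. ennreal (pois (rate (snd x)) (fst x) * v (snd x)))"

lemma pois_pair_measurable:
 assumes [measurable]: "rate \<in> borel_measurable borel"
 shows "(\<lambda>x. pois (rate (snd x)) (fst x)) \<in> borel_measurable (count_space UNIV \<Otimes>\<^sub>M H)"
 unfolding pois_def by measurable

lemma nn_integral_wmixed:
 assumes [measurable]: "rate \<in> borel_measurable borel" "v \<in> borel_measurable borel"
  and pos: "AE w in H. 0 \<le> rate w \<and> 0 \<le> v w"
  and g: "g \<in> borel_measurable (count_space UNIV \<Otimes>\<^sub>M H)"
 shows "(\<integral>\<^sup>+x. g x \<partial>wmixed rate v) = (\<integral>\<^sup>+w. (\<Sum>k. ennreal (pois (rate w) k * v w) * g (k, w)) \<partial>H)"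
proof -
 note [measurable] = pois_pair_measurable[OF assms(1)] g
 have "(\<integral>\<^sup>+x. g x \<partial>wmixed rate v) = (\<integral>\<^sup>+x. ennreal (pois (rate (snd x)) (fst x) * v (snd x)) * g x \<partial>(count_space UNIV \<Otimes>\<^sub>M H))"
  unfolding wmixed_def by (rule nn_integral_density) measurable
 also have "\<dots> = (\<integral>\<^sup>+w. \<integral>\<^sup>+k. ennreal (pois (rate w) k * v w) * g (k, w) \<partial>count_space UNIV \<partial>H)"
  by (subst NH.nn_integral_snd[symmetric]) (auto simp: case_prod_beta')
 finally show ?thesis by (simp add: nn_integral_count_space_nat)
qed

lemma AE_pair_nonneg:
 assumes [measurable]: "rate \<in> borel_measurable borel" "v \<in> borel_measurable borel"
  and pos: "AE w in H. 0 \<le> rate w \<and> 0 \<le> v w"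
 shows "AE x in count_space (UNIV :: nat set) \<Otimes>\<^sub>M H. 0 \<le> pois (rate (snd x)) (fst x) * v (snd x)"
proof -
 note [measurable] = pois_pair_measurable[OF assms(1)]
 show ?thesis
 proof (rule NH.AE_pair_measure)
  show "AE k in count_space (UNIV :: nat set). AE w in H. 0 \<le> pois (rate (snd (k, w))) (fst (k, w)) * v (snd (k, w))"
  proof (rule AE_I2)
   fix k :: nat
   show "AE w in H. 0 \<le> pois (rate (snd (k, w))) (fst (k, w)) * v (snd (k, w))"
    using pos by eventually_elim (simp add: pois_nonneg)
  qed
 qed measurable
qed

lemma integral_wmixed:
 fixes f :: "nat \<times> ext_type => complex"
 assumes rv [measurable]: "rate \<in> borel_measurable borel" "v \<in> borel_measurable borel"
  and pos: "AE w in H. 0 \<le> rate w \<and> 0 \<le> v w" and v: "integrable H v"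
  and f [measurable]: "f \<in> borel_measurable (count_space UNIV \<Otimes>\<^sub>M H)" and bound: "\<And>x. norm (f x) \<le> 1"
 shows "(\<integral>x. f x \<partial>wmixed rate v) = (\<integral>w. v w *\<^sub>R (\<Sum>k. pois (rate w) k *\<^sub>R f (k, w)) \<partial>H)"
proof -
 let ?A = "count_space UNIV"
 note [measurable] = pois_pair_measurable[OF rv(1)]
 let ?M = "count_space (UNIV :: nat set) \<Otimes>\<^sub>M H"
 let ?h = "\<lambda>x. (pois (rate (snd x)) (fst x) * v (snd x)) *\<^sub>R f x"
 have "(\<integral>x. f x \<partial>wmixed rate v) = (\<integral>x. ?h x \<partial>?M)"
  unfolding wmixed_def by (rule integral_density) (measurable, rule AE_pair_nonneg[OF rv pos])
 also have "integrable ?M ?h"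
 proof (rule integrableI_bounded)
  have "(\<integral>\<^sup>+x. ennreal (norm (?h x)) \<partial>?M) = (\<integral>\<^sup>+w. \<integral>\<^sup>+k. ennreal (norm (?h (k, w))) \<partial>?A \<partial>H)"
   by (subst NH.nn_integral_snd[symmetric]) (auto simp: case_prod_beta')
  also have "\<dots> \<le> (\<integral>\<^sup>+w. ennreal (v w) \<partial>H)"
  proof (rule nn_integral_mono_AE, use pos in eventually_elim)
   case (elim w)
   have "(\<integral>\<^sup>+k. ennreal (norm (?h (k, w))) \<partial>?A) = (\<Sum>k. ennreal (norm (?h (k, w))))"
    by (rule nn_integral_count_space_nat)
   also have "\<dots> \<le> (\<Sum>k. ennreal (v w*pois (rate w) k))"
   proof (intro suminf_le ennreal_leI)
    fix k
    have "norm (?h (k, w)) = v w*pois (rate w) k * norm (f (k, w))"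
     using elim by (simp add: pois_nonneg mult.commute)
    also have "\<dots> \<le> v w*pois (rate w) k*1"
     using elim bound by (intro mult_left_mono) (auto simp: pois_nonneg)
    finally show "norm (?h (k, w)) \<le> v w*pois (rate w) k" by simp
   qed auto
   also have "\<dots> = ennreal (\<Sum>k. v w*pois (rate w) k)"
    by (rule suminf_ennreal2) (use elim in "auto intro!: summable_mult summable_pois simp: pois_nonneg")
   also have "(\<Sum>k. v w*pois (rate w) k) = v w"
    using pois_sums[of "rate w"] by (simp add: suminf_mult summable_pois sums_iff)
   finally show ?case .
  qed
  also have "\<dots> < \<infinity>" using v pos by (intro nn_integral_eq_integral[THEN eq_refl, THEN le_less_trans]) auto
  finally show "(\<integral>\<^sup>+x. ennreal (norm (?h x)) \<partial>?M) < \<infinity>" .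
 qed measurable
 then have "(\<integral>x. ?h x \<partial>?M) = (\<integral>w. \<integral>k. ?h (k, w) \<partial>?A \<partial>H)"
  using NH.integral_snd[of "\<lambda>k w. ?h (k, w)"] by (simp add: case_prod_beta')
 also have "\<dots> = (\<integral>w. v w *\<^sub>R (\<Sum>k. pois (rate w) k *\<^sub>R f (k, w)) \<partial>H)"
 proof (rule integral_cong_AE)
  have 1: "(\<lambda>w. \<integral>k. ?h (k, w) \<partial>?A) \<in> borel_measurable H"
   by (rule sigma_finite_measure.borel_measurable_lebesgue_integral) (simp_all add: case_prod_beta' sigma_finite_measure_count_space)
  show "(\<lambda>w. \<integral>k. ?h (k, w) \<partial>?A) \<in> borel_measurable H" by (rule 1)
  show "(\<lambda>w. v w *\<^sub>R (\<Sum>k. pois (rate w) k *\<^sub>R f (k, w))) \<in> borel_measurable H" by measurable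
  show "AE w in H. (\<integral>k. ?h (k, w) \<partial>?A) = v w *\<^sub>R (\<Sum>k. pois (rate w) k *\<^sub>R f (k, w))"
   using pos
  proof eventually_elim
   case (elim w)
   have nb: "norm (pois (rate w) k *\<^sub>R f (k, w)) \<le> pois (rate w) k" for k
    using elim bound[of "(k, w)"] by (simp add: pois_nonneg mult_left_le)
   have sn: "summable (\<lambda>k. norm (pois (rate w) k *\<^sub>R f (k, w)))"
    by (rule summable_comparison_test'[OF summable_pois[of "rate w"], of 0]) (use nb in simp)
   then have s: "summable (\<lambda>k. pois (rate w) k *\<^sub>R f (k, w))" by (rule summable_norm_cancel)
   have "integrable ?A (\<lambda>k. ?h (k, w))"
    unfolding integrable_count_space_nat_iff
    using summable_mult[OF sn, of "abs (v w)"] by (simp add: abs_mult mult_ac)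
   then have "(\<integral>k. ?h (k, w) \<partial>?A) = (\<Sum>k. ?h (k, w))" by (rule integral_count_space_nat)
   also have "\<dots> = (\<Sum>k. v w *\<^sub>R (pois (rate w) k *\<^sub>R f (k, w)))" by (simp add: mult.commute)
   also have "\<dots> = v w *\<^sub>R (\<Sum>k. pois (rate w) k *\<^sub>R f (k, w))" by (rule suminf_scaleR_right[OF s, symmetric])
   finally show ?case .
  qed
 qed
 finally show ?thesis .
qed

end

section \<open>The two limiting laws, their contraction property and the recursion for the
  rank\<close>

locale pagerank_limit = type_law +
 fixes th c :: real
 assumes theta: "th > 0" and zeta: "AE w in H. abs (w_zeta w) \<le> c" and c: "0 \<le> c" "c < 1"
  and int_in: "integrable H w_in" and int_out: "integrable H w_out" and int_Q: "integrable H w_Q"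
  and out_pos: "0 < (\<integral>w. w_out w \<partial>H)"
begin

abbreviation "a \<equiv> \<integral>w. w_in w \<partial>H"
abbreviation "b \<equiv> \<integral>w. w_out w \<partial>H"

abbreviation "rN w \<equiv> b*w_in w/th"
abbreviation "rC w \<equiv> a*w_out w/th"

lemma a_nonneg: "0 \<le> a"
 by (rule integral_nonneg_AE) (use nonneg in auto)

lemma rates: "AE w in H. 0 \<le> rN w \<and> 0 \<le> (1::real)" "AE w in H. 0 \<le> rC w \<and> 0 \<le> w_out w/b"
 using nonneg theta out_pos a_nonneg by auto

lemma mixed_eq: "mixed_poisson_joint H rate = wmixed rate (\<lambda>_. 1)"
 by (simp add: mixed_poisson_joint_def wmixed_def pois_def case_prod_beta')

lemma law_NQ_eq: "law_NQ H th = distr (wmixed (\<lambda>w. rN w) (\<lambda>_. 1)) (count_space UNIV \<Otimes>\<^sub>M borel) (\<lambda>(m, w). (m, w_Q w))"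
 by (simp add: law_NQ_def mixed_eq)

lemma law_C_eq: "law_C H th = distr (wmixed (\<lambda>w. rC w) (\<lambda>w. w_out w/b)) borel (\<lambda>(k, w). w_zeta w/(real k + 1))"
proof -
 let ?rate = "\<lambda>w. rC w"
 let ?M = "count_space (UNIV :: nat set) \<Otimes>\<^sub>M H"
 have [measurable]: "(\<lambda>x. pois (?rate (snd x)) (fst x)) \<in> borel_measurable ?M" by (rule pois_pair_measurable) measurable
 have "density (wmixed ?rate (\<lambda>_. 1)) (\<lambda>(k, w). ennreal (w_out w/b)) = density ?M (\<lambda>x. ennreal (pois (?rate (snd x)) (fst x))*ennreal (w_out (snd x)/b))"
  unfolding wmixed_def by (subst density_density_eq) (auto simp: case_prod_beta')
 also have "\<dots> = wmixed ?rate (\<lambda>w. w_out w/b)"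
  unfolding wmixed_def
 proof (rule density_cong)
  show "AE x in ?M. ennreal (pois (?rate (snd x)) (fst x))*ennreal (w_out (snd x)/b) = ennreal (pois (?rate (snd x)) (fst x)*(w_out (snd x)/b))"
  proof (rule NH.AE_pair_measure)
   show "AE k in count_space (UNIV :: nat set). AE w in H. ennreal (pois (?rate (snd (k, w))) (fst (k, w)))*ennreal (w_out (snd (k, w))/b) = ennreal (pois (?rate (snd (k, w))) (fst (k, w))*(w_out (snd (k, w))/b))"
   proof (rule AE_I2)
    fix k :: nat
    show "AE w in H. ennreal (pois (?rate (snd (k, w))) (fst (k, w)))*ennreal (w_out (snd (k, w))/b) = ennreal (pois (?rate (snd (k, w))) (fst (k, w))*(w_out (snd (k, w))/b))"
     using rates(2)
    proof eventually_elim
     case (elim w)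
     then show ?case unfolding fst_conv snd_conv by (intro ennreal_mult[symmetric] pois_nonneg) auto
    qed
   qed
  qed measurable
 qed measurable
 finally show ?thesis by (simp add: law_C_def mixed_eq)
qed

lemma NQ_map: "(\<lambda>(m, w). (m, w_Q w)) \<in> wmixed rate v \<rightarrow>\<^sub>M count_space UNIV \<Otimes>\<^sub>M borel"
 unfolding wmixed_def by measurable

lemma C_map: "(\<lambda>(k, w). w_zeta w/(real k + 1)) \<in> borel_measurable (wmixed rate v)"
 unfolding wmixed_def by measurable

lemma nn_integral_NQ:
 assumes g: "g \<in> borel_measurable (count_space UNIV \<Otimes>\<^sub>M borel)"
 shows "(\<integral>\<^sup>+x. g x \<partial>law_NQ H th) = (\<integral>\<^sup>+w. (\<Sum>k. ennreal (pois (rN w) k) * g (k, w_Q w)) \<partial>H)"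
proof -
 have g': "(\<lambda>x. g (fst x, w_Q (snd x))) \<in> borel_measurable (count_space UNIV \<Otimes>\<^sub>M H)"
  by (rule measurable_compose[OF _ g]) measurable
 have "(\<integral>\<^sup>+x. g x \<partial>law_NQ H th) = (\<integral>\<^sup>+x. g (fst x, w_Q (snd x)) \<partial>wmixed (\<lambda>w. rN w) (\<lambda>_. 1))"
  unfolding law_NQ_eq by (subst nn_integral_distr[OF NQ_map]) (use g in "simp_all add: case_prod_beta'")
 also have "\<dots> = (\<integral>\<^sup>+w. (\<Sum>k. ennreal (pois (rN w) k*1) * g (fst (k, w), w_Q (snd (k, w)))) \<partial>H)"
  by (rule nn_integral_wmixed[OF _ _ rates(1) g']) measurable
 finally show ?thesis by simp
qed

lemma nn_integral_C:
 assumes g: "g \<in> borel_measurable borel"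
 shows "(\<integral>\<^sup>+x. g x \<partial>law_C H th) = (\<integral>\<^sup>+w. (\<Sum>k. ennreal (pois (rC w) k*(w_out w/b)) * g (w_zeta w/(real k + 1))) \<partial>H)"
proof -
 have g': "(\<lambda>x. g (w_zeta (snd x)/(real (fst x) + 1))) \<in> borel_measurable (count_space UNIV \<Otimes>\<^sub>M H)"
  by (rule measurable_compose[OF _ g]) measurable
 have "(\<integral>\<^sup>+x. g x \<partial>law_C H th) = (\<integral>\<^sup>+x. g (w_zeta (snd x)/(real (fst x) + 1)) \<partial>wmixed (\<lambda>w. rC w) (\<lambda>w. w_out w/b))"
  unfolding law_C_eq by (subst nn_integral_distr[OF C_map]) (use g in "simp_all add: case_prod_beta'")
 also have "\<dots> = (\<integral>\<^sup>+w. (\<Sum>k. ennreal (pois (rC w) k*(w_out w/b)) * g (w_zeta (snd (k, w))/(real (fst (k, w)) + 1))) \<partial>H)"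
  by (rule nn_integral_wmixed[OF _ _ rates(2) g']) measurable
 finally show ?thesis by simp
qed

lemma suminf_pois_ennreal: "0 \<le> l ==> 0 \<le> y ==> (\<Sum>k. ennreal (pois l k*y)) = ennreal y"
 by (subst suminf_ennreal2) (auto intro!: summable_mult2 summable_pois mult_nonneg_nonneg simp: pois_nonneg suminf_mult2[symmetric] summable_pois sums_unique[OF pois_sums, symmetric])

lemma law_NQ_prob: "prob_space (law_NQ H th)" "sets (law_NQ H th) = sets (count_space UNIV \<Otimes>\<^sub>M borel)"
proof
 let ?A = "law_NQ H th"
 have "emeasure ?A (space ?A) = (\<integral>\<^sup>+x. 1 \<partial>?A)" by simp
 also have "\<dots> = (\<integral>\<^sup>+w. (\<Sum>k. ennreal (pois (rN w) k)*1) \<partial>H)"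
  by (rule nn_integral_NQ) simp
 also have "\<dots> = (\<integral>\<^sup>+w. 1 \<partial>H)"
 proof (rule nn_integral_cong_AE)
  show "AE w in H. (\<Sum>k. ennreal (pois (rN w) k)*1) = 1"
   using rates(1)
  proof eventually_elim
   case (elim w)
   then show ?case using suminf_pois_ennreal[of "rN w" 1] by simp
  qed
 qed
 finally show "emeasure ?A (space ?A) = 1" by (simp add: H.emeasure_space_1)
qed (simp add: law_NQ_def)

lemma law_C_prob: "prob_space (law_C H th)" "sets (law_C H th) = sets borel"
proof
 have "emeasure (law_C H th) (space (law_C H th)) = (\<integral>\<^sup>+x. 1 \<partial>law_C H th)" by simp
 also have "\<dots> = (\<integral>\<^sup>+w. (\<Sum>k. ennreal (pois (rC w) k*(w_out w/b))*1) \<partial>H)"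
  by (rule nn_integral_C) simp
 also have "\<dots> = (\<integral>\<^sup>+w. ennreal (w_out w/b) \<partial>H)"
 proof (rule nn_integral_cong_AE)
  show "AE w in H. (\<Sum>k. ennreal (pois (rC w) k*(w_out w/b))*1) = ennreal (w_out w/b)"
   using rates(2)
  proof eventually_elim
   case (elim w)
   then show ?case unfolding mult_1_right by (intro suminf_pois_ennreal) auto
  qed
 qed
 also have "\<dots> = ennreal (\<integral>w. w_out w/b \<partial>H)"
  by (rule nn_integral_eq_integral) (use int_out rates(2) in auto)
 also have "\<dots> = 1" using out_pos by simp
 finally show "emeasure (law_C H th) (space (law_C H th)) = 1" .
qed (simp add: law_C_def)

lemma mean_N: "(\<integral>\<^sup>+x. of_nat (fst x) \<partial>law_NQ H th) = ennreal (a*b/th)"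
proof -
 have "(\<integral>\<^sup>+x. of_nat (fst x) \<partial>law_NQ H th) = (\<integral>\<^sup>+w. (\<Sum>k. ennreal (pois (rN w) k) * of_nat k) \<partial>H)"
  by (subst nn_integral_NQ) auto
 also have "\<dots> = (\<integral>\<^sup>+w. ennreal (rN w) \<partial>H)"
 proof (rule nn_integral_cong_AE, use rates(1) in eventually_elim)
  case (elim w)
  have "(\<Sum>k. ennreal (pois (rN w) k) * of_nat k) = (\<Sum>k. ennreal (real k*pois (rN w) k))"
   by (intro suminf_cong) (use elim in "simp add: ennreal_mult ennreal_of_nat_eq_real_of_nat pois_nonneg mult.commute")
  also have "\<dots> = ennreal (rN w)"
   using pois_mean_sums[of "rN w"] elim by (subst suminf_ennreal2) (auto simp: sums_iff pois_nonneg)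
  finally show ?case .
 qed
 also have "\<dots> = ennreal (\<integral>w. rN w \<partial>H)"
  by (rule nn_integral_eq_integral) (use int_in rates(1) in auto)
 finally show ?thesis by (simp add: mult.commute)
qed

text \<open>The mean offspring number \<open>a b/th\<close> may be large, but it turns the size bias
  \<open>w_out/b\<close> into the Poisson rate of the out-degree, and the factor
  \<open>1/(k + 1)\<close> in the weight shifts the Poisson weights from \<open>k\<close> to
  \<open>k + 1\<close>. What remains is at most \<open>c\<close> times the probability that a
  Poisson variable is positive.\<close>

lemma contraction:
 "(\<integral>\<^sup>+x. of_nat (fst x) \<partial>law_NQ H th)*(\<integral>\<^sup>+x. ennreal (abs x) \<partial>law_C H th) \<le> ennreal c"
proof -
 let ?A = "a*b/th"
 have "(\<integral>\<^sup>+x. of_nat (fst x) \<partial>law_NQ H th)*(\<integral>\<^sup>+x. ennreal (abs x) \<partial>law_C H th)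
  = (\<integral>\<^sup>+w. ennreal ?A*(\<Sum>k. ennreal (pois (rC w) k*(w_out w/b))*ennreal (abs (w_zeta w/(real k + 1)))) \<partial>H)"
  unfolding mean_N by (subst nn_integral_C, simp, subst nn_integral_cmult) (auto simp: pois_def)
 also have "\<dots> \<le> (\<integral>\<^sup>+w. ennreal c \<partial>H)"
 proof (rule nn_integral_mono_AE, use rates(2) zeta nonneg in eventually_elim)
  case (elim w)
  let ?l = "rC w"
  have "ennreal ?A*(\<Sum>k. ennreal (pois ?l k*(w_out w/b))*ennreal (abs (w_zeta w/(real k + 1))))
   = (\<Sum>k. ennreal ?A*(ennreal (pois ?l k*(w_out w/b))*ennreal (abs (w_zeta w/(real k + 1)))))"
   by simp
  also have "\<dots> = (\<Sum>k. ennreal (pois ?l (Suc k)*abs (w_zeta w)))"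
  proof (rule suminf_cong)
   fix k
   have "ennreal ?A*(ennreal (pois ?l k*(w_out w/b))*ennreal (abs (w_zeta w/(real k + 1))))
     = ennreal (?A*((pois ?l k*(w_out w/b))*(abs (w_zeta w)/(real k + 1))))"
    using elim theta out_pos a_nonneg by (subst ennreal_mult[symmetric] | simp add: pois_nonneg)+
   also have "?A*((pois ?l k*(w_out w/b))*(abs (w_zeta w)/(real k + 1))) = (?l*pois ?l k/(real k + 1))*abs (w_zeta w)"
   proof -
    have "(a*y/th)*((p*(x/y))*(z/k')) = (a*x/th*p/k')*z" if "y \<noteq> 0" for p x y z k' :: real
     using that by simp
    then show ?thesis using out_pos by simp
   qed
   finally show "ennreal ?A*(ennreal (pois ?l k*(w_out w/b))*ennreal (abs (w_zeta w/(real k + 1)))) = ennreal (pois ?l (Suc k)*abs (w_zeta w))"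
    by (simp only: pois_shift)
  qed
  also have "\<dots> \<le> (\<Sum>k. ennreal (pois ?l k*c)) "
  proof -
   have "(\<Sum>k. ennreal (pois ?l (Suc k)*abs (w_zeta w))) \<le> (\<Sum>k. ennreal (pois ?l (Suc k)*c))"
    using elim by (intro suminf_le ennreal_leI mult_left_mono) (auto simp: pois_nonneg)
   also have "\<dots> \<le> (\<Sum>k. ennreal (pois ?l k*c))"
    using suminf_offset[of "\<lambda>k. ennreal (pois ?l k*c)" 1] by simp
   finally show ?thesis .
  qed
  also have "\<dots> = ennreal c" by (rule suminf_pois_ennreal) (use elim c in auto)
  finally show ?case .
 qed
 finally show ?thesis by (simp add: H.emeasure_space_1)
qed

lemma mean_Q: "(\<integral>\<^sup>+x. ennreal (abs (snd x)) \<partial>law_NQ H th) < \<infinity>"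
proof -
 have "(\<integral>\<^sup>+x. ennreal (abs (snd x)) \<partial>law_NQ H th) = (\<integral>\<^sup>+w. (\<Sum>k. ennreal (pois (rN w) k)*ennreal (abs (w_Q w))) \<partial>H)"
  by (subst nn_integral_NQ) auto
 also have "\<dots> = (\<integral>\<^sup>+w. ennreal (abs (w_Q w)) \<partial>H)"
 proof (rule nn_integral_cong_AE, use rates(1) in eventually_elim)
  case (elim w)
  then have "(\<Sum>k. ennreal (pois (rN w) k)*ennreal (abs (w_Q w))) = (\<Sum>k. ennreal (pois (rN w) k*abs (w_Q w)))"
   by (intro suminf_cong) (simp add: ennreal_mult pois_nonneg)
  then show ?case using suminf_pois_ennreal[of "rN w" "abs (w_Q w)"] elim by simp
 qed
 also have "\<dots> < \<infinity>" using int_Q by (simp add: integrable_iff_bounded)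
 finally show ?thesis .
qed

sublocale tree: contractive_tree "law_NQ H th" "law_C H th" c
 by (intro contractive_tree.intro iid_tree.intro contractive_tree_axioms.intro law_NQ_prob law_C_prob c contraction mean_Q)

lemma integral_NQ:
 fixes g :: "nat \<times> real => complex"
 assumes g: "g \<in> borel_measurable (count_space UNIV \<Otimes>\<^sub>M borel)" and bound: "\<And>x. norm (g x) \<le> 1"
 shows "(\<integral>x. g x \<partial>law_NQ H th) = (\<integral>w. (\<Sum>k. pois (rN w) k *\<^sub>R g (k, w_Q w)) \<partial>H)"
proof -
 have g': "(\<lambda>x. g (fst x, w_Q (snd x))) \<in> borel_measurable (count_space UNIV \<Otimes>\<^sub>M H)"
  by (rule measurable_compose[OF _ g]) measurable
 have "(\<integral>x. g x \<partial>law_NQ H th) = (\<integral>x. g (fst x, w_Q (snd x)) \<partial>wmixed (\<lambda>w. rN w) (\<lambda>_. 1))"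
  unfolding law_NQ_eq by (subst integral_distr[OF NQ_map g]) (simp add: case_prod_beta')
 also have "\<dots> = (\<integral>w. 1 *\<^sub>R (\<Sum>k. pois (rN w) k *\<^sub>R g (fst (k, w), w_Q (snd (k, w)))) \<partial>H)"
  by (rule integral_wmixed[OF _ _ rates(1) _ g']) (use bound in auto)
 finally show ?thesis by simp
qed

lemma integral_C:
 fixes g :: "real => complex"
 assumes g: "g \<in> borel_measurable borel" and bound: "\<And>x. norm (g x) \<le> 1"
 shows "(\<integral>x. g x \<partial>law_C H th) = (\<integral>w. (w_out w/b) *\<^sub>R (\<Sum>k. pois (rC w) k *\<^sub>R g (w_zeta w/(1 + real k))) \<partial>H)"
proof -
 have g': "(\<lambda>x. g (w_zeta (snd x)/(real (fst x) + 1))) \<in> borel_measurable (count_space UNIV \<Otimes>\<^sub>M H)"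
  by (rule measurable_compose[OF _ g]) measurable
 have "(\<integral>x. g x \<partial>law_C H th) = (\<integral>x. g (w_zeta (snd x)/(real (fst x) + 1)) \<partial>wmixed (\<lambda>w. rC w) (\<lambda>w. w_out w/b))"
  unfolding law_C_eq by (subst integral_distr[OF C_map g]) (simp add: case_prod_beta')
 also have "\<dots> = (\<integral>w. (w_out w/b) *\<^sub>R (\<Sum>k. pois (rC w) k *\<^sub>R g (w_zeta (snd (k, w))/(real (fst (k, w)) + 1))) \<partial>H)"
  by (rule integral_wmixed[OF _ _ rates(2) _ g']) (use bound int_out in auto)
 finally show ?thesis by (simp add: add.commute)
qed

text \<open>At the root only \<open>(w_in, w_Q)\<close> matters; \<open>w_out\<close> and
  \<open>w_zeta\<close> act solely through the passing on of the rank in \<open>offspring\<close>.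
  This is the splitting of the type that the independence hypothesis respects.\<close>

lemma psi_root: "psi H th r s (w_in u, y, w_Q u, z) = psi H th r s u"
 by (cases r) (simp_all add: w_in_def w_Q_def)

lemma psi_section_measurable [measurable]: "psi H th r s \<in> borel_measurable borel"
 using measurable_compose[OF measurable_Pair1' psi_measurable[OF H], of s] by simp

lemma offspring_section_measurable [measurable]: "offspring H th (psi H th r) s \<in> borel_measurable borel"
 using measurable_compose[OF measurable_Pair1' offspring_measurable[OF psi_measurable[OF H]], of s] by simp

lemma psi_bound: "0 \<le> w_in u ==> norm (psi H th r s u) \<le> 1"
 by (rule norm_psi_le[OF H nonneg theta])

lemma integrable_offspring: "integrable H (\<lambda>v. w_out v *\<^sub>R offspring H th (psi H th r) s v)"
proof (rule Bochner_Integration.integrable_bound[where f = "\<lambda>v. 2*w_out v"])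
 show "AE v in H. norm (w_out v *\<^sub>R offspring H th (psi H th r) s v) \<le> norm (2*w_out v)"
  using nonneg
 proof eventually_elim
  case (elim v)
  then have "norm (offspring H th (psi H th r) s v) \<le> 2"
   by (intro offspring_bounds(2)[OF H nonneg theta]) (auto intro: psi_bound)
  then have "w_out v * norm (offspring H th (psi H th r) s v) \<le> w_out v * 2" using elim by (intro mult_left_mono) auto
  then show ?case using elim by (simp add: mult.commute)
 qed
 show "integrable H (\<lambda>v. 2*w_out v)" using int_out by simp
qed measurable

definition Psi :: "nat => real => complex" where
 "Psi r s = (\<integral>u. psi H th r s u \<partial>H)"

lemma integrable_psi: "integrable H (psi H th r s)"
 by (rule H.integrable_const_bound[where B = 1]) (use nonneg psi_bound in auto)

lemma norm_Psi_le: "norm (Psi r s) \<le> 1"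
proof -
 have "norm (Psi r s) \<le> (\<integral>u. norm (psi H th r s u) \<partial>H)" unfolding Psi_def by (rule integral_norm_bound)
 also have "\<dots> \<le> (\<integral>u. 1 \<partial>H)"
  by (rule integral_mono_AE) (use integrable_psi nonneg psi_bound in "auto intro: integrable_norm")
 finally show ?thesis by (simp add: H.prob_space)
qed

lemma Psi_measurable: "Psi r \<in> borel_measurable borel"
 unfolding Psi_def[abs_def] by (rule H.borel_measurable_lebesgue_integral) (use psi_measurable[OF H, of th r] in "simp add: case_prod_beta'")

context
 assumes indep: "H.indep_var borel (\<lambda>w. (w_in w, w_Q w)) borel (\<lambda>w. (w_out w, w_zeta w))"
begin

text \<open>The independence assumption decouples the size bias of a parent from its offspring.\<close>

lemma integral_resample:
 fixes g :: "ext_type => complex"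
 assumes g: "g \<in> borel_measurable borel" and int: "integrable H g"
 shows "(\<integral>v. g v \<partial>H) = (\<integral>v. \<integral>u. g (w_in u, w_out v, w_Q u, w_zeta v) \<partial>H \<partial>H)"
proof -
 let ?A = "borel \<Otimes>\<^sub>M borel"
 let ?X = "\<lambda>w. (w_in w, w_Q w)" and ?Y = "\<lambda>w. (w_out w, w_zeta w)"
 let ?D = "distr H borel ?X" and ?D' = "distr H borel ?Y"
 have X: "?X \<in> H \<rightarrow>\<^sub>M borel" and Y: "?Y \<in> H \<rightarrow>\<^sub>M borel"
  and eq: "?D \<Otimes>\<^sub>M ?D' = distr H ?A (\<lambda>x. (?X x, ?Y x))"
  using indep unfolding H.indep_var_distribution_eq by auto
 interpret D: prob_space ?D by (rule H.prob_space_distr[OF X])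
 interpret D': prob_space ?D' by (rule H.prob_space_distr[OF Y])
 interpret P: pair_sigma_finite ?D ?D' ..
 define F :: "(real \<times> real) \<times> (real \<times> real) => complex" where "F x = g (fst (fst x), fst (snd x), snd (fst x), snd (snd x))" for x
 have F: "F \<in> borel_measurable ?A"
  unfolding F_def by (rule measurable_compose[OF _ g]) (auto intro!: borel_measurable_continuous_onI continuous_intros simp: borel_prod)
 have XY: "(\<lambda>x. (?X x, ?Y x)) \<in> H \<rightarrow>\<^sub>M borel \<Otimes>\<^sub>M borel" using X Y by measurable
 have gF: "F (?X w, ?Y w) = g w" for w
  by (simp add: F_def w_in_def w_out_def w_Q_def w_zeta_def)
 have intF: "integrable (?D \<Otimes>\<^sub>M ?D') F"
  unfolding eq by (subst integrable_distr_eq[OF XY F]) (use int in "simp only: gF")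
 have "(\<integral>v. g v \<partial>H) = (\<integral>x. F x \<partial>distr H ?A (\<lambda>x. (?X x, ?Y x)))"
  by (subst integral_distr[OF XY F]) (simp only: gF)
 also have "\<dots> = (\<integral>x. F x \<partial>(?D \<Otimes>\<^sub>M ?D'))" by (simp only: eq)
 also have "\<dots> = (\<integral>y. \<integral>x. F (x, y) \<partial>?D \<partial>?D')"
  using P.integral_snd[of "\<lambda>x y. F (x, y)"] intF by simp
 also have "\<dots> = (\<integral>v. \<integral>x. F (x, ?Y v) \<partial>?D \<partial>H)"
  by (rule integral_distr[OF Y], rule D.borel_measurable_lebesgue_integral)
    (use measurable_compose[OF measurable_pair_swap' F] in "simp add: case_prod_beta' F_def")
 also have "\<dots> = (\<integral>v. \<integral>u. F (?X u, ?Y v) \<partial>H \<partial>H)"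
  by (intro Bochner_Integration.integral_cong refl integral_distr[OF X] measurable_compose[OF _ F]) auto
 finally show ?thesis by (simp add: F_def)
qed

text \<open>Once \<open>(w_in, w_Q)\<close> is resampled independently of
  \<open>(w_out, w_zeta)\<close>, the factor \<open>psi\<close> can be averaged to
  \<open>Psi\<close> under the sum over the out-degree. What is left is the mean of
  \<open>Psi\<close> over the size-biased law of the weights, with total mass
  \<open>b\<close>.\<close>

lemma offspring_decoupled:
 "(\<integral>v. w_out v *\<^sub>R offspring H th (psi H th r) s v \<partial>H) = b *\<^sub>R ((\<integral>x. Psi r (s*x) \<partial>law_C H th) - 1)"
proof -
 let ?A = "psi H th r"
 let ?l = "\<lambda>v. rC v"
 let ?S = "\<lambda>v. \<Sum>m. pois (?l v) m *\<^sub>R Psi r (s*(w_zeta v/(1 + real m)))"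
 have inner: "(\<integral>u. w_out v *\<^sub>R offspring H th ?A s (w_in u, w_out v, w_Q u, w_zeta v) \<partial>H) = w_out v *\<^sub>R (?S v - 1)"
  if v: "0 \<le> w_out v" for v
 proof -
  have l: "0 \<le> ?l v" using v a_nonneg theta by simp
  let ?t = "\<lambda>m u. pois (?l v) m *\<^sub>R (psi H th r (s*(w_zeta v/(1 + real m))) u - 1)"
  have off: "offspring H th ?A s (w_in u, w_out v, w_Q u, w_zeta v) = (\<Sum>m. ?t m u)" for u
   unfolding offspring_def psi_root by (simp add: w_out_def w_zeta_def)
  have bt: "norm (?t m u) \<le> 2*pois (?l v) m" if "0 \<le> w_in u" for m u
   by (rule norm_pois_scale_le[OF l psi_bound[OF that]])
  have intt: "integrable H (?t m)" for m
   using integrable_psi by auto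
  have "(\<integral>u. (\<Sum>m. ?t m u) \<partial>H) = (\<Sum>m. \<integral>u. ?t m u \<partial>H)"
  proof (rule integral_suminf[OF intt])
   show "AE u in H. summable (\<lambda>m. norm (?t m u))"
    using nonneg
   proof eventually_elim
    case (elim u)
    show ?case
     by (rule summable_comparison_test'[OF summable_mult[OF summable_pois[of "?l v"], of 2], of 0]) (use bt elim in simp)
   qed
   show "summable (\<lambda>m. \<integral>u. norm (?t m u) \<partial>H)"
   proof (rule summable_comparison_test'[OF summable_mult[OF summable_pois[of "?l v"], of 2], of 0])
    fix m
    have "(\<integral>u. norm (?t m u) \<partial>H) \<le> (\<integral>u. 2*pois (?l v) m \<partial>H)"
    proof (rule integral_mono_AE[OF integrable_norm[OF intt]])
     show "AE u in H. norm (?t m u) \<le> 2*pois (?l v) m"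
      using nonneg by eventually_elim (rule bt, simp)
    qed simp
    then show "norm (\<integral>u. norm (?t m u) \<partial>H) \<le> 2*pois (?l v) m"
     by (simp add: H.prob_space)
   qed
  qed
  also have "\<dots> = (\<Sum>m. pois (?l v) m *\<^sub>R Psi r (s*(w_zeta v/(1 + real m))) - pois (?l v) m *\<^sub>R 1)"
   by (rule suminf_cong) (simp add: integrable_psi Psi_def H.prob_space scaleR_diff_right)
  also have "\<dots> = ?S v - (\<Sum>m. pois (?l v) m *\<^sub>R 1)"
  proof (rule suminf_diff[symmetric])
   show "summable (\<lambda>m. pois (?l v) m *\<^sub>R Psi r (s*(w_zeta v/(1 + real m))))"
    by (rule summable_comparison_test'[OF summable_pois[of "?l v"], of 0]) (use l norm_Psi_le in "simp add: pois_nonneg mult_left_le")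
   show "summable (\<lambda>m. pois (?l v) m *\<^sub>R (1 :: complex))"
    by (intro summable_scaleR_left summable_pois)
  qed
  also have "(\<Sum>m. pois (?l v) m *\<^sub>R (1 :: complex)) = 1"
   using sums_scaleR_left[OF pois_sums[of "?l v"], of "1 :: complex"] by (simp add: sums_iff)
  finally show ?thesis unfolding off integral_scaleR_right by simp
 qed
 have S_meas: "?S \<in> borel_measurable borel"
  using Psi_measurable by (auto intro!: borel_measurable_suminf borel_measurable_scaleR measurable_compose[OF _ Psi_measurable] measurable_compose[OF _ pois_measurable])
 have S_bound: "norm (?S v) \<le> 1" if "0 \<le> w_out v" for v
 proof -
  have l: "0 \<le> ?l v" using that a_nonneg theta by simp
  have "norm (?S v) \<le> (\<Sum>m. pois (?l v) m)"
   by (rule norm_suminf_le) (use l norm_Psi_le in "auto simp: pois_nonneg mult_left_le summable_pois")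
  then show ?thesis using pois_sums[of "?l v"] by (simp add: sums_iff)
 qed
 have intS: "integrable H (\<lambda>v. w_out v *\<^sub>R ?S v)"
 proof (rule Bochner_Integration.integrable_bound[OF int_out])
  show "(\<lambda>v. w_out v *\<^sub>R ?S v) \<in> borel_measurable H" using S_meas by measurable
  show "AE v in H. norm (w_out v *\<^sub>R ?S v) \<le> norm (w_out v)"
   using nonneg by eventually_elim (use S_bound in "simp add: mult_left_le")
 qed
 have C: "(\<integral>x. Psi r (s*x) \<partial>law_C H th) = (\<integral>w. (w_out w/b) *\<^sub>R ?S w \<partial>H)"
  by (rule integral_C) (use norm_Psi_le Psi_measurable in "auto intro!: measurable_compose[OF _ Psi_measurable]")
 have "(\<integral>v. w_out v *\<^sub>R offspring H th ?A s v \<partial>H)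
   = (\<integral>v. \<integral>u. w_out (w_in u, w_out v, w_Q u, w_zeta v) *\<^sub>R offspring H th ?A s (w_in u, w_out v, w_Q u, w_zeta v) \<partial>H \<partial>H)"
  by (rule integral_resample) (measurable, rule integrable_offspring)
 also have "\<dots> = (\<integral>v. \<integral>u. w_out v *\<^sub>R offspring H th ?A s (w_in u, w_out v, w_Q u, w_zeta v) \<partial>H \<partial>H)"
  by (simp add: w_out_def)
 also have "\<dots> = (\<integral>v. w_out v *\<^sub>R (?S v - 1) \<partial>H)"
 proof (rule integral_cong_AE)
  show "AE v in H. (\<integral>u. w_out v *\<^sub>R offspring H th ?A s (w_in u, w_out v, w_Q u, w_zeta v) \<partial>H) = w_out v *\<^sub>R (?S v - 1)"
   using nonneg by eventually_elim (rule inner, simp)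
  show "(\<lambda>v. w_out v *\<^sub>R (?S v - 1)) \<in> borel_measurable H" using S_meas by measurable
  show "(\<lambda>v. \<integral>u. w_out v *\<^sub>R offspring H th ?A s (w_in u, w_out v, w_Q u, w_zeta v) \<partial>H) \<in> borel_measurable H"
  proof (rule H.borel_measurable_lebesgue_integral)
   have "(\<lambda>x. (w_in (snd x), w_out (fst x), w_Q (snd x), w_zeta (fst x))) \<in> H \<Otimes>\<^sub>M H \<rightarrow>\<^sub>M borel"
    unfolding borel_prod[symmetric] by measurable
   from measurable_compose[OF this offspring_section_measurable]
   show "(\<lambda>(v, u). w_out v *\<^sub>R offspring H th ?A s (w_in u, w_out v, w_Q u, w_zeta v)) \<in> borel_measurable (H \<Otimes>\<^sub>M H)"
    unfolding case_prod_beta' by measurable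
  qed
 qed
 also have "\<dots> = (\<integral>v. w_out v *\<^sub>R ?S v - w_out v *\<^sub>R 1 \<partial>H)" by (simp only: scaleR_diff_right)
 also have "\<dots> = (\<integral>v. w_out v *\<^sub>R ?S v \<partial>H) - (\<integral>v. w_out v *\<^sub>R 1 \<partial>H)"
  by (rule Bochner_Integration.integral_diff[OF intS]) (use int_out in auto)
 also have "(\<integral>v. w_out v *\<^sub>R (1 :: complex) \<partial>H) = b *\<^sub>R 1"
  using int_out by simp
 also have "(\<integral>v. w_out v *\<^sub>R ?S v \<partial>H) = b *\<^sub>R (\<integral>x. Psi r (s*x) \<partial>law_C H th)"
  unfolding C integral_scaleR_right[symmetric] using out_pos by simp
 finally show ?thesis by (simp only: scaleR_diff_right)
qed

text \<open>The exponential in \<open>psi\<close> is the generating function of the Poisson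
  offspring number evaluated at the mean \<open>z\<close> over the weights, so \<open>Psi\<close>
  obeys the recursion \<open>char_psum_Suc\<close> with the same initial value.\<close>

theorem Psi_eq_char: "Psi r s = char (distr tree.T borel (tree.psum r)) s"
proof (induction r arbitrary: s)
 case 0
 have g: "(\<lambda>x. cis (s * snd x)) \<in> borel_measurable (count_space UNIV \<Otimes>\<^sub>M borel)"
  by (intro cis_scale_measurable) measurable
 have "char (distr tree.T borel (tree.psum 0)) s = (\<integral>w. (\<Sum>k. pois (rN w) k *\<^sub>R cis (s * snd (k, w_Q w))) \<partial>H)"
  unfolding tree.char_psum_0 by (rule integral_NQ[OF g]) simp
 also have "\<dots> = Psi 0 s"
  unfolding Psi_def psi.simps
 proof (rule Bochner_Integration.integral_cong[OF refl])
  fix w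
  show "(\<Sum>k. pois (rN w) k *\<^sub>R cis (s * snd (k, w_Q w))) = cis (s*w_Q w)"
   using sums_scaleR_left[OF pois_sums[of "rN w"], of "cis (s*w_Q w)"] by (simp add: sums_iff)
 qed
 finally show ?case by simp
next
 case (Suc r)
 define z where "z = (\<integral>x. Psi r (s*x) \<partial>law_C H th)"
 have z: "z = (\<integral>x. char (distr tree.T borel (tree.psum r)) (s*x) \<partial>law_C H th)"
  unfolding z_def by (simp only: Suc)
 have nz: "norm z \<le> 1"
  unfolding z_def by (rule norm_prob_integral_le[OF law_C_prob(1) norm_Psi_le])
 have g: "(\<lambda>x. cis (s * snd x)*z ^ fst x) \<in> borel_measurable (count_space UNIV \<Otimes>\<^sub>M borel)"
  by (intro borel_measurable_times cis_scale_measurable measurable_compose[OF measurable_fst]) auto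
 have "char (distr tree.T borel (tree.psum (Suc r))) s = (\<integral>w. (\<Sum>k. pois (rN w) k *\<^sub>R (cis (s * snd (k, w_Q w))*z ^ fst (k, w_Q w))) \<partial>H)"
  unfolding tree.char_psum_Suc z[symmetric]
  by (rule integral_NQ[OF g]) (use nz in "simp add: norm_mult norm_power power_le_one")
 also have "\<dots> = (\<integral>w. psi H th (Suc r) s w \<partial>H)"
 proof (rule Bochner_Integration.integral_cong[OF refl])
  fix w
  let ?l = "rN w"
  have "(\<lambda>k. cis (s*w_Q w)*(pois ?l k *\<^sub>R z ^ k)) sums (cis (s*w_Q w)*exp (?l *\<^sub>R (z - 1)))"
   by (intro sums_mult pois_power_sums)
  then have "(\<Sum>k. pois ?l k *\<^sub>R (cis (s * snd (k, w_Q w))*z ^ fst (k, w_Q w))) = cis (s*w_Q w)*exp (?l *\<^sub>R (z - 1))"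
   by (simp add: sums_iff)
  also have "?l *\<^sub>R (z - 1) = (w_in w/th) *\<^sub>R (b *\<^sub>R (z - 1))" by simp
  finally show "(\<Sum>k. pois ?l k *\<^sub>R (cis (s * snd (k, w_Q w))*z ^ fst (k, w_Q w))) = psi H th (Suc r) s w"
   by (simp only: psi.simps offspring_decoupled z_def)
 qed
 finally show ?case by (simp add: Psi_def)
qed

end

end

section \<open>Discretization of the types\<close>

lemma tendsto_components:
 assumes "(u \<longlongrightarrow> v) F"
 shows "((\<lambda>x. w_in (u x)) \<longlongrightarrow> w_in v) F" "((\<lambda>x. w_out (u x)) \<longlongrightarrow> w_out v) F"
  "((\<lambda>x. w_Q (u x)) \<longlongrightarrow> w_Q v) F" "((\<lambda>x. w_zeta (u x)) \<longlongrightarrow> w_zeta v) F"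
 unfolding w_in_def w_out_def w_Q_def w_zeta_def using assms by (auto intro!: tendsto_intros)

lemma tendsto_cis: "(f \<longlongrightarrow> l) F ==> ((\<lambda>x. cis (f x)) \<longlongrightarrow> cis l) F"
 by (rule isCont_tendsto_compose[of _ cis])
   (use continuous_on_eq_continuous_at[OF open_UNIV, of cis] continuous_on_cis[OF continuous_on_id, of UNIV] in auto)

text \<open>The conditions with absolute values express rounding toward zero: the distance moved
  equals the loss of absolute value. An average rounding error is then a difference of two averages
  with known limits, which takes the place of a uniform integrability argument for the
  types.\<close>

locale discretization = type_law +
 fixes d :: "nat => ext_type => ext_type"
 assumes d_measurable [measurable]: "\<And>m. d m \<in> borel_measurable borel"
  and d_limit: "\<And>v. (\<lambda>m. d m v) \<longlonglongrightarrow> v"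
  and d_nonneg: "\<And>m v. 0 \<le> w_in v \<and> 0 \<le> w_out v ==> 0 \<le> w_in (d m v) \<and> 0 \<le> w_out (d m v)"
  and d_in: "\<And>m v. abs (w_in v - w_in (d m v)) = abs (w_in v) - abs (w_in (d m v))"
  and d_out: "\<And>m v. abs (w_out v - w_out (d m v)) = abs (w_out v) - abs (w_out (d m v))"
  and d_Q: "\<And>m v. abs (w_Q v - w_Q (d m v)) = abs (w_Q v) - abs (w_Q (d m v))"
  and d_zeta: "\<And>m v. abs (w_zeta v - w_zeta (d m v)) = abs (w_zeta v) - abs (w_zeta (d m v))"
  and d_finite: "\<And>m. finite (range (d m))"
begin

abbreviation "Hd m \<equiv> distr H borel (d m)"

lemma d_H: "d m \<in> H \<rightarrow>\<^sub>M borel"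
 by measurable

lemma Hd_prob: "prob_space (Hd m)"
 by (rule H.prob_space_distr[OF d_H])

lemma Hd_nonneg: "AE v in Hd m. 0 \<le> w_in v \<and> 0 \<le> w_out v"
proof -
 have "AE v in H. 0 \<le> w_in (d m v) \<and> 0 \<le> w_out (d m v)"
  using nonneg by eventually_elim (rule d_nonneg)
 then show ?thesis by (subst AE_distr_iff[OF d_H]) (simp_all, measurable)
qed

lemma integral_Hd: "f \<in> borel_measurable borel ==> (\<integral>v. f v \<partial>Hd m) = (\<integral>v. f (d m v) \<partial>H)"
 for f :: "ext_type => 'b::{banach, second_countable_topology}"
 by (rule integral_distr[OF d_H])

lemma component_integral_limit:
 fixes C :: "ext_type => real"
 assumes [measurable]: "C \<in> borel_measurable borel" and int: "integrable H C"
  and lim: "\<And>v. (\<lambda>m. C (d m v)) \<longlonglongrightarrow> C v" and le: "\<And>m v. abs (C v - C (d m v)) = abs (C v) - abs (C (d m v))"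
 shows "(\<lambda>m. \<integral>v. C (d m v) \<partial>H) \<longlonglongrightarrow> (\<integral>v. C v \<partial>H)" "(\<lambda>m. \<integral>v. abs (C v - C (d m v)) \<partial>H) \<longlonglongrightarrow> 0"
proof -
 let ?A = "\<lambda>m. \<integral>v. abs (C v - C (d m v)) \<partial>H"
 have b: "abs (C (d m v)) \<le> abs (C v)" for m v using le[of v m] abs_ge_zero[of "C v - C (d m v)"] by linarith
 show "(\<lambda>m. \<integral>v. C (d m v) \<partial>H) \<longlonglongrightarrow> (\<integral>v. C v \<partial>H)"
  by (rule integral_dominated_convergence[where w = "\<lambda>v. abs (C v)"]) (use int lim b in auto)
 have "?A \<longlonglongrightarrow> (\<integral>v. 0 \<partial>H)"
 proof (rule integral_dominated_convergence[where w = "\<lambda>v. abs (C v)"])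
  show "AE v in H. (\<lambda>m. abs (C v - C (d m v))) \<longlonglongrightarrow> 0"
  proof (rule AE_I2)
   fix v
   show "(\<lambda>m. abs (C v - C (d m v))) \<longlonglongrightarrow> 0"
    using tendsto_rabs[OF tendsto_diff[OF tendsto_const[of "C v"] lim[of v]]] by simp
  qed
  show "AE v in H. norm (abs (C v - C (d m v))) \<le> abs (C v)" for m
   using le[of _ m] by (intro AE_I2) (metis abs_ge_zero abs_idempotent diff_ge_0_iff_ge real_norm_def diff_le_eq le_add_same_cancel1)
 qed (use int in auto)
 then show "?A \<longlonglongrightarrow> 0" by simp
qed

lemma pois_le_power: "0 \<le> l ==> l \<le> x ==> pois l j \<le> inverse (fact j)*x ^ j"
proof -
 assume "0 \<le> l" "l \<le> x"
 then have "exp (- l)*l ^ j \<le> 1*x ^ j" by (intro mult_mono power_mono) auto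
 then show ?thesis by (simp add: pois_def field_simps)
qed

text \<open>Frequency and type move with \<open>m\<close>, because the recursion evaluates
  \<open>psi\<close> at rounded types and at frequencies scaled by rounded weights; a statement at
  fixed points would not be inductive.\<close>

lemma psi_limit:
 assumes theta: "0 < th" and int_in: "integrable H w_in" and int_out: "integrable H w_out"
  and s: "(s' \<longlonglongrightarrow> s)" and u: "(u' \<longlonglongrightarrow> u)"
 shows "(\<lambda>m. psi (Hd m) th r (s' m) (u' m)) \<longlonglongrightarrow> psi H th r s u"
 using s u
proof (induction r arbitrary: s' s u' u)
 case 0
 then show ?case by (auto intro!: tendsto_cis tendsto_mult tendsto_components)
next
 case (Suc r)
 let ?J = "\<lambda>m v. w_out (d m v) *\<^sub>R offspring (Hd m) th (psi (Hd m) th r) (s' m) (d m v)"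
 have sec: "offspring M th (psi M th r) t \<in> borel_measurable borel" if "prob_space M" "sets M = sets borel" for M t
  using measurable_compose[OF measurable_Pair1' offspring_measurable[OF psi_measurable[OF that]], of t] by simp
 have Hd_sets: "sets (Hd m) = sets borel" for m by simp
 have amean: "(\<lambda>m. \<integral>x. w_in x \<partial>Hd m) \<longlonglongrightarrow> (\<integral>x. w_in x \<partial>H)"
  using component_integral_limit(1)[OF _ int_in tendsto_components(1)[OF d_limit] d_in] by (simp add: integral_Hd)
 have d_le: "abs (w_out (d m v)) \<le> abs (w_out v)" for m v
  using d_out[of v m] abs_ge_zero[of "w_out v - w_out (d m v)"] by linarith
 have bnd: "norm (psi (Hd m) th r t v) \<le> 1" if "0 \<le> w_in v" for m t v
  by (rule norm_psi_le[OF Hd_prob Hd_sets Hd_nonneg theta that])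
 have "(\<lambda>m. \<integral>v. ?J m v \<partial>H) \<longlonglongrightarrow> (\<integral>v. w_out v *\<^sub>R offspring H th (psi H th r) s v \<partial>H)"
 proof (rule integral_dominated_convergence[where w = "\<lambda>v. 2*abs (w_out v)"])
  show "(\<lambda>v. w_out v *\<^sub>R offspring H th (psi H th r) s v) \<in> borel_measurable H"
   using sec[OF H] by measurable
  show "?J m \<in> borel_measurable H" for m
   using measurable_compose[OF d_H sec[OF Hd_prob Hd_sets]] by measurable
  show "integrable H (\<lambda>v. 2*abs (w_out v))" using int_out by simp
  show "AE v in H. norm (?J m v) \<le> 2*abs (w_out v)" for m
   using nonneg
  proof eventually_elim
   case (elim v)
   have nn: "0 \<le> w_in (d m v) \<and> 0 \<le> w_out (d m v)" by (rule d_nonneg[OF elim])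
   then have "norm (offspring (Hd m) th (psi (Hd m) th r) (s' m) (d m v)) \<le> 2"
    by (intro offspring_bounds(2)[OF Hd_prob Hd_sets Hd_nonneg theta] bnd) auto
   then have "abs (w_out (d m v)) * norm (offspring (Hd m) th (psi (Hd m) th r) (s' m) (d m v)) \<le> abs (w_out v)*2"
    by (intro mult_mono d_le) auto
   then show ?case by (simp add: mult.commute)
  qed
  show "AE v in H. (\<lambda>m. ?J m v) \<longlonglongrightarrow> w_out v *\<^sub>R offspring H th (psi H th r) s v"
   using nonneg
  proof eventually_elim
   case (elim v)
   define l where "l m = (\<integral>x. w_in x \<partial>Hd m)*w_out (d m v)/th" for m
   define l0 where "l0 = (\<integral>x. w_in x \<partial>H)*w_out v/th"
   have l: "l \<longlonglongrightarrow> l0"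
    unfolding l_def l0_def using theta by (intro tendsto_intros amean tendsto_components d_limit) auto
   have nn: "0 \<le> w_in (d m v)" "0 \<le> w_out (d m v)" for m using d_nonneg[OF elim] by auto
   have l_nonneg: "0 \<le> l m" for m
    unfolding l_def by (rule rate_nonneg[OF Hd_prob Hd_sets Hd_nonneg theta nn(2)])
   let ?t = "\<lambda>j m. pois (l m) j *\<^sub>R (psi (Hd m) th r (s' m*(w_zeta (d m v)/(1 + real j))) (d m v) - 1)"
   have tlim: "(\<lambda>m. ?t j m) \<longlonglongrightarrow> pois l0 j *\<^sub>R (psi H th r (s*(w_zeta v/(1 + real j))) v - 1)" for j
    by (intro tendsto_intros isCont_tendsto_compose[OF DERIV_isCont[OF pois_deriv] l] Suc.IH Suc.prems tendsto_components d_limit) auto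
   \<comment> \<open>A bound on the rates that is uniform in \<open>m\<close> gives an exponential
     series as the dominating series.\<close>
   have ev: "EV m. l m < l0 + 1" by (rule order_tendstoD(2)[OF l]) simp
   have "(\<lambda>m. \<Sum>j. ?t j m) \<longlonglongrightarrow> (\<Sum>j. pois l0 j *\<^sub>R (psi H th r (s*(w_zeta v/(1 + real j))) v - 1))"
   proof (rule tannerys_theorem[THEN conjunct2, THEN conjunct2])
    show "\<forall>\<^sub>F (j, m) in at_top \<times>\<^sub>F sequentially. norm (?t j m) \<le> 2*(inverse (fact j)*(l0 + 1) ^ j)"
     unfolding eventually_prod_filter
    proof (intro exI conjI allI impI)
     show "\<forall>\<^sub>F j in at_top. (\<lambda>_. True) (j :: nat)" by simp
     show "EV m. l m < l0 + 1" by (rule ev)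
     fix j m :: nat assume lm: "l m < l0 + 1"
     have "norm (?t j m) \<le> 2*pois (l m) j"
      by (rule norm_pois_scale_le[OF l_nonneg bnd[OF nn(1)]])
     also have "\<dots> \<le> 2*(inverse (fact j)*(l0 + 1) ^ j)"
      using lm by (intro mult_left_mono pois_le_power l_nonneg) auto
     finally show "case (j, m) of (j, m) => norm (?t j m) \<le> 2*(inverse (fact j)*(l0 + 1) ^ j)" by simp
    qed
    show "summable (\<lambda>j. 2*(inverse (fact j)*(l0 + 1) ^ j))"
     by (intro summable_mult summable_exp)
   qed (use tlim in auto)
   then have "(\<lambda>m. offspring (Hd m) th (psi (Hd m) th r) (s' m) (d m v)) \<longlonglongrightarrow> offspring H th (psi H th r) s v"
    by (simp add: offspring_def l_def l0_def)
   then show ?case by (intro tendsto_scaleR tendsto_components d_limit)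
  qed
 qed
 moreover have "(\<integral>v. w_out v *\<^sub>R offspring (Hd m) th (psi (Hd m) th r) (s' m) v \<partial>Hd m) = (\<integral>v. ?J m v \<partial>H)" for m
  by (rule integral_Hd) (use sec[OF Hd_prob Hd_sets] in measurable)
 ultimately show ?case
  unfolding psi.simps using Suc.prems theta
  by (auto intro!: tendsto_mult tendsto_cis tendsto_exp tendsto_scaleR tendsto_divide tendsto_components)
qed

lemma psi_integral_limit:
 assumes theta: "0 < th" and int_in: "integrable H w_in" and int_out: "integrable H w_out"
 shows "(\<lambda>m. \<integral>v. psi (Hd m) th r s v \<partial>Hd m) \<longlonglongrightarrow> (\<integral>v. psi H th r s v \<partial>H)"
proof -
 have Hd_sets: "sets (Hd m) = sets borel" for m by simp
 have sec: "psi M th r s \<in> borel_measurable borel" if "prob_space M" "sets M = sets borel" for M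
  using measurable_compose[OF measurable_Pair1' psi_measurable[OF that], of s] by simp
 have "(\<lambda>m. \<integral>v. psi (Hd m) th r s (d m v) \<partial>H) \<longlonglongrightarrow> (\<integral>v. psi H th r s v \<partial>H)"
 proof (rule integral_dominated_convergence[where w = "\<lambda>_. 1"])
  show "psi H th r s \<in> borel_measurable H" using sec[OF H] by measurable
  show "(\<lambda>v. psi (Hd m) th r s (d m v)) \<in> borel_measurable H" for m
   by (rule measurable_compose[OF d_H sec[OF Hd_prob Hd_sets]])
  show "AE v in H. norm (psi (Hd m) th r s (d m v)) \<le> 1" for m
   using nonneg by eventually_elim (intro norm_psi_le[OF Hd_prob Hd_sets Hd_nonneg theta], use d_nonneg in blast)
  show "AE v in H. (\<lambda>m. psi (Hd m) th r s (d m v)) \<longlonglongrightarrow> psi H th r s v"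
   by (intro AE_I2 psi_limit[OF theta int_in int_out] tendsto_const d_limit)
 qed simp
 then show ?thesis by (simp add: integral_Hd sec[OF Hd_prob Hd_sets])
qed

end

text \<open>The iterated limit, in \<open>k\<close> for each large \<open>m\<close>. The threshold
  for \<open>k\<close> may depend on \<open>m\<close>, which the product filter would
  forbid.\<close>

definition nested_filter :: "(nat \<times> nat) filter" where
 "nested_filter = Abs_filter (\<lambda>P. EV m. EV k. P (m, k))"

lemma eventually_nested:
 "eventually P nested_filter \<longleftrightarrow> (EV m. EV k. P (m, k))"
 unfolding nested_filter_def
proof (rule eventually_Abs_filter, rule is_filter.intro)
 fix P Q :: "nat \<times> nat => bool"
 assume P: "EV m. EV k. P (m, k)"
 {
  assume Q: "EV m. EV k. Q (m, k)"
  show "EV m. EV k. P (m, k) \<and> Q (m, k)"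
   using P Q by eventually_elim (rule eventually_conj)
 next
  assume "\<forall>x. P x \<longrightarrow> Q x"
  then show "EV m. EV k. Q (m, k)"
   using P by (auto elim!: eventually_mono)
 }
qed simp

text \<open>The edge probabilities with the perturbation \<open>\<phi>\<close> set to 0.\<close>

definition types_at :: "(nat => ext_type) => real => nat => nat \<times> nat => real" where
 "types_at w th n = (\<lambda>(i, j). min 1 (w_out (w i)*w_in (w j)/(th * real n)))"

lemma types_at_bounds:
 assumes "\<And>i. i \<in> {1..n} ==> 0 \<le> w_in (w i) \<and> 0 \<le> w_out (w i)" "0 < th" "e \<in> vertex_pairs n"
 shows "0 \<le> types_at w th n e \<and> types_at w th n e \<le> 1"
 using assms by (auto simp: types_at_def vertex_pairs_def)

lemma min_1_lipschitz: "abs (min 1 x - min 1 y) \<le> abs (x - y)" for x y :: real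
 by (auto simp: min_def)

lemma types_at_diff:
 assumes w: "\<And>i. i \<in> {1..n} ==> 0 \<le> w_in (w i) \<and> 0 \<le> w_out (w' i)" and th: "0 < th"
 shows "(\<Sum>e\<in>vertex_pairs n. abs (types_at w th n e - types_at w' th n e))
  \<le> ((\<Sum>i=1..n. abs (w_out (w i) - w_out (w' i)))*(\<Sum>j=1..n. w_in (w j))
   + (\<Sum>i=1..n. w_out (w' i))*(\<Sum>j=1..n. abs (w_in (w j) - w_in (w' j))))/(th * real n)"
proof -
 let ?A = "th * real n"
 let ?f = "\<lambda>i j. (abs (w_out (w i) - w_out (w' i))*w_in (w j) + w_out (w' i)*abs (w_in (w j) - w_in (w' j)))/?A"
 have "(\<Sum>e\<in>vertex_pairs n. abs (types_at w th n e - types_at w' th n e)) \<le> (\<Sum>(i, j)\<in>vertex_pairs n. ?f i j)"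
 proof (rule sum_mono)
  fix e assume e: "e \<in> vertex_pairs n"
  obtain i j where ij: "e = (i, j)" by (cases e)
  then have i: "i \<in> {1..n}" "j \<in> {1..n}" using e by (auto simp: vertex_pairs_def)
  have "abs (types_at w th n e - types_at w' th n e) \<le> abs (w_out (w i)*w_in (w j)/?A - w_out (w' i)*w_in (w' j)/?A)"
   unfolding types_at_def ij by (simp add: min_1_lipschitz del: min_less_iff_conj)
  also have "\<dots> = abs ((w_out (w i) - w_out (w' i))*w_in (w j) + w_out (w' i)*(w_in (w j) - w_in (w' j)))/?A"
   using th by (simp add: abs_divide[symmetric] algebra_simps diff_divide_distrib[symmetric] abs_mult)
  also have "\<dots> \<le> ?f i j"
  proof (rule divide_right_mono)
   show "abs ((w_out (w i) - w_out (w' i))*w_in (w j) + w_out (w' i)*(w_in (w j) - w_in (w' j)))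
     \<le> abs (w_out (w i) - w_out (w' i))*w_in (w j) + w_out (w' i)*abs (w_in (w j) - w_in (w' j))"
    by (rule order_trans[OF abs_triangle_ineq]) (use w[OF i(1)] w[OF i(2)] in "simp add: abs_mult")
  qed (use th in simp)
  finally show "abs (types_at w th n e - types_at w' th n e) \<le> (case e of (i, j) => ?f i j)" by (simp add: ij)
 qed
 also have "\<dots> \<le> (\<Sum>(i, j)\<in>{1..n} \<times> {1..n}. ?f i j)"
  by (rule sum_mono2) (use w th in "auto simp: vertex_pairs_def intro!: divide_nonneg_nonneg add_nonneg_nonneg mult_nonneg_nonneg")
 also have "\<dots> = (\<Sum>i=1..n. \<Sum>j=1..n. ?f i j)" by (simp add: sum.cartesian_product)
 also have "\<dots> = ((\<Sum>i=1..n. abs (w_out (w i) - w_out (w' i)))*(\<Sum>j=1..n. w_in (w j))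
   + (\<Sum>i=1..n. w_out (w' i))*(\<Sum>j=1..n. abs (w_in (w j) - w_in (w' j))))/?A"
  by (simp only: sum_divide_distrib[symmetric] sum.distrib sum_product)
 finally show ?thesis .
qed

text \<open>The characteristic function of \<open>f\<close> at a uniformly chosen vertex, with the
  graph and the types held fixed.\<close>

definition avg_cis :: "nat => real => (nat => real) => complex" where
 "avg_cis n s f = (\<Sum>i=1..n. cis (s*f i))/of_nat n"

lemma norm_avg_cis_diff: "norm (avg_cis n s f - avg_cis n s g) \<le> abs s*((\<Sum>i=1..n. abs (f i - g i))/real n)"
proof -
 have "norm (avg_cis n s f - avg_cis n s g) = norm (\<Sum>i=1..n. cis (s*f i) - cis (s * g i))/real n"
  by (simp add: avg_cis_def sum_subtractf norm_divide flip: diff_divide_distrib)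
 also have "\<dots> \<le> (\<Sum>i=1..n. abs s*abs (f i - g i))/real n"
 proof (intro divide_right_mono order_trans[OF norm_sum] sum_mono)
  fix i show "norm (cis (s*f i) - cis (s * g i)) \<le> abs s*abs (f i - g i)"
   using norm_cis_diff_le[of "s*f i" "s * g i"] by (simp add: abs_mult flip: right_diff_distrib)
 qed simp
 finally show ?thesis by (simp add: sum_distrib_left)
qed

lemma gexp_avg_cis_diff:
 assumes "\<And>e. e \<in> V ==> 0 \<le> p e \<and> p e \<le> 1"
 shows "norm (gexp V p (\<lambda>G. avg_cis n s (f G)) - gexp V p (\<lambda>G. avg_cis n s (g G)))
  \<le> abs s*(gexp V p (\<lambda>G. \<Sum>i=1..n. abs (f G i - g G i))/real n)"
 unfolding gexp_divide[symmetric] gexp_cmult[symmetric]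
 by (rule gexp_diff_le) (use assms norm_avg_cis_diff in auto)

section \<open>A deterministic sequence of types and its discretizations\<close>

locale deterministic_types = pagerank_limit H th c + discretization H d
 for H :: "ext_type measure" and th c :: real and d :: "nat => ext_type => ext_type" +
 fixes N :: "nat => nat" and w :: "nat => nat => ext_type" and p :: "nat => nat \<times> nat => real"
 assumes size: "filterlim N at_top sequentially"
  and w_nonneg: "\<And>k i. i \<in> {1..N k} ==> 0 \<le> w_in (w k i) \<and> 0 \<le> w_out (w k i)"
  and w_zeta_le: "\<And>k i. i \<in> {1..N k} ==> abs (w_zeta (w k i)) \<le> c"
  and p_prob: "\<And>k e. e \<in> vertex_pairs (N k) ==> 0 \<le> p k e \<and> p k e \<le> 1"
  and edge_error: "(\<lambda>k. (\<Sum>e\<in>vertex_pairs (N k). abs (p k e - types_at (w k) th (N k) e))/real (N k)) \<longlonglongrightarrow> 0"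
  and avg_in: "(\<lambda>k. (\<Sum>i=1..N k. w_in (w k i))/real (N k)) \<longlonglongrightarrow> (\<integral>v. w_in v \<partial>H)"
  and avg_out: "(\<lambda>k. (\<Sum>i=1..N k. w_out (w k i))/real (N k)) \<longlonglongrightarrow> (\<integral>v. w_out v \<partial>H)"
  and avg_Q: "(\<lambda>k. (\<Sum>i=1..N k. abs (w_Q (w k i)))/real (N k)) \<longlonglongrightarrow> (\<integral>v. abs (w_Q v) \<partial>H)"
  and avg_zeta: "(\<lambda>k. (\<Sum>i=1..N k. abs (w_zeta (w k i)))/real (N k)) \<longlonglongrightarrow> (\<integral>v. abs (w_zeta v) \<partial>H)"
  and freq: "\<And>m ty. ty \<in> range (d m) ==>
   (\<lambda>k. (\<Sum>i=1..N k. of_bool (d m (w k i) = ty))/real (N k)) \<longlonglongrightarrow> measure H {v. d m v = ty}"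
begin

abbreviation "wd m k i \<equiv> d m (w k i)"
abbreviation "pd m k \<equiv> types_at (wd m k) th (N k)"
abbreviation "E k \<equiv> gexp (vertex_pairs (N k)) (p k)"
abbreviation "Ed m k \<equiv> gexp (vertex_pairs (N k)) (pd m k)"

text \<open>The grid points that actual types can reach. The others have no mass under
  \<open>H\<close> and no vertices, but they could violate the sign and size bounds required of
  finitely many types.\<close>

definition "Td m = {ty \<in> range (d m). 0 \<le> w_in ty \<and> 0 \<le> w_out ty \<and> abs (w_zeta ty) \<le> 1}"
definition "bd m = (\<Sum>ty\<in>Td m. w_in ty + w_out ty)"

lemma Td_finite: "finite (Td m)"
 by (rule finite_subset[OF _ d_finite]) (auto simp: Td_def)

lemma d_zeta_le: "abs (w_zeta (d m v)) \<le> abs (w_zeta v)"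
 using d_zeta[of v m] abs_ge_zero[of "w_zeta v - w_zeta (d m v)"] by linarith

lemma d_Q_le: "abs (w_Q (d m v)) \<le> abs (w_Q v)"
 using d_Q[of v m] abs_ge_zero[of "w_Q v - w_Q (d m v)"] by linarith

lemma d_in_Td: "0 \<le> w_in v \<and> 0 \<le> w_out v ==> abs (w_zeta v) \<le> c ==> d m v \<in> Td m"
 using d_nonneg[of v m] d_zeta_le[of m v] c by (auto simp: Td_def)

lemma AE_d_in_Td: "AE v in H. d m v \<in> Td m"
 using nonneg zeta by eventually_elim (rule d_in_Td)

lemma integral_Td:
 fixes f :: "ext_type => 'b::{banach, second_countable_topology}"
 assumes f [measurable]: "f \<in> borel_measurable borel"
 shows "(\<integral>v. f v \<partial>Hd m) = (\<Sum>ty\<in>Td m. measure H {v. d m v = ty} *\<^sub>R f ty)"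
proof -
 have sets: "{v. d m v = ty} \<in> sets H" for ty
 proof -
  have "d m -` {ty} \<inter> space H \<in> sets H" by (rule measurable_sets[OF d_H]) simp
  moreover have "d m -` {ty} \<inter> space H = {v. d m v = ty}" using sets_eq_imp_space_eq[OF H(2)] by auto
  ultimately show ?thesis by simp
 qed
 have "(\<integral>v. f v \<partial>Hd m) = (\<integral>v. f (d m v) \<partial>H)" by (rule integral_Hd[OF f])
 also have "\<dots> = (\<integral>v. (\<Sum>ty\<in>Td m. indicator {v. d m v = ty} v *\<^sub>R f ty) \<partial>H)"
 proof (rule integral_cong_AE)
  show "AE v in H. f (d m v) = (\<Sum>ty\<in>Td m. indicator {v. d m v = ty} v *\<^sub>R f ty)"
   using AE_d_in_Td[of m]
  proof eventually_elim
   case (elim v)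
   have "(\<Sum>ty\<in>Td m. indicator {v. d m v = ty} v *\<^sub>R f ty) = (\<Sum>ty\<in>Td m. if d m v = ty then f (d m v) else 0)"
    by (rule sum.cong) (auto simp: indicator_def)
   then show ?case using elim Td_finite by simp
  qed
  show "(\<lambda>v. f (d m v)) \<in> borel_measurable H" by (rule measurable_compose[OF d_H f])
  show "(\<lambda>v. \<Sum>ty\<in>Td m. indicator {v. d m v = ty} v *\<^sub>R f ty) \<in> borel_measurable H"
   using sets by measurable
 qed
 also have "\<dots> = (\<Sum>ty\<in>Td m. \<integral>v. indicator {v. d m v = ty} v *\<^sub>R f ty \<partial>H)"
  by (rule Bochner_Integration.integral_sum) (use sets in "auto intro!: integrable_scaleR_left integrable_real_indicator simp: H.emeasure_eq_measure")
 also have "\<dots> = (\<Sum>ty\<in>Td m. measure H {v. d m v = ty} *\<^sub>R f ty)"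
  by (rule sum.cong[OF refl], subst integral_scaleR_left)
    (use sets in "simp_all add: integrable_real_indicator H.emeasure_eq_measure sets_eq_imp_space_eq[OF H(2)]")
 finally show ?thesis .
qed

lemma finite_model: "finite_type_digraphs N (wd m) (pd m) th (bd m) (Td m) (\<lambda>ty. measure H {v. d m v = ty}) (Hd m)"
proof (rule finite_type_digraphs.intro)
 show "filterlim N at_top sequentially" by (rule size)
 show "finite (Td m)" by (rule Td_finite)
 show "0 < th" by (rule theta)
 show "wd m k i \<in> Td m" if "i \<in> {1..N k}" for k i
  using w_nonneg[OF that] w_zeta_le[OF that] by (rule d_in_Td)
 have le: "w_in ty + w_out ty \<le> bd m" if "ty \<in> Td m" for ty
  unfolding bd_def by (rule member_le_sum[OF that _ Td_finite]) (simp add: Td_def)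
 show "0 \<le> w_in ty \<and> w_in ty \<le> bd m \<and> 0 \<le> w_out ty \<and> w_out ty \<le> bd m \<and> abs (w_zeta ty) \<le> 1" if "ty \<in> Td m" for ty
  using le[OF that] that by (auto simp: Td_def)
 show "0 \<le> bd m" unfolding bd_def by (rule sum_nonneg) (auto simp: Td_def)
 show "pd m k (i, j) = min 1 (w_out (wd m k i)*w_in (wd m k j)/(th * real (N k)))" for k i j
  by (simp add: types_at_def)
 show "(\<lambda>k. (\<Sum>i=1..N k. of_bool (wd m k i = ty))/real (N k)) \<longlonglongrightarrow> measure H {v. d m v = ty}" if "ty \<in> Td m" for ty
  by (rule freq) (use that in "auto simp: Td_def")
 show "prob_space (Hd m)" by (rule Hd_prob)
 show "sets (Hd m) = sets borel" by simp
 show "AE v in Hd m. v \<in> Td m"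
 proof (subst AE_distr_iff[OF d_H])
  have "closed (Td m)" by (rule finite_imp_closed[OF Td_finite])
  then show "{v \<in> space borel. v \<in> Td m} \<in> sets borel" by (simp add: borel_closed)
 qed (rule AE_d_in_Td)
 show "(\<integral>v. f v \<partial>Hd m) = (\<Sum>ty\<in>Td m. measure H {v. d m v = ty} *\<^sub>R f ty)" if "f \<in> borel_measurable borel" for f :: "ext_type => complex"
  by (rule integral_Td[OF that])
qed

lemma average_wd:
 assumes "f \<in> borel_measurable borel"
 shows "(\<lambda>k. (\<Sum>i=1..N k. f (wd m k i))/real (N k)) \<longlonglongrightarrow> (\<integral>v. f (d m v) \<partial>H)"
 using finite_type_digraphs.average_types[OF finite_model, of f m] integral_Td[OF assms, of m] integral_Hd[OF assms, of m] by simp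

text \<open>By \<open>le\<close> the error is a difference of two averages of absolute values. The
  first converges by hypothesis, and the second because the rounded types take finitely many values
  with convergent frequencies.\<close>

lemma component_error:
 fixes C :: "ext_type => real"
 assumes C [measurable]: "C \<in> borel_measurable borel" and int: "integrable H C"
  and avg: "(\<lambda>k. (\<Sum>i=1..N k. abs (C (w k i)))/real (N k)) \<longlonglongrightarrow> (\<integral>v. abs (C v) \<partial>H)"
  and le: "\<And>m v. abs (C v - C (d m v)) = abs (C v) - abs (C (d m v))"
 shows "(\<lambda>k. (\<Sum>i=1..N k. abs (C (w k i) - C (wd m k i)))/real (N k)) \<longlonglongrightarrow> (\<integral>v. abs (C v - C (d m v)) \<partial>H)"
proof -
 have b: "abs (C (d m v)) \<le> abs (C v)" for v using le[of v m] abs_ge_zero[of "C v - C (d m v)"] by linarith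
 have "(\<lambda>k. (\<Sum>i=1..N k. abs (C (w k i)))/real (N k) - (\<Sum>i=1..N k. abs (C (wd m k i)))/real (N k)) \<longlonglongrightarrow> (\<integral>v. abs (C v) \<partial>H) - (\<integral>v. abs (C (d m v)) \<partial>H)"
  by (intro tendsto_diff avg average_wd[of "\<lambda>v. abs (C v)"]) measurable
 also have "(\<integral>v. abs (C v) \<partial>H) - (\<integral>v. abs (C (d m v)) \<partial>H) = (\<integral>v. abs (C v - C (d m v)) \<partial>H)"
 proof -
  have "integrable H (\<lambda>v. abs (C (d m v)))"
   by (rule Bochner_Integration.integrable_bound[OF integrable_abs[OF int]]) (use b in "auto intro!: AE_I2")
  then show ?thesis unfolding le using int by (subst Bochner_Integration.integral_diff) auto
 qed
 finally show ?thesis by (simp add: le sum_subtractf diff_divide_distrib)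
qed

lemma Q_error: "(\<lambda>k. (\<Sum>i=1..N k. abs (w_Q (w k i) - w_Q (wd m k i)))/real (N k)) \<longlonglongrightarrow> (\<integral>v. abs (w_Q v - w_Q (d m v)) \<partial>H)"
 by (rule component_error[OF _ int_Q avg_Q d_Q]) measurable

lemma int_zeta: "integrable H w_zeta"
 by (rule H.integrable_const_bound[where B = c]) (use zeta in auto)

lemma zeta_error: "(\<lambda>k. (\<Sum>i=1..N k. abs (w_zeta (w k i) - w_zeta (wd m k i)))/real (N k)) \<longlonglongrightarrow> (\<integral>v. abs (w_zeta v - w_zeta (d m v)) \<partial>H)"
 by (rule component_error[OF _ int_zeta avg_zeta d_zeta]) measurable

lemma nonneg_component_error:
 assumes C: "C \<in> {w_in, w_out}" and avg: "(\<lambda>k. (\<Sum>i=1..N k. C (w k i))/real (N k)) \<longlonglongrightarrow> (\<integral>v. C v \<partial>H)"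
 shows "(\<lambda>k. (\<Sum>i=1..N k. abs (C (w k i) - C (wd m k i)))/real (N k)) \<longlonglongrightarrow> (\<integral>v. abs (C v - C (d m v)) \<partial>H)"
proof (rule component_error)
 have "(\<Sum>i=1..N k. abs (C (w k i))) = (\<Sum>i=1..N k. C (w k i))" for k using w_nonneg C by (intro sum.cong) auto
 moreover have "(\<integral>v. abs (C v) \<partial>H) = (\<integral>v. C v \<partial>H)" by (rule integral_cong_AE) (use nonneg C in auto)
 ultimately show "(\<lambda>k. (\<Sum>i=1..N k. abs (C (w k i)))/real (N k)) \<longlonglongrightarrow> (\<integral>v. abs (C v) \<partial>H)" using avg by simp
qed (use C int_in int_out d_in d_out in auto)

lemmas in_error = nonneg_component_error[OF insertI1 avg_in]
lemmas out_error = nonneg_component_error[OF insertI2[OF singletonI] avg_out]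

definition edge_diff :: "nat => nat => real" where
 "edge_diff m k = (\<Sum>e\<in>vertex_pairs (N k). abs (p k e - pd m k e))/real (N k)"

definition edge_bound :: "nat => real" where
 "edge_bound m = ((\<integral>v. abs (w_out v - w_out (d m v)) \<partial>H)*(\<integral>v. w_in v \<partial>H)
   + (\<integral>v. w_out (d m v) \<partial>H)*(\<integral>v. abs (w_in v - w_in (d m v)) \<partial>H))/th"

lemma edge_bound_limit: "edge_bound \<longlonglongrightarrow> 0"
proof -
 have "edge_bound \<longlonglongrightarrow> (0*(\<integral>v. w_in v \<partial>H) + (\<integral>v. w_out v \<partial>H)*0)/th"
  unfolding edge_bound_def[abs_def] using theta
  by (intro tendsto_intros component_integral_limit int_in int_out tendsto_components d_limit d_in d_out) measurable
 then show ?thesis by simp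
qed

lemma edge_diff_le:
 assumes "eps > 0"
 shows "EV k. edge_diff m k < edge_bound m + eps"
proof -
 let ?A = "\<lambda>k. (\<Sum>i=1..N k. abs (w_out (w k i) - w_out (wd m k i)))/real (N k)" and ?B = "\<lambda>k. (\<Sum>j=1..N k. w_in (w k j))/real (N k)"
  and ?C = "\<lambda>k. (\<Sum>i=1..N k. w_out (wd m k i))/real (N k)" and ?D = "\<lambda>k. (\<Sum>i=1..N k. abs (w_in (w k i) - w_in (wd m k i)))/real (N k)"
 let ?err = "\<lambda>k. (\<Sum>e\<in>vertex_pairs (N k). abs (p k e - types_at (w k) th (N k) e))/real (N k)"
 have "(\<lambda>k. ?err k + (?A k*?B k + ?C k*?D k)/th) \<longlonglongrightarrow> 0 + edge_bound m"
  unfolding edge_bound_def using theta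
  by (intro tendsto_intros edge_error out_error avg_in in_error average_wd) auto
 then have "EV k. ?err k + (?A k*?B k + ?C k*?D k)/th < edge_bound m + eps"
  by (rule order_tendstoD) (use assms in simp)
 then show ?thesis
 proof eventually_elim
  case (elim k)
  have "(\<Sum>e\<in>vertex_pairs (N k). abs (p k e - pd m k e))
   \<le> (\<Sum>e\<in>vertex_pairs (N k). abs (p k e - types_at (w k) th (N k) e) + abs (types_at (w k) th (N k) e - pd m k e))"
   by (rule sum_mono) simp
  also have "\<dots> \<le> (\<Sum>e\<in>vertex_pairs (N k). abs (p k e - types_at (w k) th (N k) e))
    + ((\<Sum>i=1..N k. abs (w_out (w k i) - w_out (wd m k i)))*(\<Sum>j=1..N k. w_in (w k j))
   + (\<Sum>i=1..N k. w_out (wd m k i))*(\<Sum>j=1..N k. abs (w_in (w k j) - w_in (wd m k j))))/(th * real (N k))"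
   unfolding sum.distrib by (intro add_left_mono types_at_diff theta) (use w_nonneg d_nonneg in blast)
  finally have "edge_diff m k \<le> ((\<Sum>e\<in>vertex_pairs (N k). abs (p k e - types_at (w k) th (N k) e))
    + ((\<Sum>i=1..N k. abs (w_out (w k i) - w_out (wd m k i)))*(\<Sum>j=1..N k. w_in (w k j))
   + (\<Sum>i=1..N k. w_out (wd m k i))*(\<Sum>j=1..N k. abs (w_in (w k j) - w_in (wd m k j))))/(th * real (N k)))/real (N k)"
   unfolding edge_diff_def by (rule divide_right_mono) simp
  also have "\<dots> = ?err k + (?A k*?B k + ?C k*?D k)/th"
  proof -
   have "(e + (a*b + c*d)/(th * n))/n = e/n + (a/n*(b/n) + c/n*(d/n))/th" for e a b c d n :: real
    using theta by (cases "n = 0") (simp_all add: field_simps)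
   then show ?thesis .
  qed
  finally show ?case using elim by linarith
 qed
qed

lemma pd_prob: "e \<in> vertex_pairs (N k) ==> 0 \<le> pd m k e \<and> pd m k e \<le> 1"
 by (rule types_at_bounds[OF _ theta]) (use w_nonneg d_nonneg in blast)+

lemma in_deg_lipschitz:
 assumes "e \<in> vertex_pairs n"
 shows "abs ((\<Sum>i=1..n. max 0 (in_deg n (insert e G) i - x)) - (deg_tail n x G)) \<le> 1"
proof -
 obtain a b where e: "e = (a, b)" by (cases e)
 have ab: "a \<in> {1..n}" "b \<in> {1..n}" using assms e by (auto simp: vertex_pairs_def)
 have "abs (in_deg n (insert e G) i - in_deg n G i) \<le> of_bool (i = b)" for i
 proof -
  have "in_deg n (insert e G) i - in_deg n G i = (\<Sum>j=1..n. of_bool (i = b \<and> (a, b) \<notin> G) * of_bool (j = a))"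
   unfolding in_deg_def sum_subtractf[symmetric] by (rule sum.cong) (auto simp: e)
  also have "\<dots> = of_bool (i = b \<and> (a, b) \<notin> G)" by (rule sum_of_bool_mult[OF ab(1)])
  finally show ?thesis by simp
 qed
 then have "abs (max 0 (in_deg n (insert e G) i - x) - max 0 (in_deg n G i - x)) \<le> 1 * of_bool (i = b)" for i
  by (smt (verit) mult_1)
 then have "abs (\<Sum>i=1..n. max 0 (in_deg n (insert e G) i - x) - max 0 (in_deg n G i - x)) \<le> (\<Sum>i=1..n. 1 * of_bool (i = b))"
  by (intro order_trans[OF sum_abs] sum_mono)
 also have "\<dots> = 1" by (rule sum_of_bool_mult[OF ab(2)])
 finally show ?thesis by (simp add: sum_subtractf)
qed

text \<open>Adding an edge changes one in-degree by one, so the tail functional is Lipschitz in each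
  edge and the change of edge probabilities costs at most their \<open>l1\<close> distance.\<close>

lemma in_deg_tail_transfer:
 assumes "\<And>e. e \<in> vertex_pairs (N k) ==> 0 \<le> p' e \<and> p' e \<le> 1"
 shows "gexp (vertex_pairs (N k)) p' (\<lambda>G. deg_tail (N k) x G)/real (N k)
  \<le> Ed m k (\<lambda>G. deg_tail (N k) x G)/real (N k) + (\<Sum>e\<in>vertex_pairs (N k). abs (p' e - pd m k e))/real (N k)"
proof -
 let ?A = "\<lambda>G. deg_tail (N k) x G"
 let ?B = "\<Sum>e\<in>vertex_pairs (N k). abs (p' e - pd m k e)"
 have "norm (gexp (vertex_pairs (N k)) p' ?A - Ed m k ?A)
  \<le> 1*?B"
  by (rule gexp_change_prob) (use assms pd_prob in_deg_lipschitz in auto)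
 then have "gexp (vertex_pairs (N k)) p' ?A
   \<le> Ed m k ?A + ?B" by simp
 then show ?thesis unfolding add_divide_distrib[symmetric] by (rule divide_right_mono) simp
qed

text \<open>In-degrees of unbounded types need not have uniformly bounded second moments. The tail
  is therefore bounded for one coarse discretization \<open>m0\<close>, whose types are bounded, and
  transferred from there to the original graph and to all fine discretizations, whose edge
  probabilities are close in \<open>l1\<close> after division by the number of vertices.\<close>

lemma tail_D:
 assumes eps: "eps > 0"
 shows "\<exists>x\<ge>0. (EV k. E k (\<lambda>G. deg_tail (N k) x G)/real (N k) \<le> eps)
  \<and> (EV m. EV k. Ed m k (\<lambda>G. deg_tail (N k) x G)/real (N k) \<le> eps)"
proof -
 have ev: "EV m. edge_bound m < eps/8" by (rule order_tendstoD(2)[OF edge_bound_limit]) (use eps in simp)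
 then obtain m0 where m0: "edge_bound m0 < eps/8" by (auto simp: eventually_sequentially)
 obtain x where x: "0 \<le> x" "EV k. Ed m0 k (\<lambda>G. deg_tail (N k) x G)/real (N k) \<le> eps/4"
  using finite_type_digraphs.tail_D[OF finite_model, of "eps/4" m0] eps by auto
 have d0: "EV k. edge_diff m0 k < eps/4"
  using edge_diff_le[of "eps/8" m0] eps by (auto elim!: eventually_mono) (use m0 in linarith)
 show ?thesis
 proof (intro exI[of _ x] conjI x(1))
  show "EV k. E k (\<lambda>G. deg_tail (N k) x G)/real (N k) \<le> eps"
   using x(2) d0
  proof eventually_elim
   case (elim k)
   have "E k (\<lambda>G. deg_tail (N k) x G)/real (N k)
     \<le> Ed m0 k (\<lambda>G. deg_tail (N k) x G)/real (N k) + edge_diff m0 k"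
    unfolding edge_diff_def by (rule in_deg_tail_transfer) (rule p_prob)
   then show ?case using elim eps by linarith
  qed
  show "EV m. EV k. Ed m k (\<lambda>G. deg_tail (N k) x G)/real (N k) \<le> eps"
   using ev
  proof eventually_elim
   case (elim m)
   have "EV k. edge_diff m k < eps/4"
    using edge_diff_le[of "eps/8" m] eps by (auto elim!: eventually_mono) (use elim in linarith)
   then show ?case
    using x(2) d0
   proof eventually_elim
    case (elim k)
    have "(\<Sum>e\<in>vertex_pairs (N k). abs (pd m k e - pd m0 k e)) \<le> (\<Sum>e\<in>vertex_pairs (N k). abs (p k e - pd m k e) + abs (p k e - pd m0 k e))"
     by (rule sum_mono) simp
    then have "(\<Sum>e\<in>vertex_pairs (N k). abs (pd m k e - pd m0 k e))/real (N k) \<le> edge_diff m k + edge_diff m0 k"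
     unfolding edge_diff_def add_divide_distrib[symmetric] sum.distrib[symmetric] by (rule divide_right_mono) simp
    moreover have "Ed m k (\<lambda>G. deg_tail (N k) x G)/real (N k)
      \<le> Ed m0 k (\<lambda>G. deg_tail (N k) x G)/real (N k) + (\<Sum>e\<in>vertex_pairs (N k). abs (pd m k e - pd m0 k e))/real (N k)"
     by (rule in_deg_tail_transfer) (rule pd_prob)
    ultimately show ?case using elim eps by linarith
   qed
  qed
 qed
qed

lemma Q_limit: "(\<lambda>m. \<integral>v. abs (w_Q v - w_Q (d m v)) \<partial>H) \<longlonglongrightarrow> 0"
 by (rule component_integral_limit(2)[OF _ int_Q tendsto_components(3)[OF d_limit] d_Q]) measurable

lemma zeta_limit: "(\<lambda>m. \<integral>v. abs (w_zeta v - w_zeta (d m v)) \<partial>H) \<longlonglongrightarrow> 0"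
 by (rule component_integral_limit(2)[OF _ int_zeta tendsto_components(4)[OF d_limit] d_zeta]) measurable

text \<open>The rounded values are finitely many and bounded by \<open>q\<close>, so the excess over
  \<open>q\<close> is at most the rounding error.\<close>

lemma tail_Q:
 assumes eps: "eps > 0"
 shows "\<exists>q\<ge>0. EV k. (\<Sum>i=1..N k. excess q (w_Q (w k i)))/real (N k) \<le> eps"
proof -
 from order_tendstoD(2)[OF Q_limit eps] obtain m where m: "(\<integral>v. abs (w_Q v - w_Q (d m v)) \<partial>H) < eps"
  by (auto simp: eventually_sequentially)
 define q where "q = (\<Sum>ty\<in>range (d m). abs (w_Q ty))"
 have q: "abs (w_Q (d m v)) \<le> q" for v
  unfolding q_def by (rule member_le_sum[of "d m v"]) (use d_finite in auto)
 have "EV k. (\<Sum>i=1..N k. abs (w_Q (w k i) - w_Q (wd m k i)))/real (N k) < eps"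
  by (rule order_tendstoD(2)[OF Q_error m])
 then have "EV k. (\<Sum>i=1..N k. excess q (w_Q (w k i)))/real (N k) \<le> eps"
 proof eventually_elim
  case (elim k)
  have "(\<Sum>i=1..N k. excess q (w_Q (w k i)))/real (N k) \<le> (\<Sum>i=1..N k. abs (w_Q (w k i) - w_Q (wd m k i)))/real (N k)"
  proof (intro divide_right_mono sum_mono)
   fix i
   show "excess q (w_Q (w k i)) \<le> abs (w_Q (w k i) - w_Q (wd m k i))"
    using q[of "w k i"] unfolding excess_def by linarith
  qed simp
  then show ?case using elim by linarith
 qed
 moreover have "0 \<le> q" unfolding q_def by (rule sum_nonneg) simp
 ultimately show ?thesis by blast
qed

lemma clip_true:
 assumes "eps > 0"
 shows "\<exists>L0\<ge>0. \<forall>L\<ge>L0. \<forall>\<^sub>F k in sequentially.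
  E k (\<lambda>G. \<Sum>i=1..N k. abs (rank_iter (N k) G (w k) r i - rk (clip L) (N k) G (w k) r i))/real (N k) \<le> eps"
proof (rule clip_approximation[OF _ tail_Q _ assms])
 show "EV k. (\<forall>e\<in>vertex_pairs (N k). 0 \<le> p k e \<and> p k e \<le> 1) \<and> (\<forall>j\<in>{1..N k}. abs (w_zeta (w k j)) \<le> 1)"
  using p_prob w_zeta_le c by (auto intro!: always_eventually) (smt (verit) Suc_leI atLeastAtMost_iff)
next
 fix eps :: real assume "eps > 0"
 then show "\<exists>x\<ge>0. EV k. E k (\<lambda>G. deg_tail (N k) x G)/real (N k) \<le> eps"
  using tail_D by meson
qed

lemma clip_discretized:
 assumes "eps > 0"
 shows "\<exists>L0\<ge>0. \<forall>L\<ge>L0. EV m. \<forall>\<^sub>F k in sequentially.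
  Ed m k (\<lambda>G. \<Sum>i=1..N k. abs (rank_iter (N k) G (wd m k) r i - rk (clip L) (N k) G (wd m k) r i))/real (N k) \<le> eps"
proof -
 have zeta1: "abs (w_zeta (wd m k j)) \<le> 1" if "j \<in> {1..N k}" for m k j
  using d_zeta_le[of m "w k j"] w_zeta_le[OF that] c by linarith
 have 1: "\<forall>\<^sub>F x in nested_filter. (\<forall>e\<in>vertex_pairs (N (snd x)). 0 \<le> pd (fst x) (snd x) e \<and> pd (fst x) (snd x) e \<le> 1) \<and> (\<forall>j\<in>{1..N (snd x)}. abs (w_zeta (wd (fst x) (snd x) j)) \<le> 1)"
  using pd_prob zeta1 by (auto intro!: always_eventually)
 have 2: "\<exists>q\<ge>0. \<forall>\<^sub>F x in nested_filter. (\<Sum>i=1..N (snd x). excess q (w_Q (wd (fst x) (snd x) i)))/real (N (snd x)) \<le> eps" if eps: "eps > 0" for eps :: real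
 proof -
  obtain q where q: "0 \<le> q" "EV k. (\<Sum>i=1..N k. excess q (w_Q (w k i)))/real (N k) \<le> eps"
   using tail_Q[OF eps] by blast
  have "(\<Sum>i=1..N k. excess q (w_Q (wd m k i)))/real (N k) \<le> (\<Sum>i=1..N k. excess q (w_Q (w k i)))/real (N k)" for m k
   by (intro divide_right_mono sum_mono) (unfold excess_def, insert d_Q_le, smt (verit), simp)
  then have "EV k. (\<Sum>i=1..N k. excess q (w_Q (wd m k i)))/real (N k) \<le> eps" for m
   using q(2) by (auto elim!: eventually_mono intro: order_trans)
  then show ?thesis using q(1) by (auto simp: eventually_nested)
 qed
 have 3: "\<exists>x\<ge>0. \<forall>\<^sub>F y in nested_filter. gexp (vertex_pairs (N (snd y))) (pd (fst y) (snd y)) (\<lambda>G. deg_tail (N (snd y)) x G)/real (N (snd y)) \<le> eps" if eps: "eps > 0" for eps :: real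
  using tail_D[OF eps] by (auto simp: eventually_nested)
 show ?thesis
  using clip_approximation[where F = nested_filter and N = "\<lambda>x. N (snd x)" and w = "\<lambda>x. wd (fst x) (snd x)" and p = "\<lambda>x. pd (fst x) (snd x)", OF 1 2 3 assms, of r]
  by (simp add: eventually_nested)
qed

text \<open>Four comparisons: clip the ranks for the original types, change the edge probabilities,
  change the types, undo the clipping. The second uses the bounded differences of clipped ranks, the
  third the sensitivity to types; both require a level \<open>L\<close> that is fixed
  beforehand.\<close>

lemma discretization_error:
 assumes "eps > 0"
 shows "EV m. \<forall>\<^sub>F k in sequentially.
  norm (E k (\<lambda>G. avg_cis (N k) s (rank_iter (N k) G (w k) r)) - Ed m k (\<lambda>G. avg_cis (N k) s (rank_iter (N k) G (wd m k) r))) \<le> eps"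
proof -
 let ?A = "real (Suc r)"
 \<comment> \<open>Each of the four comparisons will cost at most
   \<open>|s| \<delta>\<close>.\<close>
 define \<delta> where "\<delta> = eps/(4*(abs s + 1))"
 have \<delta>: "0 < \<delta>" "4*(abs s*\<delta>) \<le> eps" using assms by (auto simp: \<delta>_def field_simps)
 obtain L1 where L1: "0 \<le> L1" "\<And>L. L1 \<le> L ==> EV k. E k (\<lambda>G. \<Sum>i=1..N k. abs (rank_iter (N k) G (w k) r i - rk (clip L) (N k) G (w k) r i))/real (N k) \<le> \<delta>"
  using clip_true[OF \<delta>(1), of r] by (elim exE conjE) simp
 obtain L2 where L2: "0 \<le> L2" "\<And>L. L2 \<le> L ==> EV m. EV k. Ed m k (\<lambda>G. \<Sum>i=1..N k. abs (rank_iter (N k) G (wd m k) r i - rk (clip L) (N k) G (wd m k) r i))/real (N k) \<le> \<delta>"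
  using clip_discretized[OF \<delta>(1), of r] by (elim exE conjE) simp
 define L where "L = max L1 L2"
 have L: "0 \<le> L" "L1 \<le> L" "L2 \<le> L" using L1(1) by (auto simp: L_def)
 define K where "K = 2*L * real r"
 have K: "0 \<le> K" using L by (simp add: K_def)
 \<comment> \<open>Eventually \<open>edge_diff\<close> is below
   \<open>edge_bound m + \<eta> < 2 \<eta>\<close>, and \<open>K\<close> is the sensitivity of the
   clipped ranks to one edge.\<close>
 define \<eta> where "\<eta> = \<delta>/(K + 1)/2"
 have \<eta>: "0 < \<eta>" "K*(2*\<eta>) \<le> \<delta>" using \<delta>(1) K by (auto simp: \<eta>_def field_simps)
 let ?Q = "\<lambda>m. \<integral>v. abs (w_Q v - w_Q (d m v)) \<partial>H" and ?Z = "\<lambda>m. \<integral>v. abs (w_zeta v - w_zeta (d m v)) \<partial>H"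
 have "(\<lambda>m. ?A*?Q m + L * real r*?Z m) \<longlonglongrightarrow> ?A*0 + L * real r*0"
  by (intro tendsto_add tendsto_mult tendsto_const Q_limit zeta_limit)
 then have 1: "EV m. ?A*?Q m + L * real r*?Z m < \<delta>"
  by (rule order_tendstoD) (use \<delta> in simp)
 have 2: "EV m. edge_bound m < \<eta>"
  by (rule order_tendstoD(2)[OF edge_bound_limit \<eta>(1)])
 show ?thesis
  using 1 2 L2(2)[OF L(3)]
 proof eventually_elim
  case (elim m)
  let ?q = "\<lambda>k. (\<Sum>i=1..N k. abs (w_Q (w k i) - w_Q (wd m k i)))/real (N k)"
   and ?z = "\<lambda>k. (\<Sum>i=1..N k. abs (w_zeta (w k i) - w_zeta (wd m k i)))/real (N k)"
  have "(\<lambda>k. ?A*?q k + L * real r*?z k) \<longlonglongrightarrow> ?A*?Q m + L * real r*?Z m"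
   by (intro tendsto_add tendsto_mult tendsto_const Q_error zeta_error)
  then have 3: "EV k. ?A*?q k + L * real r*?z k < \<delta>"
   by (rule order_tendstoD(2)) (rule elim(1))
  have 4: "EV k. edge_diff m k < edge_bound m + \<eta>" by (rule edge_diff_le[OF \<eta>(1)])
  show ?case
   using 3 4 L1(2)[OF L(2)] elim(3)
  proof eventually_elim
   case (elim k)
   let ?V = "vertex_pairs (N k)" and ?n = "N k"
   let ?F1 = "\<lambda>G. avg_cis ?n s (rank_iter ?n G (w k) r)" and ?F2 = "\<lambda>G. avg_cis ?n s (rk (clip L) ?n G (w k) r)"
    and ?F3 = "\<lambda>G. avg_cis ?n s (rk (clip L) ?n G (wd m k) r)" and ?F4 = "\<lambda>G. avg_cis ?n s (rank_iter ?n G (wd m k) r)"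
   have zeta1: "\<And>j. j \<in> {1..?n} ==> abs (w_zeta (w k j)) \<le> 1" using w_zeta_le c by (meson less_imp_le order_trans)
   have s: "abs s*x \<le> abs s*\<delta>" if "x \<le> \<delta>" for x using that by (rule mult_left_mono) simp
   have A: "norm (E k ?F1 - E k ?F2) \<le> abs s*\<delta>"
    by (rule order_trans[OF gexp_avg_cis_diff[OF p_prob] s[OF elim(3)]])
   have D: "norm (Ed m k ?F3 - Ed m k ?F4) \<le> abs s*\<delta>"
    by (subst norm_minus_commute) (rule order_trans[OF gexp_avg_cis_diff[OF pd_prob] s[OF elim(4)]])
   have B: "norm (E k ?F2 - Ed m k ?F2) \<le> abs s*\<delta>"
   proof -
    have "norm (E k ?F2 - Ed m k ?F2) \<le> (abs s*(K/real ?n))*(\<Sum>e\<in>?V. abs (p k e - pd m k e))"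
    proof (rule gexp_change_prob)
     fix e G assume e: "e \<in> ?V" "G \<subseteq> ?V"
     have "(\<Sum>i=1..?n. abs (rk (clip L) ?n (insert e G) (w k) r i - rk (clip L) ?n G (w k) r i)) \<le> 2*L * real r * real (card {fst e})"
      by (rule rk_change_rows) (use e zeta1 L in "auto simp: prod_eq_iff")
     then have "(\<Sum>i=1..?n. abs (rk (clip L) ?n (insert e G) (w k) r i - rk (clip L) ?n G (w k) r i))/real ?n \<le> K/real ?n"
      by (intro divide_right_mono) (simp_all add: K_def)
     then show "norm (?F2 (insert e G) - ?F2 G) \<le> abs s*(K/real ?n)"
      by (intro order_trans[OF norm_avg_cis_diff] mult_left_mono) simp_all
    qed (use p_prob pd_prob in auto)
    also have "\<dots> = abs s*(K*edge_diff m k)" by (simp add: edge_diff_def)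
    also have "\<dots> \<le> abs s*\<delta>"
    proof (rule s)
     have "K*edge_diff m k \<le> K*(2*\<eta>)"
      by (rule mult_left_mono[OF _ K]) (use elim(2) \<open>edge_bound m < \<eta>\<close> in linarith)
     then show "K*edge_diff m k \<le> \<delta>" using \<eta>(2) by linarith
    qed
    finally show ?thesis .
   qed
   have C: "norm (Ed m k ?F2 - Ed m k ?F3) \<le> abs s*\<delta>"
   proof -
    have "norm (Ed m k ?F2 - Ed m k ?F3) \<le> Ed m k (\<lambda>_. abs s*\<delta>)"
    proof (rule gexp_diff_le)
     fix G assume G: "G \<subseteq> ?V"
     have "(\<Sum>i=1..?n. abs (rk (clip L) ?n G (w k) r i - rk (clip L) ?n G (wd m k) r i))/real ?n
      \<le> (?A*(\<Sum>i=1..?n. abs (w_Q (w k i) - w_Q (wd m k i))) + L * real r*(\<Sum>i=1..?n. abs (w_zeta (w k i) - w_zeta (wd m k i))))/real ?n"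
      by (intro divide_right_mono rk_change_types G zeta1 L) simp_all
     also have "\<dots> = ?A*?q k + L * real r*?z k" by (simp only: add_divide_distrib times_divide_eq_right)
     also have "\<dots> \<le> \<delta>" using elim(1) by (rule less_imp_le)
     finally show "norm (?F2 G - ?F3 G) \<le> abs s*\<delta>" by (intro order_trans[OF norm_avg_cis_diff] s)
    qed (use pd_prob in auto)
    then show ?thesis by simp
   qed
   have "norm (E k ?F1 - Ed m k ?F4) \<le> norm (E k ?F1 - E k ?F2) + norm (E k ?F2 - Ed m k ?F2) + norm (Ed m k ?F2 - Ed m k ?F3) + norm (Ed m k ?F3 - Ed m k ?F4)"
    by (rule norm_diff_triangle_le[OF norm_diff_triangle_le[OF norm_diff_triangle_le]]) (rule order_refl)+
   then show ?case using A B C D \<delta>(2) by linarith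
  qed
 qed
qed

theorem rank_iter_limit:
 "(\<lambda>k. E k (\<lambda>G. avg_cis (N k) s (rank_iter (N k) G (w k) r))) \<longlonglongrightarrow> (\<integral>v. psi H th r s v \<partial>H)"
proof (rule LIMSEQ_I)
 fix eps :: real assume eps: "0 < eps"
 let ?X = "\<lambda>k. E k (\<lambda>G. avg_cis (N k) s (rank_iter (N k) G (w k) r))" and ?Y = "\<lambda>m k. Ed m k (\<lambda>G. avg_cis (N k) s (rank_iter (N k) G (wd m k) r))"
  and ?Z = "\<lambda>m. \<integral>v. psi (Hd m) th r s v \<partial>Hd m" and ?z = "\<integral>v. psi H th r s v \<partial>H"
 have "EV m. dist (?Z m) ?z < eps/3"
  by (rule tendstoD[OF psi_integral_limit]) (use theta int_in int_out eps in auto)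
 then have "EV m. dist (?Z m) ?z < eps/3 \<and> (EV k. norm (?X k - ?Y m k) \<le> eps/3)"
  using discretization_error[of "eps/3" s r] eps by (intro eventually_conj) auto
 then obtain m where m: "dist (?Z m) ?z < eps/3" "EV k. norm (?X k - ?Y m k) \<le> eps/3"
  using eventually_happens'[OF sequentially_bot] by blast
 have "EV k. dist (?Y m k) (?Z m) < eps/3"
  unfolding avg_cis_def by (rule tendstoD[OF finite_type_digraphs.rank_iter_char_limit[OF finite_model]]) (use eps in simp)
 with m(2) have "EV k. norm (?X k - ?z) < eps"
 proof eventually_elim
  case (elim k)
  have "norm (?X k - ?z) \<le> norm (?X k - ?Y m k) + norm (?Y m k - ?Z m) + norm (?Z m - ?z)"
   by (rule norm_diff_triangle_le[OF norm_diff_triangle_le]) (rule order_refl)+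
  then show ?case using elim m(1) unfolding dist_norm by linarith
 qed
 then show "\<exists>no. \<forall>k\<ge>no. norm (?X k - ?z) < eps" by (simp add: eventually_sequentially)
qed

text \<open>The number \<open>r\<close> of iterations is fixed first, by the convergence of the
  partial sums on the tree and by the geometric error on the graph. The latter is uniform in the
  graph and, for large \<open>k\<close>, in \<open>k\<close>, because the averages of
  \<open>|w_Q|\<close> are eventually bounded by \<open>q\<close>.\<close>

theorem page_rank_char_limit:
 assumes indep: "H.indep_var borel (\<lambda>w. (w_in w, w_Q w)) borel (\<lambda>w. (w_out w, w_zeta w))"
 shows "(\<lambda>k. E k (\<lambda>G. avg_cis (N k) s (page_rank (N k) G (w k)))) \<longlonglongrightarrow> char (law_endogenous (law_NQ H th) (law_C H th)) s"
proof (rule LIMSEQ_I)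
 fix eps :: real assume eps: "0 < eps"
 let ?X = "\<lambda>k. E k (\<lambda>G. avg_cis (N k) s (page_rank (N k) G (w k)))" and ?Y = "\<lambda>r k. E k (\<lambda>G. avg_cis (N k) s (rank_iter (N k) G (w k) r))"
  and ?z = "char (law_endogenous (law_NQ H th) (law_C H th)) s" and ?q = "\<lambda>k. (\<Sum>i=1..N k. abs (w_Q (w k i)))/real (N k)"
 define q where "q = (\<integral>v. abs (w_Q v) \<partial>H) + 1"
 have q: "0 < q" unfolding q_def by (intro add_nonneg_pos integral_nonneg_AE) auto
 have "(\<lambda>r. Psi r s) \<longlonglongrightarrow> ?z" unfolding Psi_eq_char[OF indep] by (rule tree.char_psum_limit)
 then have 1: "EV r. dist (Psi r s) ?z < eps/3" by (rule tendstoD) (use eps in simp)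
 have "(\<lambda>r. abs s*(c ^ r/(1 - c)*q)) \<longlonglongrightarrow> abs s*(0/(1 - c)*q)"
  by (intro tendsto_mult tendsto_divide tendsto_const LIMSEQ_power_zero) (use c in auto)
 then have "EV r. abs s*(c ^ r/(1 - c)*q) < eps/3" by (rule order_tendstoD) (use eps in simp)
 with 1 obtain r where r: "dist (Psi r s) ?z < eps/3" "abs s*(c ^ r/(1 - c)*q) < eps/3"
  using eventually_happens'[OF sequentially_bot eventually_conj] by blast
 have "EV k. ?q k < q" by (rule order_tendstoD(2)[OF avg_Q]) (simp add: q_def)
 moreover have "EV k. dist (?Y r k) (Psi r s) < eps/3"
  unfolding Psi_def by (rule tendstoD[OF rank_iter_limit]) (use eps in simp)
 ultimately have "EV k. norm (?X k - ?z) < eps"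
 proof eventually_elim
  case (elim k)
  have "norm (?X k - ?Y r k) \<le> E k (\<lambda>_. abs s*(c ^ r/(1 - c)*q))"
  proof (rule gexp_diff_le)
   fix G assume "G \<subseteq> vertex_pairs (N k)"
   then have "(\<Sum>i=1..N k. abs (page_rank (N k) G (w k) i - rank_iter (N k) G (w k) r i)) \<le> c ^ r/(1 - c)*(\<Sum>i=1..N k. abs (w_Q (w k i)))"
    by (rule page_rank_approx) (use w_zeta_le c in auto)
   then have "(\<Sum>i=1..N k. abs (page_rank (N k) G (w k) i - rank_iter (N k) G (w k) r i))/real (N k) \<le> c ^ r/(1 - c)*(\<Sum>i=1..N k. abs (w_Q (w k i)))/real (N k)"
    by (rule divide_right_mono) simp
   also have "\<dots> = c ^ r/(1 - c)*?q k" by simp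
   also have "\<dots> \<le> c ^ r/(1 - c)*q" using c elim(1) by (intro mult_left_mono) auto
   finally show "norm (avg_cis (N k) s (page_rank (N k) G (w k)) - avg_cis (N k) s (rank_iter (N k) G (w k) r)) \<le> abs s*(c ^ r/(1 - c)*q)"
    by (intro order_trans[OF norm_avg_cis_diff] mult_left_mono) simp_all
  qed (use p_prob in auto)
  then have "norm (?X k - ?Y r k) \<le> abs s*(c ^ r/(1 - c)*q)" by simp
  moreover have "norm (?X k - ?z) \<le> norm (?X k - ?Y r k) + norm (?Y r k - Psi r s) + norm (Psi r s - ?z)"
   by (rule norm_diff_triangle_le[OF norm_diff_triangle_le]) (rule order_refl)+
  ultimately show ?case using elim r unfolding dist_norm by linarith
 qed
 then show "\<exists>no. \<forall>k\<ge>no. norm (?X k - ?z) < eps" by (simp add: eventually_sequentially)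
qed

end

text \<open>Rounding toward zero onto the grid \<open>h\<int>\<close>; the cells are half-open on the left, as required
 by distribution functions.\<close>

definition rnd :: "real => real => real" where
 "rnd h x = h*(of_int \<lceil>x/h\<rceil> - of_bool (0 < x))"

lemma rnd_pos: "0 < h ==> 0 < x ==> 0 \<le> rnd h x \<and> rnd h x \<le> x \<and> x \<le> rnd h x + h"
proof -
 assume h: "0 < h" "0 < x"
 have "0 < x/h" using h by simp
 then have "1 \<le> \<lceil>x/h\<rceil>" by linarith
 then have "0 \<le> h*(of_int \<lceil>x/h\<rceil> - 1)" using h by simp
 moreover have "h*(of_int \<lceil>x/h\<rceil> - 1) \<le> h*(x/h)" "h*(x/h) \<le> h * of_int \<lceil>x/h\<rceil>"
  using h by (intro mult_left_mono; linarith)+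
 ultimately show ?thesis using h by (simp add: rnd_def right_diff_distrib)
qed

lemma rnd_nonpos: "0 < h ==> x \<le> 0 ==> x \<le> rnd h x \<and> rnd h x \<le> 0 \<and> rnd h x \<le> x + h"
proof -
 assume h: "0 < h" "x \<le> 0"
 have "x/h \<le> 0" using h by (simp add: divide_nonpos_pos)
 then have "\<lceil>x/h\<rceil> \<le> 0" by linarith
 then have "h * of_int \<lceil>x/h\<rceil> \<le> 0" using h by (simp add: mult_nonneg_nonpos)
 moreover have "h*(x/h) \<le> h * of_int \<lceil>x/h\<rceil>" "h * of_int \<lceil>x/h\<rceil> \<le> h*(x/h + 1)"
  using h by (intro mult_left_mono; linarith)+
 ultimately show ?thesis using h by (simp add: rnd_def distrib_left)
qed

lemma abs_rnd: "0 < h ==> abs (x - rnd h x) = abs x - abs (rnd h x)"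
 using rnd_pos[of h x] rnd_nonpos[of h x] by (cases "0 < x") auto

lemma rnd_nonneg: "0 < h ==> 0 \<le> x ==> 0 \<le> rnd h x"
 using rnd_pos[of h x] rnd_nonpos[of h x] by (cases "0 < x") auto

lemma rnd_close: "0 < h ==> abs (x - rnd h x) \<le> h"
 using rnd_pos[of h x] rnd_nonpos[of h x] by (cases "0 < x") auto

lemma rnd_zero [simp]: "rnd h 0 = 0" by (simp add: rnd_def)

lemma rnd_measurable [measurable]: "rnd h \<in> borel_measurable borel"
 unfolding rnd_def[abs_def] by measurable

text \<open>Both signs round to 0 near the origin, so the cell of 0 has double width. As a
  consequence every endpoint of a cell is a nonzero multiple of \<open>h\<close>.\<close>

lemma rnd_cell:
 assumes h: "0 < h"
 shows "rnd h x = h * of_int j \<longleftrightarrow>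
  (if 0 < j then h * of_int j < x \<and> x \<le> h * of_int (j + 1)
   else if j = 0 then h * of_int (- 1) < x \<and> x \<le> h * of_int 1
   else h * of_int (j - 1) < x \<and> x \<le> h * of_int j)"
proof -
 have lt: "h * of_int i < x \<longleftrightarrow> of_int i < x/h" and le: "x \<le> h * of_int i \<longleftrightarrow> x/h \<le> of_int i" for i :: int
  using h by (simp_all add: field_simps)
 have pos: "0 < x \<longleftrightarrow> 0 < x/h" using h by (simp add: zero_less_divide_iff)
 have "rnd h x = h * of_int j \<longleftrightarrow> \<lceil>x/h\<rceil> = j + of_bool (0 < x/h)"
  unfolding rnd_def pos using h by (auto split: if_splits)
 also have "\<dots> \<longleftrightarrow> (if 0 < j then of_int j < x/h \<and> x/h \<le> of_int (j + 1)
   else if j = 0 then of_int (- 1) < x/h \<and> x/h \<le> of_int 1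
   else of_int (j - 1) < x/h \<and> x/h \<le> of_int j)"
 proof -
  define y where "y = x/h"
  consider "0 < j" "(1::real) \<le> of_int j" | "j = 0" | "j < 0" "of_int j \<le> (- 1::real)" by linarith
  then show ?thesis unfolding ceiling_eq_iff y_def[symmetric] by cases (cases "0 < y"; simp; linarith)+
 qed
 finally show ?thesis by (simp only: lt le)
qed

text \<open>The point 0 is left out: a coordinate may well have an atom there, and no choice of the
  mesh moves it. The other grid points can be made to avoid countably many atoms.\<close>

definition grid :: "real => real set" where "grid h = {h * of_int k |k. k \<noteq> 0}"

definition scell :: "real => nat => real => real set" where
 "scell h K t = {x. - (h * real K) < x \<and> x \<le> h * real K \<and> rnd h x = t}"

lemma rnd_int: "\<exists>j. rnd h x = h * of_int j"
 unfolding rnd_def by (rule exI[of _ "\<lceil>x/h\<rceil> - of_bool (0 < x)"]) simp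

text \<open>The box ends at multiples of \<open>h\<close>, so a cell that meets the box lies inside
  it and is not cut at its boundary.\<close>

lemma scell_interval:
 assumes h: "0 < h"
 shows "\<exists>a\<in>grid h. \<exists>b\<in>grid h. a \<le> b \<and> scell h K t = {a<..b}"
proof (cases "scell h K t = {}")
 case True
 \<comment> \<open>An empty cell is the degenerate interval \<open>{h<..h}\<close>.\<close>
 have "h \<in> grid h" unfolding grid_def by (intro CollectI exI[of _ 1]) simp
 then show ?thesis using True by (intro bexI[of _ h]) auto
next
 case False
 then obtain x where x: "- (h * real K) < x" "x \<le> h * real K" "rnd h x = t" by (auto simp: scell_def)
 obtain j where j: "t = h * of_int j" using rnd_int[of h x] x(3) by auto
 define p where "p = (if 0 < j then j else if j = 0 then - 1 else j - 1)"
 define q where "q = (if 0 < j then j + 1 else if j = 0 then 1 else j)"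
 have pq: "p \<noteq> 0" "q \<noteq> 0" "p \<le> q" by (auto simp: p_def q_def)
 have cell: "rnd h y = t \<longleftrightarrow> h * of_int p < y \<and> y \<le> h * of_int q" for y
  unfolding j rnd_cell[OF h] p_def q_def by simp
 have "h * of_int p < h * real K" "h * - real K < h * of_int q" using x cell[of x] by auto
 then have "of_int p < real K" "- real K < of_int q" using h by (simp_all only: mult_less_cancel_left_pos)
 then have K: "p < int K" "- int K < q" by linarith+
 have "0 < 2*(h * real K)" using x by linarith
 then have "0 < K" using h by (simp add: zero_less_mult_iff)
 then have "- int K \<le> p \<and> q \<le> int K" using K by (auto simp: p_def q_def split: if_splits)
 then have "- real K \<le> of_int p" "of_int q \<le> real K" by linarith+
 then have "h*(- real K) \<le> h * of_int p" "h * of_int q \<le> h * real K" using h by (intro mult_left_mono; simp)+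
 then have "scell h K t = {h * of_int p<..h * of_int q}" by (auto simp: scell_def cell)
 moreover have "h * of_int p \<le> h * of_int q" using pq h by simp
 ultimately show ?thesis using pq by (intro bexI[of _ "h * of_int p"] bexI[of _ "h * of_int q"]) (auto simp: grid_def)
qed

definition in_range :: "real => nat => real => bool" where
 "in_range h K x \<longleftrightarrow> - (h * real K) < x \<and> x \<le> h * real K"

text \<open>Types outside the box are sent to \<open>0\<close>, so that every other cell is bounded and its frequency
 is determined by the distribution function at finite points.\<close>

definition grid_round :: "real => nat => ext_type => ext_type" where
 "grid_round h K v = (if in_range h K (w_in v) \<and> in_range h K (w_out v) \<and> in_range h K (w_Q v) \<and> in_range h K (w_zeta v)
   then (rnd h (w_in v), rnd h (w_out v), rnd h (w_Q v), rnd h (w_zeta v)) else (0, 0, 0, 0))"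

lemma w_simps [simp]: "w_in (a, x) = a" "w_out (a, b, y) = b" "w_Q (a, b, p, z) = p" "w_zeta (a, b, p, q) = q"
 by (simp_all add: w_in_def w_out_def w_Q_def w_zeta_def)

lemma grid_round_measurable [measurable]: "grid_round h K \<in> borel_measurable borel"
proof -
 have "(\<lambda>v. (rnd h (w_in v), rnd h (w_out v), rnd h (w_Q v), rnd h (w_zeta v))) \<in> borel_measurable borel"
  by (intro borel_measurable_Pair) measurable
 then show ?thesis unfolding grid_round_def[abs_def] in_range_def by measurable
qed

lemma grid_round_components:
 assumes "0 < h"
 shows "abs (w_in v - w_in (grid_round h K v)) = abs (w_in v) - abs (w_in (grid_round h K v))"
  "abs (w_out v - w_out (grid_round h K v)) = abs (w_out v) - abs (w_out (grid_round h K v))"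
  "abs (w_Q v - w_Q (grid_round h K v)) = abs (w_Q v) - abs (w_Q (grid_round h K v))"
  "abs (w_zeta v - w_zeta (grid_round h K v)) = abs (w_zeta v) - abs (w_zeta (grid_round h K v))"
 using assms by (auto simp: grid_round_def abs_rnd)

lemma grid_round_nonneg:
 "0 < h ==> 0 \<le> w_in v \<and> 0 \<le> w_out v ==> 0 \<le> w_in (grid_round h K v) \<and> 0 \<le> w_out (grid_round h K v)"
 by (auto simp: grid_round_def rnd_nonneg)

lemma finite_range_grid_round:
 assumes h: "0 < h"
 shows "finite (range (grid_round h K))"
proof -
 let ?S = "(\<lambda>j. h * of_int j) ` {- int K..int K}"
 have S: "rnd h x \<in> ?S" if "in_range h K x" for x :: real
 proof -
  obtain j where j: "rnd h x = h * of_int j" using rnd_int by blast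
  have "abs (rnd h x) \<le> abs x" using abs_rnd[OF h, of x] abs_ge_zero[of "x - rnd h x"] by linarith
  also have "abs x \<le> h * real K" using that by (auto simp: in_range_def)
  finally have "abs (of_int j) \<le> real K" using h by (simp add: j abs_mult)
  then have "abs j \<le> int K" by linarith
  then have "j \<in> {- int K..int K}" by auto
  then show ?thesis unfolding j by (rule imageI)
 qed
 have 0: "0 \<in> ?S" by (rule image_eqI[of _ _ 0]) auto
 have "range (grid_round h K) \<subseteq> ?S \<times> ?S \<times> ?S \<times> ?S"
  using S 0 by (auto simp: grid_round_def simp del: image_iff)
 then show ?thesis by (rule finite_subset) simp
qed

lemma grid_round_limit:
 assumes h: "\<And>m. 0 < h m" "h \<longlonglongrightarrow> 0" and K: "filterlim (\<lambda>m. h m * real (K m)) at_top sequentially"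
 shows "(\<lambda>m. grid_round (h m) (K m) v) \<longlonglongrightarrow> v"
proof -
 let ?A = "\<lambda>m. (rnd (h m) (w_in v), rnd (h m) (w_out v), rnd (h m) (w_Q v), rnd (h m) (w_zeta v))"
 have r: "EV m. in_range (h m) (K m) x" for x :: real
 proof -
  have "EV m. abs x < h m * real (K m)" using K unfolding filterlim_at_top_dense by blast
  then show ?thesis by eventually_elim (auto simp: in_range_def)
 qed
 have lim: "(\<lambda>m. rnd (h m) x) \<longlonglongrightarrow> x" for x :: real
 proof -
  have "(\<lambda>m. abs (rnd (h m) x - x)) \<longlonglongrightarrow> 0"
   by (rule tendsto_sandwich[OF _ _ tendsto_const h(2)]) (use rnd_close[OF h(1), where x = x] in "auto simp: abs_minus_commute intro!: always_eventually")
  then show ?thesis by (simp add: tendsto_rabs_zero_iff LIM_zero_iff)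
 qed
 have "?A \<longlonglongrightarrow> (w_in v, w_out v, w_Q v, w_zeta v)"
  by (intro tendsto_Pair lim)
 then have "?A \<longlonglongrightarrow> v"
  by (cases v) simp
 moreover have "EV m. (rnd (h m) (w_in v), rnd (h m) (w_out v), rnd (h m) (w_Q v), rnd (h m) (w_zeta v)) = grid_round (h m) (K m) v"
  using r[of "w_in v"] r[of "w_out v"] r[of "w_Q v"] r[of "w_zeta v"] by eventually_elim (simp add: grid_round_def)
 ultimately show ?thesis by (rule Lim_transform_eventually)
qed

lemma grid_round_cell:
 assumes "(t1, t2, t3, t4) \<noteq> (0, 0, 0, 0)"
 shows "{v. grid_round h K v = (t1, t2, t3, t4)} = scell h K t1 \<times> scell h K t2 \<times> scell h K t3 \<times> scell h K t4"
 using assms by (auto simp: grid_round_def scell_def in_range_def)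

section \<open>Empirical frequencies of the grid cells\<close>

context type_law
begin

definition atoms :: "real set" where
 "atoms = {x. \<exists>C\<in>{w_in, w_out, w_Q, w_zeta}. measure H {v. C v = x} \<noteq> 0}"

lemma coordinate_measurable: "C \<in> {w_in, w_out, w_Q, w_zeta} ==> C \<in> borel_measurable H"
 using measurable_ext_type unfolding measurable_cong_sets[OF H(2) refl] by auto

lemma space_H: "space H = UNIV"
 using sets_eq_imp_space_eq[OF H(2)] by simp

lemma countable_atoms: "countable atoms"
proof -
 have "countable {x. measure H {v. C v = x} \<noteq> 0}" if C: "C \<in> {w_in, w_out, w_Q, w_zeta}" for C
 proof -
  interpret D: prob_space "distr H borel C" by (rule H.prob_space_distr[OF coordinate_measurable[OF C]])
  have "measure (distr H borel C) {x} = measure H {v. C v = x}" for x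
   by (subst measure_distr[OF coordinate_measurable[OF C]]) (auto simp: space_H vimage_def)
  then show ?thesis using D.countable_support by simp
 qed
 moreover have "atoms = (\<Union>C\<in>{w_in, w_out, w_Q, w_zeta}. {x. measure H {v. C v = x} \<noteq> 0})"
  by (auto simp: atoms_def)
 ultimately show ?thesis by (simp only:) (rule countable_UN, auto)
qed

lemma AE_neq_nonatom:
 assumes C: "C \<in> {w_in, w_out, w_Q, w_zeta}" and x: "x \<notin> atoms"
 shows "AE v in H. C v \<noteq> x"
proof -
 have "C -` {x} \<inter> space H \<in> sets H" by (rule measurable_sets[OF coordinate_measurable[OF C]]) simp
 then have s: "{v. C v = x} \<in> sets H" by (simp add: space_H vimage_def)
 have "measure H {v. C v = x} = 0" using C x by (auto simp: atoms_def)
 then have "{v. C v = x} \<in> null_sets H" using s by (simp add: null_sets_def H.emeasure_eq_measure)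
 then show ?thesis by (rule AE_I') (auto simp: space_H)
qed

definition orthant :: "ext_type => ext_type set" where
 "orthant = (\<lambda>(u, v, q, t). {..u} \<times> {..v} \<times> {..q} \<times> {..t})"

lemma type_cdf_eq: "type_cdf H x = measure H (orthant x)"
 by (simp add: type_cdf_def orthant_def split: prod.splits)

text \<open>Under the assumption the boundary of the orthant is a null set, so along any sequence
  the indicators of the orthants converge almost surely.\<close>

lemma isCont_type_cdf:
 assumes x: "w_in x \<notin> atoms" "w_out x \<notin> atoms" "w_Q x \<notin> atoms" "w_zeta x \<notin> atoms"
 shows "isCont (type_cdf H) x"
 unfolding continuous_at_sequentially
proof (intro allI impI)
 fix X assume X: "X \<longlonglongrightarrow> x"
 have mem: "v \<in> orthant y \<longleftrightarrow> w_in v \<le> w_in y \<and> w_out v \<le> w_out y \<and> w_Q v \<le> w_Q y \<and> w_zeta v \<le> w_zeta y" for v y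
  by (cases v; cases y) (simp add: orthant_def)
 have sets: "orthant y \<in> sets H" for y
  unfolding H(2) orthant_def by (cases y) (auto intro!: borel_closed closed_Times)
 have "(\<lambda>n. \<integral>v. indicator (orthant (X n)) v \<partial>H) \<longlonglongrightarrow> (\<integral>v. indicator (orthant x) v \<partial>H :: real)"
 proof (rule integral_dominated_convergence[where w = "\<lambda>_. 1"])
  have "AE v in H. w_in v \<noteq> w_in x" "AE v in H. w_out v \<noteq> w_out x" "AE v in H. w_Q v \<noteq> w_Q x" "AE v in H. w_zeta v \<noteq> w_zeta x"
   using x by (intro AE_neq_nonatom; simp)+
  then show "AE v in H. (\<lambda>n. indicator (orthant (X n)) v) \<longlonglongrightarrow> (indicator (orthant x) v :: real)"
  proof eventually_elim
   case (elim v)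
   have ev: "EV n. a \<le> s n \<longleftrightarrow> a \<le> l" if "s \<longlonglongrightarrow> l" "a \<noteq> l" for s :: "nat => real" and a l
   proof (cases "a < l")
    case True
    show ?thesis using order_tendstoD(1)[OF that(1) True] by eventually_elim (use True in auto)
   next
    case False
    then have la: "l < a" using that(2) by simp
    show ?thesis using order_tendstoD(2)[OF that(1) la] by eventually_elim (use \<open>l < a\<close> in auto)
   qed
   have "EV n. indicator (orthant x) v = (indicator (orthant (X n)) v :: real)"
    using ev[OF tendsto_components(1)[OF X] elim(1)] ev[OF tendsto_components(2)[OF X] elim(2)]
     ev[OF tendsto_components(3)[OF X] elim(3)] ev[OF tendsto_components(4)[OF X] elim(4)]
    by eventually_elim (simp add: indicator_def mem)
   then show ?case by (rule Lim_transform_eventually[OF tendsto_const])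
  qed
 qed (use sets in auto)
 then show "(type_cdf H \<circ> X) \<longlonglongrightarrow> type_cdf H x"
  by (simp add: type_cdf_eq comp_def space_H)
qed

text \<open>An atom \<open>x\<close> lies on the grid at level \<open>m\<close> with index
  \<open>k\<close> only if \<open>h = x 2^m/k\<close>. This excludes countably many
  \<open>h\<close>, so a single scale serves all levels.\<close>

lemma grid_scale_exists: "\<exists>h>0. \<forall>m. grid (h/2 ^ m) \<inter> atoms = {}"
proof -
 define B where "B = (\<Union>m::nat. \<Union>k::int. (\<lambda>x. x*2 ^ m/of_int k) ` atoms)"
 have "countable B" unfolding B_def by (intro countable_UN countable_image countable_atoms) auto
 then have "uncountable ({0<..<1::real} - B)" by (intro uncountable_minus_countable) (simp_all add: uncountable_open_interval)
 then have "{0<..<1::real} - B \<noteq> {}" by (metis countable_empty)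
 then obtain h where h: "h \<in> {0<..<1}" "h \<notin> B" by blast
 have "x \<notin> atoms" if "x \<in> grid (h/2 ^ m)" for x m
 proof
  assume a: "x \<in> atoms"
  have "\<exists>k. x = h/2 ^ m * of_int k \<and> k \<noteq> 0" using that unfolding grid_def mem_Collect_eq .
  then obtain k where k: "x = h/2 ^ m * of_int k" "k \<noteq> 0" by (elim exE conjE)
  then have "h = x*2 ^ m/of_int k" by (simp add: field_simps)
  then have "h \<in> B" using a unfolding B_def by blast
  then show False using h by simp
 qed
 then show ?thesis using h by (intro exI[of _ h]) auto
qed

definition freq :: "nat => (nat => ext_type) => ext_type set => real" where
 "freq n u S = (\<Sum>i=1..n. of_bool (u i \<in> S))/real n"

lemma empirical_cdf_eq: "empirical_cdf n u x = freq n u (orthant x)"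
proof -
 obtain a b p q where x: "x = (a, b, p, q)" by (cases x)
 have "u i \<in> orthant x \<longleftrightarrow> w_in (u i) \<le> a \<and> w_out (u i) \<le> b \<and> w_Q (u i) \<le> p \<and> w_zeta (u i) \<le> q" for i
  by (cases "u i") (simp add: orthant_def x)
 then show ?thesis by (simp only: empirical_cdf_def freq_def x prod.case)
qed

context
 fixes N :: "nat => nat" and w :: "nat => nat => ext_type"
 assumes size: "filterlim N at_top sequentially"
begin

definition conv :: "ext_type set => bool" where
 "conv S \<longleftrightarrow> S \<in> sets H \<and> (\<lambda>k. freq (N k) (w k) S) \<longlonglongrightarrow> measure H S"

lemma conv_Diff:
 assumes "conv A" "conv B" "B \<subseteq> A"
 shows "conv (A - B)"
proof -
 have "of_bool (x \<in> A - B) = of_bool (x \<in> A) - (of_bool (x \<in> B) :: real)" for x using assms(3) by auto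
 then have "freq n u (A - B) = freq n u A - freq n u B" for n u
  unfolding freq_def by (simp only: sum_subtractf diff_divide_distrib)
 moreover have "measure H (A - B) = measure H A - measure H B"
  using assms by (intro H.finite_measure_Diff) (auto simp: conv_def)
 ultimately show ?thesis using assms by (auto simp: conv_def intro!: tendsto_diff)
qed

lemma conv_disjoint_UN:
 assumes "finite I" "\<And>i. i \<in> I ==> conv (A i)" "disjoint_family_on A I"
 shows "conv (\<Union>i\<in>I. A i)"
proof -
 have "of_bool (x \<in> (\<Union>i\<in>I. A i)) = (\<Sum>i\<in>I. of_bool (x \<in> A i) :: real)" for x
  using indicator_UN_disjoint[OF assms(1,3), of x] by (simp only: indicator_def of_bool_def)
 then have "freq n u (\<Union>i\<in>I. A i) = (\<Sum>i\<in>I. freq n u (A i))" for n u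
  unfolding freq_def by (simp only:) (subst sum.swap, simp only: sum_divide_distrib)
 moreover have "measure H (\<Union>i\<in>I. A i) = (\<Sum>i\<in>I. measure H (A i))"
  using assms by (intro H.finite_measure_finite_Union) (auto simp: conv_def)
 ultimately show ?thesis using assms by (auto simp: conv_def intro!: tendsto_sum)
qed

lemma conv_UNIV: "conv UNIV"
proof -
 have "EV k. 1 \<le> N k" using size unfolding filterlim_at_top by blast
 then have "EV k. 1 = freq (N k) (w k) UNIV" by eventually_elim (simp add: freq_def)
 then have "(\<lambda>k. freq (N k) (w k) UNIV) \<longlonglongrightarrow> 1" by (rule Lim_transform_eventually[OF tendsto_const])
 moreover have "measure H UNIV = 1" using H.prob_space space_H by simp
 ultimately show ?thesis using H(2) by (simp add: conv_def)
qed

text \<open>A half-open box arises from orthants by one set difference in each coordinate.\<close>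

lemma conv_boxes:
 assumes "\<And>x. w_in x \<in> P ==> w_out x \<in> P ==> w_Q x \<in> P ==> w_zeta x \<in> P ==> conv (orthant x)"
  and P: "a1 \<in> P" "a2 \<in> P" "a3 \<in> P" "a4 \<in> P" "b1 \<in> P" "b2 \<in> P" "b3 \<in> P" "b4 \<in> P"
  and le: "a1 \<le> b1" "a2 \<le> b2" "a3 \<le> b3" "a4 \<le> b4"
 shows "conv ({a1<..b1} \<times> {a2<..b2} \<times> {a3<..b3} \<times> {a4<..b4})"
proof -
 have 0: "conv ({..u} \<times> {..v} \<times> {..q} \<times> {..t})" if "u \<in> P" "v \<in> P" "q \<in> P" "t \<in> P" for u v q t
  using assms(1)[of "(u, v, q, t)"] that by (simp add: orthant_def)
 have 1: "conv ({a1<..b1} \<times> {..v} \<times> {..q} \<times> {..t})" if "v \<in> P" "q \<in> P" "t \<in> P" for v q t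
 proof -
  have "{a1<..b1} \<times> {..v} \<times> {..q} \<times> {..t} = {..b1} \<times> {..v} \<times> {..q} \<times> {..t} - {..a1} \<times> {..v} \<times> {..q} \<times> {..t}" by auto
  then show ?thesis by (simp only:) (intro conv_Diff 0 that P Sigma_mono; use le in auto)
 qed
 have 2: "conv ({a1<..b1} \<times> {a2<..b2} \<times> {..q} \<times> {..t})" if "q \<in> P" "t \<in> P" for q t
 proof -
  have "{a1<..b1} \<times> {a2<..b2} \<times> {..q} \<times> {..t} = {a1<..b1} \<times> {..b2} \<times> {..q} \<times> {..t} - {a1<..b1} \<times> {..a2} \<times> {..q} \<times> {..t}" by auto
  then show ?thesis by (simp only:) (intro conv_Diff 1 that P Sigma_mono; use le in auto)
 qed
 have 3: "conv ({a1<..b1} \<times> {a2<..b2} \<times> {a3<..b3} \<times> {..t})" if "t \<in> P" for t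
 proof -
  have "{a1<..b1} \<times> {a2<..b2} \<times> {a3<..b3} \<times> {..t} = {a1<..b1} \<times> {a2<..b2} \<times> {..b3} \<times> {..t} - {a1<..b1} \<times> {a2<..b2} \<times> {..a3} \<times> {..t}" by auto
  then show ?thesis by (simp only:) (intro conv_Diff 2 that P Sigma_mono; use le in auto)
 qed
 have "{a1<..b1} \<times> {a2<..b2} \<times> {a3<..b3} \<times> {a4<..b4} = {a1<..b1} \<times> {a2<..b2} \<times> {a3<..b3} \<times> {..b4} - {a1<..b1} \<times> {a2<..b2} \<times> {a3<..b3} \<times> {..a4}" by auto
 then show ?thesis by (simp only:) (intro conv_Diff 3 P Sigma_mono; use le in auto)
qed

text \<open>The cells of nonzero grid points are half-open boxes. The cell of 0 also contains
  everything outside the large box, so it is treated as the complement of the finitely many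
  others.\<close>

lemma grid_round_freq:
 assumes h: "0 < h"
  and lim: "\<And>x. w_in x \<in> grid h ==> w_out x \<in> grid h ==> w_Q x \<in> grid h ==> w_zeta x \<in> grid h ==>
   (\<lambda>k. empirical_cdf (N k) (w k) x) \<longlonglongrightarrow> type_cdf H x"
 shows "conv {v. grid_round h K v = ty}"
proof -
 let ?A = "range (grid_round h K)"
 have orth: "conv (orthant x)" if "w_in x \<in> grid h" "w_out x \<in> grid h" "w_Q x \<in> grid h" "w_zeta x \<in> grid h" for x
 proof -
  have "orthant x \<in> sets H" unfolding H(2) orthant_def by (cases x) (auto intro!: borel_closed closed_Times)
  then show ?thesis using lim[OF that] by (simp add: conv_def empirical_cdf_eq type_cdf_eq)
 qed
 have nz: "conv {v. grid_round h K v = ty}" if ne: "ty \<noteq> (0, 0, 0, 0)" for ty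
 proof -
  obtain t1 t2 t3 t4 where ty: "ty = (t1, t2, t3, t4)" by (cases ty)
  obtain a1 b1 where i1: "a1 \<in> grid h" "b1 \<in> grid h" "a1 \<le> b1" "scell h K t1 = {a1<..b1}"
   using scell_interval[OF h, of K t1] by (elim bexE conjE)
  obtain a2 b2 where i2: "a2 \<in> grid h" "b2 \<in> grid h" "a2 \<le> b2" "scell h K t2 = {a2<..b2}"
   using scell_interval[OF h, of K t2] by (elim bexE conjE)
  obtain a3 b3 where i3: "a3 \<in> grid h" "b3 \<in> grid h" "a3 \<le> b3" "scell h K t3 = {a3<..b3}"
   using scell_interval[OF h, of K t3] by (elim bexE conjE)
  obtain a4 b4 where i4: "a4 \<in> grid h" "b4 \<in> grid h" "a4 \<le> b4" "scell h K t4 = {a4<..b4}"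
   using scell_interval[OF h, of K t4] by (elim bexE conjE)
  show ?thesis
   unfolding ty grid_round_cell[OF ne[unfolded ty]] i1(4) i2(4) i3(4) i4(4)
   by (rule conv_boxes[OF orth i1(1) i2(1) i3(1) i4(1) i1(2) i2(2) i3(2) i4(2) i1(3) i2(3) i3(3) i4(3)])
 qed
 show ?thesis
 proof (cases "ty = (0, 0, 0, 0)")
  case True
  have "{v. grid_round h K v = ty} = UNIV - (\<Union>\<sigma>\<in>?A - {ty}. {v. grid_round h K v = \<sigma>})" by auto
  moreover have "conv (\<Union>\<sigma>\<in>?A - {ty}. {v. grid_round h K v = \<sigma>})"
  proof (rule conv_disjoint_UN)
   show "conv {v. grid_round h K v = \<sigma>}" if "\<sigma> \<in> ?A - {ty}" for \<sigma>
    by (rule nz) (use that True in blast)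
   show "disjoint_family_on (\<lambda>\<sigma>. {v. grid_round h K v = \<sigma>}) (?A - {ty})"
    unfolding disjoint_family_on_def by blast
  qed (simp add: finite_range_grid_round[OF h])
  ultimately show ?thesis using conv_Diff[OF conv_UNIV] by simp
 qed (rule nz)
qed

end

end

section \<open>Convergence in probability\<close>

text \<open>A subsequence principle: convergence in probability is tested along sequences of sample points
 along which countably many given quantities converge.\<close>

lemma tends_in_prob_by_sequences:
 fixes X :: "'j::countable => nat => 'a => real" and Y :: "nat => 'a => real"
 assumes M: "prob_space M"
  and X: "\<And>j. tends_in_prob M (X j) (x j)" "\<And>j n. X j n \<in> borel_measurable M"
  and Y: "\<And>sz om. strict_mono sz ==> (\<And>k. om k \<in> space M) ==>
   (\<And>j. (\<lambda>k. X j (sz k) (om k)) \<longlonglongrightarrow> x j) ==> (\<lambda>k. Y (sz k) (om k)) \<longlonglongrightarrow> y"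
 shows "tends_in_prob M Y y"
 unfolding tends_in_prob_def
proof (intro allI impI, rule ccontr)
 interpret prob_space M by (rule M)
 fix eps :: real assume eps: "0 < eps"
 define I where "I k = {j :: 'j. to_nat j \<le> k}" for k
 have I: "finite (I k)" for k
  by (rule inj_on_finite[of to_nat _ "{..k}"]) (auto simp: I_def)
 let ?B = "\<lambda>n. {om \<in> space M. abs (Y n om - y) > eps}"
 assume "\<not> (\<lambda>n. measure M (?B n)) \<longlonglongrightarrow> 0"
 then obtain \<delta> where \<delta>: "0 < \<delta>" "\<And>m. \<exists>n\<ge>m. \<delta> \<le> measure M (?B n)"
  unfolding LIMSEQ_def by (auto simp: not_less)
 \<comment> \<open>For large \<open>n\<close> the finitely many tests of index set
   \<open>I k\<close> fail with total probability below \<open>\<delta>\<close>, while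
   \<open>?B n\<close> has probability at least \<open>\<delta>\<close> infinitely often. So some
   bad sample point passes all these tests.\<close>
 have ex: "\<exists>n om. m < n \<and> om \<in> ?B n \<and> (\<forall>j\<in>I k. abs (X j n om - x j) \<le> inverse (Suc k))" for m k :: nat
 proof -
  let ?C = "\<lambda>j n. {om \<in> space M. abs (X j n om - x j) > inverse (Suc k)}"
  have C: "?C j n \<in> sets M" for j n using X(2)[of j n] by measurable
  have "(\<lambda>n. \<Sum>j\<in>I k. measure M (?C j n)) \<longlonglongrightarrow> (\<Sum>j\<in>I k. 0)"
   by (rule tendsto_sum) (use X(1) in "simp add: tends_in_prob_def")
  then have "EV n. (\<Sum>j\<in>I k. measure M (?C j n)) < \<delta>" by (rule order_tendstoD(2)) (use \<delta> in simp)
  then obtain m' where m': "\<And>n. m' \<le> n ==> (\<Sum>j\<in>I k. measure M (?C j n)) < \<delta>" by (auto simp: eventually_sequentially)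
  obtain n where n: "max m' (Suc m) \<le> n" "\<delta> \<le> measure M (?B n)" using \<delta>(2) by blast
  \<comment> \<open>A set outside the sigma-algebra has measure 0 by convention, so positive measure
    forces measurability.\<close>
  have B: "?B n \<in> sets M" using n(2) \<delta>(1) measure_notin_sets[of "?B n" M] by fastforce
  have "\<not> ?B n \<subseteq> (\<Union>j\<in>I k. ?C j n)"
  proof
   assume "?B n \<subseteq> (\<Union>j\<in>I k. ?C j n)"
   then have "measure M (?B n) \<le> measure M ((\<Union>j\<in>I k. ?C j n))"
    by (rule finite_measure_mono) (use I C in auto)
   also have "\<dots> \<le> (\<Sum>j\<in>I k. measure M (?C j n))"
    by (rule finite_measure_subadditive_finite) (use I C in auto)
   also have "\<dots> < \<delta>" by (rule m') (use n(1) in simp)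
   finally show False using n(2) by simp
  qed
  then obtain om where om: "om \<in> ?B n" "om \<notin> (\<Union>j\<in>I k. ?C j n)" by blast
  then have "\<forall>j\<in>I k. abs (X j n om - x j) \<le> inverse (Suc k)" by (auto simp: not_less)
  then show ?thesis using om(1) n(1) by (intro exI[of _ n] exI[of _ om]) auto
 qed
 define Q where "Q k p \<longleftrightarrow> snd p \<in> ?B (fst p) \<and> (\<forall>j\<in>I k. abs (X j (fst p) (snd p) - x j) \<le> inverse (Suc k))" for k and p :: "nat \<times> 'a"
 have "\<exists>f. \<forall>k. Q k (f k) \<and> fst (f k) < fst (f (Suc k))"
 proof (rule dependent_nat_choice[where P = Q and Q = "\<lambda>_ p p'. fst p < fst p'"])
  show "\<exists>p. Q 0 p" using ex[of 0 0] unfolding Q_def by auto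
  show "\<exists>p'. Q (Suc k) p' \<and> fst p < fst p'" for p k using ex[of "fst p" "Suc k"] unfolding Q_def by auto
 qed
 then obtain f where f: "\<And>k. Q k (f k)" "\<And>k. fst (f k) < fst (f (Suc k))" by blast
 have "(\<lambda>k. Y (fst (f k)) (snd (f k))) \<longlonglongrightarrow> y"
 proof (rule Y)
  show "strict_mono (\<lambda>k. fst (f k))" using f(2) by (simp add: strict_mono_Suc_iff)
  show "snd (f k) \<in> space M" for k using f(1)[of k] by (auto simp: Q_def)
  show "(\<lambda>k. X j (fst (f k)) (snd (f k))) \<longlonglongrightarrow> x j" for j
  proof -
   have "(\<lambda>k. X j (fst (f k)) (snd (f k)) - x j) \<longlonglongrightarrow> 0"
   proof (rule Lim_null_comparison[OF _ LIMSEQ_inverse_real_of_nat])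
    have "norm (X j (fst (f k)) (snd (f k)) - x j) \<le> inverse (real (Suc k))" if "to_nat j \<le> k" for k
     using f(1)[of k] that by (simp add: Q_def I_def)
    then show "EV k. norm (X j (fst (f k)) (snd (f k)) - x j) \<le> inverse (real (Suc k))"
     unfolding eventually_sequentially by blast
   qed
   then show ?thesis by (simp add: LIM_zero_iff)
  qed
 qed
 then have "EV k. dist (Y (fst (f k)) (snd (f k))) y < eps" by (rule tendstoD[OF _ eps])
 then obtain k where "dist (Y (fst (f k)) (snd (f k))) y < eps" by (auto simp: eventually_sequentially)
 then show False using f(1)[of k] by (simp add: Q_def dist_real_def)
qed

lemma integral_tends_of_bounded:
 fixes Y :: "nat => 'a => real"
 assumes M: "prob_space M" and Y: "tends_in_prob M Y y" "\<And>n. Y n \<in> borel_measurable M"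
  and B: "\<And>n om. abs (Y n om) \<le> B" "abs y \<le> B"
 shows "(\<lambda>n. \<integral>om. Y n om \<partial>M) \<longlonglongrightarrow> y"
proof (rule LIMSEQ_I)
 interpret prob_space M by (rule M)
 fix eps :: real assume eps: "0 < eps"
 have B0: "0 \<le> B" using B(2) by linarith
 let ?A = "\<lambda>n. {om \<in> space M. abs (Y n om - y) > eps/2}"
 have A: "?A n \<in> sets M" for n using Y(2)[of n] by measurable
 have int: "integrable M (Y n)" for n by (rule integrable_const_bound[where B = B]) (use B Y(2) in auto)
 have "(\<lambda>n. 2*B * measure M (?A n)) \<longlonglongrightarrow> 2*B*0"
  by (intro tendsto_mult tendsto_const) (use Y(1)[unfolded tends_in_prob_def, rule_format, of "eps/2"] eps in simp)
 then have "EV n. 2*B * measure M (?A n) < eps/2" by (rule order_tendstoD(2)) (use eps in simp)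
 then have "EV n. norm ((\<integral>om. Y n om \<partial>M) - y) < eps"
 proof eventually_elim
  case (elim n)
  have "(\<integral>om. Y n om \<partial>M) - y = (\<integral>om. Y n om - y \<partial>M)" using int by (simp add: prob_space)
  then have "norm ((\<integral>om. Y n om \<partial>M) - y) \<le> (\<integral>om. abs (Y n om - y) \<partial>M)" using integral_norm_bound[of M "\<lambda>om. Y n om - y"] by simp
  also have "\<dots> \<le> (\<integral>om. eps/2 + 2*B*indicator (?A n) om \<partial>M)"
  proof (rule integral_mono)
   fix om assume "om \<in> space M"
   then show "abs (Y n om - y) \<le> eps/2 + 2*B*indicator (?A n) om"
    using B(1)[of n om] B(2) B0 eps by (auto simp: indicator_def)
  qed (use int A in "auto intro!: integrable_real_indicator simp: emeasure_eq_measure")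
  also have "\<dots> = eps/2 + 2*B * measure M (?A n)"
   using A by (simp add: prob_space emeasure_eq_measure)
  finally show ?case using elim by linarith
 qed
 then show "\<exists>no. \<forall>n\<ge>no. norm ((\<integral>om. Y n om \<partial>M) - y) < eps" by (simp add: eventually_sequentially)
qed

section \<open>The random digraph\<close>

lemma gexp_measurable:
 fixes F :: "'e set => 'a => 'b::{second_countable_topology, real_normed_vector}"
 assumes "\<And>G. G \<subseteq> V ==> F G \<in> borel_measurable M" "\<And>e. e \<in> V ==> (\<lambda>x. p x e) \<in> borel_measurable M"
 shows "(\<lambda>x. gexp V (p x) (\<lambda>G. F G x)) \<in> borel_measurable M"
 unfolding gexp_def
 by (intro borel_measurable_sum borel_measurable_scaleR borel_measurable_times borel_measurable_prod borel_measurable_diff borel_measurable_const assms) auto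

lemma norm_gexp_le_const:
 fixes F :: "'e set => 'b::real_normed_vector"
 assumes "finite V" "\<And>e. e \<in> V ==> 0 \<le> p e \<and> p e \<le> 1" "\<And>G. G \<subseteq> V ==> norm (F G) \<le> c"
 shows "norm (gexp V p F) \<le> c"
 using norm_gexp_le[of V p F] gexp_le_const[of V p "\<lambda>G. norm (F G)" c] assms by force

section \<open>Conditional expectations of functions of the graph given the types\<close>

context inhom_random_digraph
begin

abbreviation "types n \<equiv> types_upto W n"
abbreviation "F n \<equiv> types_sigma M W n"
abbreviation "TS n \<equiv> PiM {1..n} (\<lambda>_. borel :: ext_type measure)"

lemma types_measurable: "types n \<in> M \<rightarrow>\<^sub>M TS n"
 unfolding types_upto_def[abs_def] by (rule measurable_restrict) (simp add: type_measurable)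

lemma subalgebra_F: "subalgebra M (F n)"
proof -
 have "types n \<in> space M \<rightarrow> space (TS n)" using measurable_space[OF types_measurable] by blast
 then show ?thesis
  unfolding subalgebra_def types_sigma_def
  by (auto simp: sets_vimage_algebra2 intro: measurable_sets[OF types_measurable])
qed

lemma F_measurable: "f \<in> F n \<rightarrow>\<^sub>M N ==> f \<in> M \<rightarrow>\<^sub>M N"
 by (rule measurable_from_subalg[OF subalgebra_F])

lemma types_F: "types n \<in> F n \<rightarrow>\<^sub>M TS n"
 unfolding types_sigma_def
 by (rule measurable_vimage_algebra1) (use measurable_space[OF types_measurable] in blast)

lemma type_F: "i \<in> {1..n} ==> (\<lambda>om. types n om i) \<in> borel_measurable (F n)"
 by (rule measurable_compose[OF types_F measurable_component_singleton])

text \<open>Clipping at \<open>0\<close> removes the exceptional null set on which \<open>\<phi> > - 1\<close> fails.\<close>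

definition ep :: "nat => 'a => nat \<times> nat => real" where
 "ep n om = (\<lambda>(i, j). max 0 (edge_prob \<phi> \<theta> n (types n om) i j))"

lemma ep_prob: "0 \<le> ep n om e \<and> ep n om e \<le> 1"
 by (auto simp: ep_def edge_prob_def split: prod.splits)

lemma edge_ratio_nonneg: "om \<in> space M ==> i \<in> {1..n} ==> j \<in> {1..n} ==> 0 \<le> edge_ratio \<theta> n (types n om) i j"
 using type_nonneg theta_pos by (simp add: edge_ratio_def types_upto_def)

lemma edge_prob_F:
 assumes "(i, j) \<in> vertex_pairs n"
 shows "(\<lambda>om. edge_prob \<phi> \<theta> n (types n om) i j) \<in> borel_measurable (F n)"
proof -
 have ij: "i \<in> {1..n}" "j \<in> {1..n}" using assms by (auto simp: vertex_pairs_def)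
 note [measurable] = type_F[OF ij(1)] type_F[OF ij(2)]
 have [measurable]: "(\<lambda>om. \<phi> n (types n om) (types n om i) (types n om j)) \<in> borel_measurable (F n)"
  using phi_measurable[OF assms] ij by (simp add: types_upto_def)
 show ?thesis unfolding edge_prob_def edge_ratio_def by measurable
qed

lemma ep_F: "e \<in> vertex_pairs n ==> (\<lambda>om. ep n om e) \<in> borel_measurable (F n)"
 by (cases e) (auto simp: ep_def intro!: borel_measurable_max edge_prob_F)

lemma ep_eq: "e \<in> vertex_pairs n ==> AE om in M. cond_probability M (F n) {om' \<in> space M. e \<in> E n om'} om = ep n om e"
proof -
 assume e: "e \<in> vertex_pairs n"
 obtain i j where ij: "e = (i, j)" by (cases e)
 have mem: "i \<in> {1..n}" "j \<in> {1..n}" using e ij by (auto simp: vertex_pairs_def)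
 show ?thesis
  using edges_prob[OF e[unfolded ij]] phi_gt[OF e[unfolded ij]] AE_space[of M]
 proof eventually_elim
  case (elim om)
  have "0 \<le> edge_ratio \<theta> n (types n om) i j*(1 + \<phi> n (types n om) (types n om i) (types n om j))"
   using edge_ratio_nonneg[OF elim(3) mem] elim(2) mem by (intro mult_nonneg_nonneg) (auto simp: types_upto_def)
  then show ?case using elim(1) by (simp add: ij ep_def edge_prob_def)
 qed
qed

lemma edge_event: "n \<ge> 1 ==> {om \<in> space M. Pr (E n om)} \<in> sets M"
proof -
 assume n: "n \<ge> 1"
 have "E n -` {G \<in> Pow (vertex_pairs n). Pr G} \<inter> space M \<in> sets M"
  by (rule measurable_sets[OF edges_measurable[OF n]]) auto
 moreover have "E n -` {G \<in> Pow (vertex_pairs n). Pr G} \<inter> space M = {om \<in> space M. Pr (E n om)}"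
  using measurable_space[OF edges_measurable[OF n]] by auto
 ultimately show ?thesis by simp
qed

lemma graph_compose_measurable:
 assumes n: "n \<ge> 1" and f: "\<And>G. G \<subseteq> vertex_pairs n ==> f G \<in> M \<rightarrow>\<^sub>M N"
 shows "(\<lambda>om. f (E n om) om) \<in> M \<rightarrow>\<^sub>M N"
 by (rule measurable_compose_countable'[OF _ edges_measurable[OF n]]) (auto intro: f countable_finite)

text \<open>Here \<open>f\<close> may depend on the types, so it is pulled through the conditional
  expectation; the conditional independence of the model is about exactly these intersections of
  edge events.\<close>

lemma monomial_expectation:
 assumes n: "n \<ge> 1" and J: "J \<subseteq> vertex_pairs n" and f: "f \<in> borel_measurable (F n)" "\<And>om. abs (f om) \<le> B"
 shows "(\<integral>om. of_bool (J \<subseteq> E n om)*f om \<partial>M) = (\<integral>om. (\<Prod>e\<in>J. ep n om e)*f om \<partial>M)"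
proof (cases "J = {}")
 case False
 let ?A = "\<lambda>e. {om \<in> space M. e \<in> E n om}"
 have finJ: "finite J" using J finite_vertex_pairs by (rule finite_subset)
 interpret sigma_finite_subalgebra M "F n"
  by (rule finite_measure_subalgebra_is_sigma_finite) (use subalgebra_F in "unfold_locales, auto")
 have B: "0 \<le> B" using f(2)[of undefined] by linarith
 have fM: "f \<in> borel_measurable M" by (rule F_measurable[OF f(1)])
 have sets: "(\<Inter>e\<in>J. ?A e) \<in> sets M"
  by (rule sets.finite_INT) (use finJ False edge_event[OF n] in auto)
 have ind: "(indicator (\<Inter>e\<in>J. ?A e) :: _ => real) \<in> borel_measurable M"
  using sets by (rule borel_measurable_indicator)
 have "(\<integral>om. of_bool (J \<subseteq> E n om)*f om \<partial>M) = (\<integral>om. f om*indicator (\<Inter>e\<in>J. ?A e) om \<partial>M)"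
  by (rule Bochner_Integration.integral_cong) (use False in "auto simp: indicator_def")
 also have "\<dots> = (\<integral>om. f om * real_cond_exp M (F n) (indicator (\<Inter>e\<in>J. ?A e)) om \<partial>M)"
 proof (rule real_cond_exp_intg(2)[symmetric, OF _ f(1) ind], rule integrable_const_bound[where B = B])
  have "abs (f om*indicator (\<Inter>e\<in>J. ?A e) om) \<le> B*1" for om
   unfolding abs_mult using B by (intro mult_mono f(2)) (auto simp: indicator_def)
  then show "AE om in M. norm (f om*indicator (\<Inter>e\<in>J. ?A e) om) \<le> B" by simp
 qed (intro borel_measurable_times fM ind)
 also have "\<dots> = (\<integral>om. (\<Prod>e\<in>J. ep n om e)*f om \<partial>M)"
 proof (rule integral_cong_AE)
  have 1: "AE om in M. cond_probability M (F n) (\<Inter>e\<in>J. ?A e) om = (\<Prod>e\<in>J. cond_probability M (F n) (?A e) om)"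
   using edges_cond_indep[OF n] J finJ False unfolding cond_indep_events_def by blast
  have 2: "AE om in M. \<forall>e\<in>J. cond_probability M (F n) (?A e) om = ep n om e"
   by (rule AE_finite_allI[OF finJ]) (use ep_eq J in blast)
  show "AE om in M. f om * real_cond_exp M (F n) (indicator (\<Inter>e\<in>J. ?A e)) om = (\<Prod>e\<in>J. ep n om e)*f om"
   using 1 2 by eventually_elim (simp add: cond_probability_def[symmetric])
  show "(\<lambda>om. f om * real_cond_exp M (F n) (indicator (\<Inter>e\<in>J. ?A e)) om) \<in> borel_measurable M"
   by (intro borel_measurable_times fM borel_measurable_cond_exp2)
  show "(\<lambda>om. (\<Prod>e\<in>J. ep n om e)*f om) \<in> borel_measurable M"
   by (intro borel_measurable_times fM borel_measurable_prod F_measurable[OF ep_F]) (use J in blast)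
 qed
 finally show ?thesis .
qed simp

text \<open>The model specifies the conditional probabilities of edges being present jointly, and
  nothing directly about absent ones. An inclusion-exclusion fills the gap: \<open>f\<close> is its
  value without \<open>e\<close> plus, on the event that \<open>e\<close> is present, the increment
  \<open>g\<close>. The set \<open>J\<close> accumulates the edges whose presence has been imposed
  in this way.\<close>

lemma graph_expectation_aux:
 fixes f :: "(nat \<times> nat) set => 'a => real"
 assumes n: "n \<ge> 1" and V: "finite V" "V \<subseteq> vertex_pairs n" "J \<subseteq> vertex_pairs n" "J \<inter> V = {}"
  and f: "\<And>G. G \<subseteq> V ==> f G \<in> borel_measurable (F n)" "\<And>G om. abs (f G om) \<le> B"
 shows "(\<integral>om. of_bool (J \<subseteq> E n om)*f (E n om \<inter> V) om \<partial>M)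
  = (\<integral>om. (\<Prod>e\<in>J. ep n om e) * gexp V (ep n om) (\<lambda>G. f G om) \<partial>M)"
 using V f
proof (induction V arbitrary: J f B rule: finite_induct)
 case empty
 show ?case using monomial_expectation[OF n empty(2), of "f {}" B] empty(4)[of "{}"] empty(5) by simp
next
 case (insert e V)
 define g where "g G om = f (insert e G) om - f G om" for G om
 have e: "e \<in> vertex_pairs n" "e \<notin> J" using insert.prems by auto
 have J': "insert e J \<subseteq> vertex_pairs n" using insert.prems by auto
 have fin: "finite J" using insert.prems(2) finite_vertex_pairs by (rule finite_subset)
 have B: "0 \<le> B" using insert.prems(5)[of "{}" undefined] by linarith
 have fm: "f G \<in> borel_measurable (F n)" if "G \<subseteq> insert e V" for G by (rule insert.prems(4)[OF that])
 have gm: "g G \<in> borel_measurable (F n)" if "G \<subseteq> V" for G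
  unfolding g_def[abs_def] using that by (intro borel_measurable_diff fm) auto
 have gB: "abs (g G om) \<le> 2*B" for G om
  using insert.prems(5)[of "insert e G" om] insert.prems(5)[of G om] by (simp add: g_def)
 have int: "integrable M (\<lambda>om. of_bool (K \<subseteq> E n om)*h (E n om \<inter> V) om)"
  and int': "integrable M (\<lambda>om. (\<Prod>e\<in>K. ep n om e) * gexp V (ep n om) (\<lambda>G. h G om))"
  if h: "\<And>G. G \<subseteq> V ==> h G \<in> borel_measurable (F n)" "\<And>G om. abs (h G om) \<le> C" and K: "K \<subseteq> vertex_pairs n" for h K and C :: real
 proof -
  have C: "0 \<le> C" using h(2)[of "{}" undefined] by linarith
  have "(\<lambda>om. of_bool (K \<subseteq> E n om)*h (E n om \<inter> V) om) \<in> borel_measurable M"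
  proof (rule graph_compose_measurable[OF n, of "\<lambda>G om. of_bool (K \<subseteq> G)*h (G \<inter> V) om"])
   show "(\<lambda>om. of_bool (K \<subseteq> G)*h (G \<inter> V) om) \<in> borel_measurable M" for G
    by (intro borel_measurable_times borel_measurable_const F_measurable[OF h(1)]) simp
  qed
  then show "integrable M (\<lambda>om. of_bool (K \<subseteq> E n om)*h (E n om \<inter> V) om)"
   by (rule integrable_const_bound[where B = C, rotated]) (use h(2) C in "auto intro!: AE_I2")
  have m: "(\<lambda>om. (\<Prod>e\<in>K. ep n om e) * gexp V (ep n om) (\<lambda>G. h G om)) \<in> borel_measurable M"
   by (rule F_measurable[where n = n], intro borel_measurable_times borel_measurable_prod gexp_measurable ep_F h) (use K insert.prems in auto)
  have "norm ((\<Prod>e\<in>K. ep n om e) * gexp V (ep n om) (\<lambda>G. h G om)) \<le> 1 * C" for om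
   unfolding norm_mult
  proof (rule mult_mono)
   show "norm (\<Prod>e\<in>K. ep n om e) \<le> 1" using ep_prob by (auto simp: prod_nonneg abs_prod intro!: prod_le_1)
   show "norm (gexp V (ep n om) (\<lambda>G. h G om)) \<le> C"
    by (rule norm_gexp_le_const[OF insert.hyps(1) ep_prob]) (use h(2) in auto)
  qed auto
  then show "integrable M (\<lambda>om. (\<Prod>e\<in>K. ep n om e) * gexp V (ep n om) (\<lambda>G. h G om))"
   by (intro integrable_const_bound[where B = C, OF _ m]) (auto intro!: AE_I2)
 qed
 have f1: "\<And>G. G \<subseteq> V ==> f G \<in> borel_measurable (F n)" by (rule fm) auto
 have IH1: "(\<integral>om. of_bool (J \<subseteq> E n om)*f (E n om \<inter> V) om \<partial>M) = (\<integral>om. (\<Prod>e\<in>J. ep n om e) * gexp V (ep n om) (\<lambda>G. f G om) \<partial>M)"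
  by (rule insert.IH[OF _ _ _ f1 insert.prems(5)]) (use insert.prems in auto)
 have IH2: "(\<integral>om. of_bool (insert e J \<subseteq> E n om) * g (E n om \<inter> V) om \<partial>M) = (\<integral>om. (\<Prod>e\<in>insert e J. ep n om e) * gexp V (ep n om) (\<lambda>G. g G om) \<partial>M)"
  by (rule insert.IH[OF _ J' _ gm gB]) (use insert.prems insert.hyps in auto)
 have "(\<integral>om. of_bool (J \<subseteq> E n om)*f (E n om \<inter> insert e V) om \<partial>M)
  = (\<integral>om. of_bool (J \<subseteq> E n om)*f (E n om \<inter> V) om + of_bool (insert e J \<subseteq> E n om) * g (E n om \<inter> V) om \<partial>M)"
  by (rule Bochner_Integration.integral_cong) (auto simp: g_def Int_insert_right)
 also have "\<dots> = (\<integral>om. (\<Prod>e\<in>J. ep n om e) * gexp V (ep n om) (\<lambda>G. f G om) + (\<Prod>e\<in>insert e J. ep n om e) * gexp V (ep n om) (\<lambda>G. g G om) \<partial>M)"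
 proof -
  have "integrable M (\<lambda>om. of_bool (J \<subseteq> E n om)*f (E n om \<inter> V) om)" "integrable M (\<lambda>om. (\<Prod>e\<in>J. ep n om e) * gexp V (ep n om) (\<lambda>G. f G om))"
   by (rule int int', rule f1, assumption, rule insert.prems(5), rule insert.prems(2))+
  moreover have "integrable M (\<lambda>om. of_bool (insert e J \<subseteq> E n om) * g (E n om \<inter> V) om)" "integrable M (\<lambda>om. (\<Prod>e\<in>insert e J. ep n om e) * gexp V (ep n om) (\<lambda>G. g G om))"
   by (rule int int', rule gm, assumption, rule gB, rule J')+
  ultimately show ?thesis by (simp only: Bochner_Integration.integral_add IH1 IH2)
 qed
 also have "\<dots> = (\<integral>om. (\<Prod>e\<in>J. ep n om e) * gexp (insert e V) (ep n om) (\<lambda>G. f G om) \<partial>M)"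
  by (rule Bochner_Integration.integral_cong[OF refl])
    (simp add: gexp_insert[OF insert.hyps(1,2)] g_def gexp_diff e fin algebra_simps)
 finally show ?case .
qed

theorem graph_expectation:
 fixes f :: "(nat \<times> nat) set => 'a => real"
 assumes n: "n \<ge> 1" and f: "\<And>G. G \<subseteq> vertex_pairs n ==> f G \<in> borel_measurable (F n)" "\<And>G om. abs (f G om) \<le> B"
 shows "(\<integral>om. f (E n om) om \<partial>M) = (\<integral>om. gexp (vertex_pairs n) (ep n om) (\<lambda>G. f G om) \<partial>M)"
proof -
 have "E n om \<inter> vertex_pairs n = E n om" if "om \<in> space M" for om
  using measurable_space[OF edges_measurable[OF n] that] by auto
 then have "(\<integral>om. f (E n om) om \<partial>M) = (\<integral>om. of_bool ({} \<subseteq> E n om)*f (E n om \<inter> vertex_pairs n) om \<partial>M)"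
  by (intro Bochner_Integration.integral_cong) auto
 also have "\<dots> = (\<integral>om. (\<Prod>e\<in>{}. ep n om e) * gexp (vertex_pairs n) (ep n om) (\<lambda>G. f G om) \<partial>M)"
  by (rule graph_expectation_aux[OF n _ _ _ _ f]) auto
 finally show ?thesis by simp
qed

end

lemma rank_iter_measurable:
 assumes t: "\<And>j. j \<in> {1..n} ==> (\<lambda>x. t x j) \<in> borel_measurable N" and i: "i \<in> {1..n}"
 shows "(\<lambda>x. rank_iter n G (t x) k i) \<in> borel_measurable N"
 using i
proof (induction k arbitrary: i)
 case 0
 then show ?case using measurable_compose[OF t measurable_ext_type(3)] by simp
next
 case (Suc k)
 have "(\<lambda>x. amat G (t x) i j * rank_iter n G (t x) k j) \<in> borel_measurable N" if "j \<in> {1..n}" for j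
  unfolding amat_def
  by (intro borel_measurable_times borel_measurable_divide borel_measurable_const Suc.IH that measurable_compose[OF t[OF that] measurable_ext_type(4)])
 moreover have "(\<lambda>x. w_Q (t x i)) \<in> borel_measurable N" by (rule measurable_compose[OF t[OF Suc.prems] measurable_ext_type(3)])
 ultimately show ?case by (simp only: rk.simps(2)) (intro borel_measurable_add borel_measurable_sum)
qed

text \<open>A version of PageRank that is measurable in the types without any restriction on them.\<close>

definition lim_rank :: "nat => (nat \<times> nat) set => (nat => ext_type) => nat => real" where
 "lim_rank n G t i = lim (\<lambda>k. rank_iter n G t k i)"

lemma lim_rank_measurable:
 assumes "\<And>j. j \<in> {1..n} ==> (\<lambda>x. t x j) \<in> borel_measurable N" "i \<in> {1..n}"
 shows "(\<lambda>x. lim_rank n G (t x) i) \<in> borel_measurable N"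
 unfolding lim_rank_def by (intro borel_measurable_lim_metric rank_iter_measurable assms)

context inhom_random_digraph
begin

abbreviation edge_gap :: "nat => 'a => real" where
 "edge_gap n om \<equiv> (\<Sum>i=1..n. \<Sum>j\<in>{1..n} - {i}. abs (edge_prob \<phi> \<theta> n (types n om) i j - min (edge_ratio \<theta> n (types n om) i j) 1))/real n"

lemma vertex_expectation:
 fixes g :: "(nat \<times> nat) set => (nat => ext_type) => nat => real"
 assumes n: "n \<ge> 1" and g: "\<And>G i. G \<subseteq> vertex_pairs n ==> i \<in> {1..n} ==> (\<lambda>t. g G t i) \<in> borel_measurable (TS n)"
  and B: "\<And>G t i. abs (g G t i) \<le> B"
 shows "(\<integral>om. g (E n om) (types n om) (\<xi> n om) \<partial>M) = (\<integral>om. (\<Sum>i=1..n. g (E n om) (types n om) i)/real n \<partial>M)"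
proof -
 let ?S = "TS n \<Otimes>\<^sub>M count_space (Pow (vertex_pairs n))" and ?X = "\<lambda>om. (types n om, E n om)"
 have X: "?X \<in> M \<rightarrow>\<^sub>M ?S" by (rule measurable_Pair[OF types_measurable edges_measurable[OF n]])
 have gm: "(\<lambda>x. g (snd x) (fst x) i) \<in> borel_measurable ?S" if i: "i \<in> {1..n}" for i
 proof (rule measurable_compose_countable'[OF _ measurable_snd])
  show "(\<lambda>x. g G (fst x) i) \<in> borel_measurable ?S" if "G \<in> Pow (vertex_pairs n)" for G
   by (rule measurable_compose[OF measurable_fst g[OF _ i]]) (use that in blast)
 qed (auto intro: countable_finite)
 have gM: "(\<lambda>om. g (E n om) (types n om) i) \<in> borel_measurable M" if "i \<in> {1..n}" for i
  using measurable_compose[OF X gm[OF that]] by simp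
 have int: "integrable M (\<lambda>om. g (E n om) (types n om) i)" if "i \<in> {1..n}" for i
  by (rule integrable_const_bound[OF _ gM[OF that], where B = B]) (use B in auto)
 have chi: "(\<lambda>om. of_bool (\<xi> n om = i) :: real) \<in> borel_measurable M" for i
  by (rule measurable_compose[OF vertex_measurable[OF n]]) simp
 have intchi: "integrable M (\<lambda>om. of_bool (\<xi> n om = i) :: real)" for i
  by (rule integrable_const_bound[OF _ chi, where B = 1]) auto
 have pr: "(\<integral>om. of_bool (\<xi> n om = i) \<partial>M) = 1/real n" if i: "i \<in> {1..n}" for i
 proof -
  have "(\<integral>om. of_bool (\<xi> n om = i) \<partial>M) = (\<integral>x. indicator {i} x \<partial>distr M (count_space {1..n}) (\<xi> n) :: real)"
   by (subst integral_distr[OF vertex_measurable[OF n]]) (auto simp: indicator_def of_bool_def)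
  also have "\<dots> = 1/real n"
   unfolding vertex_uniform[OF n] using i by (simp add: measure_uniform_count_measure space_uniform_count_measure)
  finally show ?thesis .
 qed
 have prod: "(\<integral>om. of_bool (\<xi> n om = i) * g (E n om) (types n om) i \<partial>M) = 1/real n*(\<integral>om. g (E n om) (types n om) i \<partial>M)"
  and iprod: "integrable M (\<lambda>om. of_bool (\<xi> n om = i) * g (E n om) (types n om) i)" if i: "i \<in> {1..n}" for i
 proof -
  have iv: "indep_var borel (\<lambda>om. of_bool (\<xi> n om = i) :: real) borel (\<lambda>om. g (E n om) (types n om) i)"
   unfolding indep_var_eq
  proof (intro conjI chi gM[OF i])
   \<comment> \<open>The two variables are measurable for the sigma-algebras in
     \<open>vertex_indep\<close>, so their own generated sigma-algebras are contained in these and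
     inherit independence.\<close>
   let ?A = "vimage_algebra (space M) (\<xi> n) (count_space {1..n})" and ?B = "vimage_algebra (space M) ?X ?S"
   have "\<xi> n \<in> ?A \<rightarrow>\<^sub>M count_space {1..n}" "?X \<in> ?B \<rightarrow>\<^sub>M ?S"
    using measurable_space[OF vertex_measurable[OF n]] measurable_space[OF X] by (auto intro!: measurable_vimage_algebra1)
   then have m: "(\<lambda>om. of_bool (\<xi> n om = i) :: real) \<in> borel_measurable ?A" "(\<lambda>om. g (E n om) (types n om) i) \<in> borel_measurable ?B"
    using measurable_compose[OF _ gm[OF i], of ?X] by (auto intro: measurable_compose)
   have "sigma_sets (space M) {(\<lambda>om. of_bool (\<xi> n om = i) :: real) -` C \<inter> space M | C. C \<in> sets borel} \<subseteq> sets ?A"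
    using sets.sigma_sets_subset[of "{(\<lambda>om. of_bool (\<xi> n om = i) :: real) -` C \<inter> space M | C. C \<in> sets borel}" ?A] measurable_sets[OF m(1)] by auto
   moreover have "sigma_sets (space M) {(\<lambda>om. g (E n om) (types n om) i) -` C \<inter> space M | C. C \<in> sets borel} \<subseteq> sets ?B"
    using sets.sigma_sets_subset[of "{(\<lambda>om. g (E n om) (types n om) i) -` C \<inter> space M | C. C \<in> sets borel}" ?B] measurable_sets[OF m(2)] by auto
   ultimately show "indep_set (sigma_sets (space M) {(\<lambda>om. of_bool (\<xi> n om = i) :: real) -` C \<inter> space M | C. C \<in> sets borel})
     (sigma_sets (space M) {(\<lambda>om. g (E n om) (types n om) i) -` C \<inter> space M | C. C \<in> sets borel})"
    using vertex_indep[OF n] unfolding indep_sets2_eq by blast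
  qed
  show "integrable M (\<lambda>om. of_bool (\<xi> n om = i) * g (E n om) (types n om) i)"
   by (rule indep_var_integrable[OF iv intchi int[OF i]])
  show "(\<integral>om. of_bool (\<xi> n om = i) * g (E n om) (types n om) i \<partial>M) = 1/real n*(\<integral>om. g (E n om) (types n om) i \<partial>M)"
   unfolding indep_var_lebesgue_integral[OF iv intchi int[OF i]] pr[OF i] ..
 qed
 have "(\<integral>om. g (E n om) (types n om) (\<xi> n om) \<partial>M) = (\<integral>om. (\<Sum>i=1..n. of_bool (\<xi> n om = i) * g (E n om) (types n om) i) \<partial>M)"
 proof (rule Bochner_Integration.integral_cong[OF refl])
  fix om assume "om \<in> space M"
  then have "\<xi> n om \<in> {1..n}" using measurable_space[OF vertex_measurable[OF n]] by auto
  moreover have "(\<Sum>i=1..n. of_bool (\<xi> n om = i) * g (E n om) (types n om) i) = (\<Sum>i=1..n. if \<xi> n om = i then g (E n om) (types n om) i else 0)"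
   by (rule sum.cong) auto
  ultimately show "g (E n om) (types n om) (\<xi> n om) = (\<Sum>i=1..n. of_bool (\<xi> n om = i) * g (E n om) (types n om) i)"
   by (simp del: atLeastAtMost_iff)
 qed
 also have "\<dots> = (\<Sum>i=1..n. 1/real n*(\<integral>om. g (E n om) (types n om) i \<partial>M))"
  using iprod prod by (subst Bochner_Integration.integral_sum) auto
 also have "\<dots> = (\<integral>om. (\<Sum>i=1..n. g (E n om) (types n om) i)/real n \<partial>M)"
  using int by (simp add: Bochner_Integration.integral_sum sum_distrib_left divide_inverse mult.commute)
 finally show ?thesis .
qed

end

section \<open>The full model and its reduction to deterministic sequences\<close>

locale pagerank_model = inhom_random_digraph M W \<phi> \<theta> E \<xi> + type_law H
 for M :: "'a measure" and W :: "nat => 'a => ext_type" and \<phi> :: kernel_pert and \<theta> :: real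
  and E :: "nat => 'a => (nat \<times> nat) set" and \<xi> :: "nat => 'a => nat" and H :: "ext_type measure" +
 fixes c :: real
 assumes cdf_lim: "\<And>x. isCont (type_cdf H) x ==>
   tends_in_prob M (\<lambda>n om. empirical_cdf n (types_upto W n om) x) (type_cdf H x)"
  and in_lim: "tends_in_prob M (\<lambda>n om. (\<Sum>i=1..n. w_in (W i om))/real n) (\<integral>w. w_in w \<partial>H)"
  and out_lim: "tends_in_prob M (\<lambda>n om. (\<Sum>i=1..n. w_out (W i om))/real n) (\<integral>w. w_out w \<partial>H)"
  and Q_lim: "tends_in_prob M (\<lambda>n om. (\<Sum>i=1..n. abs (w_Q (W i om)))/real n) (\<integral>w. abs (w_Q w) \<partial>H)"
  and zeta_lim: "tends_in_prob M (\<lambda>n om. (\<Sum>i=1..n. abs (w_zeta (W i om)))/real n) (\<integral>w. abs (w_zeta w) \<partial>H)"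
  and integrable_in: "integrable H w_in" and integrable_out: "integrable H w_out" and integrable_Q: "integrable H w_Q"
  and out_mean_pos: "0 < (\<integral>w. w_out w \<partial>H)"
  and edge_lim: "tends_in_prob M
    edge_gap 0"
  and zeta_le: "c < 1" "\<And>i om. i \<ge> 1 ==> om \<in> space M ==> abs (w_zeta (W i om)) \<le> c"
begin

definition h0 :: real where "h0 = (SOME h. 0 < h \<and> (\<forall>m. grid (h/2 ^ m) \<inter> atoms = {}))"

lemma h0: "0 < h0" "grid (h0/2 ^ m) \<inter> atoms = {}"
 using someI_ex[of "\<lambda>h. 0 < h \<and> (\<forall>m. grid (h/2 ^ m) \<inter> atoms = {})"] grid_scale_exists unfolding h0_def[symmetric] by blast+

text \<open>The mesh \<open>h0/2^m\<close> tends to 0, while the half-width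
  \<open>4^m h0/2^m = h0 2^m\<close> of the box tends to infinity.\<close>

definition disc :: "nat => ext_type => ext_type" where
 "disc m = grid_round (h0/2 ^ m) (4 ^ m)"

sublocale discretization H disc
proof
 have pos: "0 < h0/2 ^ m" for m using h0(1) by simp
 have "filterlim (\<lambda>m. h0*2 ^ m) at_top sequentially"
  by (rule filterlim_tendsto_pos_mult_at_top[OF tendsto_const h0(1)])
    (rule filterlim_at_top_mono[OF filterlim_real_sequentially], simp add: less_imp_le[OF of_nat_less_two_power])
 moreover have "h0/2 ^ m * real (4 ^ m) = h0*2 ^ m" for m
 proof -
  have "(4::real) ^ m = 2 ^ m*2 ^ m" by (simp flip: power_mult_distrib)
  then show ?thesis by simp
 qed
 ultimately have "filterlim (\<lambda>m. h0/2 ^ m * real (4 ^ m)) at_top sequentially" by simp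
 moreover have "(\<lambda>m. h0/2 ^ m) \<longlonglongrightarrow> 0" using LIMSEQ_divide_realpow_zero[of 2 h0] by simp
 ultimately show "(\<lambda>m. disc m v) \<longlonglongrightarrow> v" for v
  unfolding disc_def by (intro grid_round_limit pos)
 show "disc m \<in> borel_measurable borel" "finite (range (disc m))" for m
  unfolding disc_def by (rule grid_round_measurable finite_range_grid_round[OF pos])+
 show "abs (w_in v - w_in (disc m v)) = abs (w_in v) - abs (w_in (disc m v))"
  "abs (w_out v - w_out (disc m v)) = abs (w_out v) - abs (w_out (disc m v))"
  "abs (w_Q v - w_Q (disc m v)) = abs (w_Q v) - abs (w_Q (disc m v))"
  "abs (w_zeta v - w_zeta (disc m v)) = abs (w_zeta v) - abs (w_zeta (disc m v))" for m v
  unfolding disc_def by (rule grid_round_components[OF pos])+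
 show "0 \<le> w_in v \<and> 0 \<le> w_out v ==> 0 \<le> w_in (disc m v) \<and> 0 \<le> w_out (disc m v)" for m v
  unfolding disc_def by (rule grid_round_nonneg[OF pos])
qed

definition edge_err :: "nat => 'a => real" where
 "edge_err n om = (\<Sum>e\<in>vertex_pairs n. abs (ep n om e - types_at (types n om) \<theta> n e))/real n"

text \<open>The properties of a sequence of sample points that make its types and edge probabilities
  an instance of \<open>deterministic_types\<close>.\<close>

definition good :: "(nat => nat) => (nat => 'a) => bool" where
 "good sz om \<longleftrightarrow> strict_mono sz \<and> (\<forall>k. om k \<in> space M) \<and>
   (\<forall>C\<in>{w_in, w_out, \<lambda>v. abs (w_Q v), \<lambda>v. abs (w_zeta v)}. (\<lambda>k. (\<Sum>i=1..sz k. C (types (sz k) (om k) i))/real (sz k)) \<longlonglongrightarrow> (\<integral>v. C v \<partial>H)) \<and>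
   (\<lambda>k. edge_err (sz k) (om k)) \<longlonglongrightarrow> 0 \<and>
   (\<forall>m ty. (\<lambda>k. freq (sz k) (types (sz k) (om k)) {v. disc m v = ty}) \<longlonglongrightarrow> measure H {v. disc m v = ty})"

lemma max_0_close: "0 \<le> y ==> abs (max 0 x - y) \<le> abs (x - y)" for x y :: real
 by (auto simp: max_def)

text \<open>The target probability is nonnegative, so clipping at 0 can only bring the edge
  probability closer to it.\<close>

lemma edge_err_le:
 assumes "om \<in> space M"
 shows "edge_err n om \<le> edge_gap n om"
proof -
 let ?A = "types n om"
 let ?g = "\<lambda>i j. abs (edge_prob \<phi> \<theta> n ?A i j - min (edge_ratio \<theta> n ?A i j) 1)"
 have "(\<Sum>e\<in>vertex_pairs n. abs (ep n om e - types_at ?A \<theta> n e))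
  \<le> (\<Sum>(i, j)\<in>vertex_pairs n. ?g i j)"
 proof (rule sum_mono)
  fix e assume e: "e \<in> vertex_pairs n"
  obtain i j where ij: "e = (i, j)" by (cases e)
  then have "0 \<le> edge_ratio \<theta> n ?A i j" using e by (intro edge_ratio_nonneg assms) (auto simp: vertex_pairs_def)
  then show "abs (ep n om e - types_at ?A \<theta> n e) \<le> (case e of (i, j) => ?g i j)"
   unfolding ij ep_def types_at_def prod.case edge_ratio_def by (subst min.commute) (rule max_0_close, simp)
 qed
 also have "(\<Sum>(i, j)\<in>vertex_pairs n. ?g i j)
  = (\<Sum>i=1..n. \<Sum>j\<in>{1..n} - {i}. ?g i j)"
 proof -
  have "vertex_pairs n = (SIGMA i:{1..n}. {1..n} - {i})" by (auto simp: vertex_pairs_def)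
  then show ?thesis by (simp only:) (rule sum.Sigma[symmetric], auto)
 qed
 finally show ?thesis unfolding edge_err_def by (rule divide_right_mono) simp
qed

end

context pagerank_model
begin

text \<open>All tests in one countable index type: \<open>Inl\<close> codes the four averages and,
  from 4 on, the edge error; \<open>Inr\<close> codes the points of the grids of all levels. Index 0
  in a coordinate is replaced by a constant test, because the distribution function may be
  discontinuous there.\<close>

definition tested :: "nat + (nat \<times> int \<times> int \<times> int \<times> int) => nat => 'a => real" where
 "tested j n om = (case j of
   Inl k => (if k < 4 then (\<Sum>i=1..n. ([w_in, w_out, \<lambda>v. abs (w_Q v), \<lambda>v. abs (w_zeta v)] ! k) (W i om))/real n
    else edge_gap n om)
  | Inr (m, k1, k2, k3, k4) => (if k1 \<noteq> 0 \<and> k2 \<noteq> 0 \<and> k3 \<noteq> 0 \<and> k4 \<noteq> 0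
    then empirical_cdf n (types n om) (h0/2 ^ m * of_int k1, h0/2 ^ m * of_int k2, h0/2 ^ m * of_int k3, h0/2 ^ m * of_int k4) else 0))"

definition tested_lim :: "nat + (nat \<times> int \<times> int \<times> int \<times> int) => real" where
 "tested_lim j = (case j of
   Inl k => (if k < 4 then (\<integral>v. ([w_in, w_out, \<lambda>v. abs (w_Q v), \<lambda>v. abs (w_zeta v)] ! k) v \<partial>H) else 0)
  | Inr (m, k1, k2, k3, k4) => (if k1 \<noteq> 0 \<and> k2 \<noteq> 0 \<and> k3 \<noteq> 0 \<and> k4 \<noteq> 0
    then type_cdf H (h0/2 ^ m * of_int k1, h0/2 ^ m * of_int k2, h0/2 ^ m * of_int k3, h0/2 ^ m * of_int k4) else 0))"

lemma less_4_cases: "k < (4::nat) ==> k = 0 \<or> k = 1 \<or> k = 2 \<or> k = 3"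
 by linarith

lemma isCont_grid:
 assumes "w_in x \<in> grid (h0/2 ^ m)" "w_out x \<in> grid (h0/2 ^ m)" "w_Q x \<in> grid (h0/2 ^ m)" "w_zeta x \<in> grid (h0/2 ^ m)"
 shows "isCont (type_cdf H) x"
 using assms h0(2)[of m] by (intro isCont_type_cdf) blast+

lemma tested_tends: "tends_in_prob M (tested j) (tested_lim j)"
proof (cases j)
 case (Inl k)
 show ?thesis
 proof (cases "k < 4")
  case True
  from less_4_cases[OF this] show ?thesis
   unfolding tested_def[abs_def] tested_lim_def Inl
   by (elim disjE) (simp_all add: numeral_2_eq_2 numeral_3_eq_3 in_lim[simplified] out_lim[simplified] Q_lim[simplified] zeta_lim[simplified])
 next
  case False
  then show ?thesis using edge_lim unfolding tested_def[abs_def] tested_lim_def Inl by simp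
 qed
next
 case (Inr p)
 obtain m k1 k2 k3 k4 where p: "p = (m, k1, k2, k3, k4)" by (cases p)
 show ?thesis
 proof (cases "k1 \<noteq> 0 \<and> k2 \<noteq> 0 \<and> k3 \<noteq> 0 \<and> k4 \<noteq> 0")
  case True
  have "isCont (type_cdf H) (h0/2 ^ m * of_int k1, h0/2 ^ m * of_int k2, h0/2 ^ m * of_int k3, h0/2 ^ m * of_int k4)"
   by (rule isCont_grid[of _ m]) (unfold w_simps grid_def mem_Collect_eq, (rule exI, rule conjI[OF refl], simp add: True)+)
  from cdf_lim[OF this] True show ?thesis unfolding tested_def[abs_def] tested_lim_def Inr p by simp
 next
  case False
  then have eq: "tested j = (\<lambda>n om. 0)" "tested_lim j = 0" unfolding tested_def[abs_def] tested_lim_def Inr p by auto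
  show ?thesis unfolding eq tends_in_prob_def by simp
 qed
qed

lemma edge_ratio_F: "i \<in> {1..n} ==> j \<in> {1..n} ==> (\<lambda>om. edge_ratio \<theta> n (types n om) i j) \<in> borel_measurable (F n)"
 unfolding edge_ratio_def
 by (intro borel_measurable_divide borel_measurable_times borel_measurable_const measurable_compose[OF type_F] measurable_ext_type)

lemma tested_measurable: "tested j n \<in> borel_measurable M"
proof (cases j)
 case (Inl k)
 show ?thesis
 proof (cases "k < 4")
  case True
  have "(\<lambda>om. (\<Sum>i=1..n. C (W i om))/real n) \<in> borel_measurable M" if "C \<in> borel_measurable borel" for C :: "ext_type => real"
   by (intro borel_measurable_divide borel_measurable_sum borel_measurable_const measurable_compose[OF type_measurable that]) simp
  moreover have "[w_in, w_out, \<lambda>v. abs (w_Q v), \<lambda>v. abs (w_zeta v)] ! k \<in> borel_measurable borel"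
   using less_4_cases[OF True] by (elim disjE) (simp_all add: numeral_2_eq_2 numeral_3_eq_3)
  ultimately show ?thesis using True unfolding tested_def[abs_def] Inl by simp
 next
  case False
  have "edge_gap n \<in> borel_measurable (F n)"
   by (intro borel_measurable_divide borel_measurable_sum borel_measurable_abs borel_measurable_diff borel_measurable_min borel_measurable_const
     edge_prob_F edge_ratio_F) (auto simp: vertex_pairs_def)
  then show ?thesis using F_measurable False unfolding tested_def[abs_def] Inl by simp
 qed
next
 case (Inr p)
 obtain m k1 k2 k3 k4 where p: "p = (m, k1, k2, k3, k4)" by (cases p)
 have "(\<lambda>om. empirical_cdf n (types n om) x) \<in> borel_measurable (F n)" for x
 proof -
  obtain u v q t where x: "x = (u, v, q, t)" by (cases x)
  have "(\<lambda>om. of_bool (w_in (types n om i) \<le> u \<and> w_out (types n om i) \<le> v \<and> w_Q (types n om i) \<le> q \<and> w_zeta (types n om i) \<le> t) :: real) \<in> borel_measurable (F n)"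
   if "i \<in> {1..n}" for i
   using type_F[OF that] by measurable
  then show ?thesis unfolding x empirical_cdf_def prod.case by (intro borel_measurable_divide borel_measurable_sum borel_measurable_const)
 qed
 from F_measurable[OF this] show ?thesis
  unfolding tested_def[abs_def] Inr p by (cases "k1 \<noteq> 0 \<and> k2 \<noteq> 0 \<and> k3 \<noteq> 0 \<and> k4 \<noteq> 0") (simp_all only: sum.case prod.case if_True if_False simp_thms borel_measurable_const)
qed

lemma good_of_tested:
 assumes sz: "strict_mono sz" and om: "\<And>k. om k \<in> space M" and lim: "\<And>j. (\<lambda>k. tested j (sz k) (om k)) \<longlonglongrightarrow> tested_lim j"
 shows "good sz om"
 unfolding good_def
proof (intro conjI allI ballI sz om)
 let ?L = "[w_in, w_out, \<lambda>v. abs (w_Q v), \<lambda>v. abs (w_zeta v)]"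
 fix C assume "C \<in> {w_in, w_out, \<lambda>v. abs (w_Q v), \<lambda>v. abs (w_zeta v)}"
 then have "C \<in> set ?L" by simp
 then obtain k where k: "k < length ?L" "C = ?L ! k" by (metis in_set_conv_nth)
 have "(\<Sum>i=1..n. C (types n x i)) = (\<Sum>i=1..n. C (W i x))" for n x by (rule sum.cong) (auto simp: types_upto_def)
 then show "(\<lambda>k. (\<Sum>i=1..sz k. C (types (sz k) (om k) i))/real (sz k)) \<longlonglongrightarrow> (\<integral>v. C v \<partial>H)"
  using lim[of "Inl k"] k by (simp add: tested_def tested_lim_def)
next
 show "(\<lambda>k. edge_err (sz k) (om k)) \<longlonglongrightarrow> 0"
 proof (rule tendsto_sandwich[OF _ _ tendsto_const lim[of "Inl 4", unfolded tested_lim_def, simplified]])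
  show "EV k. 0 \<le> edge_err (sz k) (om k)" by (simp add: edge_err_def sum_nonneg)
  show "EV k. edge_err (sz k) (om k) \<le> tested (Inl 4) (sz k) (om k)"
   using edge_err_le[OF om] by (simp add: tested_def)
 qed
next
 fix m ty
 have sz': "filterlim sz at_top sequentially" by (rule filterlim_subseq[OF sz])
 have "conv sz (\<lambda>k. types (sz k) (om k)) {v. disc m v = ty}"
  unfolding disc_def
 proof (rule grid_round_freq[OF sz'])
  show "0 < h0/2 ^ m" using h0(1) by simp
  fix x assume x: "w_in x \<in> grid (h0/2 ^ m)" "w_out x \<in> grid (h0/2 ^ m)" "w_Q x \<in> grid (h0/2 ^ m)" "w_zeta x \<in> grid (h0/2 ^ m)"
  from x obtain k1 k2 k3 k4 where k: "w_in x = h0/2 ^ m * of_int k1" "w_out x = h0/2 ^ m * of_int k2" "w_Q x = h0/2 ^ m * of_int k3" "w_zeta x = h0/2 ^ m * of_int k4"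
   "k1 \<noteq> 0" "k2 \<noteq> 0" "k3 \<noteq> 0" "k4 \<noteq> 0" unfolding grid_def mem_Collect_eq by (elim exE conjE)
  have "x = (w_in x, w_out x, w_Q x, w_zeta x)" by (cases x) simp
  then have "x = (h0/2 ^ m * of_int k1, h0/2 ^ m * of_int k2, h0/2 ^ m * of_int k3, h0/2 ^ m * of_int k4)" unfolding k(1-4) .
  then show "(\<lambda>k. empirical_cdf (sz k) (types (sz k) (om k)) x) \<longlonglongrightarrow> type_cdf H x"
   using lim[of "Inr (m, k1, k2, k3, k4)"] k(5-8) by (simp add: tested_def tested_lim_def)
 qed
 then show "(\<lambda>k. freq (sz k) (types (sz k) (om k)) {v. disc m v = ty}) \<longlonglongrightarrow> measure H {v. disc m v = ty}"
  by (simp add: conv_def[OF sz'])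
qed

lemma tends_in_prob_good:
 assumes "\<And>sz om. good sz om ==> (\<lambda>k. Y (sz k) (om k)) \<longlonglongrightarrow> y"
 shows "tends_in_prob M Y y"
 by (rule tends_in_prob_by_sequences[OF prob_space_axioms tested_tends tested_measurable]) (rule assms, rule good_of_tested)

lemma c_nonneg: "0 \<le> c"
proof -
 obtain om where "om \<in> space M" using not_empty by blast
 then show ?thesis using zeta_le(2)[of 1 om] by linarith
qed

text \<open>Rounding toward zero respects the bound, so no vertex ever visits a cell whose
  representative violates it; the limit of the frequencies of such a cell is its mass under
  \<open>H\<close>, which must be 0.\<close>

lemma disc_zeta_AE:
 assumes g: "good sz om"
 shows "AE v in H. abs (w_zeta (disc m v)) \<le> c"
proof -
 have "AE v in H. \<forall>ty\<in>{ty\<in>range (disc m). c < abs (w_zeta ty)}. disc m v \<noteq> ty"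
 proof (rule AE_finite_allI)
  fix ty assume ty: "ty \<in> {ty\<in>range (disc m). c < abs (w_zeta ty)}"
  have "disc m (types (sz k) (om k) i) \<noteq> ty" if "i \<in> {1..sz k}" for k i
  proof -
   have "om k \<in> space M" using g by (simp add: good_def)
   then have "abs (w_zeta (types (sz k) (om k) i)) \<le> c" using zeta_le(2)[of i "om k"] that by (simp add: types_upto_def)
   then have "abs (w_zeta (disc m (types (sz k) (om k) i))) \<le> c"
    using d_zeta[of "types (sz k) (om k) i" m] abs_ge_zero[of "w_zeta (types (sz k) (om k) i) - w_zeta (disc m (types (sz k) (om k) i))"] by linarith
   then show ?thesis using ty by auto
  qed
  then have "freq (sz k) (types (sz k) (om k)) {v. disc m v = ty} = 0" for k by (simp add: freq_def)
  moreover have "(\<lambda>k. freq (sz k) (types (sz k) (om k)) {v. disc m v = ty}) \<longlonglongrightarrow> measure H {v. disc m v = ty}"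
   using g unfolding good_def by blast
  ultimately have 0: "measure H {v. disc m v = ty} = 0" by (simp add: LIMSEQ_const_iff)
  have "disc m -` {ty} \<inter> space H \<in> sets H" by (rule measurable_sets[OF d_H]) simp
  then have "{v. disc m v = ty} \<in> null_sets H"
   using 0 by (simp add: null_sets_def H.emeasure_eq_measure space_H vimage_def)
  then show "AE v in H. disc m v \<noteq> ty" by (rule AE_I') auto
 qed (use d_finite in simp)
 then show ?thesis
 proof eventually_elim
  case (elim v)
  show ?case
  proof (rule ccontr)
   assume "\<not> abs (w_zeta (disc m v)) \<le> c"
   then have "disc m v \<in> {ty\<in>range (disc m). c < abs (w_zeta ty)}" by simp
   from bspec[OF elim this] show False by simp
  qed
 qed
qed

text \<open>The bound for the vertices passes to \<open>H\<close> along any good sequence. Good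
  sequences exist, for otherwise \<open>tends_in_prob_good\<close> would vacuously show that the
  constant 1 tends to 0 in probability.\<close>

lemma zeta_AE: "AE v in H. abs (w_zeta v) \<le> c"
proof (rule ccontr)
 assume no: "\<not> ?thesis"
 have "\<not> good sz om" for sz om
 proof
  assume "good sz om"
  from disc_zeta_AE[OF this] have "AE v in H. \<forall>m. abs (w_zeta (disc m v)) \<le> c" by (simp add: AE_all_countable)
  then have "AE v in H. abs (w_zeta v) \<le> c"
  proof eventually_elim
   case (elim v)
   have "(\<lambda>m. abs (w_zeta (disc m v))) \<longlonglongrightarrow> abs (w_zeta v)" by (intro tendsto_rabs tendsto_components d_limit)
   then show ?case by (rule LIMSEQ_le_const2) (use elim in blast)
  qed
  then show False using no by contradiction
 qed
 then have "tends_in_prob M (\<lambda>_ _. 1) 0" by (intro tends_in_prob_good) blast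
 then have "(\<lambda>_::nat. measure M (space M)) \<longlonglongrightarrow> 0"
  unfolding tends_in_prob_def by (auto dest: spec[of _ "1/2"])
 then show False by (simp add: prob_space LIMSEQ_const_iff)
qed

sublocale pagerank_limit H \<theta> c
 by unfold_locales (rule theta_pos zeta_AE c_nonneg zeta_le integrable_in integrable_out integrable_Q out_mean_pos)+

lemma good_deterministic:
 assumes g: "good sz om"
 shows "deterministic_types H \<theta> c disc sz (\<lambda>k. types (sz k) (om k)) (\<lambda>k. ep (sz k) (om k))"
proof -
 have sp: "om k \<in> space M" for k using g by (simp add: good_def)
 have lim: "(\<lambda>k. (\<Sum>i=1..sz k. C (types (sz k) (om k) i))/real (sz k)) \<longlonglongrightarrow> (\<integral>v. C v \<partial>H)"
  if "C \<in> {w_in, w_out, \<lambda>v. abs (w_Q v), \<lambda>v. abs (w_zeta v)}" for C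
 proof -
  have "\<forall>C\<in>{w_in, w_out, \<lambda>v. abs (w_Q v), \<lambda>v. abs (w_zeta v)}. (\<lambda>k. (\<Sum>i=1..sz k. C (types (sz k) (om k) i))/real (sz k)) \<longlonglongrightarrow> (\<integral>v. C v \<partial>H)"
   using g unfolding good_def by (elim conjE)
  from bspec[OF this that] show ?thesis .
 qed
 show ?thesis
 proof (intro deterministic_types.intro deterministic_types_axioms.intro pagerank_limit_axioms discretization_axioms)
  show "filterlim sz at_top sequentially" using g by (intro filterlim_subseq) (simp add: good_def)
  show "0 \<le> w_in (types (sz k) (om k) i) \<and> 0 \<le> w_out (types (sz k) (om k) i)" if "i \<in> {1..sz k}" for k i
   using type_nonneg[OF _ sp, of i k] that by (simp add: types_upto_def)
  show "abs (w_zeta (types (sz k) (om k) i)) \<le> c" if "i \<in> {1..sz k}" for k i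
   using zeta_le(2)[OF _ sp, of i k] that by (simp add: types_upto_def)
  show "(\<lambda>k. (\<Sum>e\<in>vertex_pairs (sz k). abs (ep (sz k) (om k) e - types_at (types (sz k) (om k)) \<theta> (sz k) e))/real (sz k)) \<longlonglongrightarrow> 0"
   using g unfolding good_def edge_err_def by blast
  show "(\<lambda>k. (\<Sum>i=1..sz k. of_bool (disc m (types (sz k) (om k) i) = ty))/real (sz k)) \<longlonglongrightarrow> measure H {v. disc m v = ty}" for m ty
   using g unfolding good_def freq_def mem_Collect_eq by blast
 qed (rule ep_prob, rule lim[of w_in], simp, rule lim[of w_out], simp, rule lim[of "\<lambda>v. abs (w_Q v)"], simp, rule lim[of "\<lambda>v. abs (w_zeta v)"], simp)
qed

end

lemma gexp_linear:
 assumes "bounded_linear P"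
 shows "P (gexp V p F) = gexp V p (\<lambda>G. P (F G))"
proof -
 interpret bounded_linear P by fact
 show ?thesis by (simp add: gexp_def sum scaleR)
qed

lemma part_avg_cis:
 assumes "bounded_linear P"
 shows "P (avg_cis n s f) = (\<Sum>i=1..n. P (cis (s*f i)))/real n"
proof -
 interpret bounded_linear P by fact
 have "avg_cis n s f = inverse (real n) *\<^sub>R (\<Sum>i=1..n. cis (s*f i))"
  by (simp add: avg_cis_def scaleR_conv_of_real divide_inverse mult.commute)
 then show ?thesis by (simp add: scaleR sum divide_inverse mult.commute)
qed

lemma norm_avg_cis_le: "norm (avg_cis n s f) \<le> 1"
proof -
 have "norm (\<Sum>i=1..n. cis (s*f i)) \<le> (\<Sum>i=1..n. 1)" by (rule order_trans[OF norm_sum]) simp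
 then show ?thesis by (cases "n = 0") (simp_all add: avg_cis_def norm_divide divide_le_eq)
qed

section \<open>From conditional to unconditional characteristic functions\<close>

context pagerank_model
begin

definition rank :: "nat => 'a => real" where
 "rank n om = page_rank n (E n om) (types n om) (\<xi> n om)"

abbreviation "expected_cis n s om \<equiv> gexp (vertex_pairs n) (ep n om) (\<lambda>G. avg_cis n s (lim_rank n G (types n om)))"

lemma page_rank_eq:
 assumes "om \<in> space M" "G \<subseteq> vertex_pairs n" "i \<in> {1..n}"
 shows "page_rank n G (types n om) i = lim_rank n G (types n om) i"
proof -
 have "abs (w_zeta (types n om j)) \<le> c" if "j \<in> {1..n}" for j
  using zeta_le(2)[OF _ assms(1), of j] that by (simp add: types_upto_def)
 from page_rank_limit(2)[where w = "types n om", OF assms(2) this c_nonneg zeta_le(1) assms(3)] show ?thesis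
  unfolding lim_rank_def by (simp add: limI)
qed

lemma rank_eq:
 assumes "n \<ge> 1" "om \<in> space M"
 shows "rank n om = lim_rank n (E n om) (types n om) (\<xi> n om)"
 unfolding rank_def
 by (rule page_rank_eq[OF assms(2)])
   (use measurable_space[OF edges_measurable[OF assms(1)] assms(2)] measurable_space[OF vertex_measurable[OF assms(1)] assms(2)] in auto)

lemma lim_rank_F: "i \<in> {1..n} ==> (\<lambda>om. lim_rank n G (types n om) i) \<in> borel_measurable (F n)"
 by (rule lim_rank_measurable[OF type_F])

lemma rank_measurable: "n \<ge> 1 ==> rank n \<in> borel_measurable M"
proof -
 assume n: "n \<ge> 1"
 have "(\<lambda>om. lim_rank n (E n om) (types n om) (\<xi> n om)) \<in> borel_measurable M"
 proof (rule measurable_compose_countable'[OF _ vertex_measurable[OF n]])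
  fix i assume i: "i \<in> {1..n}"
  show "(\<lambda>om. lim_rank n (E n om) (types n om) i) \<in> borel_measurable M"
   by (rule graph_compose_measurable[OF n F_measurable[OF lim_rank_F[OF i]]])
 qed simp
 then show ?thesis by (subst measurable_cong[OF rank_eq[OF n]])
qed

context
 fixes P :: "complex => real"
 assumes P: "bounded_linear P" "\<And>z. abs (P z) \<le> norm z"
begin

lemma P_cis_measurable: "f \<in> borel_measurable N ==> (\<lambda>x. P (cis (s*f x))) \<in> borel_measurable N"
 by (rule measurable_compose[OF cis_scale_measurable])
   (use bounded_linear.continuous_on[OF P(1) continuous_on_id] in "auto intro!: borel_measurable_continuous_onI")

lemma P_expected:
 "P (expected_cis n s om) = gexp (vertex_pairs n) (ep n om) (\<lambda>G. (\<Sum>i=1..n. P (cis (s*lim_rank n G (types n om) i)))/real n)"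
 unfolding gexp_linear[OF P(1)] part_avg_cis[OF P(1)] ..

lemma graph_part_F:
 "(\<lambda>om. (\<Sum>i=1..n. P (cis (s*lim_rank n G (types n om) i)))/real n) \<in> borel_measurable (F n)"
 by (intro borel_measurable_divide borel_measurable_sum borel_measurable_const P_cis_measurable lim_rank_F)

lemma expected_measurable: "(\<lambda>om. P (expected_cis n s om)) \<in> borel_measurable M"
 unfolding P_expected by (rule F_measurable, rule gexp_measurable[OF graph_part_F ep_F])

text \<open>\<open>P\<close> stands for the real or the imaginary part, since convergence in
  probability is formulated for real variables. First the uniform vertex is averaged out, then the
  graph given the types.\<close>

lemma char_part:
 assumes n: "n \<ge> 1"
 shows "P (char (distr M borel (rank n)) s) = (\<integral>om. P (expected_cis n s om) \<partial>M)"
proof -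
 have "char (distr M borel (rank n)) s = (\<integral>om. cis (s * rank n om) \<partial>M)" by (rule char_distr[OF rank_measurable[OF n]])
 moreover have "integrable M (\<lambda>om. cis (s * rank n om))"
  by (rule integrable_const_bound[where B = 1]) (use cis_scale_measurable[OF rank_measurable[OF n]] in auto)
 ultimately have "P (char (distr M borel (rank n)) s) = (\<integral>om. P (cis (s * rank n om)) \<partial>M)"
  by (simp only: integral_bounded_linear[OF P(1)])
 also have "\<dots> = (\<integral>om. P (cis (s*lim_rank n (E n om) (types n om) (\<xi> n om))) \<partial>M)"
  by (rule Bochner_Integration.integral_cong[OF refl]) (simp only: rank_eq[OF n])
 also have "\<dots> = (\<integral>om. (\<Sum>i=1..n. P (cis (s*lim_rank n (E n om) (types n om) i)))/real n \<partial>M)"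
 proof (rule vertex_expectation[OF n, of "\<lambda>G t i. P (cis (s*lim_rank n G t i))" 1])
  show "(\<lambda>t. P (cis (s*lim_rank n G t i))) \<in> borel_measurable (TS n)" if "i \<in> {1..n}" for G i
   by (rule P_cis_measurable[OF lim_rank_measurable[where t = "\<lambda>t. t", OF measurable_component_singleton that]])
  show "abs (P (cis (s*lim_rank n G t i))) \<le> 1" for G t i using P(2)[of "cis (s*lim_rank n G t i)"] by simp
 qed
 also have "\<dots> = (\<integral>om. P (expected_cis n s om) \<partial>M)"
  unfolding P_expected
 proof (rule graph_expectation[OF n graph_part_F])
  show "abs ((\<Sum>i=1..n. P (cis (s*lim_rank n G (types n om) i)))/real n) \<le> 1" for G om
   unfolding part_avg_cis[OF P(1), symmetric] by (rule order_trans[OF P(2) norm_avg_cis_le])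
 qed
 finally show ?thesis .
qed

text \<open>Along every good sequence the conditional expectation given the types has the
  deterministic limit of \<open>page_rank_char_limit\<close>. Hence it converges in probability, and
  being bounded by 1 it also converges in mean.\<close>

lemma char_part_limit:
 assumes indep: "H.indep_var borel (\<lambda>w. (w_in w, w_Q w)) borel (\<lambda>w. (w_out w, w_zeta w))"
 shows "(\<lambda>n. P (char (distr M borel (rank n)) s)) \<longlonglongrightarrow> P (char (law_endogenous (law_NQ H \<theta>) (law_C H \<theta>)) s)"
proof -
 let ?z = "char (law_endogenous (law_NQ H \<theta>) (law_C H \<theta>)) s"
 interpret L: real_distribution "law_endogenous (law_NQ H \<theta>) (law_C H \<theta>)" by (rule tree.real_distribution_endogenous)
 have "tends_in_prob M (\<lambda>n om. P (expected_cis n s om)) (P ?z)"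
 proof (rule tends_in_prob_good)
  fix sz om assume g: "good sz om"
  interpret D: deterministic_types H \<theta> c disc sz "\<lambda>k. types (sz k) (om k)" "\<lambda>k. ep (sz k) (om k)" by (rule good_deterministic[OF g])
  have "(\<lambda>k. P (gexp (vertex_pairs (sz k)) (ep (sz k) (om k)) (\<lambda>G. avg_cis (sz k) s (page_rank (sz k) G (types (sz k) (om k)))))) \<longlonglongrightarrow> P ?z"
   by (rule bounded_linear.tendsto[OF P(1) D.page_rank_char_limit[OF indep]])
  moreover have "gexp (vertex_pairs (sz k)) (ep (sz k) (om k)) (\<lambda>G. avg_cis (sz k) s (page_rank (sz k) G (types (sz k) (om k)))) = expected_cis (sz k) s (om k)" for k
  proof (rule gexp_cong[OF _ refl])
   fix G assume G: "G \<subseteq> vertex_pairs (sz k)"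
   have "om k \<in> space M" using g by (simp add: good_def)
   then show "avg_cis (sz k) s (page_rank (sz k) G (types (sz k) (om k))) = avg_cis (sz k) s (lim_rank (sz k) G (types (sz k) (om k)))"
    unfolding avg_cis_def by (intro arg_cong2[where f = "(/)"] sum.cong refl) (simp only: page_rank_eq[OF _ G])
  qed
  ultimately show "(\<lambda>k. P (expected_cis (sz k) s (om k))) \<longlonglongrightarrow> P ?z" by simp
 qed
 then have "(\<lambda>n. \<integral>om. P (expected_cis n s om) \<partial>M) \<longlonglongrightarrow> P ?z"
 proof (rule integral_tends_of_bounded[OF prob_space_axioms _ expected_measurable])
  show "abs (P (expected_cis n s om)) \<le> 1" for n om
   by (rule order_trans[OF P(2) norm_gexp_le_const]) (auto simp: ep_prob norm_avg_cis_le)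
  show "abs (P ?z) \<le> 1" by (rule order_trans[OF P(2) L.cmod_char_le_1])
 qed
 moreover have "EV n. (\<integral>om. P (expected_cis n s om) \<partial>M) = P (char (distr M borel (rank n)) s)"
  using eventually_ge_at_top[of 1] by eventually_elim (simp only: char_part)
 ultimately show ?thesis by (rule Lim_transform_eventually)
qed

end

theorem rank_weak_limit:
 assumes indep: "H.indep_var borel (\<lambda>w. (w_in w, w_Q w)) borel (\<lambda>w. (w_out w, w_zeta w))"
 shows "weak_conv_m (\<lambda>n. distr M borel (rank n)) (law_endogenous (law_NQ H \<theta>) (law_C H \<theta>))"
proof -
 let ?L = "law_endogenous (law_NQ H \<theta>) (law_C H \<theta>)"
 have "(\<lambda>n. char (distr M borel (rank n)) s) \<longlonglongrightarrow> char ?L s" for s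
  unfolding tendsto_complex_iff
  by (intro conjI char_part_limit indep bounded_linear_Re bounded_linear_Im abs_Re_le_cmod abs_Im_le_cmod)
 \<comment> \<open>The model is empty at \<open>n = 0\<close>, where the rank need not be a random
   variable, so the continuity theorem is applied to the sequence shifted by one.\<close>
 then have "(\<lambda>n. char (distr M borel (rank (Suc n))) s) \<longlonglongrightarrow> char ?L s" for s
  by (rule LIMSEQ_Suc)
 then have "weak_conv_m (\<lambda>n. distr M borel (rank (Suc n))) ?L"
  by (intro levy_continuity real_distribution_distr rank_measurable tree.real_distribution_endogenous) simp_all
 then show ?thesis
  unfolding weak_conv_m_def weak_conv_def by (subst (asm) filterlim_sequentially_Suc)
qed

end

theorem theorem3p3:
  fixes M :: "'a measure"
    and W :: "nat \<Rightarrow> 'a \<Rightarrow> ext_type"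
    and \<phi> :: kernel_pert
    and \<theta> c :: real
    and E :: "nat \<Rightarrow> 'a \<Rightarrow> (nat \<times> nat) set"
    and \<xi> :: "nat \<Rightarrow> 'a \<Rightarrow> nat"
    and H :: "ext_type measure"
  assumes model: "inhom_random_digraph M W \<phi> \<theta> E \<xi>"
    and H_dist: "prob_space H" "sets H = sets borel" "AE w in H. w_in w \<ge> 0 \<and> w_out w \<ge> 0"
    and hyp_a: "\<And>x. isCont (type_cdf H) x \<Longrightarrow>
              tends_in_prob M (\<lambda>n \<omega>. empirical_cdf n (types_upto W n \<omega>) x) (type_cdf H x)"
    and hyp_b_in: "tends_in_prob M (\<lambda>n \<omega>. (\<Sum>i=1..n. w_in (W i \<omega>)) / real n) (\<integral>w. w_in w \<partial>H)"
    and hyp_b_out: "tends_in_prob M (\<lambda>n \<omega>. (\<Sum>i=1..n. w_out (W i \<omega>)) / real n) (\<integral>w. w_out w \<partial>H)"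
    and hyp_b_Q: "tends_in_prob M (\<lambda>n \<omega>. (\<Sum>i=1..n. \<bar>w_Q (W i \<omega>)\<bar>) / real n) (\<integral>w. \<bar>w_Q w\<bar> \<partial>H)"
    and hyp_b_zeta: "tends_in_prob M (\<lambda>n \<omega>. (\<Sum>i=1..n. \<bar>w_zeta (W i \<omega>)\<bar>) / real n) (\<integral>w. \<bar>w_zeta w\<bar> \<partial>H)"
    and hyp_b_theta: "integrable H (\<lambda>w. w_in w + w_out w)" "\<theta> = (\<integral>w. w_in w + w_out w \<partial>H)"
    and hyp_b_integrable: "integrable H (\<lambda>w. \<bar>w_Q w\<bar> + \<bar>w_zeta w\<bar>)"
    and out_pos: "(\<integral>w. w_out w \<partial>H) > 0"
    and hyp_c: "tends_in_prob M
              (\<lambda>n \<omega>. (\<Sum>i=1..n. \<Sum>j\<in>{1..n} - {i}.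
                  \<bar>edge_prob \<phi> \<theta> n (types_upto W n \<omega>) i j
                    - min (edge_ratio \<theta> n (types_upto W n \<omega>) i j) 1\<bar>) / real n) 0"
    and hyp_d: "c < 1" "\<And>i \<omega>. i \<ge> 1 \<Longrightarrow> \<omega> \<in> space M \<Longrightarrow> \<bar>w_zeta (W i \<omega>)\<bar> \<le> c"
    and hyp_e_in: "tends_in_prob M (\<lambda>n \<omega>. (\<Sum>i=1..n. w_in (W i \<omega>) * w_out (W i \<omega>)) / real n)
                 (\<integral>w. w_out w * w_in w \<partial>H)"
    and hyp_e_Q: "tends_in_prob M (\<lambda>n \<omega>. (\<Sum>i=1..n. w_out (W i \<omega>) * \<bar>w_Q (W i \<omega>)\<bar>) / real n)
                (\<integral>w. w_out w * \<bar>w_Q w\<bar> \<partial>H)"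
    and hyp_e_integrable: "integrable H (\<lambda>w. w_out w * w_in w + w_out w * \<bar>w_Q w\<bar>)"
    and hyp_f: "prob_space.indep_var H borel (\<lambda>w. (w_in w, w_Q w)) borel (\<lambda>w. (w_out w, w_zeta w))"
  shows "(AE x in tree_space (law_NQ H \<theta>) (law_C H \<theta>). summable (generation_sum x))
       \<and> solves_sfpe (law_NQ H \<theta>) (law_C H \<theta>) (law_endogenous (law_NQ H \<theta>) (law_C H \<theta>))
       \<and> weak_conv_m
           (\<lambda>n. distr M borel (\<lambda>\<omega>. page_rank n (E n \<omega>) (types_upto W n \<omega>) (\<xi> n \<omega>)))
           (law_endogenous (law_NQ H \<theta>) (law_C H \<theta>))"
proof -
  have meas: "C \<in> borel_measurable H" if "C \<in> borel_measurable borel" for C :: "ext_type \<Rightarrow> real"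
    using that unfolding measurable_cong_sets[OF H_dist(2) refl] .
  have "integrable H C" if "C \<in> {w_in, w_out}" for C
  proof (rule Bochner_Integration.integrable_bound[OF hyp_b_theta(1)])
    show "C \<in> borel_measurable H" using that by (auto intro: meas)
    show "AE w in H. norm (C w) \<le> norm (w_in w + w_out w)" using H_dist(3) by eventually_elim (use that in auto)
  qed
  moreover have "integrable H w_Q"
    by (rule Bochner_Integration.integrable_bound[OF hyp_b_integrable meas]) auto
  ultimately have int: "integrable H w_in" "integrable H w_out" "integrable H w_Q" by simp_all
  interpret pagerank_model M W \<phi> \<theta> E \<xi> H c
    by (intro pagerank_model.intro pagerank_model_axioms.intro type_law.intro model H_dist hyp_a hyp_b_in hyp_b_out hyp_b_Q hyp_b_zeta int out_pos hyp_c hyp_d)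
  show ?thesis
    using tree.AE_summable tree.solves_sfpe_endogenous rank_weak_limit[OF hyp_f] unfolding rank_def[abs_def] by blast
qed

end
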